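(* Let $n\ge2$, let $\Omega\subset\mathbb{R}^n$ be an infinitely long nozzle, $m>0$, and let the pressure law, force potential $\phi$ and cut-off density $\hat\rho^\varepsilon$ be as in the context. There is a constant $l$ depending only on $\Omega$, and a constant $C$ not depending on $L$, such that for any $a,b$ with $b-a>l$ and $\Omega_{(a-1,b+1)}\subset\Omega_{L/2}$, the function $\tilde\varphi_L^{(\varepsilon)}=\varepsilon^{-2}(\varphi_L^{(\varepsilon)}-\bar\varphi_L)$, where $\varphi^{(\varepsilon)}_L$ is the solution of the truncated compressible problem and $\bar\varphi_L$ the solution of the truncated incompressible problem (both defined in the context), satisfies $$\frac{1}{|\Omega_{(a,b)}|}\int_{\Omega_{(a,b)}}|\nabla\tilde\varphi_L^{(\varepsilon)}|^2dx\le Cm^2.$$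
   Context: Nozzle: $\Omega\subset\mathbb{R}^n$ is a domain for which there is an invertible $C^{2,\alpha}$ map ($0<\alpha<1$) $T:\bar\Omega\to\bar{\mathbf C}$, $\mathbf C=B(0,1)\times\mathbb{R}$ with $B(0,1)$ the unit ball of $\mathbb{R}^{n-1}$, such that $T(\partial\Omega)=\partial\mathbf C$; $T(\Omega\cap\{x_n=k\})=B(0,1)\times\{y_n=k\}$ for every $k$; and $\|T\|_{C^{2,\alpha}}+\|T^{-1}\|_{C^{2,\alpha}}\le K<\infty$. For $L>0$: $\Omega_L=\{x\in\Omega:|x_n|<L\}$, $S_L^\pm=\Omega\cap\{x_n=\pm L\}$, $\Omega_{(a,b)}=\{x\in\Omega:a<x_n<b\}$, $H_L=\{\varphi\in H^1(\Omega_L):\varphi|_{S_L^-}=0\}$; $|\cdot|$ denotes area/measure. Gas law: $\tilde p$ is smooth on $(0,\infty)$ with $\tilde p'>0$ and $2\tilde p'+\rho\tilde p''>0$; $\tilde h'(\rho)=\tilde p'(\rho)/\rho$. The force potential satisfies $0\le\phi\le\phi^\star<\infty$. For subsonic speeds $q$ put $\rho^\varepsilon(q^2,\phi)=\tilde h^{-1}\big(\tilde h(1)+\varepsilon^2(2\phi-q^2)/2\big)$; the Mach number is $M^\varepsilon=\varepsilon q/\sqrt{\tilde p'(\rho^\varepsilon)}$. For $0<\theta<1$, $q^\varepsilon_\theta(\phi)$ is the speed such that $q\le q^\varepsilon_\theta(\phi)$ iff $M^\varepsilon\le\theta$. Cut-off: fix $0<\varepsilon_0<1$, $0<\theta<1$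 and $0<\varepsilon<\varepsilon_0$. Let $\mathring q^{\varepsilon_0}_\theta(\phi)=\inf_{0<\varepsilon<\varepsilon_0}q^\varepsilon_\theta(\phi)$. The function $\hat q(q^2,\phi)$ equals $q^2-2\phi$ if $|q|\le\mathring q^{\varepsilon_0}_\theta(\phi)$, equals the constant $\sup_{x\in\Omega}\big((\mathring q^{\varepsilon_0}_{(\theta+1)/2}(\phi))^2-2\phi\big)(x)$ if $|q|\ge\mathring q^{\varepsilon_0}_{(\theta+1)/2}(\phi)$, and is a monotone smooth interpolation in between. Set $\hat\rho^\varepsilon(\Lambda,\phi)=\tilde h^{-1}\big(\tilde h(1)-\varepsilon^2\hat q(\Lambda,\phi)/2\big)$. The cut-off is such that the matrix $\hat a_{ij}(p,\phi)=\hat\rho^\varepsilon(|p|^2,\phi)\delta_{ij}+2\hat\rho^\varepsilon_\Lambda(|p|^2,\phi)p_ip_j$ satisfies $\hat\lambda_1|\xi|^2\le\sum\hat a_{ij}\xi_i\xi_j\le\hat\lambda_2|\xi|^2$ with positive constants depending only on $\theta$, $\varepsilon_0$ (and $\tilde p$, $\phi^\star$). Truncated incompressible problem: $\bar\varphi_L\in H_L$ with $\int_{\Omega_L}\nabla\bar\varphi_L\cdot\nabla\eta\,dx=\frac m{|S_L^+|}\int_{S_L^+}\eta\,dx'$ for all $\eta\in H_L$ (weak form of $\Delta\bar\varphi_L=0$ in $\Omega_L$, $\partial_{\mathbf n}\bar\varphi_L=0$ on $\partial\Omega\cap\partial\Omega_L$, $\partial_{x_n}\bar\varphi_L=m/|S_L^+|$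 on $S_L^+$, $\bar\varphi_L=0$ on $S_L^-$). Truncated compressible problem: $\varphi_L^{(\varepsilon)}\in H_L$ with $\int_{\Omega_L}\hat\rho^\varepsilon(|\nabla\varphi_L^{(\varepsilon)}|^2,\phi)\nabla\varphi_L^{(\varepsilon)}\cdot\nabla\eta\,dx=\frac m{|S_L^+|}\int_{S_L^+}\eta\,dx'$ for all $\eta\in H_L$ (weak form of $\operatorname{div}(\hat\rho^\varepsilon\nabla\varphi_L^{(\varepsilon)})=0$ in $\Omega_L$, $\partial_{\mathbf n}\varphi_L^{(\varepsilon)}=0$ on $\partial\Omega\cap\partial\Omega_L$, $\hat\rho^\varepsilon\partial_{x_n}\varphi_L^{(\varepsilon)}=m/|S_L^+|$ on $S_L^+$, $\varphi_L^{(\varepsilon)}=0$ on $S_L^-$).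
   Formalization: As T_n(x)=x_n is unbounded, the C^{2,α} norms of T and T^{-1} are infinite; the bound is imposed on T−x_n e_n and T^{-1}−y_n e_n instead. It is also made explicit that h̃(1)+ε²s lies in the range of h̃ for 0<ε<ε_0, 0≤s≤φ*, so that the density is defined. *)

theory Defs
  imports "HOL-Analysis.Analysis"
begin

(* R^n = R^(n-1) x R with n = CARD('m) + 1 >= 2.  The axial coordinate x_n of a point x is snd x,
   and (n-1)-dimensional area is Lebesgue measure on real^'m. *)
type_synonym 'm point = "(real ^ 'm) \<times> real"


section \<open>Nozzles\<close>

(* f lies in C^{2,alpha}(closure U): Df and D^2 f exist in the open set U and extend continuously
   to closure U; each term of the C^{2,alpha} norm is at most K. *)
definition C2_holder_bound ::
  "real \<Rightarrow> 'a::euclidean_space set \<Rightarrow> ('a \<Rightarrow> 'b::euclidean_space) \<Rightarrow> real \<Rightarrow> bool" where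
  "C2_holder_bound \<alpha> U f K \<longleftrightarrow>
     (\<exists>(f' :: 'a \<Rightarrow> 'a \<Rightarrow>\<^sub>L 'b) (f'' :: 'a \<Rightarrow> 'a \<Rightarrow>\<^sub>L ('a \<Rightarrow>\<^sub>L 'b)).
        (\<forall>x\<in>U. (f has_derivative blinfun_apply (f' x)) (at x)) \<and>
        (\<forall>x\<in>U. (f' has_derivative blinfun_apply (f'' x)) (at x)) \<and>
        continuous_on (closure U) f \<and> continuous_on (closure U) f' \<and>
        continuous_on (closure U) f'' \<and>
        (\<forall>x\<in>U. norm (f x) \<le> K \<and> norm (f' x) \<le> K \<and> norm (f'' x) \<le> K) \<and>
        (\<forall>x\<in>U. \<forall>y\<in>U. norm (f'' x - f'' y) \<le> K * norm (x - y) powr \<alpha>))"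

definition cylinder :: "'m::finite point set" where
  "cylinder = ball 0 1 \<times> UNIV"

(* The level-set condition forces the last component of T and of its inverse to be x_n, which is
   unbounded on Omega.  So the C^{2,alpha} norms of T and of its inverse can only be finite after
   the term x_n e_n is removed; its derivatives are constant, so every other term of the norm
   is unaffected up to a constant. *)
definition nozzle :: "'m::finite point set \<Rightarrow> bool" where
  "nozzle \<Omega> \<longleftrightarrow> open \<Omega> \<and> connected \<Omega> \<and> \<Omega> \<noteq> {} \<and>
     (\<exists>(T :: 'm point \<Rightarrow> 'm point) \<alpha> K. 0 < \<alpha> \<and> \<alpha> < 1 \<and>
        bij_betw T (closure \<Omega>) (closure cylinder) \<and>
        T ` frontier \<Omega> = frontier cylinder \<and>
        (\<forall>k. T ` {x\<in>\<Omega>. snd x = k} = ball 0 1 \<times> {k}) \<and>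
        C2_holder_bound \<alpha> \<Omega> (\<lambda>x. T x - (0, snd x)) K \<and>
        C2_holder_bound \<alpha> cylinder
          (\<lambda>y. inv_into (closure \<Omega>) T y - (0, snd y)) K)"

definition trunc :: "'m::finite point set \<Rightarrow> real \<Rightarrow> 'm point set" where
  "trunc \<Omega> L = {x\<in>\<Omega>. \<bar>snd x\<bar> < L}"

definition section_between :: "'m::finite point set \<Rightarrow> real \<Rightarrow> real \<Rightarrow> 'm point set" where
  "section_between \<Omega> a b = {x\<in>\<Omega>. a < snd x \<and> snd x < b}"

(* The cross-section at x_n = t, as a subset of R^(n-1): S_L^+ is slice \<Omega> L, S_L^- is slice \<Omega> (- L). *)
definition slice :: "'m::finite point set \<Rightarrow> real \<Rightarrow> (real ^ 'm) set" where
  "slice \<Omega> t = {x'. (x', t) \<in> \<Omega>}"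


section \<open>Sobolev functions and traces\<close>

definition C1_grad :: "('a::euclidean_space \<Rightarrow> real) \<Rightarrow> ('a \<Rightarrow> 'a) \<Rightarrow> bool" where
  "C1_grad u Du \<longleftrightarrow>
     (\<forall>x. (u has_derivative (\<lambda>v. Du x \<bullet> v)) (at x)) \<and> continuous_on UNIV Du"

definition L2_on :: "'a::euclidean_space set \<Rightarrow> ('a \<Rightarrow> 'b::euclidean_space) \<Rightarrow> bool" where
  "L2_on U f \<longleftrightarrow> f \<in> borel_measurable (lebesgue_on U) \<and>
     integrable (lebesgue_on U) (\<lambda>x. (norm (f x))\<^sup>2)"

(* Squared L^2(U) distance, with values in [0, infinity]. *)
definition L2_dist2 ::
  "'a::euclidean_space set \<Rightarrow> ('a \<Rightarrow> 'b::euclidean_space) \<Rightarrow> ('a \<Rightarrow> 'b) \<Rightarrow> ennreal" where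
  "L2_dist2 U f g = (\<integral>\<^sup>+x. ennreal ((norm (f x - g x))\<^sup>2) \<partial>lebesgue_on U)"

(* f is in H^1(U) with weak gradient g.  As in Gilbarg-Trudinger, first weak derivatives are
   tested against compactly supported C^1 functions. *)
definition H1_grad :: "'a::euclidean_space set \<Rightarrow> ('a \<Rightarrow> real) \<Rightarrow> ('a \<Rightarrow> 'a) \<Rightarrow> bool" where
  "H1_grad U f g \<longleftrightarrow> L2_on U f \<and> L2_on U g \<and>
     (\<forall>\<psi> D\<psi>. C1_grad \<psi> D\<psi> \<longrightarrow> compact (closure {x. \<psi> x \<noteq> 0}) \<longrightarrow> closure {x. \<psi> x \<noteq> 0} \<subseteq> U \<longrightarrow>
        (LINT x:U|lebesgue. f x *\<^sub>R D\<psi> x) = - (LINT x:U|lebesgue. \<psi> x *\<^sub>R g x))"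

definition H1 :: "'a::euclidean_space set \<Rightarrow> ('a \<Rightarrow> real) set" where
  "H1 U = {f. \<exists>g. H1_grad U f g}"

(* Determined up to a null set for f in H^1(U). *)
definition weak_grad :: "'a::euclidean_space set \<Rightarrow> ('a \<Rightarrow> real) \<Rightarrow> 'a \<Rightarrow> 'a" where
  "weak_grad U f = (SOME g. H1_grad U f g)"

(* tau is the trace on the flat end x_n = t (t = L or t = -L) of f in H^1(trunc \<Omega> L): the trace
   operator is the continuous extension of restriction from functions that are C^1 up to the
   boundary, so tau is the L^2 limit of the restrictions of C^1 functions tending to f in H^1. *)
definition has_trace ::
  "'m::finite point set \<Rightarrow> real \<Rightarrow> real \<Rightarrow> ('m point \<Rightarrow> real) \<Rightarrow> (real ^ 'm \<Rightarrow> real) \<Rightarrow> bool" where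
  "has_trace \<Omega> L t f \<tau> \<longleftrightarrow> f \<in> H1 (trunc \<Omega> L) \<and> L2_on (slice \<Omega> t) \<tau> \<and>
     (\<exists>u Du. (\<forall>k::nat. C1_grad (u k) (Du k)) \<and>
        (\<lambda>k. L2_dist2 (trunc \<Omega> L) (u k) f) \<longlonglongrightarrow> 0 \<and>
        (\<lambda>k. L2_dist2 (trunc \<Omega> L) (Du k) (weak_grad (trunc \<Omega> L) f)) \<longlonglongrightarrow> 0 \<and>
        (\<lambda>k. L2_dist2 (slice \<Omega> t) (\<lambda>x'. u k (x', t)) \<tau>) \<longlonglongrightarrow> 0)"

definition H_trunc :: "'m::finite point set \<Rightarrow> real \<Rightarrow> ('m point \<Rightarrow> real) set" where
  "H_trunc \<Omega> L = {f \<in> H1 (trunc \<Omega> L). has_trace \<Omega> L (- L) f (\<lambda>_. 0)}"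


section \<open>Gas law\<close>

definition smooth_pos :: "(real \<Rightarrow> real) \<Rightarrow> bool" where
  "smooth_pos f \<longleftrightarrow> (\<forall>k. \<forall>x>0. (deriv ^^ k) f field_differentiable (at x))"

definition gas_law :: "(real \<Rightarrow> real) \<Rightarrow> (real \<Rightarrow> real) \<Rightarrow> bool" where
  "gas_law p h \<longleftrightarrow> smooth_pos p \<and>
     (\<forall>\<rho>>0. deriv p \<rho> > 0 \<and> 2 * deriv p \<rho> + \<rho> * deriv (deriv p) \<rho> > 0) \<and>
     (\<forall>\<rho>>0. (h has_real_derivative deriv p \<rho> / \<rho>) (at \<rho>))"

definition h_inv :: "(real \<Rightarrow> real) \<Rightarrow> real \<Rightarrow> real" where
  "h_inv h = inv_into {0<..} h"

definition rho_eps :: "(real \<Rightarrow> real) \<Rightarrow> real \<Rightarrow> real \<Rightarrow> real \<Rightarrow> real" where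
  "rho_eps h \<epsilon> \<Lambda> s = h_inv h (h 1 + \<epsilon>\<^sup>2 * (2 * s - \<Lambda>) / 2)"

definition mach :: "(real \<Rightarrow> real) \<Rightarrow> (real \<Rightarrow> real) \<Rightarrow> real \<Rightarrow> real \<Rightarrow> real \<Rightarrow> real" where
  "mach p h \<epsilon> q s = \<epsilon> * q / sqrt (deriv p (rho_eps h \<epsilon> (q\<^sup>2) s))"

(* The density, hence the Mach number, is only defined at speeds for which the argument of the
   inverse enthalpy lies in its range; this is made explicit in the second conjunct. *)
definition q_theta :: "(real \<Rightarrow> real) \<Rightarrow> (real \<Rightarrow> real) \<Rightarrow> real \<Rightarrow> real \<Rightarrow> real \<Rightarrow> real" where
  "q_theta p h \<epsilon> \<theta> s = (THE r. 0 \<le> r \<and>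
     (\<forall>q\<ge>0. q \<le> r \<longleftrightarrow>
        h 1 + \<epsilon>\<^sup>2 * (2 * s - q\<^sup>2) / 2 \<in> h ` {0<..} \<and> mach p h \<epsilon> q s \<le> \<theta>))"

definition q_ring :: "(real \<Rightarrow> real) \<Rightarrow> (real \<Rightarrow> real) \<Rightarrow> real \<Rightarrow> real \<Rightarrow> real \<Rightarrow> real" where
  "q_ring p h \<epsilon>0 \<theta> s = (INF \<epsilon>\<in>{0<..<\<epsilon>0}. q_theta p h \<epsilon> \<theta> s)"

(* The last conjunct is implicit in the use of the inverse enthalpy: the Bernoulli density at rest
   exists.  It is automatic when h is unbounded above, as for polytropic and isothermal gases. *)
definition force_potential ::
  "'m::finite point set \<Rightarrow> (real \<Rightarrow> real) \<Rightarrow> real \<Rightarrow> real \<Rightarrow> ('m point \<Rightarrow> real) \<Rightarrow> bool" where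
  "force_potential \<Omega> h \<epsilon>0 \<phi>star \<phi> \<longleftrightarrow>
     \<phi> \<in> borel_measurable (lebesgue_on \<Omega>) \<and> (\<forall>x\<in>\<Omega>. 0 \<le> \<phi> x \<and> \<phi> x \<le> \<phi>star) \<and>
     (\<forall>\<epsilon>\<in>{0<..<\<epsilon>0}. \<forall>s\<in>{0..\<phi>star}. h 1 + \<epsilon>\<^sup>2 * s \<in> h ` {0<..})"


section \<open>Cut-off\<close>

definition rho_hat ::
  "(real \<Rightarrow> real) \<Rightarrow> (real \<Rightarrow> real \<Rightarrow> real) \<Rightarrow> real \<Rightarrow> real \<Rightarrow> real \<Rightarrow> real" where
  "rho_hat h qh \<epsilon> \<Lambda> s = h_inv h (h 1 - \<epsilon>\<^sup>2 * qh \<Lambda> s / 2)"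

(* Indices range over the standard basis of R^n.  At P = 0 the factor of the derivative vanishes,
   so the values of qh at negative \<Lambda> play no role. *)
definition a_hat ::
  "(real \<Rightarrow> real) \<Rightarrow> (real \<Rightarrow> real \<Rightarrow> real) \<Rightarrow> real \<Rightarrow> 'a::euclidean_space \<Rightarrow> real \<Rightarrow> 'a \<Rightarrow> 'a \<Rightarrow> real" where
  "a_hat h qh \<epsilon> P s i j =
     rho_hat h qh \<epsilon> ((norm P)\<^sup>2) s * (if i = j then 1 else 0) +
     2 * deriv (\<lambda>\<Lambda>. rho_hat h qh \<epsilon> \<Lambda> s) ((norm P)\<^sup>2) * (P \<bullet> i) * (P \<bullet> j)"

(* qh \<Lambda> s is the cut-off as a function of \<Lambda> = q^2 >= 0 and of a value s taken by the potential.
   Joint continuity is the part of the smoothness of the interpolation that concerns s.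
   The ellipticity constants are uniform in \<epsilon> < \<epsilon>0. *)
definition cutoff ::
  "'m::finite point set \<Rightarrow> (real \<Rightarrow> real) \<Rightarrow> (real \<Rightarrow> real) \<Rightarrow> ('m point \<Rightarrow> real) \<Rightarrow>
   real \<Rightarrow> real \<Rightarrow> (real \<Rightarrow> real \<Rightarrow> real) \<Rightarrow> bool" where
  "cutoff \<Omega> p h \<phi> \<epsilon>0 \<theta> qh \<longleftrightarrow>
     (\<forall>s\<in>\<phi> ` \<Omega>.
        (\<forall>q. \<bar>q\<bar> \<le> q_ring p h \<epsilon>0 \<theta> s \<longrightarrow> qh (q\<^sup>2) s = q\<^sup>2 - 2 * s) \<and>
        (\<forall>q. \<bar>q\<bar> \<ge> q_ring p h \<epsilon>0 ((\<theta> + 1) / 2) s \<longrightarrow>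
           qh (q\<^sup>2) s = (SUP x\<in>\<Omega>. (q_ring p h \<epsilon>0 ((\<theta> + 1) / 2) (\<phi> x))\<^sup>2 - 2 * \<phi> x)) \<and>
        mono_on {0..} (\<lambda>\<Lambda>. qh \<Lambda> s) \<and>
        smooth_pos (\<lambda>\<Lambda>. qh \<Lambda> s)) \<and>
     continuous_on ({0..} \<times> \<phi> ` \<Omega>) (\<lambda>(\<Lambda>, s). qh \<Lambda> s) \<and>
     (\<exists>\<kappa>1>0. \<exists>\<kappa>2>0. \<forall>\<epsilon>\<in>{0<..<\<epsilon>0}. \<forall>s\<in>\<phi> ` \<Omega>. \<forall>P \<xi> :: 'm point.
        \<kappa>1 * (norm \<xi>)\<^sup>2 \<le> (\<Sum>i\<in>Basis. \<Sum>j\<in>Basis. a_hat h qh \<epsilon> P s i j * (\<xi> \<bullet> i) * (\<xi> \<bullet> j)) \<and>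
        (\<Sum>i\<in>Basis. \<Sum>j\<in>Basis. a_hat h qh \<epsilon> P s i j * (\<xi> \<bullet> i) * (\<xi> \<bullet> j)) \<le> \<kappa>2 * (norm \<xi>)\<^sup>2)"


section \<open>Truncated problems\<close>

(* In the two problems below \<tau> is the trace of the test function on S_L^+. *)
definition incompressible_solution ::
  "'m::finite point set \<Rightarrow> real \<Rightarrow> real \<Rightarrow> ('m point \<Rightarrow> real) \<Rightarrow> bool" where
  "incompressible_solution \<Omega> L m u \<longleftrightarrow> u \<in> H_trunc \<Omega> L \<and>
     (\<forall>\<eta>\<in>H_trunc \<Omega> L. \<forall>\<tau>. has_trace \<Omega> L L \<eta> \<tau> \<longrightarrow>
        (LINT x:trunc \<Omega> L|lebesgue. weak_grad (trunc \<Omega> L) u x \<bullet> weak_grad (trunc \<Omega> L) \<eta> x) =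
        m / measure lebesgue (slice \<Omega> L) * (LINT x':slice \<Omega> L|lebesgue. \<tau> x'))"

definition compressible_solution ::
  "'m::finite point set \<Rightarrow> (real \<Rightarrow> real) \<Rightarrow> (real \<Rightarrow> real \<Rightarrow> real) \<Rightarrow> ('m point \<Rightarrow> real) \<Rightarrow>
   real \<Rightarrow> real \<Rightarrow> real \<Rightarrow> ('m point \<Rightarrow> real) \<Rightarrow> bool" where
  "compressible_solution \<Omega> h qh \<phi> \<epsilon> L m u \<longleftrightarrow> u \<in> H_trunc \<Omega> L \<and>
     (\<forall>\<eta>\<in>H_trunc \<Omega> L. \<forall>\<tau>. has_trace \<Omega> L L \<eta> \<tau> \<longrightarrow>
        (LINT x:trunc \<Omega> L|lebesgue.
           rho_hat h qh \<epsilon> ((norm (weak_grad (trunc \<Omega> L) u x))\<^sup>2) (\<phi> x) *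
           (weak_grad (trunc \<Omega> L) u x \<bullet> weak_grad (trunc \<Omega> L) \<eta> x)) =
        m / measure lebesgue (slice \<Omega> L) * (LINT x':slice \<Omega> L|lebesgue. \<tau> x'))"

end

theory Submission
  imports Defs
begin

text \<open>
  The rescaled difference \<open>w = (\<phi>L - \<phi>bar) / \<epsilon>\<^sup>2\<close> solves a linear flux-free problem
  \<open>div (grad w + F) = 0\<close> with \<open>F = ((rho_hat - 1) / \<epsilon>\<^sup>2) grad \<phi>L\<close>, and \<open>|rho_hat - 1| \<le> CR \<epsilon>\<^sup>2\<close>, so it is enough to
  control the local energy of \<open>\<phi>L\<close> and to transfer that control to \<open>w\<close>. For either function, test with
  \<open>\<zeta>(x\<^sub>n) f + \<kappa>(x\<^sub>n)\<close>, which is constant on each side of the section \<open>a-1 < x\<^sub>n < b+1\<close>. The Poincare inequality on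
  the two end layers gives the Saint-Venant estimate
  \<open>E(a,b) \<le> \<theta> E(a-1,b+1) + C m\<^sup>2 (b-a+1)\<close> with \<open>\<theta> < 1\<close>. Testing with the solution itself bounds the
  total energy by \<open>C m\<^sup>2 L\<close>, and iterating the local estimate over about \<open>L/4\<close> unit layers makes
  this bound harmless: one pass treats \<open>\<phi>L\<close> away from the ends, a second pass treats \<open>w\<close>.
\<close>

section \<open>Lipschitz change of variables\<close>

text \<open>The constants c1 and c2 subtracted on the two end layers differ, so the test function
  leaves a boundary term m (c2 - c1) at x_n = L. This term is the source of m^2 (b - a + 1): c2 - c1
  is an axial increment, its square is at most C (b - a + 1) times the energy, and Young's
  inequality splits the product. Each pass spends a length L/4 at either end, so the first reaches
  |x_n| \<le> 3L/4 and the second |x_n| \<le> L/2; hence the restriction to \<Omega>_{L/2}. The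
  factor \<epsilon>^(-2) is harmless because the density bound is uniform in \<epsilon>, a
  consequence of ellipticity constants shared by all \<epsilon> < \<epsilon>0. The analytic obstacle
  is that \<open>H_trunc\<close> is described by limits of C^1 functions: Poincare and trace
  inequalities are proved for C^1 functions along straight lines of the cylinder, carried to the
  nozzle by Lipschitz bounds instead of Jacobians, and passed to the limit. Weak gradients must also
  be shown unique a.e. before the arbitrarily chosen one can be computed with.\<close>

lemma emeasure_UN_le_count_space:
  assumes "countable I" "\<And>i. i \<in> I \<Longrightarrow> A i \<in> sets M"
  shows "emeasure M (\<Union>i\<in>I. A i) \<le> (\<integral>\<^sup>+i. emeasure M (A i) \<partial>count_space I)"
proof -
  have "(\<Union>i\<in>I. A i) \<in> sets M"
    using assms by auto
  then have "emeasure M (\<Union>i\<in>I. A i) = (\<integral>\<^sup>+x. indicator (\<Union>i\<in>I. A i) x \<partial>M)"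
    by simp
  also have "\<dots> \<le> (\<integral>\<^sup>+x. (\<integral>\<^sup>+i. indicator (A i) x \<partial>count_space I) \<partial>M)"
  proof (rule nn_integral_mono)
    fix x
    show "indicator (\<Union>i\<in>I. A i) x \<le> (\<integral>\<^sup>+i. indicator (A i) x \<partial>count_space I)"
    proof (cases "x \<in> (\<Union>i\<in>I. A i)")
      case True
      then obtain j where j: "j \<in> I" "x \<in> A j" by auto
      have "1 = (\<integral>\<^sup>+i. indicator {j} i \<partial>count_space I)"
        using j by (simp add: emeasure_count_space)
      also have "\<dots> \<le> (\<integral>\<^sup>+i. indicator (A i) x \<partial>count_space I)"
        using j by (intro nn_integral_mono) (auto simp: indicator_def)
      finally show ?thesis using True by simp
    qed simp
  qed
  also have "\<dots> = (\<integral>\<^sup>+i. (\<integral>\<^sup>+x. indicator (A i) x \<partial>M) \<partial>count_space I)"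
    using assms by (intro nn_integral_count_space_nn_integral) auto
  also have "\<dots> = (\<integral>\<^sup>+i. emeasure M (A i) \<partial>count_space I)"
    using assms by (intro nn_integral_cong) auto
  finally show ?thesis .
qed

text \<open>Vitali covering in place of a Jacobian: the enlarged balls of a disjoint family cover S,
  their images lie in balls of radius 5 K r, and the disjoint small balls together measure no more
  than an open set slightly larger than S. The Lipschitz bound is local, on balls inside U, because
  a nozzle section need not be convex.\<close>

lemma emeasure_lipschitz_image_le:
  fixes g :: "'a::euclidean_space \<Rightarrow> 'a"
  assumes "open U" "S \<subseteq> U" and S: "S \<in> sets lebesgue" "g ` S \<in> sets lebesgue" and "K > 0"
    and lip: "\<And>x r y. ball x r \<subseteq> U \<Longrightarrow> y \<in> ball x r \<Longrightarrow> norm (g y - g x) \<le> K * norm (y - x)"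
  shows "emeasure lebesgue (g ` S) \<le> ennreal ((5 * K) ^ DIM('a)) * emeasure lebesgue S"
proof (rule ennreal_le_epsilon)
  define M where "M = (5 * K) ^ DIM('a)"
  have "M > 0" using \<open>K > 0\<close> by (simp add: M_def)
  fix e :: real assume "0 < e"
  \<comment> \<open>The excess \<open>e / M\<close> becomes \<open>e\<close> after multiplication by
    the factor \<open>M\<close>.\<close>
  obtain W where W: "open W" "S \<subseteq> W" "W - S \<in> lmeasurable" "emeasure lebesgue (W - S) < e / M"
    using sets_lebesgue_outer_open[OF S(1), of "e / M"] \<open>0 < e\<close> \<open>0 < M\<close> by auto
  \<comment> \<open>The five-fold ball stays in \<open>W\<close> for the volume count and in
    \<open>U\<close> for the Lipschitz bound; the cap 1 gives the bounded radii that the covering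
    lemma asks for.\<close>
  have "\<exists>r. 0 < r \<and> r \<le> 1 \<and> ball x (5 * r) \<subseteq> W \<inter> U" if "x \<in> S" for x
  proof -
    have "x \<in> W \<inter> U" "open (W \<inter> U)" using that W assms by auto
    then obtain d where d: "d > 0" "ball x d \<subseteq> W \<inter> U" using openE by blast
    have "ball x (5 * min 1 (d / 5)) \<subseteq> ball x d" by (rule subset_ball) auto
    then show ?thesis using d by (intro exI[of _ "min 1 (d / 5)"]) auto
  qed
  then obtain r where r: "\<And>x. x \<in> S \<Longrightarrow> 0 < r x \<and> r x \<le> 1 \<and> ball x (5 * r x) \<subseteq> W \<inter> U"
    by metis
  obtain C where C: "countable C" "C \<subseteq> S"
      "pairwise (\<lambda>i j. disjnt (ball i (r i)) (ball j (r j))) C"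
      "S \<subseteq> (\<Union>i\<in>C. ball i (5 * r i))"
  proof (rule Vitali_covering_lemma_balls[where S=S and K=S and a="\<lambda>x. x" and r=r and B=1], goal_cases)
    case 1
    show ?case
    proof
      fix x assume "x \<in> S"
      then show "x \<in> (\<Union>i\<in>S. ball i (r i))" using r[of x] by (intro UN_I[of x]) auto
    qed
  next
    case 2
    then show ?case using r by simp
  next
    case (3 C)
    show ?case by (rule that) (fact 3)+
  qed
  have "g ` S \<subseteq> (\<Union>i\<in>C. cball (g i) (5 * K * r i))"
  proof
    fix y assume "y \<in> g ` S"
    then obtain x where x: "x \<in> S" "y = g x" by auto
    then obtain i where i: "i \<in> C" "x \<in> ball i (5 * r i)" using C by blast
    have "norm (g x - g i) \<le> K * norm (x - i)"
      using i r C by (intro lip[of i "5 * r i"]) auto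
    also have "\<dots> \<le> K * (5 * r i)"
      using i \<open>K > 0\<close> by (intro mult_left_mono) (auto simp: dist_norm norm_minus_commute)
    finally show "y \<in> (\<Union>i\<in>C. cball (g i) (5 * K * r i))"
      using i x by (auto simp: dist_norm norm_minus_commute algebra_simps intro!: bexI[of _ i])
  qed
  then have "emeasure lebesgue (g ` S) \<le> emeasure lebesgue (\<Union>i\<in>C. cball (g i) (5 * K * r i))"
    using C(1) by (intro emeasure_mono) auto
  also have "\<dots> \<le> (\<integral>\<^sup>+i. emeasure lebesgue (cball (g i) (5 * K * r i)) \<partial>count_space C)"
    using C(1) by (intro emeasure_UN_le_count_space) auto
  also have "\<dots> = (\<integral>\<^sup>+i. M * emeasure lebesgue (ball i (r i)) \<partial>count_space C)"
  proof (rule nn_integral_cong)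
    fix i assume "i \<in> space (count_space C)"
    then have "0 < r i" using r C by auto
    then show "emeasure lebesgue (cball (g i) (5 * K * r i)) = M * emeasure lebesgue (ball i (r i))"
      using \<open>K > 0\<close>
      by (simp add: emeasure_cball emeasure_ball M_def ennreal_mult[symmetric]
            power_mult_distrib algebra_simps)
  qed
  also have "\<dots> = M * (\<integral>\<^sup>+i. emeasure lebesgue (ball i (r i)) \<partial>count_space C)"
    by (intro nn_integral_cmult) auto
  also have "(\<integral>\<^sup>+i. emeasure lebesgue (ball i (r i)) \<partial>count_space C)
      = emeasure lebesgue (\<Union>i\<in>C. ball i (r i))"
    using C(1,3)
    by (intro emeasure_UN_countable[symmetric])
       (auto simp: disjoint_family_on_def pairwise_def disjnt_def)
  also have "\<dots> \<le> emeasure lebesgue W"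
  proof (rule emeasure_mono)
    show "(\<Union>i\<in>C. ball i (r i)) \<subseteq> W"
    proof
      fix y assume "y \<in> (\<Union>i\<in>C. ball i (r i))"
      then obtain i where i: "i \<in> C" "y \<in> ball i (r i)" by auto
      then have "y \<in> ball i (5 * r i)" using r C by force
      then show "y \<in> W" using r i C by blast
    qed
  qed (use W in auto)
  also have "emeasure lebesgue W = emeasure lebesgue S + emeasure lebesgue (W - S)"
    using W S by (subst plus_emeasure) (auto simp: Un_absorb1)
  also have "M * \<dots> \<le> M * (emeasure lebesgue S + e / M)"
    using W by (intro mult_left_mono add_left_mono) auto
  also have "\<dots> = M * emeasure lebesgue S + e"
    using \<open>M > 0\<close> \<open>0 < e\<close> by (simp add: distrib_left ennreal_mult[symmetric])
  finally show "emeasure lebesgue (g ` S) \<le> ennreal ((5 * K) ^ DIM('a)) * emeasure lebesgue S + e"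
    by (simp add: M_def mult_left_mono)
qed

text \<open>The preimage of a set under \<open>k\<close> is its image under the Lipschitz map
  \<open>g\<close>, so pushing Lebesgue measure forward by \<open>k\<close> gives at most a constant
  times Lebesgue measure. The bound K therefore concerns the inverse \<open>g\<close> of the map
  being substituted.\<close>

lemma nn_integral_lipschitz_transfer:
  fixes g k :: "'a::euclidean_space \<Rightarrow> 'a" and F :: "'a \<Rightarrow> ennreal"
  assumes U: "open U" and V: "open V" and k: "continuous_on V k"
    and kU: "\<And>y. y \<in> V \<Longrightarrow> k y \<in> U \<and> g (k y) = y"
    and gV: "\<And>x. x \<in> U \<Longrightarrow> g x \<in> V \<and> k (g x) = x"
    and der: "\<And>x. x \<in> U \<Longrightarrow> (g has_derivative g' x) (at x) \<and> onorm (g' x) \<le> K"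
    and "K > 0" and F: "(\<lambda>x. F x * indicator U x) \<in> borel_measurable borel"
  shows "(\<integral>\<^sup>+y. F (k y) * indicator V y \<partial>lborel)
      \<le> ennreal ((5 * K) ^ DIM('a)) * (\<integral>\<^sup>+x. F x * indicator U x \<partial>lborel)"
proof -
  define M where "M = ennreal ((5 * K) ^ DIM('a))"
  define F' where "F' x = F x * indicator U x" for x
  have F': "F' \<in> borel_measurable borel" using F by (simp add: F'_def[abs_def])
  have [measurable]: "V \<in> sets borel" "U \<in> sets borel" using U V by auto
  have km: "k \<in> restrict_space lborel V \<rightarrow>\<^sub>M borel"
    using borel_measurable_continuous_on_restrict[OF k] by (simp cong: measurable_cong_sets)
  \<comment> \<open>Balls are convex, so the derivative bound integrates to a Lipschitz bound on
    each of them.\<close>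
  have lip: "norm (g y - g x) \<le> K * norm (y - x)" if "ball x r \<subseteq> U" "y \<in> ball x r" for x r y
  proof (rule differentiable_bound[of "ball x r" g g'])
    show "x \<in> ball x r" using that by (metis ball_eq_empty centre_in_ball emptyE not_le)
    show "(g has_derivative g' z) (at z within ball x r)" if "z \<in> ball x r" for z
      using der[of z] that \<open>ball x r \<subseteq> U\<close> has_derivative_at_withinI by blast
    show "onorm (g' z) \<le> K" if "z \<in> ball x r" for z
      using der[of z] that \<open>ball x r \<subseteq> U\<close> by auto
  qed (use that in auto)
  have "(\<integral>\<^sup>+y. F (k y) * indicator V y \<partial>lborel) = (\<integral>\<^sup>+y. F' (k y) * indicator V y \<partial>lborel)"
    using kU by (intro nn_integral_cong) (auto simp: F'_def indicator_def)
  also have "\<dots> = (\<integral>\<^sup>+y. F' (k y) \<partial>restrict_space lborel V)"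
    by (subst nn_integral_restrict_space) auto
  also have "\<dots> = (\<integral>\<^sup>+x. F' x \<partial>distr (restrict_space lborel V) borel k)"
    using F' km by (subst nn_integral_distr) auto
  also have "\<dots> \<le> (\<integral>\<^sup>+x. F' x \<partial>scale_measure M lborel)"
  proof (rule nn_integral_mono_measure)
    show "distr (restrict_space lborel V) borel k \<le> scale_measure M lborel"
      proof -
      have *: "emeasure (distr (restrict_space lborel V) borel k) A
          \<le> emeasure (scale_measure M lborel) A" for A
      proof (cases "A \<in> sets borel")
        case True
        have eq: "k -` A \<inter> V = g ` (A \<inter> U)"
        proof safe
          fix y assume "y \<in> V" "k y \<in> A"
          then show "y \<in> g ` (A \<inter> U)" using kU[of y] by (intro image_eqI[of _ _ "k y"]) auto
        qed (use gV in auto)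
        have meas: "k -` A \<inter> V \<in> sets borel"
          using measurable_sets[OF km True] V by (auto simp: sets_restrict_space_iff)
        have "emeasure (distr (restrict_space lborel V) borel k) A
            = emeasure (restrict_space lborel V) (k -` A \<inter> V)"
          using km True by (subst emeasure_distr) auto
        also have "\<dots> = emeasure lborel (k -` A \<inter> V)"
          using meas by (subst emeasure_restrict_space) auto
        also have "\<dots> = emeasure lebesgue (g ` (A \<inter> U))"
          using meas by (simp add: eq)
        also have "\<dots> \<le> M * emeasure lebesgue (A \<inter> U)"
          unfolding M_def using U \<open>K > 0\<close> True meas lip
          by (intro emeasure_lipschitz_image_le[of U]) (auto simp: eq)
        also have "\<dots> \<le> M * emeasure lborel A"
          using True by (auto intro!: mult_left_mono emeasure_mono simp: emeasure_completion)
        finally show ?thesis by simp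
      qed (simp add: emeasure_notin_sets)
      show ?thesis
        unfolding le_measure_iff using * by (auto simp: le_fun_def space_scale_measure)
    qed
  qed auto
  also have "\<dots> = M * (\<integral>\<^sup>+x. F' x \<partial>lborel)"
    using F' by (subst nn_integral_scale_measure) auto
  finally show ?thesis by (simp add: F'_def M_def)
qed

section \<open>Straightening the nozzle\<close>

lemma open_cylinder: "open (cylinder :: 'm::finite point set)"
  by (auto simp: cylinder_def intro: open_Times)

text \<open>What the estimates draw from the straightening: first derivatives bounded by
  \<open>K\<close> in both directions, and preserved heights. Continuity of \<open>S'\<close> makes
  derivatives along segments continuous, as the fundamental theorem of calculus requires, and the
  bound on \<open>fst (S y)\<close> makes truncated nozzles bounded.\<close>

locale nozzle_chart =
  fixes \<Omega> :: "'m::finite point set" and T S :: "'m point \<Rightarrow> 'm point"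
    and T' S' :: "'m point \<Rightarrow> 'm point \<Rightarrow>\<^sub>L 'm point" and K :: real
  assumes K_ge: "1 \<le> K" and open_\<Omega>: "open \<Omega>"
    and T_props: "\<And>x. x \<in> \<Omega> \<Longrightarrow> T x \<in> cylinder \<and> snd (T x) = snd x \<and> S (T x) = x"
    and S_props: "\<And>y. y \<in> cylinder \<Longrightarrow> S y \<in> \<Omega> \<and> snd (S y) = snd y \<and> T (S y) = y"
    and T_der: "\<And>x. x \<in> \<Omega> \<Longrightarrow> (T has_derivative blinfun_apply (T' x)) (at x) \<and> norm (T' x) \<le> K"
    and S_der: "\<And>y. y \<in> cylinder \<Longrightarrow> (S has_derivative blinfun_apply (S' y)) (at y) \<and> norm (S' y) \<le> K"
    and S'_cont: "continuous_on cylinder S'"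
    and S_bound: "\<And>y. y \<in> cylinder \<Longrightarrow> norm (fst (S y)) \<le> K"

text \<open>The nozzle condition bounds T only after its axial part is subtracted. Adding back the
  linear map \<open>P\<close>, of norm at most 1, costs the summand 1; together with the absolute
  value it also supplies the bound \<open>1 \<le> K\<close> of the chart. Continuity of the first
  derivative comes from the existence of the second.\<close>

lemma C2_holder_bound_shift_snd:
  fixes U :: "'m::finite point set" and T :: "'m point \<Rightarrow> 'm point"
  assumes "C2_holder_bound \<alpha> U (\<lambda>x. T x - (0, snd x)) K" "open U"
  shows "\<exists>T'. continuous_on U T' \<and>
    (\<forall>x\<in>U. (T has_derivative blinfun_apply (T' x)) (at x) \<and> norm (T' x) \<le> \<bar>K\<bar> + 1 \<and>
       norm (fst (T x)) \<le> \<bar>K\<bar> + 1)"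
proof -
  obtain f' :: "'m point \<Rightarrow> 'm point \<Rightarrow>\<^sub>L 'm point" and f'' :: "'m point \<Rightarrow> 'm point \<Rightarrow>\<^sub>L ('m point \<Rightarrow>\<^sub>L 'm point)" where
    C: "\<forall>x\<in>U. ((\<lambda>x. T x - (0, snd x)) has_derivative blinfun_apply (f' x)) (at x)"
       "\<forall>x\<in>U. (f' has_derivative blinfun_apply (f'' x)) (at x)"
       "\<forall>x\<in>U. norm (T x - (0, snd x)) \<le> K \<and> norm (f' x) \<le> K \<and> norm (f'' x) \<le> K"
    by (insert assms(1)[unfolded C2_holder_bound_def], elim conjE exE, rule that; assumption)
  note f' = bspec[OF C(1)] and f'' = bspec[OF C(2)] and b = bspec[OF C(3)]
  define P :: "'m point \<Rightarrow>\<^sub>L 'm point" where "P = Blinfun (\<lambda>x. (0, snd x))"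
  have bl: "bounded_linear (\<lambda>x::'m point. (0::real^'m, snd x))"
    by (intro bounded_linear_Pair bounded_linear_zero bounded_linear_snd)
  have P: "blinfun_apply P = (\<lambda>x. (0, snd x))"
    by (simp add: P_def bounded_linear_Blinfun_apply[OF bl])
  have nP: "norm P \<le> 1"
    by (rule norm_blinfun_bound) (auto simp: P norm_Pair norm_snd_le)
  show ?thesis
  proof (intro exI[of _ "\<lambda>x. f' x + P"] conjI ballI)
    have "continuous_on U f'"
      by (rule has_derivative_continuous_on) (use f'' has_derivative_at_withinI in blast)
    then show "continuous_on U (\<lambda>x. f' x + P)" by (intro continuous_intros)
  next
    fix x assume x: "x \<in> U"
    have "((\<lambda>x. (T x - (0, snd x)) + (0, snd x)) has_derivative (\<lambda>v. f' x v + (0, snd v))) (at x)"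
      by (intro has_derivative_add f'[OF x] bounded_linear_imp_has_derivative bl)
    then show "(T has_derivative blinfun_apply (f' x + P)) (at x)"
      by (simp add: P plus_blinfun.rep_eq)
    show "norm (f' x + P) \<le> \<bar>K\<bar> + 1"
      using norm_triangle_ineq[of "f' x" P] nP b[OF x] by linarith
    show "norm (fst (T x)) \<le> \<bar>K\<bar> + 1"
      using norm_fst_le[of "fst (T x)" "snd (T x - (0, snd x))"] b[OF x]
      by (cases "T x") auto
  qed
qed

text \<open>With \<open>S\<close> the inverse on the closure, the level-set condition says that a
  cylinder point at height k has a preimage in \<Omega> at the same height, and injectivity on the
  closure identifies that preimage with \<open>S y\<close>.\<close>

lemma nozzle_imp_chart:
  fixes \<Omega> :: "'m::finite point set"
  assumes "nozzle \<Omega>"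
  obtains T S T' S' K where "nozzle_chart \<Omega> T S T' S' K"
proof -
  obtain T :: "'m point \<Rightarrow> 'm point" and \<alpha> K where op: "open \<Omega>" and bij: "bij_betw T (closure \<Omega>) (closure cylinder)"
    and sl: "\<forall>k. T ` {x\<in>\<Omega>. snd x = k} = ball 0 1 \<times> {k}"
    and CT: "C2_holder_bound \<alpha> \<Omega> (\<lambda>x. T x - (0, snd x)) K"
    and CS: "C2_holder_bound \<alpha> cylinder (\<lambda>y. inv_into (closure \<Omega>) T y - (0, snd y)) K"
    by (insert assms[unfolded nozzle_def], elim conjE exE, rule that; assumption)
  define S where "S = inv_into (closure \<Omega>) T"
  obtain T' where T': "continuous_on \<Omega> T' \<and>
      (\<forall>x\<in>\<Omega>. (T has_derivative blinfun_apply (T' x)) (at x) \<and> norm (T' x) \<le> \<bar>K\<bar> + 1 \<and>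
       norm (fst (T x)) \<le> \<bar>K\<bar> + 1)"
    using C2_holder_bound_shift_snd[OF CT op] ..
  obtain S' where S': "continuous_on cylinder S' \<and>
      (\<forall>y\<in>cylinder. (S has_derivative blinfun_apply (S' y)) (at y) \<and> norm (S' y) \<le> \<bar>K\<bar> + 1
       \<and> norm (fst (S y)) \<le> \<bar>K\<bar> + 1)"
    using C2_holder_bound_shift_snd[OF CS open_cylinder] unfolding S_def ..
  have inj: "inj_on T (closure \<Omega>)" using bij by (rule bij_betw_imp_inj_on)
  have ST: "S (T x) = x" if "x \<in> \<Omega>" for x
    unfolding S_def by (rule inv_into_f_f[OF inj]) (use that closure_subset in blast)
  have "nozzle_chart \<Omega> T S T' S' (\<bar>K\<bar> + 1)"
  proof
    fix x assume x: "x \<in> \<Omega>"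
    have "T x \<in> ball 0 1 \<times> {snd x}" using sl[rule_format, of "snd x"] x by blast
    then show "T x \<in> cylinder \<and> snd (T x) = snd x \<and> S (T x) = x"
      using ST[OF x] by (auto simp: cylinder_def)
  next
    fix y :: "'m point" assume "y \<in> cylinder"
    then have "y \<in> ball 0 1 \<times> {snd y}" by (auto simp: cylinder_def)
    then have "y \<in> T ` {x\<in>\<Omega>. snd x = snd y}" by (simp only: sl[rule_format])
    then obtain x where "x \<in> \<Omega>" "snd x = snd y" "y = T x" by auto
    then show "S y \<in> \<Omega> \<and> snd (S y) = snd y \<and> T (S y) = y" using ST by auto
  qed (use T' S' op in auto)
  then show ?thesis by (rule that)
qed

section \<open>Integrals over nozzle sections compared with integrals over the straight
  cylinder\<close>

definition cyl :: "real \<Rightarrow> real \<Rightarrow> 'm::finite point set" where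
  "cyl a b = ball 0 1 \<times> {a<..<b}"

lemma cyl_subset: "cyl a b \<subseteq> cylinder" by (auto simp: cyl_def cylinder_def)
lemma open_cyl: "open (cyl a b)" by (auto simp: cyl_def intro: open_Times)
lemma convex_cyl: "convex (cyl a b)" by (auto simp: cyl_def intro: convex_Times)

lemma emeasure_cyl:
  assumes "a \<le> b"
  shows "emeasure lborel (cyl a b :: 'm::finite point set)
    = ennreal (b - a) * emeasure lborel (ball 0 1 :: (real^'m) set)"
  using assms unfolding cyl_def lborel_prod[symmetric]
  by (subst lborel.emeasure_pair_measure_Times) (auto simp: mult.commute)

context nozzle_chart begin

lemma T_cont: "continuous_on \<Omega> T"
  by (rule has_derivative_continuous_on) (use T_der has_derivative_at_withinI in blast)

lemma S_cont: "continuous_on cylinder S"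
  by (rule has_derivative_continuous_on) (use S_der has_derivative_at_withinI in blast)

lemma open_section: "open (section_between \<Omega> a b)"
proof -
  have "section_between \<Omega> a b = \<Omega> \<inter> snd -` {a<..<b}" by (auto simp: section_between_def)
  moreover have "open (snd -` {a<..<b} :: 'm point set)" by (intro open_vimage_snd) auto
  ultimately show ?thesis using open_\<Omega> by auto
qed

lemma open_slice: "open (slice \<Omega> t)"
proof -
  have "slice \<Omega> t = (\<lambda>x. (x, t)) -` \<Omega>" by (auto simp: slice_def)
  moreover have "open ((\<lambda>x. (x, t)) -` \<Omega>)"
    by (intro open_vimage open_\<Omega> continuous_intros)
  ultimately show ?thesis by simp
qed

text \<open>Transfer factors in dimension n, for sections, and n - 1, for cross-sections. The same
  factor serves both directions because \<open>K\<close> bounds the derivatives of \<open>T\<close>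
  and of \<open>S\<close>.\<close>

definition M where "M = (5 * K) ^ DIM('m point)"
definition Ms where "Ms = (5 * K) ^ DIM(real^'m)"

lemma M_pos: "0 < M" and Ms_pos: "0 < Ms"
  using K_ge by (auto simp: M_def Ms_def)

lemma measurable_comp_S:
  assumes "F \<in> borel_measurable borel"
  shows "(\<lambda>y. (F (S y) :: ennreal) * indicator (cyl a b) y) \<in> borel_measurable borel"
proof -
  have "S \<in> restrict_space borel (cyl a b) \<rightarrow>\<^sub>M borel"
    using S_cont cyl_subset by (intro borel_measurable_continuous_on_restrict) (rule continuous_on_subset)
  then have "(\<lambda>y. F (S y)) \<in> borel_measurable (restrict_space borel (cyl a b))"
    using assms by simp
  then show ?thesis
    by (subst (asm) borel_measurable_restrict_space_iff_ennreal) (auto intro: borel_open open_cyl)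
qed

text \<open>With \<open>cyl_le_section\<close> this makes \<Omega> and the cylinder interchangeable
  up to \<open>M\<close>: here the substituted map is \<open>T\<close>, so the factor comes from the
  derivative of its inverse \<open>S\<close>; there the roles are exchanged.\<close>

lemma section_le_cyl:
  assumes "F \<in> borel_measurable borel"
  shows "(\<integral>\<^sup>+x. F x * indicator (section_between \<Omega> a b) x \<partial>lborel)
    \<le> M * (\<integral>\<^sup>+y. F (S y) * indicator (cyl a b) y \<partial>lborel)"
proof -
  have "(\<integral>\<^sup>+x. F x * indicator (section_between \<Omega> a b) x \<partial>lborel)
    = (\<integral>\<^sup>+x. F (S (T x)) * indicator (section_between \<Omega> a b) x \<partial>lborel)"
    using T_props by (intro nn_integral_cong) (auto simp: indicator_def section_between_def)
  also have "\<dots> \<le> M * (\<integral>\<^sup>+y. F (S y) * indicator (cyl a b) y \<partial>lborel)"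
    unfolding M_def
  proof (rule nn_integral_lipschitz_transfer[OF open_cyl open_section, where g=S and g'="\<lambda>y. blinfun_apply (S' y)"])
    show "continuous_on (section_between \<Omega> a b) T"
      by (rule continuous_on_subset[OF T_cont]) (auto simp: section_between_def)
    show "T y \<in> cyl a b \<and> S (T y) = y" if "y \<in> section_between \<Omega> a b" for y
      using that T_props[of y] by (cases "T y") (auto simp: section_between_def cyl_def cylinder_def)
    show "S x \<in> section_between \<Omega> a b \<and> T (S x) = x" if "x \<in> cyl a b" for x
      using that S_props[of x] cyl_subset[of a b] by (auto simp: section_between_def cyl_def)
    show "(S has_derivative blinfun_apply (S' x)) (at x) \<and> onorm (S' x) \<le> K" if "x \<in> cyl a b" for x
      using S_der[of x] that cyl_subset[of a b] by (auto simp: norm_blinfun.rep_eq)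
    show "(\<lambda>x. F (S x) * indicator (cyl a b) x) \<in> borel_measurable borel"
      by (rule measurable_comp_S[OF assms])
  qed (use K_ge in auto)
  finally show ?thesis .
qed

lemma cyl_le_section:
  assumes "F \<in> borel_measurable borel"
  shows "(\<integral>\<^sup>+y. F (S y) * indicator (cyl a b) y \<partial>lborel)
    \<le> M * (\<integral>\<^sup>+x. F x * indicator (section_between \<Omega> a b) x \<partial>lborel)"
  unfolding M_def
proof (rule nn_integral_lipschitz_transfer[OF open_section open_cyl, where g=T and g'="\<lambda>y. blinfun_apply (T' y)"])
  show "continuous_on (cyl a b) S"
    by (rule continuous_on_subset[OF S_cont cyl_subset])
  show "T y \<in> cyl a b \<and> S (T y) = y" if "y \<in> section_between \<Omega> a b" for y
    using that T_props[of y] by (cases "T y") (auto simp: section_between_def cyl_def cylinder_def)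
  show "S x \<in> section_between \<Omega> a b \<and> T (S x) = x" if "x \<in> cyl a b" for x
    using that S_props[of x] cyl_subset[of a b] by (auto simp: section_between_def cyl_def)
  show "(T has_derivative blinfun_apply (T' x)) (at x) \<and> onorm (T' x) \<le> K"
    if "x \<in> section_between \<Omega> a b" for x
    using T_der[of x] that by (auto simp: norm_blinfun.rep_eq section_between_def)
  show "(\<lambda>x. F x * indicator (section_between \<Omega> a b) x) \<in> borel_measurable borel"
    using assms open_section[of a b] by simp
qed (use K_ge in auto)

lemma onorm_fst_comp_le:
  fixes f :: "'m point \<Rightarrow>\<^sub>L 'm point"
  assumes "norm f \<le> K"
  shows "onorm (\<lambda>v. fst (f (v, 0))) \<le> K"
proof (rule onorm_bound)
  show "norm (fst (f (v, 0))) \<le> K * norm v" for v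
  proof -
    have "norm (fst (f (v, 0))) \<le> norm (f (v, 0))"
      by (metis norm_fst_le prod.collapse)
    also have "\<dots> \<le> norm f * norm (v, 0::real)" by (rule norm_blinfun)
    also have "\<dots> \<le> K * norm v" using assms by (simp add: norm_Pair mult_right_mono)
    finally show ?thesis .
  qed
qed (use K_ge in auto)

lemma slice_map_der:
  assumes "(G has_derivative blinfun_apply (f :: 'm point \<Rightarrow>\<^sub>L 'm point)) (at (x, t))"
  shows "((\<lambda>x. fst (G (x, t))) has_derivative (\<lambda>v. fst (f (v, 0)))) (at x)"
proof -
  have "((\<lambda>x. (x, t)) has_derivative (\<lambda>v. (v, 0))) (at x)"
    by (auto intro!: derivative_eq_intros)
  from has_derivative_compose[OF this assms] show ?thesis
    by (rule has_derivative_fst)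
qed

lemma slice_fst_T: "x \<in> slice \<Omega> t \<Longrightarrow> fst (T (x, t)) \<in> ball 0 1 \<and> fst (S (fst (T (x, t)), t)) = x"
  using T_props[of "(x, t)"] unfolding slice_def cylinder_def
  by (cases "T (x, t)") (auto simp del: mem_ball)

lemma ball_fst_S: "y \<in> ball 0 1 \<Longrightarrow> fst (S (y, t)) \<in> slice \<Omega> t \<and> fst (T (fst (S (y, t)), t)) = y
    \<and> S (y, t) = (fst (S (y, t)), t)"
  using S_props[of "(y, t)"] unfolding slice_def cylinder_def
  by (cases "S (y, t)") (auto simp del: mem_ball)

lemma S_slice_cont: "continuous_on (ball 0 1) (\<lambda>y. fst (S (y, t)))"
  by (intro continuous_on_fst continuous_on_compose2[OF S_cont] continuous_intros)
     (auto simp: cylinder_def)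

lemma T_slice_cont: "continuous_on (slice \<Omega> t) (\<lambda>y. fst (T (y, t)))"
  by (intro continuous_on_fst continuous_on_compose2[OF T_cont] continuous_intros)
     (auto simp: slice_def)

text \<open>Heights are preserved, so at fixed \<open>t\<close> the first components of
  \<open>T\<close> and \<open>S\<close> are mutually inverse maps between the cross-section and the
  unit ball; restricting a derivative to horizontal vectors and projecting it does not increase its
  norm.\<close>

lemma slice_le_ball:
  assumes "F \<in> borel_measurable borel"
  shows "(\<integral>\<^sup>+x. F x * indicator (slice \<Omega> t) x \<partial>lborel)
    \<le> Ms * (\<integral>\<^sup>+y. F (fst (S (y, t))) * indicator (ball 0 1) y \<partial>lborel)"
proof -
  have "(\<integral>\<^sup>+x. F x * indicator (slice \<Omega> t) x \<partial>lborel)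
    = (\<integral>\<^sup>+x. F (fst (S (fst (T (x, t)), t))) * indicator (slice \<Omega> t) x \<partial>lborel)"
    using slice_fst_T by (intro nn_integral_cong) (auto simp: indicator_def)
  also have "\<dots> \<le> Ms * (\<integral>\<^sup>+y. F (fst (S (y, t))) * indicator (ball 0 1) y \<partial>lborel)"
    unfolding Ms_def
  proof (rule nn_integral_lipschitz_transfer[OF _ open_slice T_slice_cont, where g="\<lambda>y. fst (S (y, t))"
        and g'="\<lambda>y v. fst (S' (y, t) (v, 0))"])
    show "((\<lambda>y. fst (S (y, t))) has_derivative (\<lambda>v. fst (S' (x, t) (v, 0)))) (at x) \<and>
      onorm (\<lambda>v. fst (S' (x, t) (v, 0))) \<le> K" if "x \<in> ball 0 1" for x
      using S_der[of "(x, t)"] that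
      by (intro conjI slice_map_der onorm_fst_comp_le) (auto simp: cylinder_def)
    have "(\<lambda>y. fst (S (y, t))) \<in> restrict_space borel (ball 0 1) \<rightarrow>\<^sub>M borel"
      using S_slice_cont by (rule borel_measurable_continuous_on_restrict)
    then have "(\<lambda>y. F (fst (S (y, t)))) \<in> borel_measurable (restrict_space borel (ball 0 1))"
      using assms by (rule measurable_compose)
    then show "(\<lambda>x. F (fst (S (x, t))) * indicator (ball 0 1) x) \<in> borel_measurable borel"
      by (subst (asm) borel_measurable_restrict_space_iff_ennreal) auto
    show "\<And>y. y \<in> slice \<Omega> t \<Longrightarrow> fst (T (y, t)) \<in> ball 0 1 \<and> fst (S (fst (T (y, t)), t)) = y"
      by (rule slice_fst_T)
    show "\<And>y. y \<in> ball 0 1 \<Longrightarrow> fst (S (y, t)) \<in> slice \<Omega> t \<and> fst (T (fst (S (y, t)), t)) = y"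
      using ball_fst_S by blast
  qed (use K_ge in auto)
  finally show ?thesis .
qed

lemma ball_le_slice:
  assumes "F \<in> borel_measurable borel"
  shows "(\<integral>\<^sup>+y. F (fst (S (y, t))) * indicator (ball 0 1) y \<partial>lborel)
    \<le> Ms * (\<integral>\<^sup>+x. F x * indicator (slice \<Omega> t) x \<partial>lborel)"
  unfolding Ms_def
proof (rule nn_integral_lipschitz_transfer[OF open_slice _ S_slice_cont, where g="\<lambda>y. fst (T (y, t))"
      and g'="\<lambda>y v. fst (T' (y, t) (v, 0))"])
  show "((\<lambda>y. fst (T (y, t))) has_derivative (\<lambda>v. fst (T' (x, t) (v, 0)))) (at x) \<and>
    onorm (\<lambda>v. fst (T' (x, t) (v, 0))) \<le> K" if "x \<in> slice \<Omega> t" for x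
    using T_der[of "(x, t)"] that
    by (intro conjI slice_map_der onorm_fst_comp_le) (auto simp: slice_def)
  show "(\<lambda>x. F x * indicator (slice \<Omega> t) x) \<in> borel_measurable borel"
    using assms open_slice[of t] by simp
  show "\<And>y. y \<in> slice \<Omega> t \<Longrightarrow> fst (T (y, t)) \<in> ball 0 1 \<and> fst (S (fst (T (y, t)), t)) = y"
    by (rule slice_fst_T)
  show "\<And>y. y \<in> ball 0 1 \<Longrightarrow> fst (S (y, t)) \<in> slice \<Omega> t \<and> fst (T (fst (S (y, t)), t)) = y"
    using ball_fst_S by blast
qed (use K_ge in auto)

definition \<beta> where "\<beta> = measure lborel (ball 0 1 :: (real^'m) set)"

lemma \<beta>_pos: "0 < \<beta>"
  unfolding \<beta>_def by (rule content_ball_pos) (rule zero_less_one)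

lemma emeasure_ball_\<beta>: "emeasure lborel (ball 0 1 :: (real^'m) set) = ennreal \<beta>"
  unfolding \<beta>_def by (rule emeasure_eq_ennreal_measure, rule less_imp_neq)
     (simp only: infinity_ennreal_def[symmetric] emeasure_lborel_ball_finite)

text \<open>A lower bound on the area uniform in \<open>t\<close>; it keeps the prescribed outflow
  density, which is divided by the area of the end section, bounded independently of L.\<close>

lemma emeasure_slice: "ennreal \<beta> \<le> ennreal Ms * emeasure lborel (slice \<Omega> t)"
proof -
  have "(\<integral>\<^sup>+x. 1 * indicator (slice \<Omega> t) x \<partial>lborel) = emeasure lborel (slice \<Omega> t)"
      "(\<integral>\<^sup>+x. 1 * indicator (ball 0 1 :: (real^'m) set) x \<partial>lborel) = ennreal \<beta>"
    using open_slice[of t] by (simp_all add: emeasure_ball_\<beta>)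
  with ball_le_slice[of "\<lambda>_. 1" t] show ?thesis by simp
qed

text \<open>The comparison applied to the constant 1. It yields a volume of at least a fixed
  multiple of the length, for the denominator of the final average.\<close>

lemma emeasure_section:
  assumes "a \<le> b"
  shows "ennreal (\<beta> * (b - a)) \<le> ennreal M * emeasure lborel (section_between \<Omega> a b)"
proof -
  have I: "(\<integral>\<^sup>+x. 1 * indicator (section_between \<Omega> a b) x \<partial>lborel)
        = emeasure lborel (section_between \<Omega> a b)"
    using borel_open[OF open_section[of a b]] by simp
  have "(\<integral>\<^sup>+x. 1 * indicator (cyl a b :: 'm point set) x \<partial>lborel) = emeasure lborel (cyl a b :: 'm point set)"
    unfolding mult_1_left by (rule nn_integral_indicator) (simp only: sets_lborel borel_open[OF open_cyl])
  also have "\<dots> = ennreal (\<beta> * (b - a))"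
    using assms \<beta>_pos
    by (simp only: emeasure_cyl emeasure_ball_\<beta> mult.commute[of \<beta>] ennreal_mult' diff_ge_0_iff_ge)
  finally have J: "(\<integral>\<^sup>+x. 1 * indicator (cyl a b :: 'm point set) x \<partial>lborel) = ennreal (\<beta> * (b - a))" .
  show "ennreal (\<beta> * (b - a)) \<le> ennreal M * emeasure lborel (section_between \<Omega> a b)"
    using cyl_le_section[of "\<lambda>_. 1" a b] unfolding I J by simp
qed

end

section \<open>Integral inequalities behind the Poincare estimate\<close>

lemma sq_diff_le_nn_integral:
  fixes f f' :: "real \<Rightarrow> real"
  assumes "a < b" and der: "\<And>s. s \<in> {a..b} \<Longrightarrow> (f has_real_derivative f' s) (at s)"
    and cont: "continuous_on {a..b} f'"
  shows "ennreal ((f b - f a)\<^sup>2)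
    \<le> ennreal (b - a) * (\<integral>\<^sup>+s. ennreal ((f' s)\<^sup>2) * indicator {a<..<b} s \<partial>lborel)"
proof -
  \<comment> \<open>\<open>d\<close> is the mean slope: the integral of (f' - d)^2 over the interval
    is nonnegative, and multiplied by the length h it equals h I - \<delta>^2.\<close>
  define \<delta> h d where "\<delta> = f b - f a" and "h = b - a" and "d = (f b - f a) / (b - a)"
  have h: "h > 0" "d * h = \<delta>" using \<open>a < b\<close> by (auto simp: h_def d_def \<delta>_def)
  define I where "I = integral {a..b} (\<lambda>s. (f' s)\<^sup>2)"
  have 1: "(f' has_integral \<delta>) {a..b}"
    unfolding \<delta>_def using \<open>a < b\<close> der
    by (intro fundamental_theorem_of_calculus)
       (auto simp: has_real_derivative_iff_has_vector_derivative[symmetric] intro: has_field_derivative_at_within)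
  have 2: "((\<lambda>s. (f' s)\<^sup>2) has_integral I) {a..b}"
    unfolding I_def by (intro integrable_integral integrable_continuous_real continuous_intros cont)
  have 3: "((\<lambda>s. d\<^sup>2) has_integral h * d\<^sup>2) {a..b}"
    using has_integral_const_real[of "d\<^sup>2" a b] \<open>a < b\<close> by (simp add: h_def)
  have "((\<lambda>s. (f' s)\<^sup>2 - 2 * d * f' s + d\<^sup>2) has_integral (I - 2 * d * \<delta> + h * d\<^sup>2)) {a..b}"
    by (intro has_integral_add has_integral_diff has_integral_mult_right 1 2 3)
  then have "0 \<le> I - 2 * d * \<delta> + h * d\<^sup>2"
  proof (rule has_integral_nonneg)
    fix s
    have "(f' s)\<^sup>2 - 2 * d * f' s + d\<^sup>2 = (f' s - d)\<^sup>2" by (simp add: power2_eq_square algebra_simps)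
    then show "0 \<le> (f' s)\<^sup>2 - 2 * d * f' s + d\<^sup>2" by simp
  qed
  then have "0 \<le> h * (I - 2 * d * \<delta> + h * d\<^sup>2)" using h by simp
  also have "\<dots> = h * I - \<delta>\<^sup>2" by (simp add: h(2)[symmetric] power2_eq_square algebra_simps)
  finally have le: "\<delta>\<^sup>2 \<le> h * I" by simp
  have "((\<lambda>s. (f' s)\<^sup>2) has_integral I) {a<..<b}" using 2 by (simp add: has_integral_Icc_iff_Ioo)
  then have "(\<integral>\<^sup>+s. ennreal (indicator {a<..<b} s * (f' s)\<^sup>2) \<partial>lborel) = ennreal I"
    by (intro nn_integral_has_integral_lebesgue) auto
  also have "(\<integral>\<^sup>+s. ennreal (indicator {a<..<b} s * (f' s)\<^sup>2) \<partial>lborel)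
      = (\<integral>\<^sup>+s. ennreal ((f' s)\<^sup>2) * indicator {a<..<b} s \<partial>lborel)"
    by (intro nn_integral_cong) (auto simp: indicator_def)
  finally have "ennreal (b - a) * (\<integral>\<^sup>+s. ennreal ((f' s)\<^sup>2) * indicator {a<..<b} s \<partial>lborel)
      = ennreal (h * I)"
    using h by (simp add: h_def ennreal_mult')
  then show ?thesis using le by (simp add: \<delta>_def ennreal_leI)
qed

lemma nn_integral_lborel_affine:
  fixes H :: "'a::euclidean_space \<Rightarrow> ennreal"
  assumes "H \<in> borel_measurable borel" "c > 0"
  shows "(\<integral>\<^sup>+x. H x \<partial>lborel) = ennreal (c ^ DIM('a)) * (\<integral>\<^sup>+x. H (t + c *\<^sub>R x) \<partial>lborel)"
proof -
  note [measurable] = assms(1)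
  define N where "N = distr lborel borel (\<lambda>x::'a. t + c *\<^sub>R x)"
  have N: "lborel = density N (\<lambda>_. ennreal (c ^ DIM('a)))"
    using lborel_affine[of c t] \<open>c > 0\<close> by (simp add: N_def)
  have sN: "sets N = sets borel" by (simp add: N_def)
  have HN: "H \<in> borel_measurable N" using assms(1) by (simp cong: measurable_cong_sets add: sN)
  have "(\<integral>\<^sup>+x. H x \<partial>lborel) = (\<integral>\<^sup>+x. H x \<partial>density N (\<lambda>_. ennreal (c ^ DIM('a))))"
    using N by simp
  also have "\<dots> = (\<integral>\<^sup>+x. ennreal (c ^ DIM('a)) * H x \<partial>N)"
    by (rule nn_integral_density[OF _ HN]) simp
  also have "\<dots> = ennreal (c ^ DIM('a)) * (\<integral>\<^sup>+x. H x \<partial>N)"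
    by (rule nn_integral_cmult[OF HN])
  also have "(\<integral>\<^sup>+x. H x \<partial>N) = (\<integral>\<^sup>+x. H (t + c *\<^sub>R x) \<partial>lborel)"
    unfolding N_def by (rule nn_integral_distr) measurable
  finally show ?thesis .
qed

text \<open>A dilation factor of at least 1/2 keeps the Jacobian above 2^(-n), so the bound does not
  depend on \<open>c\<close>.\<close>

lemma nn_integral_lborel_affine_le:
  fixes H :: "'a::euclidean_space \<Rightarrow> ennreal"
  assumes "H \<in> borel_measurable borel" "c \<ge> 1 / 2"
  shows "(\<integral>\<^sup>+x. H (t + c *\<^sub>R x) \<partial>lborel) \<le> ennreal (2 ^ DIM('a)) * (\<integral>\<^sup>+x. H x \<partial>lborel)"
proof -
  have "1 \<le> (2 * c) ^ DIM('a)"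
    by (rule one_le_power) (use assms(2) in simp)
  then have 1: "1 \<le> ennreal (2 ^ DIM('a) * c ^ DIM('a))"
    by (simp only: power_mult_distrib ennreal_1[symmetric] ennreal_leI)
  have "(\<integral>\<^sup>+x. H (t + c *\<^sub>R x) \<partial>lborel) = 1 * (\<integral>\<^sup>+x. H (t + c *\<^sub>R x) \<partial>lborel)"
    by (rule mult_1_left[symmetric])
  also have "\<dots> \<le> ennreal (2 ^ DIM('a) * c ^ DIM('a)) * (\<integral>\<^sup>+x. H (t + c *\<^sub>R x) \<partial>lborel)"
    by (intro mult_right_mono 1) (rule zero_le)
  also have "\<dots> = ennreal (2 ^ DIM('a)) * (\<integral>\<^sup>+x. H x \<partial>lborel)"
    using nn_integral_lborel_affine[OF assms(1), of c t] assms(2)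
    by (simp add: ennreal_mult' mult.assoc)
  finally show ?thesis .
qed

text \<open>For \<open>s \<ge> 1/2\<close> substitute in \<open>z\<close>, otherwise in \<open>y\<close>: the Jacobian is then at least \<open>2\<^sup>-\<^sup>n\<close>.\<close>

lemma nn_integral_segments_le:
  fixes H :: "'a::euclidean_space \<Rightarrow> ennreal" and D :: "'a set"
  assumes [measurable]: "H \<in> borel_measurable borel" "D \<in> sets borel"
  shows "(\<integral>\<^sup>+y. (\<integral>\<^sup>+z. (\<integral>\<^sup>+s. indicator D y * indicator D z * indicator {0<..<1} s * H (y + s *\<^sub>R (z - y))
      \<partial>lborel) \<partial>lborel) \<partial>lborel)
    \<le> ennreal (2 ^ DIM('a)) * emeasure lborel D * (\<integral>\<^sup>+x. H x \<partial>lborel)" (is "_ \<le> ?R")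
proof -
  define F :: "real \<Rightarrow> 'a \<Rightarrow> 'a \<Rightarrow> ennreal" where
    "F s y z = indicator D y * indicator D z * indicator {0<..<1} s * H (y + s *\<^sub>R (z - y))" for s y z
  have [measurable (raw)]: "(\<lambda>w. F (f w) (g w) (h w)) \<in> borel_measurable N"
    if "f \<in> borel_measurable N" "g \<in> borel_measurable N" "h \<in> borel_measurable N" for f g h and N :: "'w measure"
    using that unfolding F_def by measurable
  have inner: "(\<integral>\<^sup>+y. (\<integral>\<^sup>+z. F s y z \<partial>lborel) \<partial>lborel) \<le> ?R * indicator {0<..<1} s" for s
  proof (cases "0 < s \<and> s < 1")
    case s: True
    show ?thesis
    proof (cases "s \<ge> 1 / 2")
      case True
      have "(\<integral>\<^sup>+y. (\<integral>\<^sup>+z. F s y z \<partial>lborel) \<partial>lborel)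
        \<le> (\<integral>\<^sup>+y. indicator D y * (ennreal (2 ^ DIM('a)) * (\<integral>\<^sup>+x. H x \<partial>lborel)) \<partial>lborel)"
      proof (rule nn_integral_mono)
        fix y
        have "(\<integral>\<^sup>+z. F s y z \<partial>lborel) \<le> (\<integral>\<^sup>+z. indicator D y * H ((1 - s) *\<^sub>R y + s *\<^sub>R z) \<partial>lborel)"
          by (intro nn_integral_mono) (auto simp: F_def indicator_def algebra_simps)
        also have "\<dots> = indicator D y * (\<integral>\<^sup>+z. H ((1 - s) *\<^sub>R y + s *\<^sub>R z) \<partial>lborel)"
          by (intro nn_integral_cmult) measurable
        also have "\<dots> \<le> indicator D y * (ennreal (2 ^ DIM('a)) * (\<integral>\<^sup>+x. H x \<partial>lborel))"
          using True by (intro mult_left_mono nn_integral_lborel_affine_le) auto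
        finally show "(\<integral>\<^sup>+z. F s y z \<partial>lborel)
          \<le> indicator D y * (ennreal (2 ^ DIM('a)) * (\<integral>\<^sup>+x. H x \<partial>lborel))" .
      qed
      also have "\<dots> = ?R" by (subst nn_integral_multc) (auto simp: mult_ac)
      finally show ?thesis using s by simp
    next
      case False
      have "(\<integral>\<^sup>+y. (\<integral>\<^sup>+z. F s y z \<partial>lborel) \<partial>lborel) = (\<integral>\<^sup>+z. (\<integral>\<^sup>+y. F s y z \<partial>lborel) \<partial>lborel)"
        by (rule lborel_pair.Fubini') measurable
      also have "\<dots> \<le> (\<integral>\<^sup>+z. indicator D z * (ennreal (2 ^ DIM('a)) * (\<integral>\<^sup>+x. H x \<partial>lborel)) \<partial>lborel)"
      proof (rule nn_integral_mono)
        fix z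
        have "(\<integral>\<^sup>+y. F s y z \<partial>lborel) \<le> (\<integral>\<^sup>+y. indicator D z * H (s *\<^sub>R z + (1 - s) *\<^sub>R y) \<partial>lborel)"
          by (intro nn_integral_mono) (auto simp: F_def indicator_def algebra_simps)
        also have "\<dots> = indicator D z * (\<integral>\<^sup>+y. H (s *\<^sub>R z + (1 - s) *\<^sub>R y) \<partial>lborel)"
          by (intro nn_integral_cmult) measurable
        also have "\<dots> \<le> indicator D z * (ennreal (2 ^ DIM('a)) * (\<integral>\<^sup>+x. H x \<partial>lborel))"
          using False by (intro mult_left_mono nn_integral_lborel_affine_le) auto
        finally show "(\<integral>\<^sup>+y. F s y z \<partial>lborel)
          \<le> indicator D z * (ennreal (2 ^ DIM('a)) * (\<integral>\<^sup>+x. H x \<partial>lborel))" .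
      qed
      also have "\<dots> = ?R" by (subst nn_integral_multc) (auto simp: mult_ac)
      finally show ?thesis using s by simp
    qed
  next
    case False
    then have "F s y z = 0" for y z by (auto simp: F_def indicator_def)
    then show ?thesis by simp
  qed
  have "(\<integral>\<^sup>+y. (\<integral>\<^sup>+z. (\<integral>\<^sup>+s. F s y z \<partial>lborel) \<partial>lborel) \<partial>lborel)
    = (\<integral>\<^sup>+y. (\<integral>\<^sup>+s. (\<integral>\<^sup>+z. F s y z \<partial>lborel) \<partial>lborel) \<partial>lborel)"
    by (intro nn_integral_cong lborel_pair.Fubini') measurable
  also have "\<dots> = (\<integral>\<^sup>+s. (\<integral>\<^sup>+y. (\<integral>\<^sup>+z. F s y z \<partial>lborel) \<partial>lborel) \<partial>lborel)"
    by (rule lborel_pair.Fubini') measurable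
  also have "\<dots> \<le> (\<integral>\<^sup>+s. ?R * indicator {0<..<1::real} s \<partial>lborel)"
    by (rule nn_integral_mono) (rule inner)
  also have "\<dots> = ?R * emeasure lborel {0<..<1::real}"
    by (rule nn_integral_cmult_indicator) simp
  also have "\<dots> = ?R" by (simp only: emeasure_lborel_Ioo zero_le_one diff_zero ennreal_1 mult_1_right)
  finally show ?thesis by (simp add: F_def)
qed

text \<open>If the integrand exceeded X throughout D, the two integrals would compare strictly;
  positive finite measure of D and finiteness of X are what makes the comparison strict in the
  extended reals.\<close>

lemma exists_le_mean_nn_integral:
  assumes [measurable]: "D \<in> sets M" "(\<lambda>x. I x * indicator D x) \<in> borel_measurable M"
    and D: "emeasure M D \<noteq> 0" "emeasure M D \<noteq> \<infinity>" and "X \<noteq> \<infinity>"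
    and le: "(\<integral>\<^sup>+x. I x * indicator D x \<partial>M) \<le> X * emeasure M D"
  shows "\<exists>x\<in>D. I x \<le> (X::ennreal)"
proof (rule ccontr)
  assume "\<not> ?thesis"
  then have gt: "\<And>x. x \<in> D \<Longrightarrow> X < I x" by (auto simp: not_le)
  have "(\<integral>\<^sup>+x. X * indicator D x \<partial>M) < (\<integral>\<^sup>+x. I x * indicator D x \<partial>M)"
  proof (rule nn_integral_less)
    show "(\<integral>\<^sup>+x. X * indicator D x \<partial>M) \<noteq> \<infinity>"
      using D \<open>X \<noteq> \<infinity>\<close> by (simp add: nn_integral_cmult_indicator ennreal_mult_eq_top_iff)
    show "AE x in M. X * indicator D x \<le> I x * indicator D x"
      using gt by (intro AE_I2) (auto simp: indicator_def less_imp_le)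
    show "\<not> (AE x in M. I x * indicator D x \<le> X * indicator D x)"
    proof
      assume "AE x in M. I x * indicator D x \<le> X * indicator D x"
      then have "AE x in M. x \<notin> D" by eventually_elim (use gt in \<open>auto simp: indicator_def not_le[symmetric]\<close>)
      then have "emeasure M {x\<in>space M. x \<in> D} = 0"
        by (subst (asm) AE_iff_measurable[where N="{x\<in>space M. x \<in> D}"]) auto
      then show False using D sets.sets_into_space[OF assms(1)] by (simp add: Int_absorb1 Collect_conj_eq Int_commute)
    qed
  qed measurable
  then show False using le by (simp add: nn_integral_cmult_indicator)
qed

lemma C1_gradD:
  assumes "C1_grad u Du"
  shows "(u has_derivative (\<lambda>v. Du x \<bullet> v)) (at x)" "continuous_on UNIV Du" "continuous_on UNIV u"
proof -
  show d: "(u has_derivative (\<lambda>v. Du x \<bullet> v)) (at x)" for x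
    using assms unfolding C1_grad_def by blast
  show "continuous_on UNIV Du" using assms unfolding C1_grad_def by blast
  show "continuous_on UNIV u" by (rule has_derivative_continuous_on[OF d])
qed

lemma C1_grad_borel:
  assumes "C1_grad u Du"
  shows "u \<in> borel_measurable borel" "Du \<in> borel_measurable borel"
  by (rule borel_measurable_continuous_onI, rule C1_gradD[OF assms])+

lemma nn_integral_lborel_iterated:
  fixes W :: "'a::euclidean_space \<times> 'b::euclidean_space \<Rightarrow> ennreal"
  assumes "W \<in> borel_measurable borel"
  shows "(\<integral>\<^sup>+y. (\<integral>\<^sup>+s. W (y, s) \<partial>lborel) \<partial>lborel) = (\<integral>\<^sup>+x. W x \<partial>lborel)"
proof -
  have "W \<in> borel_measurable (lborel \<Otimes>\<^sub>M lborel)" using assms by (simp add: lborel_prod)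
  from lborel.nn_integral_fst[OF this] show ?thesis by (simp add: lborel_prod)
qed

section \<open>Poincare and trace inequalities for C^1 functions\<close>

context nozzle_chart begin

text \<open>A straight segment in the cylinder is carried by \<open>S\<close> to a curve in
  \<Omega>, and the chain rule bounds the derivative of u along it by K |e| |Du|. General directions
  serve the Poincare inequality; the axial one serves traces and the comparison of distant
  layers.\<close>

lemma line_estimate:
  assumes u: "C1_grad u Du" and "t1 < t2" and p: "\<And>s. s \<in> {t1..t2} \<Longrightarrow> p + s *\<^sub>R e \<in> cylinder"
  shows "ennreal ((u (S (p + t2 *\<^sub>R e)) - u (S (p + t1 *\<^sub>R e)))\<^sup>2)
    \<le> ennreal (t2 - t1) * (\<integral>\<^sup>+s. ennreal (K\<^sup>2 * (norm e)\<^sup>2) *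
        (ennreal ((norm (Du (S (p + s *\<^sub>R e))))\<^sup>2) * indicator {t1<..<t2} s) \<partial>lborel)"
proof -
  define f' where "f' s = Du (S (p + s *\<^sub>R e)) \<bullet> blinfun_apply (S' (p + s *\<^sub>R e)) e" for s
  have "ennreal ((u (S (p + t2 *\<^sub>R e)) - u (S (p + t1 *\<^sub>R e)))\<^sup>2)
    \<le> ennreal (t2 - t1) * (\<integral>\<^sup>+s. ennreal ((f' s)\<^sup>2) * indicator {t1<..<t2} s \<partial>lborel)"
  proof (rule sq_diff_le_nn_integral[OF \<open>t1 < t2\<close>, where f="\<lambda>s. u (S (p + s *\<^sub>R e))" and f'=f'])
    fix s assume s: "s \<in> {t1..t2}"
    have 1: "((\<lambda>s. p + s *\<^sub>R e) has_derivative (\<lambda>r. r *\<^sub>R e)) (at s)"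
      by (auto intro!: derivative_eq_intros)
    have 2: "(S has_derivative blinfun_apply (S' (p + s *\<^sub>R e))) (at (p + s *\<^sub>R e))"
      using S_der[OF p[OF s]] by blast
    have 3: "(u has_derivative (\<lambda>v. Du (S (p + s *\<^sub>R e)) \<bullet> v)) (at (S (p + s *\<^sub>R e)))"
      using u unfolding C1_grad_def by blast
    have "((\<lambda>s. u (S (p + s *\<^sub>R e))) has_derivative
        (\<lambda>r. Du (S (p + s *\<^sub>R e)) \<bullet> blinfun_apply (S' (p + s *\<^sub>R e)) (r *\<^sub>R e))) (at s)"
      using has_derivative_compose[OF has_derivative_compose[OF 1 2] 3] .
    moreover have "(\<lambda>r. Du (S (p + s *\<^sub>R e)) \<bullet> blinfun_apply (S' (p + s *\<^sub>R e)) (r *\<^sub>R e)) = (*) (f' s)"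
      by (rule ext) (simp add: f'_def blinfun.scaleR_right)
    ultimately show "((\<lambda>s. u (S (p + s *\<^sub>R e))) has_real_derivative f' s) (at s)"
      by (simp add: has_field_derivative_def)
  next
    have c: "continuous_on {t1..t2} (\<lambda>s. S (p + s *\<^sub>R e))"
      by (intro continuous_on_compose2[OF S_cont] continuous_intros) (use p in auto)
    have c': "continuous_on {t1..t2} (\<lambda>s. S' (p + s *\<^sub>R e))"
      by (intro continuous_on_compose2[OF S'_cont] continuous_intros) (use p in auto)
    have "continuous_on {t1..t2} (\<lambda>s. Du (S (p + s *\<^sub>R e)))"
      by (rule continuous_on_compose2[OF _ c, of UNIV]) (use u in \<open>auto simp: C1_grad_def\<close>)
    then show "continuous_on {t1..t2} f'"
      unfolding f'_def by (intro continuous_intros c')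
  qed
  also have "\<dots> \<le> ennreal (t2 - t1) * (\<integral>\<^sup>+s. ennreal (K\<^sup>2 * (norm e)\<^sup>2) *
        (ennreal ((norm (Du (S (p + s *\<^sub>R e))))\<^sup>2) * indicator {t1<..<t2} s) \<partial>lborel)"
  proof (intro mult_left_mono nn_integral_mono)
    fix s
    show "ennreal ((f' s)\<^sup>2) * indicator {t1<..<t2} s \<le> ennreal (K\<^sup>2 * (norm e)\<^sup>2) *
        (ennreal ((norm (Du (S (p + s *\<^sub>R e))))\<^sup>2) * indicator {t1<..<t2} s)"
    proof (cases "s \<in> {t1<..<t2}")
      case True
      then have "p + s *\<^sub>R e \<in> cylinder" by (intro p) auto
      have "\<bar>f' s\<bar> \<le> norm (Du (S (p + s *\<^sub>R e))) * norm (blinfun_apply (S' (p + s *\<^sub>R e)) e)"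
        unfolding f'_def by (rule Cauchy_Schwarz_ineq2)
      also have "\<dots> \<le> norm (Du (S (p + s *\<^sub>R e))) * (norm (S' (p + s *\<^sub>R e)) * norm e)"
        by (intro mult_left_mono norm_blinfun) auto
      also have "\<dots> \<le> norm (Du (S (p + s *\<^sub>R e))) * (K * norm e)"
        using S_der[OF \<open>p + s *\<^sub>R e \<in> cylinder\<close>] by (intro mult_left_mono mult_right_mono) auto
      finally have "(f' s)\<^sup>2 \<le> (norm (Du (S (p + s *\<^sub>R e))) * (K * norm e))\<^sup>2"
        by (rule abs_le_square_iff[THEN iffD1, OF order_trans]) simp
      then have "ennreal ((f' s)\<^sup>2) \<le> ennreal ((K\<^sup>2 * (norm e)\<^sup>2) * (norm (Du (S (p + s *\<^sub>R e))))\<^sup>2)"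
        by (intro ennreal_leI) (simp add: power_mult_distrib algebra_simps)
      then show ?thesis using True by (simp add: ennreal_mult'')
    qed simp
  qed auto
  finally show ?thesis .
qed

lemma borel_cyl: "(cyl a b :: 'm point set) \<in> sets borel"
  by (rule borel_open[OF open_cyl])

text \<open>Extension by zero, so that compositions with it are Borel on the whole space.\<close>

definition Sc :: "'m point \<Rightarrow> 'm point" where "Sc y = indicator cylinder y *\<^sub>R S y"

lemma Sc_eq: "y \<in> cylinder \<Longrightarrow> Sc y = S y"
  by (simp add: Sc_def)

lemma Sc_borel: "Sc \<in> borel_measurable borel"
  unfolding Sc_def[abs_def]
  by (rule borel_measurable_continuous_on_indicator[OF borel_open[OF open_cylinder] S_cont])

text \<open>The mean over \<open>y\<close> of the squared \<open>L\<^sup>2\<close> distance from \<open>u \<circ> S\<close> to its value at \<open>y\<close> satisfies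
  the bound, so some value \<open>c = u (S y)\<close> does.\<close>

lemma cyl_poincare:
  assumes u: "C1_grad u Du"
  shows "\<exists>c. (\<integral>\<^sup>+x. ennreal ((u (S x) - c)\<^sup>2) * indicator (cyl t (t + 1)) x \<partial>lborel)
    \<le> ennreal (9 * K\<^sup>2 * 2 ^ DIM('m point)) *
      (\<integral>\<^sup>+x. ennreal ((norm (Du (S x)))\<^sup>2) * indicator (cyl t (t + 1)) x \<partial>lborel)"
proof -
  define D :: "'m point set" where "D = cyl t (t + 1)"
  define H where "H x = ennreal ((norm (Du (Sc x)))\<^sup>2) * indicator D x" for x
  define w where "w x = u (Sc x)" for x
  \<comment> \<open>9 = 3^2: two points of a cylinder of radius 1 and length 1 are at distance at
    most 2 + 1.\<close>
  define k where "k = 9 * K\<^sup>2"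
  define n2 where "n2 = (2::real) ^ DIM('m point)"
  define I where "I y = (\<integral>\<^sup>+z. ennreal ((w z - w y)\<^sup>2) * indicator D z \<partial>lborel)" for y
  have k: "k \<ge> 0" and n2: "n2 \<ge> 0" by (auto simp: k_def n2_def)
  have Dm[measurable]: "D \<in> sets borel" unfolding D_def by (rule borel_cyl)
  note [measurable] = Sc_borel C1_grad_borel[OF u]
  have Hm[measurable]: "H \<in> borel_measurable borel" unfolding H_def by measurable
  have wm[measurable]: "w \<in> borel_measurable borel" unfolding w_def by measurable
  have D_cyl: "D \<subseteq> cylinder" unfolding D_def by (rule cyl_subset)
  have eD: "emeasure lborel D = ennreal \<beta>"
    unfolding D_def by (simp only: emeasure_cyl emeasure_ball_\<beta>) simp
  have est: "ennreal ((w z - w y)\<^sup>2) \<le> (\<integral>\<^sup>+s. ennreal k * (indicator {0<..<1} s * H (y + s *\<^sub>R (z - y))) \<partial>lborel)"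
    if y: "y \<in> D" and z: "z \<in> D" for y z
  proof -
    have seg: "y + s *\<^sub>R (z - y) \<in> D" if "s \<in> {0..1}" for s
    proof -
      have "(1 - s) *\<^sub>R y + s *\<^sub>R z \<in> D"
        using convex_cyl y z that unfolding D_def by (intro convexD_alt) auto
      then show ?thesis by (simp add: algebra_simps)
    qed
    have nn: "norm (z - y) \<le> 3"
    proof -
      have "norm (fst z - fst y) \<le> norm (fst z) + norm (fst y)" by (rule norm_triangle_ineq4)
      also have "\<dots> \<le> 2" using y z by (auto simp: D_def cyl_def)
      finally have 1: "norm (fst (z - y)) \<le> 2" by simp
      have 2: "norm (snd (z - y)) \<le> 1" using y z by (auto simp: D_def cyl_def)
      have "norm (z - y) \<le> norm (fst (z - y)) + norm (snd (z - y))"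
        by (metis norm_Pair_le prod.collapse)
      then show ?thesis using 1 2 by linarith
    qed
    have "ennreal ((w z - w y)\<^sup>2) = ennreal ((u (S (y + 1 *\<^sub>R (z - y))) - u (S (y + 0 *\<^sub>R (z - y))))\<^sup>2)"
      using Sc_eq[OF subsetD[OF D_cyl y]] Sc_eq[OF subsetD[OF D_cyl z]] by (simp add: w_def)
    also have "\<dots> \<le> ennreal (1 - 0) * (\<integral>\<^sup>+s. ennreal (K\<^sup>2 * (norm (z - y))\<^sup>2) *
        (ennreal ((norm (Du (S (y + s *\<^sub>R (z - y)))))\<^sup>2) * indicator {0<..<1} s) \<partial>lborel)"
      by (rule line_estimate[OF u, of 0 1 y "z - y"]) (use seg D_cyl in auto)
    also have "\<dots> = (\<integral>\<^sup>+s. ennreal (K\<^sup>2 * (norm (z - y))\<^sup>2) *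
        (ennreal ((norm (Du (S (y + s *\<^sub>R (z - y)))))\<^sup>2) * indicator {0<..<1} s) \<partial>lborel)"
      by simp
    also have "\<dots> \<le> (\<integral>\<^sup>+s. ennreal k * (indicator {0<..<1} s * H (y + s *\<^sub>R (z - y))) \<partial>lborel)"
    proof (rule nn_integral_mono)
      fix s :: real
      have "(norm (z - y))\<^sup>2 \<le> 3\<^sup>2" using nn by (intro power_mono) auto
      then have "ennreal (K\<^sup>2 * (norm (z - y))\<^sup>2) \<le> ennreal k"
        unfolding k_def by (intro ennreal_leI) (auto simp: mult.commute[of 9] intro!: mult_left_mono)
      moreover have "ennreal ((norm (Du (S (y + s *\<^sub>R (z - y)))))\<^sup>2) * indicator {0<..<1} s
          = indicator {0<..<1} s * H (y + s *\<^sub>R (z - y))"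
      proof (cases "s \<in> {0<..<1}")
        case True
        then have "y + s *\<^sub>R (z - y) \<in> D" by (intro seg) auto
        then show ?thesis using True Sc_eq[OF subsetD[OF D_cyl]] by (simp add: H_def)
      qed simp
      ultimately show "ennreal (K\<^sup>2 * (norm (z - y))\<^sup>2) *
        (ennreal ((norm (Du (S (y + s *\<^sub>R (z - y)))))\<^sup>2) * indicator {0<..<1} s)
        \<le> ennreal k * (indicator {0<..<1} s * H (y + s *\<^sub>R (z - y)))"
        by (metis mult_right_mono zero_le)
    qed
    finally show ?thesis .
  qed
  have double: "(\<integral>\<^sup>+y. I y * indicator D y \<partial>lborel)
      \<le> ennreal (k * n2) * (\<integral>\<^sup>+x. H x \<partial>lborel) * emeasure lborel D"
  proof -
    have "(\<integral>\<^sup>+y. I y * indicator D y \<partial>lborel)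
      \<le> (\<integral>\<^sup>+y. (\<integral>\<^sup>+z. (\<integral>\<^sup>+s. ennreal k * (indicator D y * indicator D z * indicator {0<..<1} s
          * H (y + s *\<^sub>R (z - y))) \<partial>lborel) \<partial>lborel) \<partial>lborel)"
    proof (rule nn_integral_mono)
      fix y
      show "I y * indicator D y \<le> (\<integral>\<^sup>+z. (\<integral>\<^sup>+s. ennreal k * (indicator D y * indicator D z * indicator {0<..<1} s
          * H (y + s *\<^sub>R (z - y))) \<partial>lborel) \<partial>lborel)"
      proof (cases "y \<in> D")
        case True
        have "I y \<le> (\<integral>\<^sup>+z. (\<integral>\<^sup>+s. ennreal k * (indicator D y * indicator D z * indicator {0<..<1} s
          * H (y + s *\<^sub>R (z - y))) \<partial>lborel) \<partial>lborel)"
          unfolding I_def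
        proof (rule nn_integral_mono)
          fix z
          show "ennreal ((w z - w y)\<^sup>2) * indicator D z \<le> (\<integral>\<^sup>+s. ennreal k * (indicator D y * indicator D z * indicator {0<..<1} s
          * H (y + s *\<^sub>R (z - y))) \<partial>lborel)"
            using est[OF True, of z] True by (cases "z \<in> D") auto
        qed
        then show ?thesis using True by simp
      qed simp
    qed
    also have "\<dots> = (\<integral>\<^sup>+y. (\<integral>\<^sup>+z. ennreal k * (\<integral>\<^sup>+s. indicator D y * indicator D z * indicator {0<..<1} s
          * H (y + s *\<^sub>R (z - y)) \<partial>lborel) \<partial>lborel) \<partial>lborel)"
      by (intro nn_integral_cong nn_integral_cmult) measurable
    also have "\<dots> = (\<integral>\<^sup>+y. ennreal k * (\<integral>\<^sup>+z. (\<integral>\<^sup>+s. indicator D y * indicator D z * indicator {0<..<1} s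
          * H (y + s *\<^sub>R (z - y)) \<partial>lborel) \<partial>lborel) \<partial>lborel)"
      by (intro nn_integral_cong nn_integral_cmult) measurable
    also have "\<dots> = ennreal k * (\<integral>\<^sup>+y. (\<integral>\<^sup>+z. (\<integral>\<^sup>+s. indicator D y * indicator D z * indicator {0<..<1} s
          * H (y + s *\<^sub>R (z - y)) \<partial>lborel) \<partial>lborel) \<partial>lborel)"
      by (intro nn_integral_cmult) measurable
    also have "\<dots> \<le> ennreal k * (ennreal (2 ^ DIM('m point)) * emeasure lborel D * (\<integral>\<^sup>+x. H x \<partial>lborel))"
      by (rule mult_left_mono[OF nn_integral_segments_le[OF Hm Dm]]) (rule zero_le)
    also have "\<dots> = ennreal (k * n2) * (\<integral>\<^sup>+x. H x \<partial>lborel) * emeasure lborel D"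
      by (simp only: n2_def[symmetric] ennreal_mult[OF k n2] mult_ac)
    finally show ?thesis .
  qed
  have Heq: "(\<integral>\<^sup>+x. H x \<partial>lborel) = (\<integral>\<^sup>+x. ennreal ((norm (Du (S x)))\<^sup>2) * indicator D x \<partial>lborel)"
    using Sc_eq[OF subsetD[OF D_cyl]] by (intro nn_integral_cong) (simp add: H_def indicator_def)
  have Ieq: "I y = (\<integral>\<^sup>+x. ennreal ((u (S x) - w y)\<^sup>2) * indicator D x \<partial>lborel)" for y
    unfolding I_def using Sc_eq[OF subsetD[OF D_cyl]]
    by (intro nn_integral_cong) (simp add: w_def indicator_def)
  have "\<exists>c. (\<integral>\<^sup>+x. ennreal ((u (S x) - c)\<^sup>2) * indicator D x \<partial>lborel)
    \<le> ennreal (k * n2) * (\<integral>\<^sup>+x. H x \<partial>lborel)"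
  \<comment> \<open>If the right-hand side is infinite any constant works; otherwise the mean bounds
    the value at some point of \<open>D\<close>.\<close>
  proof (cases "ennreal (k * n2) * (\<integral>\<^sup>+x. H x \<partial>lborel) = \<infinity>")
    case False
    have Im: "(\<lambda>y. I y * indicator D y) \<in> borel_measurable lborel" unfolding I_def by measurable
    have "\<exists>y\<in>D. I y \<le> ennreal (k * n2) * (\<integral>\<^sup>+x. H x \<partial>lborel)"
      by (rule exists_le_mean_nn_integral[OF _ Im _ _ False double])
         (use eD \<beta>_pos in \<open>simp_all add: Dm\<close>)
    then show ?thesis unfolding Ieq by blast
  qed auto
  then show ?thesis unfolding Heq D_def k_def n2_def .
qed

lemma axial_estimate:
  assumes u: "C1_grad u Du" and "t1 < t2" and y: "y \<in> ball 0 1"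
  shows "ennreal ((u (S (y, t2)) - u (S (y, t1)))\<^sup>2)
    \<le> ennreal (K\<^sup>2 * (t2 - t1)) *
      (\<integral>\<^sup>+s. ennreal ((norm (Du (S (y, s))))\<^sup>2) * indicator {t1<..<t2} s \<partial>lborel)"
proof -
  have in_cyl: "(y, s) \<in> cylinder" for s using y by (simp add: cylinder_def)
  have eq: "(y, 0) + s *\<^sub>R (0, 1) = (y, s)" for s :: real by simp
  have n: "norm ((0::real^'m), (1::real)) = 1" by (simp add: norm_Pair)
  note [measurable] = Sc_borel C1_grad_borel[OF u]
  have Hm: "(\<lambda>s. ennreal ((norm (Du (S (y, s))))\<^sup>2) * indicator {t1<..<t2} s) \<in> borel_measurable lborel"
    unfolding Sc_eq[OF in_cyl, symmetric] by measurable
  have "ennreal ((u (S (y, t2)) - u (S (y, t1)))\<^sup>2)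
    \<le> ennreal (t2 - t1) * (\<integral>\<^sup>+s. ennreal (K\<^sup>2 * 1\<^sup>2) *
        (ennreal ((norm (Du (S (y, s))))\<^sup>2) * indicator {t1<..<t2} s) \<partial>lborel)"
    using line_estimate[OF u \<open>t1 < t2\<close>, of "(y, 0)" "(0, 1)"] unfolding eq n using in_cyl by simp
  also have "\<dots> = ennreal (t2 - t1) * (ennreal (K\<^sup>2 * 1\<^sup>2) * (\<integral>\<^sup>+s.
        (ennreal ((norm (Du (S (y, s))))\<^sup>2) * indicator {t1<..<t2} s) \<partial>lborel))"
    by (subst nn_integral_cmult[OF Hm]) (rule refl)
  also have "\<dots> = ennreal (K\<^sup>2 * (t2 - t1)) *
      (\<integral>\<^sup>+s. ennreal ((norm (Du (S (y, s))))\<^sup>2) * indicator {t1<..<t2} s \<partial>lborel)"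
    using \<open>t1 < t2\<close> by (simp add: ennreal_mult mult_ac)
  finally show ?thesis .
qed

text \<open>Translation by b - a + 1 maps the left end layer onto the right one, so this measures
  the change of u between them. Every axial segment involved lies between a - 1 and b + 1, and the
  layer has length 1, so integrating over the starting height costs no further factor.\<close>

lemma shift_estimate:
  assumes u: "C1_grad u Du" and "a \<le> b"
  shows "(\<integral>\<^sup>+x. ennreal ((u (S (x + (0, b - a + 1))) - u (S x))\<^sup>2) * indicator (cyl (a - 1) a) x \<partial>lborel)
    \<le> ennreal (K\<^sup>2 * (b - a + 1)) *
      (\<integral>\<^sup>+x. ennreal ((norm (Du (S x)))\<^sup>2) * indicator (cyl (a - 1) (b + 1)) x \<partial>lborel)"
proof -
  define h where "h = b - a + 1"
  have h: "h > 0" using assms by (simp add: h_def)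
  define W where "W x = ennreal ((norm (Du (Sc x)))\<^sup>2) * indicator (cyl (a - 1) (b + 1)) x" for x
  note [measurable] = Sc_borel C1_grad_borel[OF u] borel_cyl
  have Wm[measurable]: "W \<in> borel_measurable borel" unfolding W_def by measurable
  have Wm2[measurable]: "(\<lambda>s. W (y, s)) \<in> borel_measurable borel" for y by measurable
  have Wm3[measurable]: "W \<in> borel_measurable (lborel \<Otimes>\<^sub>M lborel)"
    using Wm by (simp add: lborel_prod)
  \<comment> \<open>For fixed cross-sectional position the majorant is constant in the starting
    height \<open>t\<close> on the layer.\<close>
  define V where "V x = (case x of (y, t) \<Rightarrow>
    (ennreal (K\<^sup>2 * h) * (\<integral>\<^sup>+s. W (y, s) \<partial>lborel)) * indicator {a - 1<..<a} t)" for x :: "'m point"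
  have Vm[measurable]: "V \<in> borel_measurable (lborel \<Otimes>\<^sub>M lborel)"
    unfolding V_def by measurable
  have "(\<integral>\<^sup>+x. ennreal ((u (S (x + (0, b - a + 1))) - u (S x))\<^sup>2) * indicator (cyl (a - 1) a) x \<partial>lborel)
    \<le> (\<integral>\<^sup>+x. V x \<partial>lborel)"
  proof (rule nn_integral_mono)
    fix x :: "'m point"
    obtain y t where x: "x = (y, t)" by (cases x)
    show "ennreal ((u (S (x + (0, b - a + 1))) - u (S x))\<^sup>2) * indicator (cyl (a - 1) a) x \<le> V x"
    proof (cases "x \<in> cyl (a - 1) a")
      case True
      then have y: "y \<in> ball 0 1" and t: "a - 1 < t" "t < a" by (auto simp: x cyl_def)
      have "ennreal ((u (S (y, t + h)) - u (S (y, t)))\<^sup>2) \<le> ennreal (K\<^sup>2 * (t + h - t)) *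
          (\<integral>\<^sup>+s. ennreal ((norm (Du (S (y, s))))\<^sup>2) * indicator {t<..<t + h} s \<partial>lborel)"
        by (rule axial_estimate[OF u _ y]) (use h in simp)
      also have "\<dots> \<le> ennreal (K\<^sup>2 * (t + h - t)) * (\<integral>\<^sup>+s. W (y, s) \<partial>lborel)"
      proof (intro mult_left_mono nn_integral_mono)
        fix s :: real
        have "Sc (y, s) = S (y, s)" by (rule Sc_eq) (use y in \<open>simp add: cylinder_def\<close>)
        then show "ennreal ((norm (Du (S (y, s))))\<^sup>2) * indicator {t<..<t + h} s \<le> W (y, s)"
          using y t by (auto simp: W_def cyl_def indicator_def h_def)
      qed auto
      finally show ?thesis using True t by (simp add: x V_def h_def)
    qed simp
  qed
  also have "\<dots> = (\<integral>\<^sup>+y. (\<integral>\<^sup>+t. V (y, t) \<partial>lborel) \<partial>lborel)"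
    by (rule nn_integral_lborel_iterated[symmetric]) (use Vm in \<open>simp add: lborel_prod\<close>)
  also have "\<dots> = (\<integral>\<^sup>+y. ennreal (K\<^sup>2 * h) * (\<integral>\<^sup>+s. W (y, s) \<partial>lborel) \<partial>lborel)"
  proof (rule nn_integral_cong)
    fix y
    have "(\<integral>\<^sup>+t. V (y, t) \<partial>lborel)
      = (ennreal (K\<^sup>2 * h) * (\<integral>\<^sup>+s. W (y, s) \<partial>lborel)) * emeasure lborel {a - 1<..<a}"
      unfolding V_def by (simp only: prod.case) (rule nn_integral_cmult_indicator, simp)
    also have "emeasure lborel {a - 1<..<a} = 1" by simp
    finally show "(\<integral>\<^sup>+t. V (y, t) \<partial>lborel) = ennreal (K\<^sup>2 * h) * (\<integral>\<^sup>+s. W (y, s) \<partial>lborel)" by simp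
  qed
  also have "\<dots> = ennreal (K\<^sup>2 * h) * (\<integral>\<^sup>+y. (\<integral>\<^sup>+s. W (y, s) \<partial>lborel) \<partial>lborel)"
    by (rule nn_integral_cmult) measurable
  also have "(\<integral>\<^sup>+y. (\<integral>\<^sup>+s. W (y, s) \<partial>lborel) \<partial>lborel) = (\<integral>\<^sup>+x. W x \<partial>lborel)"
    by (rule nn_integral_lborel_iterated[OF Wm])
  also have "\<dots> = (\<integral>\<^sup>+x. ennreal ((norm (Du (S x)))\<^sup>2) * indicator (cyl (a - 1) (b + 1)) x \<partial>lborel)"
    using Sc_eq[OF subsetD[OF cyl_subset]] by (intro nn_integral_cong) (simp add: W_def indicator_def)
  finally show ?thesis unfolding h_def .
qed

text \<open>Along each axial line the value at L is the value at - L plus an increment, and the line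
  has length 2 L, whence the linear factor \<open>L\<close>. The term at - L is kept because an
  approximant of a function in \<open>H_trunc\<close> vanishes there only in the limit.\<close>

lemma C1_trace:
  assumes u: "C1_grad u Du" and "0 < L"
  shows "(\<integral>\<^sup>+x. ennreal ((u (x, L))\<^sup>2) * indicator (slice \<Omega> L) x \<partial>lborel)
    \<le> ennreal (2 * Ms * Ms) * (\<integral>\<^sup>+x. ennreal ((u (x, - L))\<^sup>2) * indicator (slice \<Omega> (- L)) x \<partial>lborel)
      + ennreal (4 * Ms * K\<^sup>2 * M * L) *
        (\<integral>\<^sup>+x. ennreal ((norm (Du x))\<^sup>2) * indicator (section_between \<Omega> (- L) L) x \<partial>lborel)"
proof -
  note [measurable] = Sc_borel C1_grad_borel[OF u] borel_cyl
  have um: "(\<lambda>x. ennreal ((u (x, t))\<^sup>2)) \<in> borel_measurable borel" for t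
    using C1_grad_borel(1)[OF u] by measurable
  define W where "W x = ennreal ((norm (Du (Sc x)))\<^sup>2) * indicator (cyl (- L) L) x" for x
  have Wm[measurable]: "W \<in> borel_measurable borel" unfolding W_def by measurable
  have Wm3[measurable]: "W \<in> borel_measurable (lborel \<Otimes>\<^sub>M lborel)"
    using Wm by (simp add: lborel_prod)
  define V where "V y = (\<integral>\<^sup>+s. W (y, s) \<partial>lborel)" for y
  have Vm[measurable]: "V \<in> borel_measurable borel" unfolding V_def by measurable
  define J where "J y = ennreal ((u (Sc (y, - L)))\<^sup>2) * indicator (ball 0 1) y" for y
  have [measurable]: "ball (0::real^'m) 1 \<in> sets borel" by simp
  have Jm[measurable]: "J \<in> borel_measurable borel" unfolding J_def by measurable
  have "(\<integral>\<^sup>+x. ennreal ((u (x, L))\<^sup>2) * indicator (slice \<Omega> L) x \<partial>lborel)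
    \<le> Ms * (\<integral>\<^sup>+y. ennreal ((u (fst (S (y, L)), L))\<^sup>2) * indicator (ball 0 1) y \<partial>lborel)"
    by (rule slice_le_ball[OF um])
  also have "(\<integral>\<^sup>+y. ennreal ((u (fst (S (y, L)), L))\<^sup>2) * indicator (ball 0 1) y \<partial>lborel)
    \<le> (\<integral>\<^sup>+y. 2 * J y + ennreal (4 * K\<^sup>2 * L) * V y \<partial>lborel)"
  proof (rule nn_integral_mono)
    fix y :: "real^'m"
    show "ennreal ((u (fst (S (y, L)), L))\<^sup>2) * indicator (ball 0 1) y \<le> 2 * J y + ennreal (4 * K\<^sup>2 * L) * V y"
    proof (cases "y \<in> ball 0 1")
      case True
      have Sceq: "Sc (y, s) = S (y, s)" for s by (rule Sc_eq) (use True in \<open>simp add: cylinder_def\<close>)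
      have "ennreal ((u (S (y, L)) - u (S (y, - L)))\<^sup>2) \<le> ennreal (K\<^sup>2 * (L - - L)) *
          (\<integral>\<^sup>+s. ennreal ((norm (Du (S (y, s))))\<^sup>2) * indicator {- L<..<L} s \<partial>lborel)"
        by (rule axial_estimate[OF u _ True]) (use \<open>0 < L\<close> in simp)
      also have "(\<integral>\<^sup>+s. ennreal ((norm (Du (S (y, s))))\<^sup>2) * indicator {- L<..<L} s \<partial>lborel) = V y"
        unfolding V_def using True by (intro nn_integral_cong) (auto simp: W_def Sceq cyl_def indicator_def)
      finally have e: "ennreal ((u (S (y, L)) - u (S (y, - L)))\<^sup>2) \<le> ennreal (2 * K\<^sup>2 * L) * V y"
        by (simp add: mult_ac)
      \<comment> \<open>With A and B the values at - L and L, the two sides differ by exactly (B - 2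
        A)^2.\<close>
      have "(u (S (y, L)))\<^sup>2 \<le> 2 * (u (S (y, - L)))\<^sup>2 + 2 * (u (S (y, L)) - u (S (y, - L)))\<^sup>2"
        using zero_le_power2[of "u (S (y, L)) - 2 * u (S (y, - L))"] by (simp add: power2_eq_square algebra_simps)
      then have "ennreal ((u (S (y, L)))\<^sup>2) \<le> ennreal (2 * (u (S (y, - L)))\<^sup>2 + 2 * (u (S (y, L)) - u (S (y, - L)))\<^sup>2)"
        by (rule ennreal_leI)
      also have "\<dots> = 2 * ennreal ((u (S (y, - L)))\<^sup>2) + 2 * ennreal ((u (S (y, L)) - u (S (y, - L)))\<^sup>2)"
        by (simp add: ennreal_plus ennreal_mult')
      also have "\<dots> \<le> 2 * ennreal ((u (S (y, - L)))\<^sup>2) + 2 * (ennreal (2 * K\<^sup>2 * L) * V y)"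
        by (intro add_left_mono mult_left_mono e) auto
      also have "2 * (ennreal (2 * K\<^sup>2 * L) * V y) = ennreal (4 * K\<^sup>2 * L) * V y"
      proof -
        have "2 * ennreal (2 * K\<^sup>2 * L) = ennreal (4 * K\<^sup>2 * L)"
          using \<open>0 < L\<close> ennreal_mult'[of 2 "2 * K\<^sup>2 * L"] by (simp add: mult.assoc)
        then show ?thesis by (simp only: mult.assoc[symmetric])
      qed
      finally show ?thesis
        using True ball_fst_S[OF True, of L] by (simp add: J_def Sceq del: mem_ball)
    qed simp
  qed
  also have "(\<integral>\<^sup>+y. 2 * J y + ennreal (4 * K\<^sup>2 * L) * V y \<partial>lborel)
    = 2 * (\<integral>\<^sup>+y. J y \<partial>lborel) + ennreal (4 * K\<^sup>2 * L) * (\<integral>\<^sup>+y. V y \<partial>lborel)"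
    by (subst nn_integral_add) (auto simp: nn_integral_cmult)
  also have "(\<integral>\<^sup>+y. J y \<partial>lborel)
      = (\<integral>\<^sup>+y. ennreal ((u (fst (S (y, - L)), - L))\<^sup>2) * indicator (ball 0 1) y \<partial>lborel)"
  proof (rule nn_integral_cong)
    fix y :: "real^'m"
    show "J y = ennreal ((u (fst (S (y, - L)), - L))\<^sup>2) * indicator (ball 0 1) y"
    proof (cases "y \<in> ball 0 1")
      case True
      have "Sc (y, - L) = S (y, - L)" by (rule Sc_eq) (use True in \<open>simp add: cylinder_def\<close>)
      then show ?thesis using ball_fst_S[OF True, of "- L"] by (simp add: J_def del: mem_ball)
    qed (simp add: J_def)
  qed
  also have "\<dots> \<le> Ms * (\<integral>\<^sup>+x. ennreal ((u (x, - L))\<^sup>2) * indicator (slice \<Omega> (- L)) x \<partial>lborel)"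
    by (rule ball_le_slice[OF um])
  also have "(\<integral>\<^sup>+y. V y \<partial>lborel) = (\<integral>\<^sup>+x. W x \<partial>lborel)"
    unfolding V_def by (rule nn_integral_lborel_iterated[OF Wm])
  also have "\<dots> = (\<integral>\<^sup>+x. ennreal ((norm (Du (S x)))\<^sup>2) * indicator (cyl (- L) L) x \<partial>lborel)"
    using Sc_eq[OF subsetD[OF cyl_subset]] by (intro nn_integral_cong) (simp add: W_def indicator_def)
  also have "\<dots> \<le> M * (\<integral>\<^sup>+x. ennreal ((norm (Du x))\<^sup>2) * indicator (section_between \<Omega> (- L) L) x \<partial>lborel)"
    by (rule cyl_le_section) measurable
  finally have "(\<integral>\<^sup>+x. ennreal ((u (x, L))\<^sup>2) * indicator (slice \<Omega> L) x \<partial>lborel)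
    \<le> ennreal Ms * (2 * (ennreal Ms * (\<integral>\<^sup>+x. ennreal ((u (x, - L))\<^sup>2) * indicator (slice \<Omega> (- L)) x \<partial>lborel))
      + ennreal (4 * K\<^sup>2 * L) *
        (ennreal M * (\<integral>\<^sup>+x. ennreal ((norm (Du x))\<^sup>2) * indicator (section_between \<Omega> (- L) L) x \<partial>lborel)))"
    by (simp add: mult_left_mono add_mono)
  moreover have "ennreal Ms * (2 * (ennreal Ms * A) + ennreal (4 * K\<^sup>2 * L) * (ennreal M * B))
    = ennreal (2 * Ms * Ms) * A + ennreal (4 * Ms * K\<^sup>2 * M * L) * B" for A B
    using Ms_pos M_pos \<open>0 < L\<close> by (simp add: ennreal_mult distrib_left mult_ac)
  ultimately show ?thesis by simp
qed

text \<open>\<open>kP\<close> is the Poincare constant of a cylinder layer of unit length.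
  \<open>CP\<close> is its nozzle version, with one factor \<open>M\<close> for each direction of
  transfer. \<open>CD\<close> carries one \<open>M\<close> and a division by \<open>\<beta>\<close>,
  the volume of the layer over which the difference of the two layer constants is averaged.\<close>

definition kP :: real where "kP = 9 * K\<^sup>2 * 2 ^ DIM('m point)"
definition CP :: real where "CP = M * kP * M"
definition CD :: real where "CD = 3 * (2 * kP + K\<^sup>2) * M / \<beta>"

lemma kP_nonneg: "0 \<le> kP" by (simp add: kP_def)
lemma CP_nonneg: "0 \<le> CP" using M_pos kP_nonneg by (simp add: CP_def)
lemma CD_nonneg: "0 \<le> CD" using M_pos kP_nonneg \<beta>_pos by (simp add: CD_def)

text \<open>Write c2 - c1 as u - c1 at a point of the left layer, plus the increment to the
  translated point, plus c2 - u there, and integrate over the left layer, whose volume is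
  \<open>\<beta>\<close>. The 3 comes from squaring a sum of three terms, and b - a + 1 \<ge> 1 lets
  the two Poincare terms join the increment.\<close>

lemma cyl_mean_difference:
  assumes u: "C1_grad u Du" and "a \<le> b"
    and c1: "(\<integral>\<^sup>+x. ennreal ((u (S x) - c1)\<^sup>2) * indicator (cyl (a - 1) a) x \<partial>lborel) \<le> ennreal kP * H"
    and c2: "(\<integral>\<^sup>+x. ennreal ((u (S x) - c2)\<^sup>2) * indicator (cyl b (b + 1)) x \<partial>lborel) \<le> ennreal kP * H"
    and H: "(\<integral>\<^sup>+x. ennreal ((norm (Du (S x)))\<^sup>2) * indicator (cyl (a - 1) (b + 1)) x \<partial>lborel) \<le> H"
  shows "ennreal (\<beta> * (c2 - c1)\<^sup>2) \<le> ennreal (3 * (2 * kP + K\<^sup>2) * (b - a + 1)) * H"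
proof -
  define h where "h = b - a + 1"
  have h: "h \<ge> 1" using assms by (simp add: h_def)
  define e :: "'m point" where "e = (0, h)"
  define D :: "'m point set" where "D = cyl (a - 1) a"
  note [measurable] = Sc_borel C1_grad_borel[OF u]
  have [measurable]: "(cyl s t :: 'm point set) \<in> sets borel" for s t by (rule borel_cyl)
  have Dm[measurable]: "D \<in> sets borel" unfolding D_def by (rule borel_cyl)
  have D_cyl: "x \<in> cylinder" "x + e \<in> cyl b (b + 1)" "x + e \<in> cylinder" if "x \<in> D" for x
    using that by (cases x; auto simp: D_def cyl_def cylinder_def e_def h_def)+
  define P where "P x = ennreal ((u (Sc x) - c1)\<^sup>2) * indicator D x" for x
  define Q where "Q x = ennreal ((u (Sc (x + e)) - u (Sc x))\<^sup>2) * indicator D x" for x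
  define R where "R z = ennreal ((u (Sc z) - c2)\<^sup>2) * indicator (cyl b (b + 1)) z" for z
  have [measurable]: "P \<in> borel_measurable borel" "Q \<in> borel_measurable borel"
    unfolding P_def Q_def by measurable
  have Rm[measurable]: "R \<in> borel_measurable borel" unfolding R_def by measurable
  have Rm'[measurable]: "(\<lambda>x. R (e + 1 *\<^sub>R x)) \<in> borel_measurable borel" by measurable
  have eD: "emeasure lborel D = ennreal \<beta>"
    unfolding D_def by (simp only: emeasure_cyl emeasure_ball_\<beta>) simp
  have "ennreal (\<beta> * (c2 - c1)\<^sup>2) = (\<integral>\<^sup>+x. ennreal ((c2 - c1)\<^sup>2) * indicator D x \<partial>lborel)"
    using \<beta>_pos
    by (subst nn_integral_cmult_indicator) (simp_all add: Dm eD ennreal_mult mult.commute)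
  also have "\<dots> \<le> (\<integral>\<^sup>+x. 3 * (P x + Q x + R (e + 1 *\<^sub>R x)) \<partial>lborel)"
  proof (rule nn_integral_mono)
    fix x
    show "ennreal ((c2 - c1)\<^sup>2) * indicator D x \<le> 3 * (P x + Q x + R (e + 1 *\<^sub>R x))"
    proof (cases "x \<in> D")
      case True
      define p q r where "p = u (Sc x) - c1" and "q = u (Sc (x + e)) - u (Sc x)" and "r = c2 - u (Sc (x + e))"
      have "0 \<le> (p - q)\<^sup>2 + (q - r)\<^sup>2 + (p - r)\<^sup>2" by simp
      then have "(p + q + r)\<^sup>2 \<le> 3 * (p\<^sup>2 + q\<^sup>2 + r\<^sup>2)" by (simp add: power2_eq_square algebra_simps)
      moreover have "c2 - c1 = p + q + r" by (simp add: p_def q_def r_def)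
      ultimately have "ennreal ((c2 - c1)\<^sup>2) \<le> ennreal (3 * (p\<^sup>2 + q\<^sup>2 + r\<^sup>2))"
        by (simp only: ennreal_leI)
      also have "\<dots> = ennreal 3 * ennreal (p\<^sup>2 + q\<^sup>2 + r\<^sup>2)"
        by (rule ennreal_mult') simp
      also have "\<dots> = 3 * (ennreal (p\<^sup>2) + ennreal (q\<^sup>2) + ennreal (r\<^sup>2))"
        by simp
      also have "ennreal (r\<^sup>2) = R (e + 1 *\<^sub>R x)"
        using D_cyl[OF True] by (simp add: R_def r_def add.commute power2_commute)
      finally show ?thesis using True by (simp add: P_def Q_def p_def q_def)
    qed simp
  qed
  also have "\<dots> = 3 * ((\<integral>\<^sup>+x. P x \<partial>lborel) + (\<integral>\<^sup>+x. Q x \<partial>lborel) + (\<integral>\<^sup>+x. R (e + 1 *\<^sub>R x) \<partial>lborel))"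
    by (simp add: nn_integral_cmult nn_integral_add)
  also have "(\<integral>\<^sup>+x. R (e + 1 *\<^sub>R x) \<partial>lborel) = (\<integral>\<^sup>+x. R x \<partial>lborel)"
    using nn_integral_lborel_affine[OF Rm zero_less_one, of e] by simp
  also have "\<dots> = (\<integral>\<^sup>+x. ennreal ((u (S x) - c2)\<^sup>2) * indicator (cyl b (b + 1)) x \<partial>lborel)"
    using Sc_eq[OF subsetD[OF cyl_subset]] by (intro nn_integral_cong) (simp add: R_def indicator_def)
  also have "(\<integral>\<^sup>+x. P x \<partial>lborel) = (\<integral>\<^sup>+x. ennreal ((u (S x) - c1)\<^sup>2) * indicator (cyl (a - 1) a) x \<partial>lborel)"
    using D_cyl Sc_eq by (intro nn_integral_cong) (simp add: P_def D_def[symmetric] indicator_def)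
  also have "(\<integral>\<^sup>+x. Q x \<partial>lborel)
      = (\<integral>\<^sup>+x. ennreal ((u (S (x + (0, b - a + 1))) - u (S x))\<^sup>2) * indicator (cyl (a - 1) a) x \<partial>lborel)"
    using D_cyl Sc_eq by (intro nn_integral_cong) (simp add: Q_def D_def[symmetric] indicator_def e_def h_def)
  also have "\<dots> \<le> ennreal (K\<^sup>2 * (b - a + 1)) *
      (\<integral>\<^sup>+x. ennreal ((norm (Du (S x)))\<^sup>2) * indicator (cyl (a - 1) (b + 1)) x \<partial>lborel)"
    by (rule shift_estimate[OF u \<open>a \<le> b\<close>])
  also have "\<dots> \<le> ennreal (K\<^sup>2 * (b - a + 1)) * H"
    by (intro mult_left_mono H) auto
  finally have "ennreal (\<beta> * (c2 - c1)\<^sup>2)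
      \<le> 3 * ((\<integral>\<^sup>+x. ennreal ((u (S x) - c1)\<^sup>2) * indicator (cyl (a - 1) a) x \<partial>lborel)
        + ennreal (K\<^sup>2 * (b - a + 1)) * H
        + (\<integral>\<^sup>+x. ennreal ((u (S x) - c2)\<^sup>2) * indicator (cyl b (b + 1)) x \<partial>lborel))"
    by (simp add: mult_left_mono)
  also have "\<dots> \<le> 3 * (ennreal kP * H + ennreal (K\<^sup>2 * (b - a + 1)) * H + ennreal kP * H)"
    by (intro mult_left_mono add_mono c1 c2 order_refl zero_le)
  also have "\<dots> = ennreal (3 * (kP + K\<^sup>2 * (b - a + 1) + kP)) * H"
  proof -
    have n: "0 \<le> kP" "0 \<le> K\<^sup>2 * (b - a + 1)" using kP_nonneg \<open>a \<le> b\<close> by auto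
    have "ennreal (3 * (kP + K\<^sup>2 * (b - a + 1) + kP)) = 3 * (ennreal kP + ennreal (K\<^sup>2 * (b - a + 1)) + ennreal kP)"
    proof -
      have "ennreal (3 * (kP + K\<^sup>2 * (b - a + 1) + kP)) = ennreal 3 * ennreal (kP + K\<^sup>2 * (b - a + 1) + kP)"
        by (rule ennreal_mult') simp
      also have "\<dots> = 3 * (ennreal kP + ennreal (K\<^sup>2 * (b - a + 1)) + ennreal kP)"
        using n by (simp only: ennreal_plus add_nonneg_nonneg ennreal_numeral)
      finally show ?thesis .
    qed
    then show ?thesis by (simp only: distrib_right mult.assoc distrib_left)
  qed
  also have "\<dots> \<le> ennreal (3 * (2 * kP + K\<^sup>2) * (b - a + 1)) * H"
  proof (intro mult_right_mono ennreal_leI)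
    have "kP * 1 \<le> kP * (b - a + 1)" using kP_nonneg \<open>a \<le> b\<close> by (intro mult_left_mono) auto
    then show "3 * (kP + K\<^sup>2 * (b - a + 1) + kP) \<le> 3 * (2 * kP + K\<^sup>2) * (b - a + 1)"
      by (simp add: algebra_simps)
  qed auto
  finally show ?thesis .
qed

text \<open>The first two bounds see only the gradient in their own layer, which later allows these
  terms to be charged to E(a-1,b+1) - E(a,b). The third sees the whole section, at the price of its
  length, and controls the flux term produced by two different layer constants.\<close>

lemma C1_poincare_pair:
  assumes u: "C1_grad u Du" and "a \<le> b"
  shows "\<exists>c1 c2.
    (\<integral>\<^sup>+x. ennreal ((u x - c1)\<^sup>2) * indicator (section_between \<Omega> (a - 1) a) x \<partial>lborel)
      \<le> ennreal CP * (\<integral>\<^sup>+x. ennreal ((norm (Du x))\<^sup>2) * indicator (section_between \<Omega> (a - 1) a) x \<partial>lborel) \<and>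
    (\<integral>\<^sup>+x. ennreal ((u x - c2)\<^sup>2) * indicator (section_between \<Omega> b (b + 1)) x \<partial>lborel)
      \<le> ennreal CP * (\<integral>\<^sup>+x. ennreal ((norm (Du x))\<^sup>2) * indicator (section_between \<Omega> b (b + 1)) x \<partial>lborel) \<and>
    ennreal ((c2 - c1)\<^sup>2) \<le> ennreal (CD * (b - a + 1)) *
      (\<integral>\<^sup>+x. ennreal ((norm (Du x))\<^sup>2) * indicator (section_between \<Omega> (a - 1) (b + 1)) x \<partial>lborel)"
proof -
  note [measurable] = C1_grad_borel[OF u]
  define E where "E s t = (\<integral>\<^sup>+x. ennreal ((norm (Du (S x)))\<^sup>2) * indicator (cyl s t) x \<partial>lborel)" for s t
  define F where "F s t = (\<integral>\<^sup>+x. ennreal ((norm (Du x))\<^sup>2) * indicator (section_between \<Omega> s t) x \<partial>lborel)" for s t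
  have EF: "E s t \<le> ennreal M * F s t" for s t
    unfolding E_def F_def by (rule cyl_le_section) measurable
  have lift: "(\<integral>\<^sup>+x. ennreal ((u x - c)\<^sup>2) * indicator (section_between \<Omega> s t) x \<partial>lborel) \<le> ennreal CP * F s t"
    if "(\<integral>\<^sup>+x. ennreal ((u (S x) - c)\<^sup>2) * indicator (cyl s t) x \<partial>lborel) \<le> ennreal kP * E s t" for c s t
  proof -
    have "(\<integral>\<^sup>+x. ennreal ((u x - c)\<^sup>2) * indicator (section_between \<Omega> s t) x \<partial>lborel)
      \<le> ennreal M * (\<integral>\<^sup>+x. ennreal ((u (S x) - c)\<^sup>2) * indicator (cyl s t) x \<partial>lborel)"
      by (rule section_le_cyl) measurable
    also have "\<dots> \<le> ennreal M * (ennreal kP * (ennreal M * F s t))"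
      by (intro mult_left_mono order_trans[OF that] EF) auto
    also have "\<dots> = ennreal CP * F s t"
      using M_pos kP_nonneg by (simp add: CP_def ennreal_mult mult.assoc)
    finally show ?thesis .
  qed
  obtain c1 where c1: "(\<integral>\<^sup>+x. ennreal ((u (S x) - c1)\<^sup>2) * indicator (cyl (a - 1) a) x \<partial>lborel) \<le> ennreal kP * E (a - 1) a"
    using cyl_poincare[OF u, of "a - 1"] unfolding E_def kP_def by (auto simp del: power_Suc)
  obtain c2 where c2: "(\<integral>\<^sup>+x. ennreal ((u (S x) - c2)\<^sup>2) * indicator (cyl b (b + 1)) x \<partial>lborel) \<le> ennreal kP * E b (b + 1)"
    using cyl_poincare[OF u, of b] unfolding E_def kP_def by auto
  have mono: "E (a - 1) a \<le> E (a - 1) (b + 1)" "E b (b + 1) \<le> E (a - 1) (b + 1)"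
    unfolding E_def using \<open>a \<le> b\<close>
    by (auto intro!: nn_integral_mono mult_left_mono simp: cyl_def indicator_def)
  have "ennreal (\<beta> * (c2 - c1)\<^sup>2) \<le> ennreal (3 * (2 * kP + K\<^sup>2) * (b - a + 1)) * E (a - 1) (b + 1)"
  proof (rule cyl_mean_difference[OF u \<open>a \<le> b\<close>])
    show "(\<integral>\<^sup>+x. ennreal ((u (S x) - c1)\<^sup>2) * indicator (cyl (a - 1) a) x \<partial>lborel) \<le> ennreal kP * E (a - 1) (b + 1)"
      by (rule order_trans[OF c1 mult_left_mono[OF mono(1)]]) simp
    show "(\<integral>\<^sup>+x. ennreal ((u (S x) - c2)\<^sup>2) * indicator (cyl b (b + 1)) x \<partial>lborel) \<le> ennreal kP * E (a - 1) (b + 1)"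
      by (rule order_trans[OF c2 mult_left_mono[OF mono(2)]]) simp
  qed (simp add: E_def)
  then have "ennreal (1 / \<beta>) * ennreal (\<beta> * (c2 - c1)\<^sup>2)
      \<le> ennreal (1 / \<beta>) * (ennreal (3 * (2 * kP + K\<^sup>2) * (b - a + 1)) * (ennreal M * F (a - 1) (b + 1)))"
    by (intro mult_left_mono zero_le) (rule order_trans[OF _ mult_left_mono[OF EF zero_le]])
  moreover have "ennreal (1 / \<beta>) * ennreal (\<beta> * (c2 - c1)\<^sup>2) = ennreal ((c2 - c1)\<^sup>2)"
    using \<beta>_pos by (simp add: ennreal_mult[symmetric])
  moreover have "ennreal (1 / \<beta>) * (ennreal (3 * (2 * kP + K\<^sup>2) * (b - a + 1)) * (ennreal M * F (a - 1) (b + 1)))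
      = ennreal (CD * (b - a + 1)) * F (a - 1) (b + 1)"
  proof -
    have "CD * (b - a + 1) = (1 / \<beta>) * ((3 * (2 * kP + K\<^sup>2) * (b - a + 1)) * M)"
      by (simp add: CD_def)
    moreover have "ennreal ((1 / \<beta>) * ((3 * (2 * kP + K\<^sup>2) * (b - a + 1)) * M))
        = ennreal (1 / \<beta>) * (ennreal (3 * (2 * kP + K\<^sup>2) * (b - a + 1)) * ennreal M)"
      using \<beta>_pos kP_nonneg \<open>a \<le> b\<close> M_pos by (simp only: ennreal_mult' divide_nonneg_pos zero_le_one zero_less_one mult_nonneg_nonneg less_imp_le) (subst ennreal_mult', auto)
    ultimately show ?thesis by (simp only: mult.assoc)
  qed
  ultimately have "ennreal ((c2 - c1)\<^sup>2) \<le> ennreal (CD * (b - a + 1)) * F (a - 1) (b + 1)" by simp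
  then show ?thesis using lift[OF c1] lift[OF c2] unfolding F_def by blast
qed

end

section \<open>Square integrable functions and weak gradients\<close>

lemma L2_onD:
  assumes "L2_on U f"
  shows "f \<in> borel_measurable (lebesgue_on U)" "integrable (lebesgue_on U) (\<lambda>x. (norm (f x))\<^sup>2)"
  using assms by (simp_all add: L2_on_def)

lemma norm_add_sq_le: "(norm (a + b))\<^sup>2 \<le> 2 * (norm a)\<^sup>2 + 2 * (norm (b::'a::real_normed_vector))\<^sup>2"
proof -
  have "(norm (a + b))\<^sup>2 \<le> (norm a + norm b)\<^sup>2" by (intro power_mono norm_triangle_ineq) auto
  also have "\<dots> \<le> 2 * (norm a)\<^sup>2 + 2 * (norm b)\<^sup>2"
    using zero_le_power2[of "norm a - norm b"] by (simp add: power2_eq_square algebra_simps)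
  finally show ?thesis .
qed

lemma L2_on_add:
  assumes f: "L2_on U f" and g: "L2_on U g"
  shows "L2_on U (\<lambda>x. f x + g x)"
proof -
  note [measurable] = L2_onD(1)[OF f] L2_onD(1)[OF g]
  have "integrable (lebesgue_on U) (\<lambda>x. (norm (f x + g x))\<^sup>2)"
  proof (rule Bochner_Integration.integrable_bound)
    show "integrable (lebesgue_on U) (\<lambda>x. 2 * (norm (f x))\<^sup>2 + 2 * (norm (g x))\<^sup>2)"
      using L2_onD(2)[OF f] L2_onD(2)[OF g] by auto
    show "AE x in lebesgue_on U. norm ((norm (f x + g x))\<^sup>2) \<le> norm (2 * (norm (f x))\<^sup>2 + 2 * (norm (g x))\<^sup>2)"
      using norm_add_sq_le by (intro AE_I2) auto
  qed measurable
  then show ?thesis by (simp add: L2_on_def)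
qed

lemma L2_on_bounded_scale:
  assumes f: "L2_on U f" and [measurable]: "b \<in> borel_measurable (lebesgue_on U)"
    and B: "\<And>x. x \<in> U \<Longrightarrow> \<bar>b x\<bar> \<le> (B::real)" and U: "U \<in> sets lebesgue"
  shows "L2_on U (\<lambda>x. b x *\<^sub>R f x)"
proof -
  note [measurable] = L2_onD(1)[OF f]
  have "integrable (lebesgue_on U) (\<lambda>x. (norm (b x *\<^sub>R f x))\<^sup>2)"
  proof (rule Bochner_Integration.integrable_bound)
    show "integrable (lebesgue_on U) (\<lambda>x. B\<^sup>2 * (norm (f x))\<^sup>2)"
      using L2_onD(2)[OF f] by auto
    show "AE x in lebesgue_on U. norm ((norm (b x *\<^sub>R f x))\<^sup>2) \<le> norm (B\<^sup>2 * (norm (f x))\<^sup>2)"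
    proof (rule AE_I2)
      fix x assume "x \<in> space (lebesgue_on U)"
      then have "\<bar>b x\<bar> \<le> B" using B U by (simp add: space_restrict_space)
      then have "(b x)\<^sup>2 \<le> B\<^sup>2" using abs_le_square_iff[of "b x" B] by auto
      then show "norm ((norm (b x *\<^sub>R f x))\<^sup>2) \<le> norm (B\<^sup>2 * (norm (f x))\<^sup>2)"
        by (simp add: power_mult_distrib mult_right_mono)
    qed
  qed measurable
  then show ?thesis by (simp add: L2_on_def)
qed

lemma L2_on_scale:
  assumes "L2_on U f" "U \<in> sets lebesgue"
  shows "L2_on U (\<lambda>x. c *\<^sub>R f x)"
  using L2_on_bounded_scale[of U f "\<lambda>_. c" "\<bar>c\<bar>"] assms by auto

lemma L2_on_diff:
  assumes "L2_on U f" "L2_on U g" "U \<in> sets lebesgue"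
  shows "L2_on U (\<lambda>x. f x - g x)"
  using L2_on_add[OF assms(1) L2_on_scale[OF assms(2,3), of "-1"]] by simp

lemma L2_on_scaleR_right:
  assumes f: "L2_on U f"
  shows "L2_on U (\<lambda>x. f x *\<^sub>R (e::'b::euclidean_space))"
  using L2_onD[OF f] by (auto simp: L2_on_def power_mult_distrib)

lemma L2_on_bounded:
  assumes "U \<in> lmeasurable" "f \<in> borel_measurable (lebesgue_on U)" "\<And>x. x \<in> U \<Longrightarrow> norm (f x) \<le> B"
  shows "L2_on U f"
proof -
  have "finite_measure (lebesgue_on U)"
    by (rule finite_measureI)
       (use assms(1) in \<open>auto simp: emeasure_restrict_space space_restrict_space fmeasurable_def\<close>)
  then have "integrable (lebesgue_on U) (\<lambda>x. (norm (f x))\<^sup>2)"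
    using assms
    by (intro finite_measure.integrable_const_bound[where B="B\<^sup>2"])
       (auto intro!: AE_I2 power_mono simp: space_restrict_space)
  then show ?thesis using assms by (simp add: L2_on_def)
qed

text \<open>The integral of (|f| - t |g|)^2 is nonnegative for every real t; its value at the
  minimum t = I / B is the inequality.\<close>

lemma Cauchy_Schwarz_integral_norm:
  fixes f :: "'a \<Rightarrow> 'b::{banach, second_countable_topology}" and g :: "'a \<Rightarrow> 'c::{banach, second_countable_topology}"
  assumes [measurable]: "f \<in> borel_measurable M" "g \<in> borel_measurable M"
    and f: "integrable M (\<lambda>x. (norm (f x))\<^sup>2)" and g: "integrable M (\<lambda>x. (norm (g x))\<^sup>2)"
  shows "integrable M (\<lambda>x. norm (f x) * norm (g x))"
    "(\<integral>x. norm (f x) * norm (g x) \<partial>M) \<le> sqrt (\<integral>x. (norm (f x))\<^sup>2 \<partial>M) * sqrt (\<integral>x. (norm (g x))\<^sup>2 \<partial>M)"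
proof -
  define A B where "A = (\<integral>x. (norm (f x))\<^sup>2 \<partial>M)" and "B = (\<integral>x. (norm (g x))\<^sup>2 \<partial>M)"
  show i: "integrable M (\<lambda>x. norm (f x) * norm (g x))"
  proof (rule Bochner_Integration.integrable_bound)
    show "integrable M (\<lambda>x. (norm (f x))\<^sup>2 + (norm (g x))\<^sup>2)" using f g by auto
    show "AE x in M. norm (norm (f x) * norm (g x)) \<le> norm ((norm (f x))\<^sup>2 + (norm (g x))\<^sup>2)"
    proof (rule AE_I2)
      fix x
      show "norm (norm (f x) * norm (g x)) \<le> norm ((norm (f x))\<^sup>2 + (norm (g x))\<^sup>2)"
        using zero_le_power2[of "norm (f x) - norm (g x)"]
          mult_nonneg_nonneg[OF norm_ge_zero[of "f x"] norm_ge_zero[of "g x"]]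
        unfolding power2_diff by (simp only: real_norm_def abs_of_nonneg add_nonneg_nonneg zero_le_power2)
    qed
  qed measurable
  define I where "I = (\<integral>x. norm (f x) * norm (g x) \<partial>M)"
  have nn: "0 \<le> A" "0 \<le> B" "0 \<le> I" by (auto simp: A_def B_def I_def)
  have q: "0 \<le> A - 2 * t * I + t\<^sup>2 * B" for t
  proof -
    have "0 \<le> (\<integral>x. (norm (f x) - t * norm (g x))\<^sup>2 \<partial>M)" by simp
    also have "\<dots> = (\<integral>x. (norm (f x))\<^sup>2 - 2 * t * (norm (f x) * norm (g x)) + t\<^sup>2 * (norm (g x))\<^sup>2 \<partial>M)"
      by (simp add: power2_eq_square algebra_simps)
    also have "\<dots> = A - 2 * t * I + t\<^sup>2 * B"
      using f g i by (simp add: A_def B_def I_def)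
    finally show ?thesis .
  qed
  have "I\<^sup>2 \<le> A * B"
  proof (cases "B = 0")
    case True
    have "I = 0"
    proof (rule ccontr)
      assume "I \<noteq> 0"
      \<comment> \<open>With B = 0 the quadratic degenerates to A - 2 t I, which equals -1 at this
        t.\<close>
      then show False using q[of "(A + 1) / (2 * I)"] True by simp
    qed
    then show ?thesis using True by simp
  next
    case False
    then have "0 \<le> B * (A - 2 * (I / B) * I + (I / B)\<^sup>2 * B)" using q[of "I / B"] nn by simp
    also have "\<dots> = A * B - I\<^sup>2" using False by (simp add: power2_eq_square field_simps)
    finally show ?thesis by simp
  qed
  then have "I \<le> sqrt (A * B)" using nn by (intro real_le_rsqrt)
  then show "(\<integral>x. norm (f x) * norm (g x) \<partial>M) \<le> sqrt (\<integral>x. (norm (f x))\<^sup>2 \<partial>M) * sqrt (\<integral>x. (norm (g x))\<^sup>2 \<partial>M)"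
    by (simp add: I_def A_def B_def real_sqrt_mult)
qed

text \<open>Stated for any integrand dominated by a product of norms, so that scalar multiples of
  vectors and inner products, which both occur in weak identities, are treated at once.\<close>

lemma L2_product_integrable:
  fixes h :: "'a::euclidean_space \<Rightarrow> 'c::euclidean_space"
  assumes f: "L2_on U f" and g: "L2_on U g"
    and [measurable]: "h \<in> borel_measurable (lebesgue_on U)"
    and h: "\<And>x. norm (h x) \<le> norm (f x) * norm (g x)"
  shows "integrable (lebesgue_on U) h"
    "norm (integral\<^sup>L (lebesgue_on U) h)
      \<le> sqrt (\<integral>x. (norm (f x))\<^sup>2 \<partial>lebesgue_on U) * sqrt (\<integral>x. (norm (g x))\<^sup>2 \<partial>lebesgue_on U)"
proof -
  note cs = Cauchy_Schwarz_integral_norm[OF L2_onD(1)[OF f] L2_onD(1)[OF g] L2_onD(2)[OF f] L2_onD(2)[OF g]]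
  show i: "integrable (lebesgue_on U) h"
  proof (rule Bochner_Integration.integrable_bound)
    show "integrable (lebesgue_on U) (\<lambda>x. norm (f x) * norm (g x))" by (rule cs(1))
    show "AE x in lebesgue_on U. norm (h x) \<le> norm (norm (f x) * norm (g x))"
      using h by (intro AE_I2) simp
  qed fact
  have "norm (integral\<^sup>L (lebesgue_on U) h) \<le> (\<integral>x. norm (h x) \<partial>lebesgue_on U)"
    by (rule integral_norm_bound)
  also have "\<dots> \<le> (\<integral>x. norm (f x) * norm (g x) \<partial>lebesgue_on U)"
    using i cs(1) h by (intro integral_mono) auto
  also note cs(2)
  finally show "norm (integral\<^sup>L (lebesgue_on U) h)
      \<le> sqrt (\<integral>x. (norm (f x))\<^sup>2 \<partial>lebesgue_on U) * sqrt (\<integral>x. (norm (g x))\<^sup>2 \<partial>lebesgue_on U)" .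
qed

lemma L2_inner_integrable:
  fixes f g :: "'a::euclidean_space \<Rightarrow> 'b::euclidean_space"
  assumes f: "L2_on U f" and g: "L2_on U g"
  shows "integrable (lebesgue_on U) (\<lambda>x. f x \<bullet> g x)"
    "\<bar>\<integral>x. f x \<bullet> g x \<partial>lebesgue_on U\<bar>
      \<le> sqrt (\<integral>x. (norm (f x))\<^sup>2 \<partial>lebesgue_on U) * sqrt (\<integral>x. (norm (g x))\<^sup>2 \<partial>lebesgue_on U)"
proof -
  have m: "(\<lambda>x. f x \<bullet> g x) \<in> borel_measurable (lebesgue_on U)"
    using L2_onD(1)[OF f] L2_onD(1)[OF g] by measurable
  have b: "norm (f x \<bullet> g x) \<le> norm (f x) * norm (g x)" for x
    using Cauchy_Schwarz_ineq2 by simp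
  show "integrable (lebesgue_on U) (\<lambda>x. f x \<bullet> g x)"
    by (rule L2_product_integrable(1)[OF f g m b])
  show "\<bar>\<integral>x. f x \<bullet> g x \<partial>lebesgue_on U\<bar>
      \<le> sqrt (\<integral>x. (norm (f x))\<^sup>2 \<partial>lebesgue_on U) * sqrt (\<integral>x. (norm (g x))\<^sup>2 \<partial>lebesgue_on U)"
    using L2_product_integrable(2)[OF f g m b] by simp
qed

lemma L2_dist2_eq:
  assumes "L2_on U (\<lambda>x. f x - g x)"
  shows "L2_dist2 U f g = ennreal (\<integral>x. (norm (f x - g x))\<^sup>2 \<partial>lebesgue_on U)"
  unfolding L2_dist2_def using L2_onD(2)[OF assms] by (subst nn_integral_eq_integral) auto

lemma L2_on_of_dist2:
  assumes "f \<in> borel_measurable (lebesgue_on U)" and g: "L2_on U g" and "L2_dist2 U f g < \<infinity>"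
  shows "L2_on U (\<lambda>x. f x - g x)" "L2_on U f"
proof -
  note [measurable] = assms(1) L2_onD(1)[OF g]
  have "integrable (lebesgue_on U) (\<lambda>x. (norm (f x - g x))\<^sup>2)"
    using assms(3) unfolding L2_dist2_def by (intro integrableI_nonneg) auto
  then show 1: "L2_on U (\<lambda>x. f x - g x)" by (simp add: L2_on_def)
  show "L2_on U f" using L2_on_add[OF 1 g] by simp
qed

text \<open>A distance tending to 0 is finite from some index on, and there it is an ordinary
  integral; hence the membership claims hold eventually rather than for all k.\<close>

lemma L2_dist2_tendsto:
  assumes g: "L2_on U g" and m: "\<And>k. f k \<in> borel_measurable (lebesgue_on U)"
    and lim: "(\<lambda>k. L2_dist2 U (f k) g) \<longlonglongrightarrow> 0"
  shows "eventually (\<lambda>k. L2_on U (f k) \<and> L2_on U (\<lambda>x. f k x - g x)) sequentially"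
    "(\<lambda>k. \<integral>x. (norm (f k x - g x))\<^sup>2 \<partial>lebesgue_on U) \<longlonglongrightarrow> 0"
proof -
  have ev: "eventually (\<lambda>k. L2_dist2 U (f k) g < \<infinity>) sequentially"
    using order_tendstoD(2)[OF lim, of \<infinity>] by simp
  then show ev2: "eventually (\<lambda>k. L2_on U (f k) \<and> L2_on U (\<lambda>x. f k x - g x)) sequentially"
    by eventually_elim (use L2_on_of_dist2[OF m g] in blast)
  have "(\<lambda>k. ennreal (\<integral>x. (norm (f k x - g x))\<^sup>2 \<partial>lebesgue_on U)) \<longlonglongrightarrow> ennreal 0"
  proof (rule Lim_transform_eventually)
    show "(\<lambda>k. L2_dist2 U (f k) g) \<longlonglongrightarrow> ennreal 0" using lim by simp
    show "eventually (\<lambda>k. L2_dist2 U (f k) g = ennreal (\<integral>x. (norm (f k x - g x))\<^sup>2 \<partial>lebesgue_on U)) sequentially"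
      using ev2 by eventually_elim (use L2_dist2_eq in blast)
  qed
  then show "(\<lambda>k. \<integral>x. (norm (f k x - g x))\<^sup>2 \<partial>lebesgue_on U) \<longlonglongrightarrow> 0"
    by (subst (asm) tendsto_ennreal_iff) auto
qed

lemma L2_dist2_add:
  assumes [measurable]: "a \<in> borel_measurable (lebesgue_on U)" "a' \<in> borel_measurable (lebesgue_on U)"
    "b \<in> borel_measurable (lebesgue_on U)" "b' \<in> borel_measurable (lebesgue_on U)"
  shows "L2_dist2 U (\<lambda>x. a x + b x) (\<lambda>x. a' x + b' x) \<le> 2 * L2_dist2 U a a' + 2 * L2_dist2 U b b'"
proof -
  have "L2_dist2 U (\<lambda>x. a x + b x) (\<lambda>x. a' x + b' x)
    \<le> (\<integral>\<^sup>+x. 2 * ennreal ((norm (a x - a' x))\<^sup>2) + 2 * ennreal ((norm (b x - b' x))\<^sup>2) \<partial>lebesgue_on U)"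
    unfolding L2_dist2_def
  proof (rule nn_integral_mono)
    fix x
    have "a x + b x - (a' x + b' x) = (a x - a' x) + (b x - b' x)" by simp
    then have "ennreal ((norm (a x + b x - (a' x + b' x)))\<^sup>2)
        \<le> ennreal (2 * (norm (a x - a' x))\<^sup>2 + 2 * (norm (b x - b' x))\<^sup>2)"
      using norm_add_sq_le[of "a x - a' x" "b x - b' x"] by (intro ennreal_leI) (simp only:)
    also have "\<dots> = 2 * ennreal ((norm (a x - a' x))\<^sup>2) + 2 * ennreal ((norm (b x - b' x))\<^sup>2)"
      by (simp add: ennreal_mult')
    finally show "ennreal ((norm (a x + b x - (a' x + b' x)))\<^sup>2)
        \<le> 2 * ennreal ((norm (a x - a' x))\<^sup>2) + 2 * ennreal ((norm (b x - b' x))\<^sup>2)" .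
  qed
  also have "\<dots> = 2 * L2_dist2 U a a' + 2 * L2_dist2 U b b'"
    unfolding L2_dist2_def by (subst nn_integral_add) (simp_all add: nn_integral_cmult)
  finally show ?thesis .
qed

lemma L2_dist2_le_scale:
  assumes [measurable]: "a \<in> borel_measurable (lebesgue_on U)" "a' \<in> borel_measurable (lebesgue_on U)"
    and U: "U \<in> sets lebesgue" and B: "\<And>x. x \<in> U \<Longrightarrow> norm (b x - b' x) \<le> B * norm (a x - a' x)"
  shows "L2_dist2 U b b' \<le> ennreal (B\<^sup>2) * L2_dist2 U a a'"
proof -
  have "L2_dist2 U b b' \<le> (\<integral>\<^sup>+x. ennreal (B\<^sup>2) * ennreal ((norm (a x - a' x))\<^sup>2) \<partial>lebesgue_on U)"
    unfolding L2_dist2_def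
  proof (rule nn_integral_mono)
    fix x assume "x \<in> space (lebesgue_on U)"
    then have "x \<in> U" by (simp add: space_restrict_space)
    then have "(norm (b x - b' x))\<^sup>2 \<le> (B * norm (a x - a' x))\<^sup>2"
      using B by (intro power_mono) auto
    then show "ennreal ((norm (b x - b' x))\<^sup>2) \<le> ennreal (B\<^sup>2) * ennreal ((norm (a x - a' x))\<^sup>2)"
      by (simp add: ennreal_mult'[symmetric] power_mult_distrib ennreal_leI)
  qed
  also have "\<dots> = ennreal (B\<^sup>2) * L2_dist2 U a a'"
    unfolding L2_dist2_def by (rule nn_integral_cmult) measurable
  finally show ?thesis .
qed

lemma L2_dist2_add_tendsto:
  assumes "\<And>k. a k \<in> borel_measurable (lebesgue_on U)" "a' \<in> borel_measurable (lebesgue_on U)"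
    "\<And>k. b k \<in> borel_measurable (lebesgue_on U)" "b' \<in> borel_measurable (lebesgue_on U)"
    and a: "(\<lambda>k. L2_dist2 U (a k) a') \<longlonglongrightarrow> 0" and b: "(\<lambda>k. L2_dist2 U (b k) b') \<longlonglongrightarrow> 0"
  shows "(\<lambda>k. L2_dist2 U (\<lambda>x. a k x + b k x) (\<lambda>x. a' x + b' x)) \<longlonglongrightarrow> 0"
proof (rule tendsto_sandwich[OF _ _ tendsto_const])
  show "\<forall>\<^sub>F k in sequentially. L2_dist2 U (\<lambda>x. a k x + b k x) (\<lambda>x. a' x + b' x)
      \<le> 2 * L2_dist2 U (a k) a' + 2 * L2_dist2 U (b k) b'"
    using assms by (intro always_eventually allI L2_dist2_add)
  have "(\<lambda>k. 2 * L2_dist2 U (a k) a' + 2 * L2_dist2 U (b k) b') \<longlonglongrightarrow> 2 * 0 + 2 * 0"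
    by (intro tendsto_add ennreal_tendsto_cmult a b) auto
  then show "(\<lambda>k. 2 * L2_dist2 U (a k) a' + 2 * L2_dist2 U (b k) b') \<longlonglongrightarrow> 0" by simp
qed auto

lemma L2_dist2_scale_tendsto:
  assumes "\<And>k. a k \<in> borel_measurable (lebesgue_on U)" "a' \<in> borel_measurable (lebesgue_on U)"
    and U: "U \<in> sets lebesgue" and B: "\<And>k x. x \<in> U \<Longrightarrow> norm (b k x - b' x) \<le> B * norm (a k x - a' x)"
    and a: "(\<lambda>k. L2_dist2 U (a k) a') \<longlonglongrightarrow> 0"
  shows "(\<lambda>k. L2_dist2 U (b k) b') \<longlonglongrightarrow> 0"
proof (rule tendsto_sandwich[OF _ _ tendsto_const])
  show "\<forall>\<^sub>F k in sequentially. L2_dist2 U (b k) b' \<le> ennreal (B\<^sup>2) * L2_dist2 U (a k) a'"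
    using assms by (intro always_eventually allI L2_dist2_le_scale)
  have "(\<lambda>k. ennreal (B\<^sup>2) * L2_dist2 U (a k) a') \<longlonglongrightarrow> ennreal (B\<^sup>2) * 0"
    by (intro ennreal_tendsto_cmult a) auto
  then show "(\<lambda>k. ennreal (B\<^sup>2) * L2_dist2 U (a k) a') \<longlonglongrightarrow> 0" by simp
qed auto

section \<open>C^1 calculus and integration by parts\<close>

lemma C1_gradI:
  assumes "\<And>x. (u has_derivative (\<lambda>v. Du x \<bullet> v)) (at x)" "continuous_on UNIV Du"
  shows "C1_grad u Du"
  unfolding C1_grad_def using assms by blast

lemma C1_grad_mult:
  assumes u: "C1_grad u Du" and v: "C1_grad v Dv"
  shows "C1_grad (\<lambda>x. u x * v x) (\<lambda>x. u x *\<^sub>R Dv x + v x *\<^sub>R Du x)"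
proof (rule C1_gradI)
  fix x
  show "((\<lambda>x. u x * v x) has_derivative (\<lambda>h. (u x *\<^sub>R Dv x + v x *\<^sub>R Du x) \<bullet> h)) (at x)"
    by (rule has_derivative_eq_rhs[OF has_derivative_mult[OF C1_gradD(1)[OF u] C1_gradD(1)[OF v]]])
       (simp add: inner_add_left mult.commute)
  show "continuous_on UNIV (\<lambda>x. u x *\<^sub>R Dv x + v x *\<^sub>R Du x)"
    by (intro continuous_intros C1_gradD[OF u] C1_gradD[OF v])
qed

lemma C1_grad_chain:
  assumes u: "C1_grad u Du" and f: "\<And>t. (f has_real_derivative f' t) (at t)" "continuous_on UNIV f'"
  shows "C1_grad (\<lambda>x. f (u x)) (\<lambda>x. f' (u x) *\<^sub>R Du x)"
proof (rule C1_gradI)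
  fix x
  show "((\<lambda>x. f (u x)) has_derivative (\<lambda>h. (f' (u x) *\<^sub>R Du x) \<bullet> h)) (at x)"
    by (rule has_derivative_eq_rhs[OF has_derivative_compose[OF C1_gradD(1)[OF u]
          f(1)[of "u x", unfolded has_field_derivative_def]]]) simp
  show "continuous_on UNIV (\<lambda>x. f' (u x) *\<^sub>R Du x)"
    by (intro continuous_intros C1_gradD[OF u] continuous_on_compose2[OF f(2) C1_gradD(3)[OF u]]) auto
qed

lemma C1_grad_zero_outside:
  assumes F: "C1_grad F DF" and "closed C" and 0: "\<And>x. x \<notin> C \<Longrightarrow> F x = 0" and x: "x \<notin> C"
  shows "DF x = 0"
proof -
  have "((\<lambda>_. 0::real) has_derivative (\<lambda>_. 0)) (at x)" by simp
  then have "(F has_derivative (\<lambda>_. 0)) (at x)"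
    by (rule has_derivative_transform_within_open[of _ _ x UNIV "- C"]) (use assms in auto)
  from has_derivative_unique[OF C1_gradD(1)[OF F] this]
  have "DF x \<bullet> DF x = 0" by (rule fun_cong)
  then show ?thesis by simp
qed

lemma integrable_continuous_compact_support:
  fixes g :: "'a::euclidean_space \<Rightarrow> 'b::euclidean_space"
  assumes "continuous_on UNIV g" "compact C" "\<And>x. x \<notin> C \<Longrightarrow> g x = 0"
  shows "integrable lborel g"
proof -
  have "integrable lborel (\<lambda>x. indicator C x *\<^sub>R g x)"
    by (rule borel_integrable_compact[OF assms(2)]) (rule continuous_on_subset[OF assms(1) subset_UNIV])
  moreover have "(\<lambda>x. indicator C x *\<^sub>R g x) = g" using assms(3) by (auto simp: indicator_def fun_eq_iff)
  ultimately show ?thesis by simp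
qed

text \<open>Translation invariance makes the integral of every difference quotient vanish, and
  dominated convergence carries this over to the directional derivatives.\<close>

lemma integral_grad_compact_support:
  fixes F :: "'a::euclidean_space \<Rightarrow> real"
  assumes F: "C1_grad F DF" and C: "compact C" and 0: "\<And>x. x \<notin> C \<Longrightarrow> F x = 0"
  shows "(\<integral>x. DF x \<partial>lborel) = 0"
proof -
  have D0: "DF x = 0" if "x \<notin> C" for x
    using C1_grad_zero_outside[OF F compact_imp_closed[OF C] 0 that] .
  have iD: "integrable lborel DF"
    by (rule integrable_continuous_compact_support[OF C1_gradD(2)[OF F] C D0])
  have iF: "integrable lborel F"
    by (rule integrable_continuous_compact_support[OF C1_gradD(3)[OF F] C 0])
  have "bounded (DF ` C)"
    by (intro compact_imp_bounded compact_continuous_image[OF _ C] continuous_on_subset[OF C1_gradD(2)[OF F]]) auto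
  then obtain B where B: "B > 0" "\<And>x. x \<in> C \<Longrightarrow> norm (DF x) \<le> B"
    unfolding bounded_pos by auto
  have B': "norm (DF x) \<le> B" for x
    using B D0[of x] by (cases "x \<in> C") auto
  have lip: "\<bar>F x - F y\<bar> \<le> B * norm (x - y)" for x y
  proof -
    have "norm (F x - F y) \<le> B * norm (x - y)"
    proof (rule differentiable_bound[of UNIV])
      show "(F has_derivative (\<lambda>v. DF z \<bullet> v)) (at z within UNIV)" for z using C1_gradD(1)[OF F] .
      show "onorm (\<lambda>v. DF z \<bullet> v) \<le> B" for z
      proof (rule onorm_bound)
        show "norm (DF z \<bullet> v) \<le> B * norm v" for v
          using Cauchy_Schwarz_ineq2[of "DF z" v] mult_right_mono[OF B'[of z] norm_ge_zero[of v]] by simp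
      qed (use B in auto)
    qed auto
    then show ?thesis by simp
  qed
  obtain R where R: "\<And>x. x \<in> C \<Longrightarrow> norm x \<le> R"
    using compact_imp_bounded[OF C] unfolding bounded_iff by auto
  have comp: "(\<integral>x. DF x \<bullet> e \<partial>lborel) = 0" if e: "e \<in> Basis" for e
  proof -
    define h where "h k = inverse (real (Suc k))" for k
    have h: "0 < h k" "h k \<le> 1" for k by (auto simp: h_def inverse_le_1_iff)
    define q where "q k x = (F (x + h k *\<^sub>R e) - F x) / h k" for k x
    have qlim: "(\<lambda>k. q k x) \<longlonglongrightarrow> DF x \<bullet> e" for x
    proof -
      have "((\<lambda>t. x + t *\<^sub>R e) has_derivative (\<lambda>t. t *\<^sub>R e)) (at 0)"
        by (auto intro!: derivative_eq_intros)
      then have "((\<lambda>t. F (x + t *\<^sub>R e)) has_derivative (\<lambda>t. DF (x + 0 *\<^sub>R e) \<bullet> (t *\<^sub>R e))) (at 0)"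
        by (rule has_derivative_compose) (rule C1_gradD(1)[OF F])
      moreover have "(\<lambda>t. DF (x + 0 *\<^sub>R e) \<bullet> (t *\<^sub>R e)) = (*) (DF x \<bullet> e)"
        by (rule ext) simp
      ultimately have "((\<lambda>t. F (x + t *\<^sub>R e)) has_real_derivative DF x \<bullet> e) (at 0)"
        by (simp add: has_field_derivative_def)
      then have d: "((\<lambda>t. (F (x + (0 + t) *\<^sub>R e) - F (x + 0 *\<^sub>R e)) / t) \<longlongrightarrow> DF x \<bullet> e) (at 0)"
        by (rule DERIV_D)
      have "filterlim h (at 0) sequentially"
        unfolding h_def by (intro filterlim_atI LIMSEQ_inverse_real_of_nat) auto
      from filterlim_compose[OF d this] show ?thesis by (simp add: q_def)
    qed
    have Fm: "F \<in> borel_measurable borel" by (rule C1_grad_borel[OF F])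
    have qm: "q k \<in> borel_measurable lborel" for k
      unfolding q_def using Fm by measurable
    have iFs: "integrable lborel (\<lambda>x. F (x + c))" "(\<integral>x. F (x + c) \<partial>lborel) = (\<integral>x. F x \<partial>lborel)" for c
    proof -
      have eq: "(\<integral>x. F x \<partial>lborel) = (\<integral>x. F x \<partial>distr lborel borel ((+) c))"
        by (simp add: lborel_distr_plus)
      also have "\<dots> = (\<integral>x. F (c + x) \<partial>lborel)" using Fm by (intro integral_distr) auto
      finally show "(\<integral>x. F (x + c) \<partial>lborel) = (\<integral>x. F x \<partial>lborel)" by (simp add: add.commute)
      have "integrable (distr lborel borel ((+) c)) F" using iF by (simp add: lborel_distr_plus)
      then have "integrable lborel (\<lambda>x. F (c + x))" using Fm by (subst (asm) integrable_distr_eq) auto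
      then show "integrable lborel (\<lambda>x. F (x + c))" by (simp add: add.commute)
    qed
    have q0: "(\<integral>x. q k x \<partial>lborel) = 0" for k
      unfolding q_def using iFs iF by simp
    have "(\<lambda>k. \<integral>x. q k x \<partial>lborel) \<longlonglongrightarrow> (\<integral>x. DF x \<bullet> e \<partial>lborel)"
    \<comment> \<open>\<open>B\<close> is a global Lipschitz constant of F, and a step of length at
      most 1 cannot reach the support, contained in the ball of radius R, from outside the ball of
      radius R + 1.\<close>
    proof (rule integral_dominated_convergence[where w="\<lambda>x. B * indicator (cball 0 (R + 1)) x"])
      show "(\<lambda>x. DF x \<bullet> e) \<in> borel_measurable lborel" using C1_grad_borel(2)[OF F] by measurable
      show "q k \<in> borel_measurable lborel" for k by (rule qm)
      show "integrable lborel (\<lambda>x. B * indicator (cball (0::'a) (R + 1)) x)"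
        using emeasure_lborel_cball_finite[of "0::'a" "R + 1"]
        by (intro integrable_mult_right integrable_real_indicator) auto
      show "AE x in lborel. (\<lambda>k. q k x) \<longlonglongrightarrow> DF x \<bullet> e" using qlim by simp
      show "AE x in lborel. norm (q k x) \<le> B * indicator (cball 0 (R + 1)) x" for k
      proof (rule AE_I2)
        fix x :: 'a
        show "norm (q k x) \<le> B * indicator (cball 0 (R + 1)) x"
        proof (cases "norm x \<le> R + 1")
          case True
          have "\<bar>F (x + h k *\<^sub>R e) - F x\<bar> \<le> B * h k"
            using lip[of "x + h k *\<^sub>R e" x] h[of k] e by simp
          then show ?thesis using True h[of k] by (simp add: q_def abs_div divide_le_eq)
        next
          case False
          have "norm x \<le> norm (x + h k *\<^sub>R e) + norm (h k *\<^sub>R e)"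
            using norm_triangle_ineq4[of "x + h k *\<^sub>R e" "h k *\<^sub>R e"] by simp
          also have "norm (h k *\<^sub>R e) \<le> 1" using h[of k] e by simp
          finally have "\<not> norm (x + h k *\<^sub>R e) \<le> R" using False by linarith
          moreover have "\<not> norm x \<le> R" using False by linarith
          ultimately have "F x = 0" "F (x + h k *\<^sub>R e) = 0" using R 0 by blast+
          then show ?thesis using False by (simp add: q_def)
        qed
      qed
    qed
    then have "(\<lambda>k::nat. 0::real) \<longlonglongrightarrow> (\<integral>x. DF x \<bullet> e \<partial>lborel)" by (simp add: q0)
    then show ?thesis by (rule LIMSEQ_unique[OF tendsto_const, symmetric])
  qed
  show ?thesis
  proof (rule euclidean_eqI)
    fix e :: 'a assume e: "e \<in> Basis"
    have "(\<integral>x. DF x \<partial>lborel) \<bullet> e = (\<integral>x. DF x \<bullet> e \<partial>lborel)"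
      by (rule integral_inner_left[symmetric]) (rule iD)
    then show "(\<integral>x. DF x \<partial>lborel) \<bullet> e = 0 \<bullet> e" using comp[OF e] by simp
  qed
qed

lemma set_integral_compact_support:
  fixes g :: "'a::euclidean_space \<Rightarrow> 'b::euclidean_space"
  assumes "g \<in> borel_measurable borel" "\<And>x. x \<notin> U \<Longrightarrow> g x = 0"
  shows "(LINT x:U|lebesgue. g x) = (\<integral>x. g x \<partial>lborel)"
proof -
  have "(\<lambda>x. indicator U x *\<^sub>R g x) = g" using assms(2) by (auto simp: indicator_def fun_eq_iff)
  then show ?thesis unfolding set_lebesgue_integral_def using assms(1) by (simp add: integral_completion)
qed

text \<open>The product of u and \<psi> has compact support, so its gradient integrates to
  zero.\<close>

lemma C1_integration_by_parts:
  fixes u \<psi> :: "'a::euclidean_space \<Rightarrow> real"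
  assumes u: "C1_grad u Du" and \<psi>: "C1_grad \<psi> D\<psi>" and C: "compact (closure {x. \<psi> x \<noteq> 0})"
    "closure {x. \<psi> x \<noteq> 0} \<subseteq> U"
  shows "(LINT x:U|lebesgue. u x *\<^sub>R D\<psi> x) = - (LINT x:U|lebesgue. \<psi> x *\<^sub>R Du x)"
proof -
  define S where "S = closure {x. \<psi> x \<noteq> 0}"
  have S: "compact S" "S \<subseteq> U" using C by (auto simp: S_def)
  have 0: "\<psi> x = 0" if "x \<notin> S" for x using that closure_subset[of "{x. \<psi> x \<noteq> 0}"] by (auto simp: S_def)
  have D0: "D\<psi> x = 0" if "x \<notin> S" for x
    by (rule C1_grad_zero_outside[OF \<psi> compact_imp_closed[OF S(1)] 0 that])
  have c1: "continuous_on UNIV (\<lambda>x. u x *\<^sub>R D\<psi> x)" and c2: "continuous_on UNIV (\<lambda>x. \<psi> x *\<^sub>R Du x)"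
    by (intro continuous_intros C1_gradD[OF u] C1_gradD[OF \<psi>])+
  have 1: "integrable lborel (\<lambda>x. u x *\<^sub>R D\<psi> x)"
    by (rule integrable_continuous_compact_support[OF c1 S(1)]) (simp add: D0)
  have 2: "integrable lborel (\<lambda>x. \<psi> x *\<^sub>R Du x)"
    by (rule integrable_continuous_compact_support[OF c2 S(1)]) (simp add: 0)
  have "(\<integral>x. u x *\<^sub>R D\<psi> x + \<psi> x *\<^sub>R Du x \<partial>lborel) = 0"
    by (rule integral_grad_compact_support[OF C1_grad_mult[OF u \<psi>] S(1)]) (simp add: 0)
  then have "(\<integral>x. u x *\<^sub>R D\<psi> x \<partial>lborel) = - (\<integral>x. \<psi> x *\<^sub>R Du x \<partial>lborel)"
    using 1 2 by (simp add: eq_neg_iff_add_eq_0)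
  moreover have "(LINT x:U|lebesgue. u x *\<^sub>R D\<psi> x) = (\<integral>x. u x *\<^sub>R D\<psi> x \<partial>lborel)"
    using S(2) D0 by (intro set_integral_compact_support borel_measurable_continuous_onI[OF c1]) auto
  moreover have "(LINT x:U|lebesgue. \<psi> x *\<^sub>R Du x) = (\<integral>x. \<psi> x *\<^sub>R Du x \<partial>lborel)"
    using S(2) 0 by (intro set_integral_compact_support borel_measurable_continuous_onI[OF c2]) auto
  ultimately show ?thesis by simp
qed

lemma set_integral_lebesgue_on:
  fixes f :: "'a::euclidean_space \<Rightarrow> 'b::euclidean_space"
  assumes "U \<in> sets lebesgue"
  shows "(LINT x:U|lebesgue. f x) = integral\<^sup>L (lebesgue_on U) f"
  unfolding set_lebesgue_integral_def using assms by (subst integral_restrict_space) auto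

lemma borel_measurable_lebesgue_on:
  "f \<in> borel_measurable borel \<Longrightarrow> f \<in> borel_measurable (lebesgue_on U)"
  by (intro measurable_restrict_space1 measurable_completion) simp

lemma L2_on_bounded_borel_support:
  fixes g :: "'a::euclidean_space \<Rightarrow> 'b::euclidean_space"
  assumes g: "continuous_on UNIV g" and C: "compact C" and 0: "\<And>x. x \<notin> C \<Longrightarrow> g x = 0"
    and U: "U \<in> sets lebesgue"
  shows "L2_on U g"
proof -
  have m: "g \<in> borel_measurable borel" by (rule borel_measurable_continuous_onI[OF g])
  have "integrable lborel (\<lambda>x. (norm (g x))\<^sup>2)"
    by (rule integrable_continuous_compact_support[OF _ C]) (auto intro!: continuous_intros g simp: 0)
  then have "integrable lebesgue (\<lambda>x. (norm (g x))\<^sup>2)"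
    using m by (subst integrable_completion) measurable
  then have "integrable (lebesgue_on U) (\<lambda>x. (norm (g x))\<^sup>2)"
    using U by (subst integrable_restrict_space) (auto intro: integrable_mult_indicator[where f="\<lambda>x. (norm (g x))\<^sup>2", simplified])
  then show ?thesis using borel_measurable_lebesgue_on[OF m] by (simp add: L2_on_def)
qed

text \<open>Both sides of the weak identity are continuous in L^2 by Cauchy-Schwarz, so the identity
  passes from C^1 functions to their limits. Weak gradients of combinations and of cut-off functions
  are later exhibited through their C^1 approximants in this way.\<close>

lemma H1_grad_limit:
  assumes U: "U \<in> sets lebesgue" and f: "L2_on U f" and g: "L2_on U g"
    and u: "\<And>k. C1_grad (u k) (Du k)"
    and lf: "(\<lambda>k. L2_dist2 U (u k) f) \<longlonglongrightarrow> 0" and lg: "(\<lambda>k. L2_dist2 U (Du k) g) \<longlonglongrightarrow> 0"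
  shows "H1_grad U f g"
  unfolding H1_grad_def
proof (intro conjI allI impI f g)
  fix \<psi> D\<psi>
  assume \<psi>: "C1_grad \<psi> D\<psi>" and C: "compact (closure {x. \<psi> x \<noteq> 0})" "closure {x. \<psi> x \<noteq> 0} \<subseteq> U"
  define S where "S = closure {x. \<psi> x \<noteq> 0}"
  have S: "compact S" using C by (simp add: S_def)
  have 0: "\<psi> x = 0" if "x \<notin> S" for x using that closure_subset[of "{x. \<psi> x \<noteq> 0}"] by (auto simp: S_def)
  have D0: "D\<psi> x = 0" if "x \<notin> S" for x
    by (rule C1_grad_zero_outside[OF \<psi> compact_imp_closed[OF S] 0 that])
  have L\<psi>: "L2_on U \<psi>" by (rule L2_on_bounded_borel_support[OF C1_gradD(3)[OF \<psi>] S 0 U])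
  have LD: "L2_on U D\<psi>" by (rule L2_on_bounded_borel_support[OF C1_gradD(2)[OF \<psi>] S D0 U])
  note um = borel_measurable_lebesgue_on[OF C1_grad_borel(1)[OF u]]
  note Dum = borel_measurable_lebesgue_on[OF C1_grad_borel(2)[OF u]]
  note tf = L2_dist2_tendsto[OF f um lf] and tg = L2_dist2_tendsto[OF g Dum lg]
  note [measurable] = L2_onD(1)[OF f] L2_onD(1)[OF g] L2_onD(1)[OF L\<psi>] L2_onD(1)[OF LD] um Dum
  have A: "(\<lambda>k. \<integral>x. u k x *\<^sub>R D\<psi> x \<partial>lebesgue_on U) \<longlonglongrightarrow> (\<integral>x. f x *\<^sub>R D\<psi> x \<partial>lebesgue_on U)"
  proof (rule Lim_null[THEN iffD2], rule Lim_null_comparison)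
    show "eventually (\<lambda>k. norm ((\<integral>x. u k x *\<^sub>R D\<psi> x \<partial>lebesgue_on U) - (\<integral>x. f x *\<^sub>R D\<psi> x \<partial>lebesgue_on U))
      \<le> sqrt (\<integral>x. (norm (u k x - f x))\<^sup>2 \<partial>lebesgue_on U) * sqrt (\<integral>x. (norm (D\<psi> x))\<^sup>2 \<partial>lebesgue_on U)) sequentially"
      using tf(1)
    proof eventually_elim
      case (elim k)
      have i1: "integrable (lebesgue_on U) (\<lambda>x. u k x *\<^sub>R D\<psi> x)"
        by (rule L2_product_integrable(1)[OF conjunct1[OF elim] LD]) auto
      have i2: "integrable (lebesgue_on U) (\<lambda>x. f x *\<^sub>R D\<psi> x)"
        by (rule L2_product_integrable(1)[OF f LD]) auto
      have "norm (\<integral>x. (u k x - f x) *\<^sub>R D\<psi> x \<partial>lebesgue_on U)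
        \<le> sqrt (\<integral>x. (norm (u k x - f x))\<^sup>2 \<partial>lebesgue_on U) * sqrt (\<integral>x. (norm (D\<psi> x))\<^sup>2 \<partial>lebesgue_on U)"
        by (rule L2_product_integrable(2)[OF conjunct2[OF elim] LD]) auto
      then show ?case using i1 i2 by (simp add: scaleR_diff_left)
    qed
    show "(\<lambda>k. sqrt (\<integral>x. (norm (u k x - f x))\<^sup>2 \<partial>lebesgue_on U) * sqrt (\<integral>x. (norm (D\<psi> x))\<^sup>2 \<partial>lebesgue_on U)) \<longlonglongrightarrow> 0"
      using tendsto_mult_right[OF tendsto_real_sqrt[OF tf(2)]] by fastforce
  qed
  have B: "(\<lambda>k. \<integral>x. \<psi> x *\<^sub>R Du k x \<partial>lebesgue_on U) \<longlonglongrightarrow> (\<integral>x. \<psi> x *\<^sub>R g x \<partial>lebesgue_on U)"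
  proof (rule Lim_null[THEN iffD2], rule Lim_null_comparison)
    show "eventually (\<lambda>k. norm ((\<integral>x. \<psi> x *\<^sub>R Du k x \<partial>lebesgue_on U) - (\<integral>x. \<psi> x *\<^sub>R g x \<partial>lebesgue_on U))
      \<le> sqrt (\<integral>x. (norm (Du k x - g x))\<^sup>2 \<partial>lebesgue_on U) * sqrt (\<integral>x. (norm (\<psi> x))\<^sup>2 \<partial>lebesgue_on U)) sequentially"
      using tg(1)
    proof eventually_elim
      case (elim k)
      have i1: "integrable (lebesgue_on U) (\<lambda>x. \<psi> x *\<^sub>R Du k x)"
        by (rule L2_product_integrable(1)[OF conjunct1[OF elim] L\<psi>]) (auto simp: mult.commute)
      have i2: "integrable (lebesgue_on U) (\<lambda>x. \<psi> x *\<^sub>R g x)"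
        by (rule L2_product_integrable(1)[OF g L\<psi>]) (auto simp: mult.commute)
      have "norm (\<integral>x. \<psi> x *\<^sub>R (Du k x - g x) \<partial>lebesgue_on U)
        \<le> sqrt (\<integral>x. (norm (Du k x - g x))\<^sup>2 \<partial>lebesgue_on U) * sqrt (\<integral>x. (norm (\<psi> x))\<^sup>2 \<partial>lebesgue_on U)"
        by (rule L2_product_integrable(2)[OF conjunct2[OF elim] L\<psi>]) (auto simp: mult.commute)
      then show ?case using i1 i2 by (simp add: scaleR_diff_right)
    qed
    show "(\<lambda>k. sqrt (\<integral>x. (norm (Du k x - g x))\<^sup>2 \<partial>lebesgue_on U) * sqrt (\<integral>x. (norm (\<psi> x))\<^sup>2 \<partial>lebesgue_on U)) \<longlonglongrightarrow> 0"
      using tendsto_mult_right[OF tendsto_real_sqrt[OF tg(2)]] by fastforce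
  qed
  have "(\<integral>x. u k x *\<^sub>R D\<psi> x \<partial>lebesgue_on U) = - (\<integral>x. \<psi> x *\<^sub>R Du k x \<partial>lebesgue_on U)" for k
    using C1_integration_by_parts[OF u \<psi> C] by (simp add: set_integral_lebesgue_on[OF U])
  then have "(\<lambda>k. \<integral>x. u k x *\<^sub>R D\<psi> x \<partial>lebesgue_on U) \<longlonglongrightarrow> - (\<integral>x. \<psi> x *\<^sub>R g x \<partial>lebesgue_on U)"
    using tendsto_minus[OF B] by simp
  from LIMSEQ_unique[OF A this]
  show "(LINT x:U|lebesgue. f x *\<^sub>R D\<psi> x) = - (LINT x:U|lebesgue. \<psi> x *\<^sub>R g x)"
    by (simp add: set_integral_lebesgue_on[OF U])
qed

section \<open>Uniqueness of weak gradients\<close>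

lemma has_real_derivative_pos_part_sq:
  "((\<lambda>t::real. (max 0 t)\<^sup>2) has_real_derivative 2 * max 0 t) (at t)"
proof -
  consider "t > 0" | "t < 0" | "t = 0" by linarith
  then show ?thesis
  proof cases
    case 1
    have "((\<lambda>t::real. t\<^sup>2) has_real_derivative 2 * max 0 t) (at t)"
      using 1 by (auto intro!: derivative_eq_intros)
    then show ?thesis
      by (rule DERIV_cong_ev[THEN iffD1, rotated -1, OF _ refl _ refl])
         (use eventually_nhds_in_open[of "{0<..}" t] 1 in \<open>auto elim!: eventually_mono\<close>)
  next
    case 2
    have "((\<lambda>t::real. 0) has_real_derivative 2 * max 0 t) (at t)"
      using 2 by (auto intro!: derivative_eq_intros)
    then show ?thesis
      by (rule DERIV_cong_ev[THEN iffD1, rotated -1, OF _ refl _ refl])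
         (use eventually_nhds_in_open[of "{..<0}" t] 2 in \<open>auto elim!: eventually_mono\<close>)
  next
    case 3
    have "((\<lambda>h::real. ((max 0 (0 + h))\<^sup>2 - (max 0 0)\<^sup>2) / h) \<longlongrightarrow> 0) (at 0)"
    proof (rule Lim_null_comparison)
      show "\<forall>\<^sub>F h in at 0. norm (((max 0 (0 + h))\<^sup>2 - (max 0 (0::real))\<^sup>2) / h) \<le> \<bar>h\<bar>"
        by (intro always_eventually allI) (auto simp: max_def power2_eq_square)
      show "((\<lambda>h::real. \<bar>h\<bar>) \<longlongrightarrow> 0) (at 0)"
        using tendsto_rabs[OF tendsto_ident_at[of "0::real" UNIV]] by simp
    qed
    then show ?thesis using 3 by (simp add: DERIV_def)
  qed
qed

lemma C1_grad_prod:
  assumes "finite A" "\<And>i. i \<in> A \<Longrightarrow> \<exists>D. C1_grad (f i) D"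
  shows "\<exists>D. C1_grad (\<lambda>x::'a::euclidean_space. \<Prod>i\<in>A. f i x :: real) D"
  using assms
proof (induction A rule: finite_induct)
  case empty
  have "C1_grad (\<lambda>x::'a. 1::real) (\<lambda>_. 0)" by (rule C1_gradI) auto
  then show ?case by auto
next
  case (insert i A)
  then obtain D1 D2 where "C1_grad (f i) D1" "C1_grad (\<lambda>x. \<Prod>i\<in>A. f i x) D2" by blast
  from C1_grad_mult[OF this] insert(1,2) show ?case by auto
qed

text \<open>Products of squared positive parts are C^1 and nonzero exactly on the box; the
  composition with a saturating function drives their positive values to 1 and keeps their
  zeros.\<close>

lemma box_bump_functions:
  fixes a b :: "'a::euclidean_space"
  obtains \<psi> D\<psi> where "\<And>k. C1_grad (\<psi> k) (D\<psi> k)" "\<And>k x. 0 \<le> \<psi> k x \<and> \<psi> k x \<le> 1"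
    "\<And>k::nat. {x. \<psi> k x \<noteq> 0} = box a b" "\<And>x. (\<lambda>k. \<psi> k x) \<longlonglongrightarrow> indicator (box a b) x"
proof -
  define p where "p t = (max 0 t)\<^sup>2" for t :: real
  have p: "(p has_real_derivative 2 * max 0 t) (at t)" for t
    unfolding p_def[abs_def] by (rule has_real_derivative_pos_part_sq)
  have p0: "0 \<le> p t" for t by (simp add: p_def)
  have p_pos: "p t \<noteq> 0 \<longleftrightarrow> 0 < t" for t by (cases "0 < t") (auto simp: p_def)
  have pc: "continuous_on UNIV p" unfolding p_def by (intro continuous_intros)
  have lin1: "C1_grad (\<lambda>x. (x - a) \<bullet> i) (\<lambda>_. i)" for i :: 'a
    by (rule C1_gradI) (auto intro!: derivative_eq_intros simp: inner_commute)
  have lin2: "C1_grad (\<lambda>x. (b - x) \<bullet> i) (\<lambda>_. - i)" for i :: 'a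
    by (rule C1_gradI) (auto intro!: derivative_eq_intros simp: inner_commute)
  have c2: "continuous_on UNIV (\<lambda>t::real. 2 * max 0 t)" by (intro continuous_intros)
  define \<rho> where "\<rho> x = (\<Prod>i\<in>Basis. p ((x - a) \<bullet> i) * p ((b - x) \<bullet> i))" for x
  have "\<exists>D. C1_grad \<rho> D"
    unfolding \<rho>_def
    using C1_grad_mult[OF C1_grad_chain[OF lin1 p c2] C1_grad_chain[OF lin2 p c2]]
    by (intro C1_grad_prod) auto
  then obtain D\<rho> where D\<rho>: "C1_grad \<rho> D\<rho>" by blast
  have \<rho>0: "0 \<le> \<rho> x" for x unfolding \<rho>_def by (intro prod_nonneg mult_nonneg_nonneg ballI p0)
  have \<rho>_pos: "\<rho> x \<noteq> 0 \<longleftrightarrow> x \<in> box a b" for x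
    unfolding \<rho>_def by (simp add: p_pos[simplified] mem_box inner_diff_left)
  \<comment> \<open>The denominator is at least 1 for every t since \<open>p\<close> is nonnegative,
    which keeps \<open>f k\<close> in C^1; \<open>Suc k\<close> avoids k = 0, where \<open>f\<close>
    would vanish identically.\<close>
  define f where "f k t = real (Suc k) * p t / (1 + real (Suc k) * p t)" for k t
  define f' where "f' k t = real (Suc k) * (2 * max 0 t) / (1 + real (Suc k) * p t)\<^sup>2" for k t
  have den: "0 < 1 + real (Suc k) * p t" for k t using p0[of t] by (simp add: add_pos_nonneg)
  have df: "(f k has_real_derivative f' k t) (at t)" for k t
  proof -
    have 1: "((\<lambda>t. real (Suc k) * p t) has_real_derivative real (Suc k) * (2 * max 0 t)) (at t)"
      by (rule DERIV_cmult[OF p])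
    have 2: "((\<lambda>t. 1 + real (Suc k) * p t) has_real_derivative 0 + real (Suc k) * (2 * max 0 t)) (at t)"
      by (rule DERIV_add[OF DERIV_const 1])
    have "(f k has_real_derivative (real (Suc k) * (2 * max 0 t) * (1 + real (Suc k) * p t)
        - (real (Suc k) * p t) * (0 + real (Suc k) * (2 * max 0 t)))
        / ((1 + real (Suc k) * p t) * (1 + real (Suc k) * p t))) (at t)"
      unfolding f_def[abs_def] by (rule DERIV_divide[OF 1 2]) (use den[of k t] in simp)
    moreover have "(real (Suc k) * (2 * max 0 t) * (1 + real (Suc k) * p t)
        - (real (Suc k) * p t) * (0 + real (Suc k) * (2 * max 0 t))) = real (Suc k) * (2 * max 0 t)"
      by (simp add: algebra_simps)
    ultimately show ?thesis by (simp only: f'_def power2_eq_square)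
  qed
  have cf: "continuous_on UNIV (f' k)" for k
    unfolding f'_def by (intro continuous_intros pc) (use den in \<open>auto simp: less_imp_neq[symmetric]\<close>)
  show ?thesis
  proof (rule that[of "\<lambda>k x. f k (\<rho> x)" "\<lambda>k x. f' k (\<rho> x) *\<^sub>R D\<rho> x"])
    show "C1_grad (\<lambda>x. f k (\<rho> x)) (\<lambda>x. f' k (\<rho> x) *\<^sub>R D\<rho> x)" for k
      by (rule C1_grad_chain[OF D\<rho> df cf])
    show "0 \<le> f k (\<rho> x) \<and> f k (\<rho> x) \<le> 1" for k x
      using den[of k "\<rho> x"] p0[of "\<rho> x"] by (simp add: f_def divide_le_eq del: of_nat_Suc)
    have pr: "p (\<rho> x) \<noteq> 0 \<longleftrightarrow> x \<in> box a b" for x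
      using \<rho>_pos[of x] \<rho>0[of x] p_pos[of "\<rho> x"] by linarith
    show "{x. f k (\<rho> x) \<noteq> 0} = box a b" for k
      using den[of k] pr by (auto simp: f_def less_imp_neq[symmetric] simp del: of_nat_Suc)
    show "(\<lambda>k. f k (\<rho> x)) \<longlonglongrightarrow> indicator (box a b) x" for x
    proof (cases "x \<in> box a b")
      case True
      then have q: "0 < p (\<rho> x)" using pr[of x] p0[of "\<rho> x"] by linarith
      have "f k (\<rho> x) = 1 - inverse (1 + real (Suc k) * p (\<rho> x))" for k
        using den[of k "\<rho> x"] by (simp add: f_def field_simps del: of_nat_Suc)
      moreover have "(\<lambda>k. 1 - inverse (1 + real (Suc k) * p (\<rho> x))) \<longlonglongrightarrow> 1 - 0"
      proof (intro tendsto_diff tendsto_const tendsto_inverse_0_at_top)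
        show "filterlim (\<lambda>k. 1 + real (Suc k) * p (\<rho> x)) at_top sequentially"
          by (intro filterlim_tendsto_add_at_top[OF tendsto_const] filterlim_at_top_mult_tendsto_pos[OF tendsto_const q]
              filterlim_compose[OF filterlim_real_sequentially filterlim_Suc])
      qed
      ultimately show ?thesis using True by simp
    next
      case False
      then have "f k (\<rho> x) = 0" for k using pr[of x] by (simp add: f_def)
      then show ?thesis using False by simp
    qed
  qed
qed

text \<open>Bumps supported in the closed box converge to the indicator of the open one. They are
  dominated by |d| on the closed box, which is integrable because d is in L^2 and the box is
  bounded.\<close>

lemma test_function_box_integral:
  fixes d :: "'a::euclidean_space \<Rightarrow> 'a"
  assumes U: "U \<in> sets lebesgue" and d: "L2_on U d"
    and test: "\<And>\<psi> D\<psi>. C1_grad \<psi> D\<psi> \<Longrightarrow> compact (closure {x. \<psi> x \<noteq> 0}) \<Longrightarrow> closure {x. \<psi> x \<noteq> 0} \<subseteq> U \<Longrightarrow>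
        (LINT x:U|lebesgue. \<psi> x *\<^sub>R d x) = 0"
    and ab: "cbox a b \<subseteq> U" "box a b \<noteq> {}"
  shows "(LINT x:box a b|lebesgue. d x) = 0"
proof -
  obtain \<psi> D\<psi> where \<psi>: "\<And>k. C1_grad (\<psi> k) (D\<psi> k)" "\<And>k x. 0 \<le> \<psi> k x \<and> \<psi> k x \<le> 1"
    "\<And>k::nat. {x. \<psi> k x \<noteq> 0} = box a b" "\<And>x. (\<lambda>k. \<psi> k x) \<longlonglongrightarrow> indicator (box a b) x"
    using box_bump_functions[of a b] by metis
  note [measurable] = L2_onD(1)[OF d] borel_measurable_lebesgue_on[OF C1_grad_borel(1)[OF \<psi>(1)]]
  have bm[measurable]: "(indicator (box a b) :: 'a \<Rightarrow> real) \<in> borel_measurable (lebesgue_on U)"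
    by (intro borel_measurable_lebesgue_on) simp
  have bm'[measurable]: "(indicator (cbox a b) :: 'a \<Rightarrow> real) \<in> borel_measurable (lebesgue_on U)"
    by (intro borel_measurable_lebesgue_on) simp
  have Lc: "L2_on U (indicator (cbox a b) :: 'a \<Rightarrow> real)"
  proof -
    have "integrable lebesgue (indicator (cbox a b) :: 'a \<Rightarrow> real)"
      by (intro integrable_real_indicator) (auto simp: emeasure_lborel_cbox_eq)
    then have "integrable (lebesgue_on U) (indicator (cbox a b) :: 'a \<Rightarrow> real)"
      using U by (subst integrable_restrict_space)
        (auto intro: integrable_mult_indicator[where f="indicator (cbox a b) :: 'a \<Rightarrow> real", simplified])
    moreover have "(\<lambda>x. (norm (indicator (cbox a b) x :: real))\<^sup>2) = indicator (cbox a b)"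
      by (auto simp: indicator_def)
    ultimately show ?thesis using bm' by (simp add: L2_on_def)
  qed
  have iw: "integrable (lebesgue_on U) (\<lambda>x. indicator (cbox a b) x * norm (d x))"
    by (rule L2_product_integrable(1)[OF Lc d]) auto
  have z: "(\<integral>x. \<psi> k x *\<^sub>R d x \<partial>lebesgue_on U) = 0" for k
    using test[OF \<psi>(1)[of k]] ab U unfolding \<psi>(3) by (simp add: set_integral_lebesgue_on)
  have "(\<lambda>k. \<integral>x. \<psi> k x *\<^sub>R d x \<partial>lebesgue_on U) \<longlonglongrightarrow> (\<integral>x. indicator (box a b) x *\<^sub>R d x \<partial>lebesgue_on U)"
  proof (rule integral_dominated_convergence[OF _ _ iw])
    show "AE x in lebesgue_on U. (\<lambda>k. \<psi> k x *\<^sub>R d x) \<longlonglongrightarrow> indicator (box a b) x *\<^sub>R d x"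
      by (intro AE_I2 tendsto_scaleR tendsto_const \<psi>(4))
    show "AE x in lebesgue_on U. norm (\<psi> k x *\<^sub>R d x) \<le> indicator (cbox a b) x * norm (d x)" for k
    proof (rule AE_I2)
      fix x
      show "norm (\<psi> k x *\<^sub>R d x) \<le> indicator (cbox a b) x * norm (d x)"
      proof (cases "x \<in> cbox a b")
        case True
        then show ?thesis using \<psi>(2)[of k x] by (simp add: mult_left_le_one_le)
      next
        case False
        then have "x \<notin> box a b" using box_subset_cbox by blast
        then have "\<psi> k x = 0" using \<psi>(3)[of k] by blast
        then show ?thesis by simp
      qed
    qed
  qed measurable
  then have "(\<lambda>k::nat. 0) \<longlonglongrightarrow> (\<integral>x. indicator (box a b) x *\<^sub>R d x \<partial>lebesgue_on U)" by (simp add: z)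
  then have "(\<integral>x. indicator (box a b) x *\<^sub>R d x \<partial>lebesgue_on U) = 0"
    by (rule LIMSEQ_unique[OF tendsto_const, symmetric])
  then have "(\<integral>x. indicator U x *\<^sub>R indicator (box a b) x *\<^sub>R d x \<partial>lebesgue) = 0"
    using U by (subst (asm) integral_restrict_space) auto
  also have "(\<lambda>x. indicator U x *\<^sub>R indicator (box a b) x *\<^sub>R d x) = (\<lambda>x. indicator (box a b) x *\<^sub>R d x)"
    using ab(1) box_subset_cbox[of a b] by (auto simp: indicator_def fun_eq_iff)
  finally show ?thesis by (simp add: set_lebesgue_integral_def)
qed

text \<open>Boxes form an intersection-stable generator of the Borel sets, and sets of vanishing
  integral are closed under complements and countable disjoint unions. Lebesgue sets differ from
  Borel sets by null sets, and a function whose integrals over all sets vanish is zero a.e.\<close>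

lemma AE_zero_of_box_integrals:
  fixes d :: "'a::euclidean_space \<Rightarrow> 'a"
  assumes int: "set_integrable lebesgue (box a b) d"
    and z: "\<And>u v. box u v \<noteq> {} \<Longrightarrow> box u v \<subseteq> box a b \<Longrightarrow> (LINT x:box u v|lebesgue. d x) = 0"
  shows "AE x in lebesgue. x \<in> box a b \<longrightarrow> d x = 0"
proof -
  define B where "B = box a b"
  have Bm: "B \<in> sets lebesgue" by (simp add: B_def)
  have si: "set_integrable lebesgue (A \<inter> B) d" if "A \<in> sets lebesgue" for A
    by (rule set_integrable_subset[OF int[folded B_def]]) (use that Bm in auto)
  have stab: "Int_stable (range (\<lambda>(u, v). box u v :: 'a set))"
    by (auto simp: Int_stable_def box_Int_box)
  have bor: "sigma_sets UNIV (range (\<lambda>(u, v). box u v :: 'a set)) = sets borel"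
    by (simp add: borel_eq_box)
  have zB: "(LINT x:box u v|lebesgue. d x) = 0" if "box u v \<subseteq> B" for u v
    using z[of u v] that by (cases "box u v = {}") (auto simp: B_def set_lebesgue_integral_def)
  have borel0: "(LINT x:A \<inter> B|lebesgue. d x) = 0" if "A \<in> sets borel" for A
  proof -
    have P: "range (\<lambda>(u, v). box u v :: 'a set) \<subseteq> Pow UNIV" by simp
    show ?thesis
      using stab P that[folded bor]
    proof (induction A rule: sigma_sets_induct_disjoint)
    case (basic A)
    then obtain u v where A: "A = box u v" by auto
    have "\<exists>u v. A \<inter> B = box u v" by (auto simp: A B_def box_Int_box)
    then obtain u' v' where "A \<inter> B = box u' v'" by blast
    then show ?case using zB[of u' v'] by auto
  next
    case empty
    show ?case by (simp add: set_lebesgue_integral_def)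
  next
    case (compl A)
    have Am: "A \<in> sets lebesgue" using compl(1) by (simp add: bor)
    have "(LINT x:(A \<inter> B) \<union> ((UNIV - A) \<inter> B)|lebesgue. d x)
      = (LINT x:A \<inter> B|lebesgue. d x) + (LINT x:(UNIV - A) \<inter> B|lebesgue. d x)"
      using Am by (intro set_integral_Un si) auto
    moreover have "(A \<inter> B) \<union> ((UNIV - A) \<inter> B) = B" by auto
    ultimately show ?case using compl zB[of a b] by (simp add: B_def)
  next
    case (union A)
    have Am: "A i \<in> sets lebesgue" for i using union(2) by (auto simp: bor)
    have eq: "(\<Union>i. A i) \<inter> B = (\<Union>i. A i \<inter> B)" by auto
    have "(LINT x:(\<Union>i. A i \<inter> B)|lebesgue. d x) = (\<Sum>i. (LINT x:A i \<inter> B|lebesgue. d x))"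
    proof (rule lebesgue_integral_countable_add)
      show "A i \<inter> B \<in> sets lebesgue" for i using Am Bm by auto
      show "(A i \<inter> B) \<inter> (A j \<inter> B) = {}" if "i \<noteq> j" for i j
        using union(1) that by (auto simp: disjoint_family_on_def)
      show "set_integrable lebesgue (\<Union>i. A i \<inter> B) d"
        unfolding eq[symmetric] by (rule si) (use Am in auto)
    qed
    then show ?case unfolding eq union(3) by (simp only: suminf_zero)
  qed
  qed
  have leb0: "(LINT x:A \<inter> B|lebesgue. d x) = 0" if A: "A \<in> sets lebesgue" for A
  proof -
    define S where "S = main_part lborel A"
    obtain N' where "null_part lborel A \<subseteq> N'" and N': "N' \<in> null_sets lborel"
      using null_part[OF A] by blast
    then have S: "A = S \<union> null_part lborel A" "null_part lborel A \<subseteq> N'" "N' \<in> null_sets lborel" "S \<in> sets lborel"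
      using main_part_null_part_Un[OF A] main_part_sets[OF A] by (auto simp: S_def)
    have "AE x in lborel. x \<notin> N'" by (rule AE_not_in[OF S(3)])
    then have "AE x in lebesgue. x \<notin> N'" by (rule AE_completion)
    then have ae: "AE x in lebesgue. indicator (A \<inter> B) x *\<^sub>R d x = indicator (S \<inter> B) x *\<^sub>R d x"
      by eventually_elim (use S(1,2) in \<open>auto simp: indicator_def\<close>)
    have "(LINT x:A \<inter> B|lebesgue. d x) = (LINT x:S \<inter> B|lebesgue. d x)"
      unfolding set_lebesgue_integral_def
      using si[OF A] si[of S] S(4)
      by (intro integral_cong_AE ae) (auto simp: set_integrable_def)
    then show ?thesis using borel0[of S] S(4) by simp
  qed
  have "AE x in lebesgue_on B. d x = 0"
  proof (rule sigma_finite_measure.density_zero)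
    have "finite_measure (lebesgue_on B)"
      by (rule finite_measure_lebesgue_on) (simp add: B_def)
    then show "sigma_finite_measure (lebesgue_on B)"
      by (rule finite_measure.axioms(1))
    show "integrable (lebesgue_on B) d"
      using int Bm by (subst integrable_restrict_space) (auto simp: set_integrable_def B_def)
    fix A assume "A \<in> sets (lebesgue_on B)"
    then have A: "A \<in> sets lebesgue" using Bm by (simp add: sets_restrict_space_iff)
    have "set_lebesgue_integral (lebesgue_on B) A d = (\<integral>x. indicator B x *\<^sub>R indicator A x *\<^sub>R d x \<partial>lebesgue)"
      unfolding set_lebesgue_integral_def using Bm by (subst integral_restrict_space) auto
    also have "(\<lambda>x. indicator B x *\<^sub>R indicator A x *\<^sub>R d x) = (\<lambda>x. indicator (A \<inter> B) x *\<^sub>R d x)"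
      by (auto simp: indicator_def fun_eq_iff)
    finally show "set_lebesgue_integral (lebesgue_on B) A d = 0"
      using leb0[OF A] by (simp add: set_lebesgue_integral_def)
  qed
  then show ?thesis using Bm by (subst (asm) AE_restrict_space_iff) (auto simp: B_def)
qed

lemma H1_grad_by_parts:
  assumes "H1_grad U f g" "C1_grad \<psi> D\<psi>" "compact (closure {x. \<psi> x \<noteq> 0})" "closure {x. \<psi> x \<noteq> 0} \<subseteq> U"
  shows "(LINT x:U|lebesgue. f x *\<^sub>R D\<psi> x) = - (LINT x:U|lebesgue. \<psi> x *\<^sub>R g x)"
  using assms unfolding H1_grad_def by blast

text \<open>The difference of two weak gradients integrates to zero against every test function,
  hence over boxes whose closure lies in U, hence vanishes a.e. on each of them; countably many
  cover U.\<close>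

lemma H1_grad_unique:
  fixes U :: "'a::euclidean_space set"
  assumes U: "open U" and g1: "H1_grad U f g1" and g2: "H1_grad U f g2"
  shows "AE x in lebesgue_on U. g1 x = g2 x"
proof -
  have Um: "U \<in> sets lebesgue" using U by auto
  define d where "d x = g1 x - g2 x" for x
  have L: "L2_on U g1" "L2_on U g2" using g1 g2 by (auto simp: H1_grad_def)
  have Ld: "L2_on U d" unfolding d_def by (rule L2_on_diff[OF L Um])
  have test: "(LINT x:U|lebesgue. \<psi> x *\<^sub>R d x) = 0"
    if \<psi>: "C1_grad \<psi> D\<psi>" and C: "compact (closure {x. \<psi> x \<noteq> 0})" "closure {x. \<psi> x \<noteq> 0} \<subseteq> U" for \<psi> D\<psi>
  proof -
    have 0: "\<psi> x = 0" if "x \<notin> closure {x. \<psi> x \<noteq> 0}" for x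
      using that closure_subset[of "{x. \<psi> x \<noteq> 0}"] by auto
    have L\<psi>: "L2_on U \<psi>" by (rule L2_on_bounded_borel_support[OF C1_gradD(3)[OF \<psi>] C(1) 0 Um])
    note [measurable] = L2_onD(1)[OF L\<psi>] L2_onD(1)[OF L(1)] L2_onD(1)[OF L(2)]
    have i: "integrable (lebesgue_on U) (\<lambda>x. \<psi> x *\<^sub>R g1 x)" "integrable (lebesgue_on U) (\<lambda>x. \<psi> x *\<^sub>R g2 x)"
      by (rule L2_product_integrable(1)[OF L\<psi> L(1)], auto)
         (rule L2_product_integrable(1)[OF L\<psi> L(2)], auto)
    have "- (LINT x:U|lebesgue. \<psi> x *\<^sub>R g1 x) = - (LINT x:U|lebesgue. \<psi> x *\<^sub>R g2 x)"
      using H1_grad_by_parts[OF g1 \<psi> C] H1_grad_by_parts[OF g2 \<psi> C] by simp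
    then show ?thesis using i by (simp add: set_integral_lebesgue_on[OF Um] d_def scaleR_diff_right)
  qed
  have cb: "AE x in lebesgue. x \<in> cbox a b \<longrightarrow> d x = 0" if ab: "cbox a b \<subseteq> U" for a b
  proof -
    \<comment> \<open>The argument works on open boxes while the countable cover consists of closed
      ones; the difference is a null set.\<close>
    have "negligible (cbox a b - box a b)"
      using negligible_frontier_interval by blast
    then have n: "AE x in lebesgue. x \<notin> cbox a b - box a b"
      by (intro AE_not_in) (simp add: negligible_iff_null_sets)
    have 1: "AE x in lebesgue. x \<in> box a b \<longrightarrow> d x = 0"
    proof (rule AE_zero_of_box_integrals)
      have Lc: "L2_on (box a b) d"
      proof -
        have "(\<lambda>x. indicator (box a b) x *\<^sub>R (norm (d x))\<^sup>2) = (\<lambda>x. indicator (box a b) x *\<^sub>R (indicator U x *\<^sub>R (norm (d x))\<^sup>2))"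
          using ab box_subset_cbox[of a b] by (auto simp: indicator_def fun_eq_iff)
        moreover have "integrable lebesgue (\<lambda>x. indicator U x *\<^sub>R (norm (d x))\<^sup>2)"
          using L2_onD(2)[OF Ld] Um by (subst (asm) integrable_restrict_space) auto
        then have "integrable lebesgue (\<lambda>x. indicator (box a b) x *\<^sub>R (indicator U x *\<^sub>R (norm (d x))\<^sup>2))"
          by (rule integrable_mult_indicator[rotated]) auto
        ultimately have "integrable (lebesgue_on (box a b)) (\<lambda>x. (norm (d x))\<^sup>2)"
          by (subst integrable_restrict_space) auto
        moreover have "d \<in> borel_measurable (lebesgue_on (box a b))"
          by (rule measurable_restrict_mono[OF L2_onD(1)[OF Ld]])
             (rule order_trans[OF box_subset_cbox ab])
        ultimately show ?thesis by (simp add: L2_on_def)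
      qed
      have L1: "L2_on (box a b) (\<lambda>_. 1::real)" by (rule L2_on_bounded[of _ _ 1]) auto
      have "integrable (lebesgue_on (box a b)) d"
        by (rule L2_product_integrable(1)[OF L1 Lc]) (use L2_onD(1)[OF Lc] in auto)
      then show "set_integrable lebesgue (box a b) d"
        by (subst (asm) integrable_restrict_space) (auto simp: set_integrable_def)
      fix u v assume uv: "box u v \<noteq> {}" "box u v \<subseteq> box a b"
      have "cbox u v \<subseteq> cbox a b"
      proof -
        have "box a b \<noteq> {}" using uv by blast
        then show ?thesis using closure_mono[OF uv(2)] unfolding closure_box[OF uv(1)] by (metis closure_box)
      qed
      then show "(LINT x:box u v|lebesgue. d x) = 0"
        using ab uv by (intro test_function_box_integral[OF Um Ld test]) auto
    qed
    show ?thesis using 1 n by eventually_elim auto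
  qed
  obtain \<D> where \<D>: "countable \<D>" "\<D> \<subseteq> Pow U" "\<And>X. X \<in> \<D> \<Longrightarrow> \<exists>a b. X = cbox a b" "\<Union>\<D> = U"
    using open_countable_Union_open_cbox[OF U] by metis
  have "AE x in lebesgue. \<forall>X\<in>\<D>. x \<in> X \<longrightarrow> d x = 0"
  proof (rule AE_ball_countable'[OF _ \<D>(1)])
    fix X assume "X \<in> \<D>"
    then obtain a b where "X = cbox a b" "cbox a b \<subseteq> U" using \<D> by blast
    then show "AE x in lebesgue. x \<in> X \<longrightarrow> d x = 0" using cb by simp
  qed
  then have "AE x in lebesgue. x \<in> U \<longrightarrow> g1 x = g2 x"
    by eventually_elim (use \<D>(4) in \<open>auto simp: d_def\<close>)
  then show ?thesis using Um by (subst AE_restrict_space_iff) auto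
qed

lemma weak_grad_H1:
  assumes "f \<in> H1 U"
  shows "H1_grad U f (weak_grad U f)"
proof -
  have "\<exists>g. H1_grad U f g" using assms by (simp add: H1_def)
  then show ?thesis unfolding weak_grad_def by (rule someI_ex)
qed

text \<open>\<open>weak_grad\<close> is an arbitrary choice; this is the way to replace it by a
  gradient known explicitly.\<close>

lemma weak_grad_AE:
  assumes "open U" "H1_grad U f g"
  shows "AE x in lebesgue_on U. weak_grad U f x = g x"
proof -
  have "f \<in> H1 U" using assms(2) by (auto simp: H1_def)
  from H1_grad_unique[OF assms(1) weak_grad_H1[OF this] assms(2)] show ?thesis .
qed

lemma C1_grad_add:
  assumes u: "C1_grad u Du" and v: "C1_grad v Dv"
  shows "C1_grad (\<lambda>x. u x + v x) (\<lambda>x. Du x + Dv x)"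
proof (rule C1_gradI)
  fix x
  show "((\<lambda>x. u x + v x) has_derivative (\<lambda>h. (Du x + Dv x) \<bullet> h)) (at x)"
    by (rule has_derivative_eq_rhs[OF has_derivative_add[OF C1_gradD(1)[OF u] C1_gradD(1)[OF v]]])
       (simp add: inner_add_left)
  show "continuous_on UNIV (\<lambda>x. Du x + Dv x)"
    by (intro continuous_intros C1_gradD[OF u] C1_gradD[OF v])
qed

lemma C1_grad_cmult:
  assumes u: "C1_grad u Du"
  shows "C1_grad (\<lambda>x. c * u x) (\<lambda>x. c *\<^sub>R Du x)"
proof (rule C1_gradI)
  fix x
  show "((\<lambda>x. c * u x) has_derivative (\<lambda>h. (c *\<^sub>R Du x) \<bullet> h)) (at x)"
    by (rule has_derivative_eq_rhs[OF has_derivative_mult_right[OF C1_gradD(1)[OF u]]]) simp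
  show "continuous_on UNIV (\<lambda>x. c *\<^sub>R Du x)"
    by (intro continuous_intros C1_gradD[OF u])
qed

lemma C1_grad_diff:
  assumes u: "C1_grad u Du" and v: "C1_grad v Dv"
  shows "C1_grad (\<lambda>x. u x - v x) (\<lambda>x. Du x - Dv x)"
  using C1_grad_add[OF u C1_grad_cmult[OF v, of "-1"]] by simp

lemma C1_grad_snd: "C1_grad (\<lambda>x::'m::finite point. snd x) (\<lambda>_. (0, 1))"
  by (rule C1_gradI) (auto intro!: derivative_eq_intros simp: inner_prod_def)

section \<open>Limits and completeness in L^2\<close>

lemma L2_norm_tendsto:
  assumes f: "L2_on U f" and m: "\<And>k. u k \<in> borel_measurable (lebesgue_on U)"
    and lim: "(\<lambda>k. L2_dist2 U (u k) f) \<longlonglongrightarrow> 0"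
  shows "(\<lambda>k. \<integral>x. (norm (u k x))\<^sup>2 \<partial>lebesgue_on U) \<longlonglongrightarrow> (\<integral>x. (norm (f x))\<^sup>2 \<partial>lebesgue_on U)"
proof -
  note t = L2_dist2_tendsto[OF f m lim]
  define A where "A = (\<integral>x. (norm (f x))\<^sup>2 \<partial>lebesgue_on U)"
  define d where "d k = (\<integral>x. (norm (u k x - f x))\<^sup>2 \<partial>lebesgue_on U)" for k
  \<comment> \<open>The cross term in the expansion of |u|^2 around f; Cauchy-Schwarz sends it to
    zero.\<close>
  define c where "c k = (\<integral>x. f x \<bullet> (u k x - f x) \<partial>lebesgue_on U)" for k
  have c0: "c \<longlonglongrightarrow> 0"
  proof (rule Lim_null_comparison)
    show "eventually (\<lambda>k. norm (c k) \<le> sqrt A * sqrt (d k)) sequentially"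
      using t(1)
    proof eventually_elim
      case (elim k)
      then show ?case unfolding c_def A_def d_def real_norm_def
        by (intro L2_inner_integrable(2)[OF f]) blast
    qed
    show "(\<lambda>k. sqrt A * sqrt (d k)) \<longlonglongrightarrow> 0"
      using tendsto_mult_left[OF tendsto_real_sqrt[OF t(2)], of "sqrt A"] by (simp add: d_def)
  qed
  have "(\<lambda>k. A + 2 * c k + d k) \<longlonglongrightarrow> A + 2 * 0 + 0"
    using t(2) unfolding d_def[symmetric] by (intro tendsto_intros c0)
  moreover have "eventually (\<lambda>k. A + 2 * c k + d k = (\<integral>x. (norm (u k x))\<^sup>2 \<partial>lebesgue_on U)) sequentially"
    using t(1)
  proof eventually_elim
    case (elim k)
    have L: "L2_on U (\<lambda>x. u k x - f x)" using elim by blast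
    have "(\<integral>x. (norm (u k x))\<^sup>2 \<partial>lebesgue_on U)
      = (\<integral>x. (norm (f x))\<^sup>2 + 2 * (f x \<bullet> (u k x - f x)) + (norm (u k x - f x))\<^sup>2 \<partial>lebesgue_on U)"
      by (intro Bochner_Integration.integral_cong refl)
         (simp add: power2_norm_eq_inner inner_diff_left inner_diff_right inner_commute)
    also have "\<dots> = A + 2 * c k + d k"
      using L2_onD(2)[OF f] L2_onD(2)[OF L] L2_inner_integrable(1)[OF f L]
      by (simp add: A_def c_def d_def)
    finally show ?case by simp
  qed
  ultimately have "(\<lambda>k. \<integral>x. (norm (u k x))\<^sup>2 \<partial>lebesgue_on U) \<longlonglongrightarrow> A + 2 * 0 + 0"
    by (rule Lim_transform_eventually)
  then show ?thesis by (simp add: A_def)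
qed

lemma L2_dist2_cong_AE:
  assumes "AE x in lebesgue_on U. g x = g' x"
  shows "L2_dist2 U f g = L2_dist2 U f g'"
  unfolding L2_dist2_def using assms by (intro nn_integral_cong_AE) auto

lemma L2_dist2_commute: "L2_dist2 U f g = L2_dist2 U g f"
  by (simp add: L2_dist2_def norm_minus_commute)

lemma L2_dist2_triangle:
  assumes "f \<in> borel_measurable (lebesgue_on U)" "g \<in> borel_measurable (lebesgue_on U)"
    "h \<in> borel_measurable (lebesgue_on U)"
  shows "L2_dist2 U f h \<le> 2 * L2_dist2 U f g + 2 * L2_dist2 U h g"
proof -
  have "L2_dist2 U f h = L2_dist2 U (\<lambda>x. f x + g x) (\<lambda>x. g x + h x)"
    by (simp add: L2_dist2_def add.commute)
  also have "\<dots> \<le> 2 * L2_dist2 U f g + 2 * L2_dist2 U g h"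
    using assms by (intro L2_dist2_add)
  finally show ?thesis by (simp add: L2_dist2_commute[of U g h])
qed

text \<open>Riesz-Fischer, needed to produce traces. A subsequence along which \<open>d\<close> is
  below 4^(-j) has successive differences summable a.e., and Fatou's lemma makes its pointwise limit
  the L^2 limit of the full sequence. The Cauchy condition has the form in which the trace estimate
  delivers it.\<close>

lemma L2_complete:
  fixes v :: "nat \<Rightarrow> 'a::euclidean_space \<Rightarrow> real"
  assumes U: "U \<in> lmeasurable" and v: "\<And>k. L2_on U (v k)"
    and cauchy: "\<And>k l. L2_dist2 U (v k) (v l) \<le> d k + d l" and d: "d \<longlonglongrightarrow> 0"
  shows "\<exists>\<tau>. L2_on U \<tau> \<and> (\<lambda>k. L2_dist2 U (v k) \<tau>) \<longlonglongrightarrow> 0"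
proof -
  define M where "M = lebesgue_on U"
  have vm[measurable]: "v k \<in> borel_measurable M" for k using L2_onD(1)[OF v] by (simp add: M_def)
  have "\<exists>N. \<forall>k\<ge>N. d k \<le> ennreal ((1 / 4) ^ j)" for j :: nat
  proof -
    have "eventually (\<lambda>k. d k < ennreal ((1 / 4) ^ j)) sequentially"
      by (rule order_tendstoD(2)[OF d]) simp
    then show ?thesis unfolding eventually_sequentially using less_imp_le by blast
  qed
  then obtain N where N: "\<And>j k. k \<ge> N j \<Longrightarrow> d k \<le> ennreal ((1 / 4) ^ j)" by metis
  \<comment> \<open>The maximum makes \<open>r\<close> nondecreasing, so \<open>r (Suc j)\<close> is
    also beyond \<open>N j\<close> and consecutive terms can be compared.\<close>
  define r where "r j = Max (N ` {..j})" for j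
  have rN: "N j \<le> r j" for j unfolding r_def by (rule Max_ge) auto
  have rmono: "r j \<le> r (Suc j)" for j unfolding r_def by (rule Max_mono) auto
  have rN': "N j \<le> r (Suc j)" for j using rN[of j] rmono[of j] by simp
  define w where "w j = v (r j)" for j
  have wm[measurable]: "w j \<in> borel_measurable M" for j unfolding w_def by (rule vm)
  have step: "(\<integral>\<^sup>+x. ennreal \<bar>w (Suc j) x - w j x\<bar> \<partial>M) \<le> ennreal ((1 / 2) ^ j) * (2 + emeasure M (space M))" for j
  proof -
    have "(\<integral>\<^sup>+x. ennreal \<bar>w (Suc j) x - w j x\<bar> \<partial>M)
      \<le> (\<integral>\<^sup>+x. ennreal (2 ^ j) * ennreal ((norm (w (Suc j) x - w j x))\<^sup>2) + ennreal ((1 / 2) ^ j) \<partial>M)"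
    proof (rule nn_integral_mono)
      fix x
      define a where "a = \<bar>w (Suc j) x - w j x\<bar>"
      define s where "s = (2::real) ^ j"
      have s: "s > 0" by (simp add: s_def)
      \<comment> \<open>With s = 2^j this is a \<le> 2^j a^2 + 2^(-j): on a set of finite measure,
        squared distances of order 4^(-j) then bound the first-power integrals by a multiple of
        2^(-j).\<close>
      have "0 \<le> (s * a - 1)\<^sup>2 + s * a" using s by (simp add: a_def)
      then have "s * a \<le> s * (s * a\<^sup>2) + 1" by (simp add: power2_eq_square algebra_simps)
      then have "a \<le> s * a\<^sup>2 + 1 / s" using s by (simp add: field_simps)
      moreover have "1 / s = (1 / 2) ^ j" by (simp add: s_def power_one_over)
      ultimately have "ennreal a \<le> ennreal (s * a\<^sup>2 + (1 / 2) ^ j)" by (simp add: ennreal_leI)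
      also have "\<dots> = ennreal s * ennreal (a\<^sup>2) + ennreal ((1 / 2) ^ j)"
        using s by (simp add: ennreal_mult')
      finally show "ennreal \<bar>w (Suc j) x - w j x\<bar>
        \<le> ennreal (2 ^ j) * ennreal ((norm (w (Suc j) x - w j x))\<^sup>2) + ennreal ((1 / 2) ^ j)"
        by (simp add: a_def s_def)
    qed
    also have "\<dots> = ennreal (2 ^ j) * L2_dist2 U (w (Suc j)) (w j) + ennreal ((1 / 2) ^ j) * emeasure M (space M)"
      unfolding L2_dist2_def M_def[symmetric]
      by (subst nn_integral_add) (simp_all add: nn_integral_cmult)
    also have "\<dots> \<le> ennreal (2 ^ j) * (ennreal ((1 / 4) ^ j) + ennreal ((1 / 4) ^ j)) + ennreal ((1 / 2) ^ j) * emeasure M (space M)"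
      unfolding w_def
      by (intro add_right_mono mult_left_mono order_trans[OF cauchy] add_mono N rN rN' zero_le)
    also have "ennreal (2 ^ j) * (ennreal ((1 / 4) ^ j) + ennreal ((1 / 4) ^ j)) = ennreal ((1 / 2) ^ j) * 2"
    proof -
      have "(2::real) ^ j * (2 * (1 / 4) ^ j) = (1 / 2) ^ j * 2"
        by (simp add: power_mult_distrib[symmetric] mult.left_commute)
      then have "ennreal (2 ^ j * (2 * (1 / 4) ^ j)) = ennreal ((1 / 2) ^ j * 2)" by simp
      then show ?thesis by (simp add: ennreal_mult' mult_2[symmetric] ennreal_mult''[of 2])
    qed
    finally show ?thesis by (simp add: distrib_left)
  qed
  have fin: "emeasure M (space M) < \<infinity>"
    using finite_measure.emeasure_finite[OF finite_measure_lebesgue_on[OF U]] by (simp add: M_def less_top)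
  have "(\<integral>\<^sup>+x. (\<Sum>j. ennreal \<bar>w (Suc j) x - w j x\<bar>) \<partial>M) = (\<Sum>j. \<integral>\<^sup>+x. ennreal \<bar>w (Suc j) x - w j x\<bar> \<partial>M)"
    by (rule nn_integral_suminf) measurable
  also have "\<dots> \<le> (\<Sum>j. ennreal ((1 / 2) ^ j) * (2 + emeasure M (space M)))"
    by (intro suminf_le step) auto
  also have "\<dots> = (\<Sum>j. ennreal ((1 / 2) ^ j)) * (2 + emeasure M (space M))"
    by (rule ennreal_suminf_multc)
  also have "(\<Sum>j. ennreal ((1 / 2) ^ j)) = ennreal 2"
    by (subst suminf_ennreal2) (auto simp: suminf_geometric)
  also have "ennreal 2 * (2 + emeasure M (space M)) < \<infinity>"
    using fin by (simp add: ennreal_mult_less_top)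
  finally have "(\<integral>\<^sup>+x. (\<Sum>j. ennreal \<bar>w (Suc j) x - w j x\<bar>) \<partial>M) \<noteq> \<infinity>" by simp
  then have "AE x in M. (\<Sum>j. ennreal \<bar>w (Suc j) x - w j x\<bar>) \<noteq> \<infinity>"
    by (intro nn_integral_noteq_infinite) measurable
  then have conv: "AE x in M. convergent (\<lambda>j. w j x)"
  proof eventually_elim
    case (elim x)
    have "summable (\<lambda>j. \<bar>w (Suc j) x - w j x\<bar>)"
      by (rule summable_suminf_not_top) (use elim in auto)
    then have "summable (\<lambda>j. w (Suc j) x - w j x)" by (rule summable_rabs_cancel)
    then have "convergent (\<lambda>n. \<Sum>j<n. w (Suc j) x - w j x)" by (simp add: summable_iff_convergent)
    then have "convergent (\<lambda>n. w n x - w 0 x)"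
      using sum_lessThan_telescope[of "\<lambda>j. w j x"] by (simp only:)
    then have "convergent (\<lambda>n. (w n x - w 0 x) + w 0 x)" by (intro convergent_add convergent_const)
    then show ?case by simp
  qed
  \<comment> \<open>\<open>lim\<close> is total, hence \<open>\<tau>\<close> is measurable
    everywhere; its value matters only where the subsequence converges.\<close>
  define \<tau> where "\<tau> x = lim (\<lambda>j. w j x)" for x
  have \<tau>m[measurable]: "\<tau> \<in> borel_measurable M" unfolding \<tau>_def by measurable
  have le: "L2_dist2 U (v k) \<tau> \<le> d k" for k
  proof -
    have "L2_dist2 U (v k) \<tau> = (\<integral>\<^sup>+x. liminf (\<lambda>j. ennreal ((norm (v k x - w j x))\<^sup>2)) \<partial>M)"
      unfolding L2_dist2_def M_def[symmetric]
    proof (rule nn_integral_cong_AE)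
      show "AE x in M. ennreal ((norm (v k x - \<tau> x))\<^sup>2) = liminf (\<lambda>j. ennreal ((norm (v k x - w j x))\<^sup>2))"
        using conv
      proof eventually_elim
        case (elim x)
        then have "(\<lambda>j. w j x) \<longlonglongrightarrow> \<tau> x" by (simp add: \<tau>_def convergent_LIMSEQ_iff)
        then have "(\<lambda>j. ennreal ((norm (v k x - w j x))\<^sup>2)) \<longlonglongrightarrow> ennreal ((norm (v k x - \<tau> x))\<^sup>2)"
          by (intro tendsto_ennrealI tendsto_intros)
        then show ?case by (intro lim_imp_Liminf[symmetric]) auto
      qed
    qed
    \<comment> \<open>Fatou along the subsequence with \<open>k\<close> fixed, so that the limit
      inherits the bound \<open>d k\<close> itself.\<close>
    also have "\<dots> \<le> liminf (\<lambda>j. \<integral>\<^sup>+x. ennreal ((norm (v k x - w j x))\<^sup>2) \<partial>M)"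
      by (rule nn_integral_liminf) measurable
    also have "\<dots> \<le> liminf (\<lambda>j. d k + ennreal ((1 / 4) ^ j))"
    proof (intro Liminf_mono always_eventually allI)
      fix j
      have "(\<integral>\<^sup>+x. ennreal ((norm (v k x - w j x))\<^sup>2) \<partial>M) \<le> d k + d (r j)"
        using cauchy[of k "r j"] by (simp add: L2_dist2_def M_def w_def)
      also have "\<dots> \<le> d k + ennreal ((1 / 4) ^ j)" by (intro add_left_mono N rN)
      finally show "(\<integral>\<^sup>+x. ennreal ((norm (v k x - w j x))\<^sup>2) \<partial>M) \<le> d k + ennreal ((1 / 4) ^ j)" .
    qed
    also have "\<dots> = d k + ennreal 0"
      by (intro lim_imp_Liminf tendsto_add tendsto_const tendsto_ennrealI LIMSEQ_realpow_zero) auto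
    finally show ?thesis by simp
  qed
  have lim: "(\<lambda>k. L2_dist2 U (v k) \<tau>) \<longlonglongrightarrow> 0"
    by (rule tendsto_sandwich[OF _ _ tendsto_const d]) (auto simp: le)
  have "eventually (\<lambda>k. L2_dist2 U (v k) \<tau> < \<infinity>) sequentially"
    using order_tendstoD(2)[OF lim, of \<infinity>] by simp
  then obtain k where "L2_dist2 U (v k) \<tau> < \<infinity>"
    using eventually_happens'[OF sequentially_bot] by blast
  then have "L2_on U \<tau>"
    by (intro L2_on_of_dist2(2)[OF _ v[of k]]) (use \<tau>m in \<open>auto simp: M_def L2_dist2_commute\<close>)
  then show ?thesis using lim by blast
qed

section \<open>Functions on the truncated nozzle\<close>

context nozzle_chart begin

lemma trunc_eq: "trunc \<Omega> L = section_between \<Omega> (- L) L"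
  by (auto simp: trunc_def section_between_def)

lemma section_bounded:
  assumes "x \<in> section_between \<Omega> a b"
  shows "norm x \<le> K + \<bar>a\<bar> + \<bar>b\<bar>"
proof -
  have x: "x \<in> \<Omega>" "a < snd x" "snd x < b" using assms by (auto simp: section_between_def)
  have "norm (fst (S (T x))) \<le> K" using T_props[OF x(1)] by (intro S_bound) blast
  then have "norm (fst x) \<le> K" using T_props[OF x(1)] by simp
  moreover have "norm x \<le> norm (fst x) + norm (snd x)" by (metis norm_Pair_le prod.collapse)
  ultimately show ?thesis using x by simp
qed

lemma open_trunc: "open (trunc \<Omega> L)"
  unfolding trunc_eq by (rule open_section)

lemma trunc_sets: "trunc \<Omega> L \<in> sets lebesgue"
  using open_trunc by (simp add: borel_open)

lemma section_lmeasurable: "section_between \<Omega> a b \<in> lmeasurable"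
proof (rule bounded_set_imp_lmeasurable)
  show "bounded (section_between \<Omega> a b)" using section_bounded by (rule boundedI)
qed (use open_section[of a b] in \<open>simp add: borel_open\<close>)

lemma trunc_lmeasurable: "trunc \<Omega> L \<in> lmeasurable"
  unfolding trunc_eq by (rule section_lmeasurable)

lemma slice_bounded: "x \<in> slice \<Omega> t \<Longrightarrow> norm x \<le> K"
  using S_bound[of "T (x, t)"] T_props[of "(x, t)"] by (simp add: slice_def)

lemma slice_lmeasurable: "slice \<Omega> t \<in> lmeasurable"
proof (rule bounded_set_imp_lmeasurable)
  show "bounded (slice \<Omega> t)" using slice_bounded by (rule boundedI)
qed (use open_slice[of t] in \<open>simp add: borel_open\<close>)

lemma slice_sets: "slice \<Omega> t \<in> sets lebesgue"
  using slice_lmeasurable by (rule fmeasurableD)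

lemma trunc_snd_bound: "x \<in> trunc \<Omega> L \<Longrightarrow> snd x \<in> {- L..L}"
  by (auto simp: trunc_def)

lemma slice_restrict_borel:
  assumes "C1_grad u Du"
  shows "(\<lambda>x. u (x, t)) \<in> borel_measurable (lebesgue_on (slice \<Omega> t))"
  by (intro borel_measurable_lebesgue_on borel_measurable_continuous_onI
      continuous_on_compose2[OF C1_gradD(3)[OF assms]] continuous_intros) auto

lemma C1_L2_slice:
  assumes "C1_grad u Du"
  shows "L2_on (slice \<Omega> t) (\<lambda>x. u (x, t))"
proof -
  have "continuous_on (cball 0 K) (\<lambda>x. u (x, t))"
    by (rule continuous_on_compose2[OF C1_gradD(3)[OF assms]]) (auto intro!: continuous_intros)
  then have "bounded ((\<lambda>x. u (x, t)) ` cball 0 K)"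
    by (intro compact_imp_bounded compact_continuous_image) auto
  then obtain B where "\<And>x. x \<in> cball 0 K \<Longrightarrow> norm (u (x, t)) \<le> B"
    unfolding bounded_iff by blast
  then show ?thesis
    by (intro L2_on_bounded[OF slice_lmeasurable slice_restrict_borel[OF assms], of _ B])
       (use slice_bounded in auto)
qed

lemma H_truncE:
  assumes "f \<in> H_trunc \<Omega> L"
  obtains u Du where "\<And>k. C1_grad (u k) (Du k)" "(\<lambda>k. L2_dist2 (trunc \<Omega> L) (u k) f) \<longlonglongrightarrow> 0"
    "(\<lambda>k. L2_dist2 (trunc \<Omega> L) (Du k) (weak_grad (trunc \<Omega> L) f)) \<longlonglongrightarrow> 0"
    "(\<lambda>k. L2_dist2 (slice \<Omega> (- L)) (\<lambda>x'. u k (x', - L)) (\<lambda>_. 0)) \<longlonglongrightarrow> 0"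
proof -
  have "\<exists>u Du. (\<forall>k::nat. C1_grad (u k) (Du k)) \<and>
        (\<lambda>k. L2_dist2 (trunc \<Omega> L) (u k) f) \<longlonglongrightarrow> 0 \<and>
        (\<lambda>k. L2_dist2 (trunc \<Omega> L) (Du k) (weak_grad (trunc \<Omega> L) f)) \<longlonglongrightarrow> 0 \<and>
        (\<lambda>k. L2_dist2 (slice \<Omega> (- L)) (\<lambda>x'. u k (x', - L)) (\<lambda>_. 0)) \<longlonglongrightarrow> 0"
    using assms unfolding H_trunc_def has_trace_def by simp
  then show ?thesis by (elim exE conjE) (rule that; auto)
qed

lemma H_trunc_L2:
  assumes "f \<in> H_trunc \<Omega> L"
  shows "L2_on (trunc \<Omega> L) f" "L2_on (trunc \<Omega> L) (weak_grad (trunc \<Omega> L) f)"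
  using weak_grad_H1[of f "trunc \<Omega> L"] assms by (auto simp: H_trunc_def H1_grad_def)

text \<open>One C^1 sequence converging together with its gradients settles everything: the limit of
  the gradients is the weak gradient up to a null set, and traces are read from the same
  sequence.\<close>

lemma trunc_approxI:
  assumes f: "L2_on (trunc \<Omega> L) f" and g: "L2_on (trunc \<Omega> L) g"
    and u: "\<And>k. C1_grad (u k) (Du k)" and lf: "(\<lambda>k. L2_dist2 (trunc \<Omega> L) (u k) f) \<longlonglongrightarrow> 0"
    and lg: "(\<lambda>k. L2_dist2 (trunc \<Omega> L) (Du k) g) \<longlonglongrightarrow> 0"
  shows "AE x in lebesgue_on (trunc \<Omega> L). weak_grad (trunc \<Omega> L) f x = g x"
    "\<And>t \<tau>. L2_on (slice \<Omega> t) \<tau> \<Longrightarrow> (\<lambda>k. L2_dist2 (slice \<Omega> t) (\<lambda>x'. u k (x', t)) \<tau>) \<longlonglongrightarrow> 0 \<Longrightarrow>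
      has_trace \<Omega> L t f \<tau>"
    "(\<lambda>k. L2_dist2 (slice \<Omega> (- L)) (\<lambda>x'. u k (x', - L)) (\<lambda>_. 0)) \<longlonglongrightarrow> 0 \<Longrightarrow> f \<in> H_trunc \<Omega> L"
proof -
  have h: "H1_grad (trunc \<Omega> L) f g"
    by (rule H1_grad_limit[OF trunc_sets f g u lf lg])
  then have h1: "f \<in> H1 (trunc \<Omega> L)" by (auto simp: H1_def)
  show ae: "AE x in lebesgue_on (trunc \<Omega> L). weak_grad (trunc \<Omega> L) f x = g x"
    by (rule weak_grad_AE[OF open_trunc h])
  have lg': "(\<lambda>k. L2_dist2 (trunc \<Omega> L) (Du k) (weak_grad (trunc \<Omega> L) f)) \<longlonglongrightarrow> 0"
    using lg unfolding L2_dist2_cong_AE[OF ae] .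
  show tr: "has_trace \<Omega> L t f \<tau>" if "L2_on (slice \<Omega> t) \<tau>"
    "(\<lambda>k. L2_dist2 (slice \<Omega> t) (\<lambda>x'. u k (x', t)) \<tau>) \<longlonglongrightarrow> 0" for t \<tau>
    unfolding has_trace_def
    by (intro conjI h1 that exI[of _ u] exI[of _ Du] allI u lf lg')
  assume "(\<lambda>k. L2_dist2 (slice \<Omega> (- L)) (\<lambda>x'. u k (x', - L)) (\<lambda>_. 0)) \<longlonglongrightarrow> 0"
  then have "has_trace \<Omega> L (- L) f (\<lambda>_. 0)"
    by (intro tr) (auto intro!: L2_on_bounded[OF slice_lmeasurable, of _ _ 0])
  then show "f \<in> H_trunc \<Omega> L" using h1 by (simp add: H_trunc_def)
qed

text \<open>Used with c = \<epsilon>^(-2) to put the rescaled difference into the solution space;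
  the same combination of the two approximating sequences gives its gradient and its zero
  trace.\<close>

lemma H_trunc_lincomb:
  assumes f1: "f1 \<in> H_trunc \<Omega> L" and f2: "f2 \<in> H_trunc \<Omega> L"
  shows "(\<lambda>x. c * (f1 x - f2 x)) \<in> H_trunc \<Omega> L"
    "AE x in lebesgue_on (trunc \<Omega> L). weak_grad (trunc \<Omega> L) (\<lambda>x. c * (f1 x - f2 x)) x
      = c *\<^sub>R (weak_grad (trunc \<Omega> L) f1 x - weak_grad (trunc \<Omega> L) f2 x)"
proof -
  define D where "D = trunc \<Omega> L"
  define g1 g2 where "g1 = weak_grad D f1" and "g2 = weak_grad D f2"
  obtain u1 D1 where u1: "\<And>k. C1_grad (u1 k) (D1 k)" "(\<lambda>k. L2_dist2 D (u1 k) f1) \<longlonglongrightarrow> 0"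
    "(\<lambda>k. L2_dist2 D (D1 k) g1) \<longlonglongrightarrow> 0"
    "(\<lambda>k. L2_dist2 (slice \<Omega> (- L)) (\<lambda>x'. u1 k (x', - L)) (\<lambda>_. 0)) \<longlonglongrightarrow> 0"
    using H_truncE[OF f1] unfolding D_def g1_def by metis
  obtain u2 D2 where u2: "\<And>k. C1_grad (u2 k) (D2 k)" "(\<lambda>k. L2_dist2 D (u2 k) f2) \<longlonglongrightarrow> 0"
    "(\<lambda>k. L2_dist2 D (D2 k) g2) \<longlonglongrightarrow> 0"
    "(\<lambda>k. L2_dist2 (slice \<Omega> (- L)) (\<lambda>x'. u2 k (x', - L)) (\<lambda>_. 0)) \<longlonglongrightarrow> 0"
    using H_truncE[OF f2] unfolding D_def g2_def by metis
  have Ds: "D \<in> sets lebesgue" unfolding D_def by (rule trunc_sets)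
  note L1 = H_trunc_L2[OF f1, folded D_def g1_def] and L2 = H_trunc_L2[OF f2, folded D_def g2_def]
  define u where "u k x = c * (u1 k x - u2 k x)" for k x
  define Du where "Du k x = c *\<^sub>R (D1 k x - D2 k x)" for k x
  have C: "C1_grad (u k) (Du k)" for k
    unfolding u_def[abs_def] Du_def[abs_def] by (rule C1_grad_cmult[OF C1_grad_diff[OF u1(1) u2(1)]])
  note m1 = borel_measurable_lebesgue_on[OF C1_grad_borel(1)[OF u1(1)]]
    and m2 = borel_measurable_lebesgue_on[OF C1_grad_borel(1)[OF u2(1)]]
    and n1 = borel_measurable_lebesgue_on[OF C1_grad_borel(2)[OF u1(1)]]
    and n2 = borel_measurable_lebesgue_on[OF C1_grad_borel(2)[OF u2(1)]]
  \<comment> \<open>Proved for arbitrary domains and values, since it is applied to functions, to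
    gradients and to restrictions to the inflow section.\<close>
  have comb: "(\<lambda>k. L2_dist2 W (\<lambda>x. c *\<^sub>R (a k x - b k x)) (\<lambda>x. c *\<^sub>R (a' x - b' x))) \<longlonglongrightarrow> 0"
    if W: "W \<in> sets lebesgue"
      and am: "\<And>k. a k \<in> borel_measurable (lebesgue_on W)" "a' \<in> borel_measurable (lebesgue_on W)"
      and bm: "\<And>k. b k \<in> borel_measurable (lebesgue_on W)" "b' \<in> borel_measurable (lebesgue_on W)"
      and a: "(\<lambda>k. L2_dist2 W (a k) a') \<longlonglongrightarrow> 0" and b: "(\<lambda>k. L2_dist2 W (b k) b') \<longlonglongrightarrow> 0"
    for W :: "'w::euclidean_space set" and a b :: "nat \<Rightarrow> 'w \<Rightarrow> 'v::euclidean_space" and a' b'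
  proof -
    have "(\<lambda>k. L2_dist2 W (\<lambda>x. c *\<^sub>R a k x + (- c) *\<^sub>R b k x) (\<lambda>x. c *\<^sub>R a' x + (- c) *\<^sub>R b' x)) \<longlonglongrightarrow> 0"
    proof (rule L2_dist2_add_tendsto)
      show "(\<lambda>k. L2_dist2 W (\<lambda>x. c *\<^sub>R a k x) (\<lambda>x. c *\<^sub>R a' x)) \<longlonglongrightarrow> 0"
        by (rule L2_dist2_scale_tendsto[OF am W _ a, where B="\<bar>c\<bar>"]) (simp add: scaleR_diff_right[symmetric])
      show "(\<lambda>k. L2_dist2 W (\<lambda>x. (- c) *\<^sub>R b k x) (\<lambda>x. (- c) *\<^sub>R b' x)) \<longlonglongrightarrow> 0"
      proof (rule L2_dist2_scale_tendsto[OF bm W _ b, where B="\<bar>c\<bar>"])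
        fix k x
        have "(- c) *\<^sub>R b k x - (- c) *\<^sub>R b' x = (- c) *\<^sub>R (b k x - b' x)" by (simp add: scaleR_diff_right)
        then show "norm ((- c) *\<^sub>R b k x - (- c) *\<^sub>R b' x) \<le> \<bar>c\<bar> * norm (b k x - b' x)"
          by (simp only: norm_scaleR abs_minus_cancel)
      qed
    qed (use am bm in measurable)
    then show ?thesis by (simp add: scaleR_diff_right)
  qed
  have lu: "(\<lambda>k. L2_dist2 D (u k) (\<lambda>x. c * (f1 x - f2 x))) \<longlonglongrightarrow> 0"
    using comb[OF Ds m1 L2_onD(1)[OF L1(1)] m2 L2_onD(1)[OF L2(1)] u1(2) u2(2)] by (simp add: u_def[abs_def])
  have lDu: "(\<lambda>k. L2_dist2 D (Du k) (\<lambda>x. c *\<^sub>R (g1 x - g2 x))) \<longlonglongrightarrow> 0"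
    using comb[OF Ds n1 L2_onD(1)[OF L1(2)] n2 L2_onD(1)[OF L2(2)] u1(3) u2(3)] by (simp add: Du_def[abs_def])
  have "(\<lambda>k. L2_dist2 (slice \<Omega> (- L)) (\<lambda>x'. c *\<^sub>R (u1 k (x', - L) - u2 k (x', - L))) (\<lambda>x. c *\<^sub>R (0 - 0))) \<longlonglongrightarrow> 0"
    by (rule comb[OF slice_sets slice_restrict_borel[OF u1(1)] _ slice_restrict_borel[OF u2(1)] _ u1(4) u2(4)]) auto
  then have tr: "(\<lambda>k. L2_dist2 (slice \<Omega> (- L)) (\<lambda>x'. u k (x', - L)) (\<lambda>_. 0)) \<longlonglongrightarrow> 0"
    by (simp add: u_def)
  have Lf: "L2_on D (\<lambda>x. c * (f1 x - f2 x))"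
    using L2_on_scale[OF L2_on_diff[OF L1(1) L2(1) Ds] Ds, of c] by simp
  have Lg: "L2_on D (\<lambda>x. c *\<^sub>R (g1 x - g2 x))"
    by (rule L2_on_scale[OF L2_on_diff[OF L1(2) L2(2) Ds] Ds])
  note A = trunc_approxI[OF Lf[unfolded D_def] Lg[unfolded D_def] C lu[unfolded D_def] lDu[unfolded D_def]]
  show "(\<lambda>x. c * (f1 x - f2 x)) \<in> H_trunc \<Omega> L" by (rule A(3)[OF tr])
  show "AE x in lebesgue_on (trunc \<Omega> L). weak_grad (trunc \<Omega> L) (\<lambda>x. c * (f1 x - f2 x)) x
      = c *\<^sub>R (weak_grad (trunc \<Omega> L) f1 x - weak_grad (trunc \<Omega> L) f2 x)"
    using A(1) unfolding g1_def g2_def D_def .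
qed

lemma continuous_bounded_interval:
  fixes f :: "real \<Rightarrow> real"
  assumes "continuous_on UNIV f"
  shows "\<exists>B. \<forall>t\<in>{a..b}. \<bar>f t\<bar> \<le> B"
proof -
  have "bounded (f ` {a..b})"
    by (intro compact_imp_bounded compact_continuous_image continuous_on_subset[OF assms]) auto
  then show ?thesis unfolding bounded_iff by auto
qed

text \<open>The admissible test functions. \<open>\<kappa> (- L) = 0\<close> preserves the zero
  trace at the inflow, where the product with f vanishes already, and \<open>\<zeta> L = 0\<close>
  makes the outflow trace the constant \<open>\<kappa> L\<close>, whatever f does there.\<close>

lemma H_trunc_cutoff:
  assumes f: "f \<in> H_trunc \<Omega> L"
    and z: "\<And>t. (\<zeta> has_real_derivative \<zeta>' t) (at t)" "continuous_on UNIV \<zeta>'"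
    and k: "\<And>t. (\<kappa> has_real_derivative \<kappa>' t) (at t)" "continuous_on UNIV \<kappa>'"
    and ends: "\<kappa> (- L) = 0" "\<zeta> L = 0"
  defines "\<eta> \<equiv> \<lambda>x. \<zeta> (snd x) * f x + \<kappa> (snd x)"
  shows "\<eta> \<in> H_trunc \<Omega> L" "has_trace \<Omega> L L \<eta> (\<lambda>_. \<kappa> L)"
    "AE x in lebesgue_on (trunc \<Omega> L). weak_grad (trunc \<Omega> L) \<eta> x
      = \<zeta> (snd x) *\<^sub>R weak_grad (trunc \<Omega> L) f x + (\<zeta>' (snd x) * f x + \<kappa>' (snd x)) *\<^sub>R (0, 1)"
proof -
  define D where "D = trunc \<Omega> L"
  define g where "g = weak_grad D f"
  obtain u Du where u: "\<And>k. C1_grad (u k) (Du k)" "(\<lambda>k. L2_dist2 D (u k) f) \<longlonglongrightarrow> 0"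
    "(\<lambda>k. L2_dist2 D (Du k) g) \<longlonglongrightarrow> 0"
    "(\<lambda>k. L2_dist2 (slice \<Omega> (- L)) (\<lambda>x'. u k (x', - L)) (\<lambda>_. 0)) \<longlonglongrightarrow> 0"
    using H_truncE[OF f] unfolding D_def g_def by metis
  have Ds: "D \<in> sets lebesgue" and Dl: "D \<in> lmeasurable"
    unfolding D_def by (rule trunc_sets, rule trunc_lmeasurable)
  have snd_D: "snd x \<in> {- L..L}" if "x \<in> D" for x using trunc_snd_bound that unfolding D_def .
  note Lf = H_trunc_L2(1)[OF f, folded D_def] and Lg = H_trunc_L2(2)[OF f, folded D_def, folded g_def]
  have cz: "continuous_on UNIV \<zeta>" using z(1) by (intro DERIV_continuous_on) (auto intro: has_field_derivative_at_within)
  have ck: "continuous_on UNIV \<kappa>" using k(1) by (intro DERIV_continuous_on) (auto intro: has_field_derivative_at_within)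
  have meas: "(\<lambda>x. h (snd x)) \<in> borel_measurable (lebesgue_on D)" if "continuous_on UNIV h" for h :: "real \<Rightarrow> real"
    by (intro borel_measurable_lebesgue_on borel_measurable_continuous_onI
        continuous_on_compose2[OF that] continuous_intros) auto
  obtain B where B: "\<And>t. t \<in> {-L..L} \<Longrightarrow> \<bar>\<zeta> t\<bar> \<le> B" using continuous_bounded_interval[OF cz, of "- L" L] by blast
  obtain B' where B': "\<And>t. t \<in> {-L..L} \<Longrightarrow> \<bar>\<zeta>' t\<bar> \<le> B'" using continuous_bounded_interval[OF z(2), of "- L" L] by blast
  obtain E where E: "\<And>t. t \<in> {-L..L} \<Longrightarrow> \<bar>\<kappa> t\<bar> \<le> E" using continuous_bounded_interval[OF ck, of "- L" L] by blast
  obtain E' where E': "\<And>t. t \<in> {-L..L} \<Longrightarrow> \<bar>\<kappa>' t\<bar> \<le> E'" using continuous_bounded_interval[OF k(2), of "- L" L] by blast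
  note [measurable] = meas[OF cz] meas[OF ck] meas[OF z(2)] meas[OF k(2)] L2_onD(1)[OF Lf] L2_onD(1)[OF Lg]
    borel_measurable_lebesgue_on[OF C1_grad_borel(1)[OF u(1)]]
    borel_measurable_lebesgue_on[OF C1_grad_borel(2)[OF u(1)]]
  define v where "v k x = \<zeta> (snd x) * u k x + \<kappa> (snd x)" for k x
  define G where "G w w' x = \<zeta> (snd x) *\<^sub>R w' x + (\<zeta>' (snd x) * w x + \<kappa>' (snd x)) *\<^sub>R (0, 1)"
    for w and w' :: "'m point \<Rightarrow> 'm point" and x :: "'m point"
  have C: "C1_grad (v k) (G (u k) (Du k))" for k
  proof -
    have "C1_grad (v k) (\<lambda>x. (\<zeta> (snd x) *\<^sub>R Du k x + u k x *\<^sub>R (\<zeta>' (snd x) *\<^sub>R (0, 1))) + \<kappa>' (snd x) *\<^sub>R (0, 1))"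
      unfolding v_def[abs_def]
      by (rule C1_grad_add[OF C1_grad_mult[OF C1_grad_chain[OF C1_grad_snd z] u(1)] C1_grad_chain[OF C1_grad_snd k]])
    moreover have "(\<lambda>x. (\<zeta> (snd x) *\<^sub>R Du k x + u k x *\<^sub>R (\<zeta>' (snd x) *\<^sub>R (0, 1))) + \<kappa>' (snd x) *\<^sub>R (0, 1)) = G (u k) (Du k)"
      by (rule ext) (simp add: G_def algebra_simps)
    ultimately show ?thesis by simp
  qed
  have lv: "(\<lambda>k. L2_dist2 D (v k) \<eta>) \<longlonglongrightarrow> 0"
  proof (rule L2_dist2_scale_tendsto[OF _ _ Ds _ u(2), where B=B])
    fix k x assume "x \<in> D"
    have "v k x - \<eta> x = \<zeta> (snd x) * (u k x - f x)" by (simp add: v_def \<eta>_def algebra_simps)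
    then show "norm (v k x - \<eta> x) \<le> B * norm (u k x - f x)"
      using B[OF snd_D[OF \<open>x \<in> D\<close>]] by (simp add: abs_mult mult_right_mono)
  qed measurable
  have lG: "(\<lambda>k. L2_dist2 D (G (u k) (Du k)) (G f g)) \<longlonglongrightarrow> 0"
    unfolding G_def
  proof (rule L2_dist2_add_tendsto)
    show "(\<lambda>k. L2_dist2 D (\<lambda>x. \<zeta> (snd x) *\<^sub>R Du k x) (\<lambda>x. \<zeta> (snd x) *\<^sub>R g x)) \<longlonglongrightarrow> 0"
    proof (rule L2_dist2_scale_tendsto[OF _ _ Ds _ u(3), where B=B])
      fix k x assume "x \<in> D"
      then show "norm (\<zeta> (snd x) *\<^sub>R Du k x - \<zeta> (snd x) *\<^sub>R g x) \<le> B * norm (Du k x - g x)"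
        using B[OF snd_D[OF \<open>x \<in> D\<close>]] by (simp add: scaleR_diff_right[symmetric] mult_right_mono)
    qed measurable
    show "(\<lambda>k. L2_dist2 D (\<lambda>x. (\<zeta>' (snd x) * u k x + \<kappa>' (snd x)) *\<^sub>R (0, 1))
        (\<lambda>x. (\<zeta>' (snd x) * f x + \<kappa>' (snd x)) *\<^sub>R ((0, 1) :: 'm point))) \<longlonglongrightarrow> 0"
    proof (rule L2_dist2_scale_tendsto[OF _ _ Ds _ u(2), where B=B'])
      fix k x assume "x \<in> D"
      have "(\<zeta>' (snd x) * u k x + \<kappa>' (snd x)) *\<^sub>R (0, 1) - (\<zeta>' (snd x) * f x + \<kappa>' (snd x)) *\<^sub>R ((0, 1) :: 'm point)
        = (\<zeta>' (snd x) * (u k x - f x)) *\<^sub>R (0, 1)"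
        by (simp add: algebra_simps)
      moreover have "norm ((0, 1) :: 'm point) = 1" by (simp add: norm_Pair)
      ultimately show "norm ((\<zeta>' (snd x) * u k x + \<kappa>' (snd x)) *\<^sub>R (0, 1) - (\<zeta>' (snd x) * f x + \<kappa>' (snd x)) *\<^sub>R ((0, 1) :: 'm point))
          \<le> B' * norm (u k x - f x)"
        using B'[OF snd_D[OF \<open>x \<in> D\<close>]] by (simp only: norm_scaleR) (simp add: abs_mult mult_right_mono)
    qed measurable
  qed measurable
  have bd: "L2_on D (\<lambda>x. h (snd x))" if hc: "continuous_on UNIV h" for h :: "real \<Rightarrow> real"
  proof -
    obtain B0 where "\<And>t. t \<in> {-L..L} \<Longrightarrow> \<bar>h t\<bar> \<le> B0" using continuous_bounded_interval[OF hc, of "- L" L] by blast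
    then show ?thesis using snd_D by (intro L2_on_bounded[OF Dl meas[OF hc], of B0]) auto
  qed
  have L\<eta>: "L2_on D \<eta>"
    unfolding \<eta>_def
    using L2_on_add[OF L2_on_bounded_scale[OF Lf meas[OF cz] B[OF snd_D] Ds] bd[OF ck]] by simp
  have LG: "L2_on D (G f g)"
  proof -
    have 1: "L2_on D (\<lambda>x. \<zeta> (snd x) *\<^sub>R g x)" by (rule L2_on_bounded_scale[OF Lg meas[OF cz] B[OF snd_D] Ds])
    have 2: "L2_on D (\<lambda>x. \<zeta>' (snd x) * f x + \<kappa>' (snd x))"
      using L2_on_add[OF L2_on_bounded_scale[OF Lf meas[OF z(2)] B'[OF snd_D] Ds] bd[OF k(2)]] by simp
    show ?thesis unfolding G_def[abs_def] by (rule L2_on_add[OF 1 L2_on_scaleR_right[OF 2]])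
  qed
  note A = trunc_approxI[OF L\<eta>[unfolded D_def] LG[unfolded D_def] C lv[unfolded D_def] lG[unfolded D_def]]
  show "AE x in lebesgue_on (trunc \<Omega> L). weak_grad (trunc \<Omega> L) \<eta> x
      = \<zeta> (snd x) *\<^sub>R weak_grad (trunc \<Omega> L) f x + (\<zeta>' (snd x) * f x + \<kappa>' (snd x)) *\<^sub>R (0, 1)"
    using A(1) unfolding G_def g_def D_def .
  show "\<eta> \<in> H_trunc \<Omega> L"
  proof (rule A(3), rule L2_dist2_scale_tendsto[OF _ _ slice_sets _ u(4), where B="\<bar>\<zeta> (- L)\<bar>"])
    show "norm (v k (x, - L) - 0) \<le> \<bar>\<zeta> (- L)\<bar> * norm (u k (x, - L) - 0)" for k x
      by (simp add: v_def ends abs_mult)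
  qed (auto intro: slice_restrict_borel[OF u(1)])
  show "has_trace \<Omega> L L \<eta> (\<lambda>_. \<kappa> L)"
  proof (rule A(2))
    show "L2_on (slice \<Omega> L) (\<lambda>_. \<kappa> L)" by (rule L2_on_bounded[OF slice_lmeasurable, of _ _ "\<bar>\<kappa> L\<bar>"]) auto
    show "(\<lambda>k. L2_dist2 (slice \<Omega> L) (\<lambda>x'. v k (x', L)) (\<lambda>_. \<kappa> L)) \<longlonglongrightarrow> 0"
      by (simp add: v_def ends L2_dist2_def)
  qed
qed

end

section \<open>Traces and the Poincare inequality in the nozzle\<close>

lemma L2_dist2_lborel:
  assumes "U \<in> sets lebesgue"
  shows "L2_dist2 U f g = (\<integral>\<^sup>+x. ennreal ((norm (f x - g x))\<^sup>2) * indicator U x \<partial>lborel)"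
  unfolding L2_dist2_def using assms
  by (subst nn_integral_restrict_space) (auto simp: nn_integral_completion)

lemma integrable_indicator_mult:
  fixes h :: "'a \<Rightarrow> real"
  assumes "A \<inter> space M \<in> sets M" "integrable M h"
  shows "integrable M (\<lambda>x. indicator A x * h x)"
proof -
  have "integrable M (\<lambda>x. indicator (A \<inter> space M) x *\<^sub>R h x)"
    by (rule integrable_mult_indicator[OF assms])
  also have "?this \<longleftrightarrow> ?thesis"
    by (intro Bochner_Integration.integrable_cong refl) (auto simp: indicator_def)
  finally show ?thesis .
qed

text \<open>Bridge between the C^1 inequalities, stated with nonnegative integrals over the whole
  space, and energies, which are real integrals over the truncated nozzle.\<close>

lemma nn_integral_section_eq:
  fixes h :: "'a::euclidean_space \<Rightarrow> real"
  assumes D: "D \<in> sets lebesgue" and A: "A \<in> sets lebesgue" "A \<subseteq> D"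
    and h: "integrable (lebesgue_on D) h" "\<And>x. 0 \<le> h x"
  shows "(\<integral>\<^sup>+x. ennreal (h x) * indicator A x \<partial>lborel) = ennreal (\<integral>x. indicator A x * h x \<partial>lebesgue_on D)"
proof -
  have AD: "A \<inter> space (lebesgue_on D) \<in> sets (lebesgue_on D)"
    using A D by (auto simp: space_restrict_space sets_restrict_space_iff Int_absorb2)
  have "(\<integral>\<^sup>+x. ennreal (h x) * indicator A x \<partial>lborel) = (\<integral>\<^sup>+x. ennreal (h x) * indicator A x \<partial>lebesgue)"
    by (rule nn_integral_completion[symmetric])
  also have "\<dots> = (\<integral>\<^sup>+x. (ennreal (h x) * indicator A x) * indicator D x \<partial>lebesgue)"
    using A(2) by (intro nn_integral_cong) (auto simp: indicator_def)
  also have "\<dots> = (\<integral>\<^sup>+x. ennreal (h x) * indicator A x \<partial>lebesgue_on D)"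
    using D by (subst nn_integral_restrict_space) auto
  also have "\<dots> = (\<integral>\<^sup>+x. ennreal (indicator A x * h x) \<partial>lebesgue_on D)"
    by (intro nn_integral_cong) (auto simp: indicator_def)
  also have "\<dots> = ennreal (\<integral>x. indicator A x * h x \<partial>lebesgue_on D)"
    by (intro nn_integral_eq_integral integrable_indicator_mult AD h(1)) (auto simp: h(2))
  finally show ?thesis .
qed

context nozzle_chart begin

definition CT :: real where "CT = 4 * Ms * K\<^sup>2 * M"

lemma CT_nonneg: "0 \<le> CT" using Ms_pos M_pos by (simp add: CT_def)

lemma C1_trace_dist:
  assumes u: "C1_grad u Du" and v: "C1_grad v Dv" and "0 < L"
  shows "L2_dist2 (slice \<Omega> L) (\<lambda>x. u (x, L)) (\<lambda>x. v (x, L))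
    \<le> ennreal (2 * Ms * Ms) * L2_dist2 (slice \<Omega> (- L)) (\<lambda>x. u (x, - L)) (\<lambda>x. v (x, - L))
      + ennreal (CT * L) * L2_dist2 (trunc \<Omega> L) Du Dv"
  using C1_trace[OF C1_grad_diff[OF u v] \<open>0 < L\<close>]
  by (simp add: L2_dist2_lborel[OF slice_sets] L2_dist2_lborel[OF trunc_sets, unfolded trunc_eq] trunc_eq CT_def)

text \<open>The C^1 trace estimate applied to differences of approximants shows that their values on
  x_n = L are Cauchy, so a trace exists by completeness. The estimate then passes to the limit,
  where the contribution of x_n = - L disappears. The factor \<open>L\<close> is what makes the
  total energy linear in L.\<close>

lemma H_trunc_trace:
  assumes f: "f \<in> H_trunc \<Omega> L" and "0 < L"
  shows "\<exists>\<tau>. has_trace \<Omega> L L f \<tau> \<and> L2_on (slice \<Omega> L) \<tau> \<and>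
    (\<integral>x. (norm (\<tau> x))\<^sup>2 \<partial>lebesgue_on (slice \<Omega> L))
      \<le> CT * L * (\<integral>x. (norm (weak_grad (trunc \<Omega> L) f x))\<^sup>2 \<partial>lebesgue_on (trunc \<Omega> L))"
proof -
  define D where "D = trunc \<Omega> L"
  define g where "g = weak_grad D f"
  obtain u Du where u: "\<And>k. C1_grad (u k) (Du k)" "(\<lambda>k. L2_dist2 D (u k) f) \<longlonglongrightarrow> 0"
    "(\<lambda>k. L2_dist2 D (Du k) g) \<longlonglongrightarrow> 0"
    "(\<lambda>k. L2_dist2 (slice \<Omega> (- L)) (\<lambda>x'. u k (x', - L)) (\<lambda>_. 0)) \<longlonglongrightarrow> 0"
    using H_truncE[OF f] unfolding D_def g_def by metis
  note Lf = H_trunc_L2(1)[OF f, folded D_def] and Lg = H_trunc_L2(2)[OF f, folded D_def, folded g_def]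
  have Ds: "D \<in> sets lebesgue" unfolding D_def by (rule trunc_sets)
  define c1 where "c1 = 2 * Ms * Ms"
  define c2 where "c2 = CT * L"
  have c: "0 \<le> c1" "0 \<le> c2" using Ms_pos CT_nonneg \<open>0 < L\<close> by (auto simp: c1_def c2_def)
  define e where "e k = L2_dist2 (slice \<Omega> (- L)) (\<lambda>x'. u k (x', - L)) (\<lambda>_. 0)" for k
  define h where "h k = L2_dist2 D (Du k) g" for k
  \<comment> \<open>The factors 2 come from the triangle inequality for squared distances.\<close>
  define d where "d k = ennreal c1 * (2 * e k) + ennreal c2 * (2 * h k)" for k
  have Dum: "Du k \<in> borel_measurable (lebesgue_on D)" for k
    by (rule borel_measurable_lebesgue_on[OF C1_grad_borel(2)[OF u(1)]])
  have d0: "d \<longlonglongrightarrow> 0"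
  proof -
    have "d \<longlonglongrightarrow> ennreal c1 * (2 * 0) + ennreal c2 * (2 * 0)"
      unfolding d_def e_def h_def by (intro tendsto_add ennreal_tendsto_cmult u(3,4)) auto
    then show ?thesis by simp
  qed
  have cauchy: "L2_dist2 (slice \<Omega> L) (\<lambda>x. u k (x, L)) (\<lambda>x. u l (x, L)) \<le> d k + d l" for k l
  proof -
    have 1: "L2_dist2 (slice \<Omega> (- L)) (\<lambda>x. u k (x, - L)) (\<lambda>x. u l (x, - L)) \<le> 2 * e k + 2 * e l"
      unfolding e_def by (rule L2_dist2_triangle) (auto intro: slice_restrict_borel[OF u(1)])
    have 2: "L2_dist2 D (Du k) (Du l) \<le> 2 * h k + 2 * h l"
      unfolding h_def by (rule L2_dist2_triangle[OF Dum L2_onD(1)[OF Lg] Dum])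
    have "L2_dist2 (slice \<Omega> L) (\<lambda>x. u k (x, L)) (\<lambda>x. u l (x, L))
      \<le> ennreal c1 * L2_dist2 (slice \<Omega> (- L)) (\<lambda>x. u k (x, - L)) (\<lambda>x. u l (x, - L))
        + ennreal c2 * L2_dist2 D (Du k) (Du l)"
      unfolding c1_def c2_def D_def by (rule C1_trace_dist[OF u(1) u(1) \<open>0 < L\<close>])
    also have "\<dots> \<le> ennreal c1 * (2 * e k + 2 * e l) + ennreal c2 * (2 * h k + 2 * h l)"
      by (intro add_mono mult_left_mono 1 2 zero_le)
    also have "\<dots> = d k + d l" by (simp add: d_def distrib_left add_ac)
    finally show ?thesis .
  qed
  obtain \<tau> where \<tau>: "L2_on (slice \<Omega> L) \<tau>" "(\<lambda>k. L2_dist2 (slice \<Omega> L) (\<lambda>x. u k (x, L)) \<tau>) \<longlonglongrightarrow> 0"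
    using L2_complete[OF slice_lmeasurable C1_L2_slice[OF u(1)] cauchy d0] by blast
  note A = trunc_approxI[OF Lf[unfolded D_def] Lg[unfolded D_def] u(1) u(2)[unfolded D_def] u(3)[unfolded D_def]]
  have tr: "has_trace \<Omega> L L f \<tau>" by (rule A(2)[OF \<tau>])
  \<comment> \<open>Comparison with the zero function turns the estimate for differences into one
    for \<open>u k\<close> itself.\<close>
  define zz :: "'m point \<Rightarrow> 'm point" where "zz x = 0" for x
  have zC: "C1_grad (\<lambda>_. 0 :: real) zz" unfolding zz_def[abs_def] by (rule C1_gradI) auto
  have lim1: "(\<lambda>k. \<integral>x. (norm (u k (x, L)))\<^sup>2 \<partial>lebesgue_on (slice \<Omega> L)) \<longlonglongrightarrow> (\<integral>x. (norm (\<tau> x))\<^sup>2 \<partial>lebesgue_on (slice \<Omega> L))"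
    by (rule L2_norm_tendsto[OF \<tau>(1) slice_restrict_borel[OF u(1)] \<tau>(2)])
  have L0: "L2_on (slice \<Omega> (- L)) (\<lambda>_. 0 :: real)"
    by (rule L2_on_bounded[OF slice_lmeasurable, of _ _ 0]) auto
  have lim2: "(\<lambda>k. \<integral>x. (norm (u k (x, - L)))\<^sup>2 \<partial>lebesgue_on (slice \<Omega> (- L))) \<longlonglongrightarrow> 0"
    using L2_norm_tendsto[OF L0 slice_restrict_borel[OF u(1)] u(4)] by simp
  have lim3: "(\<lambda>k. \<integral>x. (norm (Du k x))\<^sup>2 \<partial>lebesgue_on D) \<longlonglongrightarrow> (\<integral>x. (norm (g x))\<^sup>2 \<partial>lebesgue_on D)"
    by (rule L2_norm_tendsto[OF Lg Dum u(3)])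
  have "eventually (\<lambda>k. (\<integral>x. (norm (u k (x, L)))\<^sup>2 \<partial>lebesgue_on (slice \<Omega> L))
    \<le> c1 * (\<integral>x. (norm (u k (x, - L)))\<^sup>2 \<partial>lebesgue_on (slice \<Omega> (- L))) + c2 * (\<integral>x. (norm (Du k x))\<^sup>2 \<partial>lebesgue_on D)) sequentially"
    using L2_dist2_tendsto(1)[OF Lg Dum u(3)]
  proof eventually_elim
    case (elim k)
    have e1: "L2_dist2 (slice \<Omega> t) (\<lambda>x. u k (x, t)) (\<lambda>x. 0) = ennreal (\<integral>x. (norm (u k (x, t)))\<^sup>2 \<partial>lebesgue_on (slice \<Omega> t))" for t
      using L2_dist2_eq[of "slice \<Omega> t" "\<lambda>x. u k (x, t)" "\<lambda>_. 0"] C1_L2_slice[OF u(1)[of k], of t] by simp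
    have e2: "L2_dist2 D (Du k) zz = ennreal (\<integral>x. (norm (Du k x))\<^sup>2 \<partial>lebesgue_on D)"
      using L2_dist2_eq[of D "Du k" zz] elim by (simp add: zz_def)
    have "ennreal (\<integral>x. (norm (u k (x, L)))\<^sup>2 \<partial>lebesgue_on (slice \<Omega> L))
      \<le> ennreal c1 * ennreal (\<integral>x. (norm (u k (x, - L)))\<^sup>2 \<partial>lebesgue_on (slice \<Omega> (- L)))
        + ennreal c2 * ennreal (\<integral>x. (norm (Du k x))\<^sup>2 \<partial>lebesgue_on D)"
      using C1_trace_dist[OF u(1)[of k] zC \<open>0 < L\<close>] unfolding e1 e2[unfolded D_def] c1_def c2_def D_def .
    also have "\<dots> = ennreal (c1 * (\<integral>x. (norm (u k (x, - L)))\<^sup>2 \<partial>lebesgue_on (slice \<Omega> (- L))) + c2 * (\<integral>x. (norm (Du k x))\<^sup>2 \<partial>lebesgue_on D))"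
      using c by (simp add: ennreal_mult')
    finally show ?case using c by (subst (asm) ennreal_le_iff) auto
  qed
  moreover have "(\<lambda>k. c1 * (\<integral>x. (norm (u k (x, - L)))\<^sup>2 \<partial>lebesgue_on (slice \<Omega> (- L))) + c2 * (\<integral>x. (norm (Du k x))\<^sup>2 \<partial>lebesgue_on D))
      \<longlonglongrightarrow> c1 * 0 + c2 * (\<integral>x. (norm (g x))\<^sup>2 \<partial>lebesgue_on D)"
    by (intro tendsto_add tendsto_mult_left lim2 lim3)
  ultimately have "(\<integral>x. (norm (\<tau> x))\<^sup>2 \<partial>lebesgue_on (slice \<Omega> L)) \<le> c1 * 0 + c2 * (\<integral>x. (norm (g x))\<^sup>2 \<partial>lebesgue_on D)"
    by (intro tendsto_le[OF sequentially_bot _ lim1])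
  then show ?thesis using tr \<tau>(1) unfolding c2_def g_def D_def by (intro exI[of _ \<tau>]) simp
qed

lemma section_sets: "section_between \<Omega> a b \<in> sets lebesgue"
  by (rule fmeasurableD[OF section_lmeasurable])

text \<open>The slack \<open>\<delta>\<close> allows the constants of a single \<open>C\<^sup>1\<close> approximant to be used for \<open>f\<close> itself.\<close>

lemma trunc_poincare:
  assumes f: "f \<in> H_trunc \<Omega> L" and ab: "a \<le> b" "- L \<le> a - 1" "b + 1 \<le> L" and "0 < \<delta>"
  defines "I \<equiv> \<lambda>A h. \<integral>x. indicator A x * h x \<partial>lebesgue_on (trunc \<Omega> L)"
  defines "e \<equiv> \<lambda>x. (norm (weak_grad (trunc \<Omega> L) f x))\<^sup>2"
  shows "\<exists>c1 c2.
    I (section_between \<Omega> (a - 1) a) (\<lambda>x. (f x - c1)\<^sup>2) \<le> 4 * CP * I (section_between \<Omega> (a - 1) a) e + \<delta> \<and>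
    I (section_between \<Omega> b (b + 1)) (\<lambda>x. (f x - c2)\<^sup>2) \<le> 4 * CP * I (section_between \<Omega> b (b + 1)) e + \<delta> \<and>
    (c2 - c1)\<^sup>2 \<le> CD * (b - a + 1) * (2 * I (section_between \<Omega> (a - 1) (b + 1)) e + \<delta>)"
proof -
  define D where "D = trunc \<Omega> L"
  define g where "g = weak_grad D f"
  obtain u Du where u: "\<And>k. C1_grad (u k) (Du k)" "(\<lambda>k. L2_dist2 D (u k) f) \<longlonglongrightarrow> 0"
    "(\<lambda>k. L2_dist2 D (Du k) g) \<longlonglongrightarrow> 0"
    using H_truncE[OF f] unfolding D_def g_def by metis
  note Lf = H_trunc_L2(1)[OF f, folded D_def] and Lg = H_trunc_L2(2)[OF f, folded D_def, folded g_def]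
  have Ds: "D \<in> sets lebesgue" and Dl: "D \<in> lmeasurable"
    unfolding D_def by (rule trunc_sets, rule trunc_lmeasurable)
  have um: "u k \<in> borel_measurable (lebesgue_on D)" and Dum: "Du k \<in> borel_measurable (lebesgue_on D)" for k
    by (rule borel_measurable_lebesgue_on[OF C1_grad_borel(1)[OF u(1)]],
        rule borel_measurable_lebesgue_on[OF C1_grad_borel(2)[OF u(1)]])
  note tf = L2_dist2_tendsto[OF Lf um u(2)] and tg = L2_dist2_tendsto[OF Lg Dum u(3)]
  \<comment> \<open>The approximation errors add up to 2 \<epsilon> from the values and 4 CP
    \<epsilon> from the gradients.\<close>
  define \<epsilon> where "\<epsilon> = \<delta> / (2 + 4 * CP)"
  have \<epsilon>: "0 < \<epsilon>" "(2 + 4 * CP) * \<epsilon> = \<delta>" using \<open>0 < \<delta>\<close> CP_nonneg by (auto simp: \<epsilon>_def)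
  have CPe: "0 \<le> CP * \<epsilon>" using CP_nonneg \<epsilon> by simp
  have "eventually (\<lambda>k. (L2_on D (u k) \<and> L2_on D (\<lambda>x. u k x - f x)) \<and> (L2_on D (Du k) \<and> L2_on D (\<lambda>x. Du k x - g x)) \<and>
      (\<integral>x. (norm (u k x - f x))\<^sup>2 \<partial>lebesgue_on D) < \<epsilon> \<and> (\<integral>x. (norm (Du k x - g x))\<^sup>2 \<partial>lebesgue_on D) < \<epsilon>) sequentially"
    by (intro eventually_conj tf(1) tg(1) order_tendstoD(2)[OF tf(2) \<epsilon>(1)] order_tendstoD(2)[OF tg(2) \<epsilon>(1)])
  then obtain k where k: "L2_on D (u k)" "L2_on D (\<lambda>x. u k x - f x)" "L2_on D (Du k)" "L2_on D (\<lambda>x. Du k x - g x)"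
      "(\<integral>x. (norm (u k x - f x))\<^sup>2 \<partial>lebesgue_on D) < \<epsilon>" "(\<integral>x. (norm (Du k x - g x))\<^sup>2 \<partial>lebesgue_on D) < \<epsilon>"
    using eventually_happens'[OF sequentially_bot] by blast
  \<comment> \<open>Exchanges f with its approximant, or their gradients, inside an integral: a
    square is at most twice the error plus twice the other square, and the error integrates to less
    than \<epsilon> over all of \<open>D\<close>.\<close>
  have Icmp: "I A p \<le> 2 * \<epsilon> + 2 * I A q"
    if A: "A \<in> sets lebesgue" "A \<subseteq> D" and p: "integrable (lebesgue_on D) p" and q: "integrable (lebesgue_on D) q"
      and r: "integrable (lebesgue_on D) r" "(\<integral>x. r x \<partial>lebesgue_on D) < \<epsilon>" "\<And>x. 0 \<le> r x"
      and le: "\<And>x. p x \<le> 2 * r x + 2 * q x" for A and p q r :: "'m point \<Rightarrow> real"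
  proof -
    have AD: "A \<inter> space (lebesgue_on D) \<in> sets (lebesgue_on D)"
      using A Ds by (auto simp: space_restrict_space sets_restrict_space_iff Int_absorb2)
    have "I A p \<le> (\<integral>x. 2 * r x + 2 * (indicator A x * q x) \<partial>lebesgue_on D)"
      unfolding I_def D_def[symmetric]
    proof (rule integral_mono)
      show "indicator A x * p x \<le> 2 * r x + 2 * (indicator A x * q x)" for x
        using le[of x] r(3)[of x] by (auto simp: indicator_def)
    qed (use p q r integrable_indicator_mult[OF AD] in auto)
    also have "\<dots> = 2 * (\<integral>x. r x \<partial>lebesgue_on D) + 2 * I A q"
      unfolding I_def D_def[symmetric] using r(1) integrable_indicator_mult[OF AD q] by simp
    also have "\<dots> \<le> 2 * \<epsilon> + 2 * I A q" using r(2) by simp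
    finally show ?thesis .
  qed
  define E where "E x = (norm (Du k x))\<^sup>2" for x
  have iE: "integrable (lebesgue_on D) E" unfolding E_def using L2_onD(2)[OF k(3)] .
  have ie: "integrable (lebesgue_on D) e" unfolding e_def using L2_onD(2)[OF Lg] by (simp add: g_def D_def)
  have Lc: "L2_on D (\<lambda>_. c :: real)" for c by (rule L2_on_bounded[OF Dl, of _ "\<bar>c\<bar>"]) auto
  have iuc: "integrable (lebesgue_on D) (\<lambda>x. (u k x - c)\<^sup>2)" for c
    using L2_onD(2)[OF L2_on_diff[OF k(1) Lc Ds]] by simp
  have ifc: "integrable (lebesgue_on D) (\<lambda>x. (f x - c)\<^sup>2)" for c
    using L2_onD(2)[OF L2_on_diff[OF Lf Lc Ds]] by simp
  have sub: "section_between \<Omega> (a - 1) a \<subseteq> D" "section_between \<Omega> b (b + 1) \<subseteq> D" "section_between \<Omega> (a - 1) (b + 1) \<subseteq> D"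
    unfolding D_def trunc_eq using ab by (auto simp: section_between_def)
  have IE: "I A E \<le> 2 * \<epsilon> + 2 * I A e" if "A \<in> sets lebesgue" "A \<subseteq> D" for A
  proof (rule Icmp[OF that iE ie L2_onD(2)[OF k(4)] k(6)])
    show "E x \<le> 2 * (norm (Du k x - g x))\<^sup>2 + 2 * e x" for x
      using norm_add_sq_le[of "Du k x - g x" "g x"] by (simp add: E_def e_def g_def D_def)
  qed simp
  have If: "I A (\<lambda>x. (f x - c)\<^sup>2) \<le> 2 * \<epsilon> + 2 * I A (\<lambda>x. (u k x - c)\<^sup>2)" if "A \<in> sets lebesgue" "A \<subseteq> D" for A c
  proof (rule Icmp[OF that ifc iuc L2_onD(2)[OF k(2)] k(5)])
    show "(f x - c)\<^sup>2 \<le> 2 * (norm (u k x - f x))\<^sup>2 + 2 * (u k x - c)\<^sup>2" for x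
      using norm_add_sq_le[of "f x - u k x" "u k x - c"] by (simp add: power2_commute)
  qed simp
  have nn: "(\<integral>\<^sup>+x. ennreal (h x) * indicator A x \<partial>lborel) = ennreal (I A h)"
    if "A \<in> sets lebesgue" "A \<subseteq> D" "integrable (lebesgue_on D) h" "\<And>x. 0 \<le> h x" for A h
    unfolding I_def D_def[symmetric] by (rule nn_integral_section_eq[OF Ds that])
  have Ipos: "0 \<le> I A h" if "\<And>x. 0 \<le> h x" for A h
    unfolding I_def using that by (intro Bochner_Integration.integral_nonneg) simp
  obtain c1 c2 where
    c1: "(\<integral>\<^sup>+x. ennreal ((u k x - c1)\<^sup>2) * indicator (section_between \<Omega> (a - 1) a) x \<partial>lborel)
      \<le> ennreal CP * (\<integral>\<^sup>+x. ennreal (E x) * indicator (section_between \<Omega> (a - 1) a) x \<partial>lborel)" and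
    c2: "(\<integral>\<^sup>+x. ennreal ((u k x - c2)\<^sup>2) * indicator (section_between \<Omega> b (b + 1)) x \<partial>lborel)
      \<le> ennreal CP * (\<integral>\<^sup>+x. ennreal (E x) * indicator (section_between \<Omega> b (b + 1)) x \<partial>lborel)" and
    c12: "ennreal ((c2 - c1)\<^sup>2) \<le> ennreal (CD * (b - a + 1)) *
      (\<integral>\<^sup>+x. ennreal (E x) * indicator (section_between \<Omega> (a - 1) (b + 1)) x \<partial>lborel)"
    using C1_poincare_pair[OF u(1)[of k] ab(1)] unfolding E_def by blast
  have cc: "0 \<le> CD * (b - a + 1)" using CD_nonneg ab by simp
  have 1: "I A (\<lambda>x. (u k x - c)\<^sup>2) \<le> CP * I A E"
    if "(\<integral>\<^sup>+x. ennreal ((u k x - c)\<^sup>2) * indicator A x \<partial>lborel) \<le> ennreal CP * (\<integral>\<^sup>+x. ennreal (E x) * indicator A x \<partial>lborel)"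
      "A \<in> sets lebesgue" "A \<subseteq> D" for A c
  proof -
    have "ennreal (I A (\<lambda>x. (u k x - c)\<^sup>2)) \<le> ennreal CP * ennreal (I A E)"
      using that(1) unfolding nn[OF that(2,3) iuc zero_le_power2] nn[OF that(2,3) iE, unfolded E_def, OF zero_le_power2, folded E_def] .
    then show ?thesis
      using CP_nonneg Ipos[of E] by (simp add: ennreal_mult[symmetric] E_def)
  qed
  have fin: "I A (\<lambda>x. (f x - c)\<^sup>2) \<le> 4 * CP * I A e + \<delta>"
    if "(\<integral>\<^sup>+x. ennreal ((u k x - c)\<^sup>2) * indicator A x \<partial>lborel) \<le> ennreal CP * (\<integral>\<^sup>+x. ennreal (E x) * indicator A x \<partial>lborel)"
      "A \<in> sets lebesgue" "A \<subseteq> D" for A c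
  proof -
    have "I A (\<lambda>x. (f x - c)\<^sup>2) \<le> 2 * \<epsilon> + 2 * (CP * I A E)"
      using If[OF that(2,3), of c] 1[OF that] by simp
    also have "\<dots> \<le> 2 * \<epsilon> + 2 * (CP * (2 * \<epsilon> + 2 * I A e))"
      using mult_left_mono[OF IE[OF that(2,3)] CP_nonneg] by simp
    also have "\<dots> = 4 * CP * I A e + \<delta>" using \<epsilon>(2) by (simp add: algebra_simps)
    finally show ?thesis .
  qed
  have "(c2 - c1)\<^sup>2 \<le> CD * (b - a + 1) * I (section_between \<Omega> (a - 1) (b + 1)) E"
  proof -
    have "ennreal ((c2 - c1)\<^sup>2) \<le> ennreal (CD * (b - a + 1)) * ennreal (I (section_between \<Omega> (a - 1) (b + 1)) E)"
      using c12 unfolding nn[OF section_sets sub(3) iE, unfolded E_def, OF zero_le_power2, folded E_def] .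
    then show ?thesis using cc Ipos[of E] by (simp add: ennreal_mult[symmetric] E_def)
  qed
  also have "\<dots> \<le> CD * (b - a + 1) * (2 * I (section_between \<Omega> (a - 1) (b + 1)) e + \<delta>)"
    using IE[OF section_sets sub(3)] \<epsilon> CPe by (intro mult_left_mono[OF _ cc]) (simp add: algebra_simps)
  finally have "(c2 - c1)\<^sup>2 \<le> CD * (b - a + 1) * (2 * I (section_between \<Omega> (a - 1) (b + 1)) e + \<delta>)" .
  then show ?thesis using fin[OF c1 section_sets sub(1)] fin[OF c2 section_sets sub(2)] by blast
qed

end

section \<open>The cut-off density\<close>

text \<open>The derivative p' / \<rho> of h is positive and, p being smooth, continuous; so h is
  strictly increasing and its derivative attains a positive minimum on compact intervals of
  densities.\<close>

lemma gas_law_enthalpy: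
  assumes "gas_law p h"
  shows "\<And>\<rho>. \<rho> > 0 \<Longrightarrow> (h has_real_derivative deriv p \<rho> / \<rho>) (at \<rho>)"
    "\<And>\<rho>. \<rho> > 0 \<Longrightarrow> deriv p \<rho> / \<rho> > 0"
    "\<And>a b. 0 < a \<Longrightarrow> continuous_on {a..b} (\<lambda>\<rho>. deriv p \<rho> / \<rho>)"
    "\<And>a b. 0 < a \<Longrightarrow> a < b \<Longrightarrow> h a < h b"
    "\<And>a b. 0 < a \<Longrightarrow> continuous_on {a..b} h"
    "inj_on h {0<..}"
proof -
  show d: "\<And>\<rho>. \<rho> > 0 \<Longrightarrow> (h has_real_derivative deriv p \<rho> / \<rho>) (at \<rho>)"
    using assms by (simp add: gas_law_def)
  show pos: "\<And>\<rho>. \<rho> > 0 \<Longrightarrow> deriv p \<rho> / \<rho> > 0"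
    using assms by (simp add: gas_law_def)
  have "(deriv ^^ 1) p field_differentiable (at x)" if "x > 0" for x
    using assms that unfolding gas_law_def smooth_pos_def by blast
  then have dc: "isCont (deriv p) x" if "x > 0" for x
    using that by (simp add: field_differentiable_imp_continuous_at)
  show "\<And>a b. 0 < a \<Longrightarrow> continuous_on {a..b} (\<lambda>\<rho>. deriv p \<rho> / \<rho>)"
    by (intro continuous_intros continuous_at_imp_continuous_on ballI dc) auto
  show mono: "h a < h b" if "0 < a" "a < b" for a b
    by (rule DERIV_pos_imp_increasing[OF that(2)]) (use d pos that(1) in \<open>meson less_le_trans\<close>)
  show "\<And>a b. 0 < a \<Longrightarrow> continuous_on {a..b} h"
    by (intro continuous_at_imp_continuous_on ballI DERIV_isCont[OF d]) auto
  show "inj_on h {0<..}"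
    by (rule linorder_inj_onI) (use mono in \<open>auto dest: less_imp_neq\<close>)
qed

lemma h_inv_eq:
  assumes "gas_law p h" "r > 0"
  shows "h_inv h (h r) = r"
  unfolding h_inv_def by (rule inv_into_f_f[OF gas_law_enthalpy(6)[OF assms(1)]]) (use assms(2) in simp)

text \<open>For \<open>\<xi>\<close> orthogonal to \<open>P\<close> the quadratic form of \<open>a_hat\<close> reduces to the density.\<close>

lemma rho_hat_elliptic:
  fixes \<Omega> :: "'m::finite point set"
  assumes "cutoff \<Omega> p h \<phi> \<epsilon>0 \<theta> qh"
  obtains \<kappa>1 \<kappa>2 where "0 < \<kappa>1" "0 < \<kappa>2"
    "\<And>\<epsilon> s \<Lambda>. \<epsilon> \<in> {0<..<\<epsilon>0} \<Longrightarrow> s \<in> \<phi> ` \<Omega> \<Longrightarrow> 0 \<le> \<Lambda> \<Longrightarrow>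
      \<kappa>1 \<le> rho_hat h qh \<epsilon> \<Lambda> s \<and> rho_hat h qh \<epsilon> \<Lambda> s \<le> \<kappa>2"
proof -
  obtain \<kappa>1 \<kappa>2 where k: "0 < \<kappa>1" "0 < \<kappa>2" and
    ell: "\<forall>\<epsilon>\<in>{0<..<\<epsilon>0}. \<forall>s\<in>\<phi> ` \<Omega>. \<forall>P \<xi> :: 'm point.
        \<kappa>1 * (norm \<xi>)\<^sup>2 \<le> (\<Sum>i\<in>Basis. \<Sum>j\<in>Basis. a_hat h qh \<epsilon> P s i j * (\<xi> \<bullet> i) * (\<xi> \<bullet> j)) \<and>
        (\<Sum>i\<in>Basis. \<Sum>j\<in>Basis. a_hat h qh \<epsilon> P s i j * (\<xi> \<bullet> i) * (\<xi> \<bullet> j)) \<le> \<kappa>2 * (norm \<xi>)\<^sup>2"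
    using assms unfolding cutoff_def by blast
  show ?thesis
  proof (rule that[OF k])
    fix \<epsilon> s \<Lambda> assume a: "\<epsilon> \<in> {0<..<\<epsilon>0}" "s \<in> \<phi> ` \<Omega>" "0 \<le> (\<Lambda>::real)"
    \<comment> \<open>Any cross-sectional direction will do; one exists because n - 1 \<ge> 1.
      \<open>P\<close> is axial with squared length \<Lambda>, hence orthogonal to \<open>b\<close>,
      which removes the derivative term of \<open>a_hat\<close>.\<close>
    define k0 :: 'm where "k0 = undefined"
    define b :: "'m point" where "b = (axis k0 1, 0)"
    define P :: "'m point" where "P = (0, sqrt \<Lambda>)"
    have b: "b \<in> Basis" by (auto simp: b_def Basis_prod_def axis_in_Basis_iff)
    have nb: "norm b = 1" using b by simp
    have P: "(norm P)\<^sup>2 = \<Lambda>" "P \<bullet> b = 0" using a(3) by (simp_all add: P_def b_def norm_Pair)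
    have "(\<Sum>i\<in>Basis. \<Sum>j\<in>Basis. a_hat h qh \<epsilon> P s i j * (b \<bullet> i) * (b \<bullet> j))
        = (\<Sum>i\<in>Basis. \<Sum>j\<in>Basis. if j = b then (if i = b then a_hat h qh \<epsilon> P s b b else 0) else 0)"
      using b by (intro sum.cong refl) (auto simp: inner_Basis)
    also have "\<dots> = a_hat h qh \<epsilon> P s b b" using b by (simp add: sum.delta)
    also have "\<dots> = rho_hat h qh \<epsilon> \<Lambda> s" by (simp add: a_hat_def P)
    finally have "(\<Sum>i\<in>Basis. \<Sum>j\<in>Basis. a_hat h qh \<epsilon> P s i j * (b \<bullet> i) * (b \<bullet> j)) = rho_hat h qh \<epsilon> \<Lambda> s" .
    moreover have "\<kappa>1 * (norm b)\<^sup>2 \<le> (\<Sum>i\<in>Basis. \<Sum>j\<in>Basis. a_hat h qh \<epsilon> P s i j * (b \<bullet> i) * (b \<bullet> j)) \<and>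
        (\<Sum>i\<in>Basis. \<Sum>j\<in>Basis. a_hat h qh \<epsilon> P s i j * (b \<bullet> i) * (b \<bullet> j)) \<le> \<kappa>2 * (norm b)\<^sup>2"
      using ell a(1,2) by blast
    ultimately show "\<kappa>1 \<le> rho_hat h qh \<epsilon> \<Lambda> s \<and> rho_hat h qh \<epsilon> \<Lambda> s \<le> \<kappa>2" using nb by simp
  qed
qed

text \<open>The ellipticity constants are uniform in \<open>\<epsilon>\<close>. If \<open>qh\<close> took a large value, then for a
  suitable \<open>\<epsilon>\<close> the density would equal \<open>r1\<close> or \<open>r2\<close>, which ellipticity excludes. So \<open>qh\<close> is
  bounded and the enthalpy stays in a compact part of its range.\<close>

lemma rho_hat_range:
  fixes \<Omega> :: "'m::finite point set"
  assumes g: "gas_law p h" and c: "cutoff \<Omega> p h \<phi> \<epsilon>0 \<theta> qh" and "0 < \<epsilon>0"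
  obtains r1 r2 Q where "0 < r1" "r1 < 1" "1 < r2" "0 \<le> Q"
    "\<And>s \<Lambda>. s \<in> \<phi> ` \<Omega> \<Longrightarrow> 0 \<le> \<Lambda> \<Longrightarrow> \<bar>qh \<Lambda> s\<bar> \<le> Q"
    "\<And>\<epsilon> s \<Lambda>. \<epsilon> \<in> {0<..<\<epsilon>0} \<Longrightarrow> s \<in> \<phi> ` \<Omega> \<Longrightarrow> 0 \<le> \<Lambda> \<Longrightarrow>
      h 1 - \<epsilon>\<^sup>2 * qh \<Lambda> s / 2 \<in> h ` {r1..r2}"
proof -
  obtain \<kappa>1 \<kappa>2 where k: "0 < \<kappa>1" "0 < \<kappa>2" and
    ell: "\<And>\<epsilon> s \<Lambda>. \<epsilon> \<in> {0<..<\<epsilon>0} \<Longrightarrow> s \<in> \<phi> ` \<Omega> \<Longrightarrow> 0 \<le> \<Lambda> \<Longrightarrow>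
      \<kappa>1 \<le> rho_hat h qh \<epsilon> \<Lambda> s \<and> rho_hat h qh \<epsilon> \<Lambda> s \<le> \<kappa>2"
    by (rule rho_hat_elliptic[OF c]) blast
  \<comment> \<open>Strictly outside the ellipticity interval and on either side of 1: the
    enthalpies at \<open>r1\<close> and \<open>r2\<close> bracket \<open>h 1\<close>, yet the
    argument of the inverse never takes these values.\<close>
  define r1 r2 where "r1 = min \<kappa>1 1 / 2" and "r2 = max \<kappa>2 1 + 1"
  have r: "0 < r1" "r1 < 1" "1 < r2" "r1 < \<kappa>1" "\<kappa>2 < r2" using k by (auto simp: r1_def r2_def min_def)
  note mono = gas_law_enthalpy(4)[OF g]
  define A B where "A = h 1 - h r1" and "B = h r2 - h 1"
  have AB: "0 < A" "0 < B" using mono[OF r(1,2)] mono[OF zero_less_one r(3)] by (auto simp: A_def B_def)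
  have no: "h 1 - \<epsilon>\<^sup>2 * qh \<Lambda> s / 2 \<noteq> h r1" "h 1 - \<epsilon>\<^sup>2 * qh \<Lambda> s / 2 \<noteq> h r2"
    if "\<epsilon> \<in> {0<..<\<epsilon>0}" "s \<in> \<phi> ` \<Omega>" "0 \<le> \<Lambda>" for \<epsilon> s \<Lambda>
  proof -
    have r2: "0 < r2" using r by simp
    have "rho_hat h qh \<epsilon> \<Lambda> s = r1" if "h 1 - \<epsilon>\<^sup>2 * qh \<Lambda> s / 2 = h r1"
      unfolding rho_hat_def that by (rule h_inv_eq[OF g r(1)])
    then show "h 1 - \<epsilon>\<^sup>2 * qh \<Lambda> s / 2 \<noteq> h r1" using ell[OF that] r(4) by linarith
    have "rho_hat h qh \<epsilon> \<Lambda> s = r2" if "h 1 - \<epsilon>\<^sup>2 * qh \<Lambda> s / 2 = h r2"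
      unfolding rho_hat_def that by (rule h_inv_eq[OF g r2])
    then show "h 1 - \<epsilon>\<^sup>2 * qh \<Lambda> s / 2 \<noteq> h r2" using ell[OF that] r(5) by linarith
  qed
  have up: "\<epsilon>0\<^sup>2 * qh \<Lambda> s \<le> 2 * A" if s: "s \<in> \<phi> ` \<Omega>" "0 \<le> \<Lambda>" for s \<Lambda>
  proof (rule ccontr)
    assume *: "\<not> ?thesis"
    have X: "0 < qh \<Lambda> s"
    proof (rule ccontr)
      assume "\<not> ?thesis"
      then have "\<epsilon>0\<^sup>2 * qh \<Lambda> s \<le> 0" by (simp add: mult_nonneg_nonpos)
      then show False using * AB by simp
    qed
    \<comment> \<open>Chosen with \<epsilon>^2 qh = 2 A, which makes the argument of
      \<open>h_inv\<close> exactly \<open>h r1\<close>; the assumption being refuted is what gives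
      \<epsilon> < \<epsilon>0.\<close>
    define \<epsilon> where "\<epsilon> = sqrt (2 * A / qh \<Lambda> s)"
    have e2: "\<epsilon>\<^sup>2 = 2 * A / qh \<Lambda> s" using AB X by (simp add: \<epsilon>_def)
    have "\<epsilon>\<^sup>2 < \<epsilon>0\<^sup>2" using * X by (simp add: e2 divide_less_eq)
    then have "\<epsilon> < \<epsilon>0" by (rule power2_less_imp_less) (use \<open>0 < \<epsilon>0\<close> in linarith)
    then have ein: "\<epsilon> \<in> {0<..<\<epsilon>0}" using AB X by (simp add: \<epsilon>_def)
    have "\<epsilon>\<^sup>2 * qh \<Lambda> s = 2 * A" using X by (simp add: e2)
    then show False using no(1)[OF ein s] by (simp add: A_def field_simps)
  qed
  have lo: "- (2 * B) \<le> \<epsilon>0\<^sup>2 * qh \<Lambda> s" if s: "s \<in> \<phi> ` \<Omega>" "0 \<le> \<Lambda>" for s \<Lambda>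
  proof (rule ccontr)
    assume *: "\<not> ?thesis"
    have X: "qh \<Lambda> s < 0"
    proof (rule ccontr)
      assume "\<not> ?thesis"
      then have "0 \<le> \<epsilon>0\<^sup>2 * qh \<Lambda> s" by simp
      then show False using * AB by simp
    qed
    define \<epsilon> where "\<epsilon> = sqrt (2 * B / (- qh \<Lambda> s))"
    have q: "0 < 2 * B / (- qh \<Lambda> s)" using AB X by (intro divide_pos_pos) auto
    then have e2: "\<epsilon>\<^sup>2 = 2 * B / (- qh \<Lambda> s)" unfolding \<epsilon>_def by (intro real_sqrt_pow2) linarith
    have "\<epsilon>\<^sup>2 * (- qh \<Lambda> s) < \<epsilon>0\<^sup>2 * (- qh \<Lambda> s)" using * X by (simp add: e2)
    then have "\<epsilon>\<^sup>2 < \<epsilon>0\<^sup>2" using X by (simp add: mult_less_cancel_right_disj)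
    then have "\<epsilon> < \<epsilon>0" by (rule power2_less_imp_less) (use \<open>0 < \<epsilon>0\<close> in linarith)
    then have ein: "\<epsilon> \<in> {0<..<\<epsilon>0}" using real_sqrt_gt_zero[OF q] by (simp add: \<epsilon>_def)
    have "\<epsilon>\<^sup>2 * qh \<Lambda> s = - 2 * B" using X by (simp add: e2)
    then show False using no(2)[OF ein s] by (simp add: B_def field_simps)
  qed
  define Q where "Q = 2 * (A + B) / \<epsilon>0\<^sup>2"
  show ?thesis
  proof (rule that[OF r(1-3), of Q])
    show "0 \<le> Q" using AB by (simp add: Q_def)
    show "\<bar>qh \<Lambda> s\<bar> \<le> Q" if "s \<in> \<phi> ` \<Omega>" "0 \<le> \<Lambda>" for s \<Lambda>
    proof -
      have "\<bar>\<epsilon>0\<^sup>2 * qh \<Lambda> s\<bar> \<le> 2 * (A + B)" using up[OF that] lo[OF that] AB by (simp add: abs_le_iff)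
      then show ?thesis using \<open>0 < \<epsilon>0\<close> by (simp add: Q_def abs_mult le_divide_eq mult.commute)
    qed
    fix \<epsilon> s \<Lambda> assume e: "\<epsilon> \<in> {0<..<\<epsilon>0}" and s: "s \<in> \<phi> ` \<Omega>" "0 \<le> (\<Lambda>::real)"
    \<comment> \<open>The bounds obtained at \<epsilon>0 persist for smaller \<epsilon>; the sign of
      \<open>qh\<close> decides which of the two is at stake.\<close>
    have "\<epsilon>\<^sup>2 \<le> \<epsilon>0\<^sup>2" using e by (intro power_mono) auto
    then have le: "\<epsilon>\<^sup>2 * \<bar>qh \<Lambda> s\<bar> \<le> \<epsilon>0\<^sup>2 * \<bar>qh \<Lambda> s\<bar>" by (intro mult_right_mono) auto
    have "\<epsilon>\<^sup>2 * qh \<Lambda> s \<le> 2 * A"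
    proof (cases "qh \<Lambda> s \<ge> 0")
      case True
      then show ?thesis using le up[OF s] by simp
    next
      case False
      then have "\<epsilon>\<^sup>2 * qh \<Lambda> s \<le> 0" by (simp add: mult_nonneg_nonpos)
      then show ?thesis using AB by simp
    qed
    moreover have "- (2 * B) \<le> \<epsilon>\<^sup>2 * qh \<Lambda> s"
    proof (cases "qh \<Lambda> s \<ge> 0")
      case True
      then have "0 \<le> \<epsilon>\<^sup>2 * qh \<Lambda> s" by simp
      then show ?thesis using AB by simp
    next
      case False
      then have "\<epsilon>0\<^sup>2 * qh \<Lambda> s \<le> \<epsilon>\<^sup>2 * qh \<Lambda> s"
        using \<open>\<epsilon>\<^sup>2 \<le> \<epsilon>0\<^sup>2\<close> by (intro mult_right_mono_neg) auto
      then show ?thesis using lo[OF s] by linarith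
    qed
    ultimately have 1: "h r1 \<le> h 1 - \<epsilon>\<^sup>2 * qh \<Lambda> s / 2" "h 1 - \<epsilon>\<^sup>2 * qh \<Lambda> s / 2 \<le> h r2"
      by (simp_all add: A_def B_def)
    obtain x where "r1 \<le> x" "x \<le> r2" "h x = h 1 - \<epsilon>\<^sup>2 * qh \<Lambda> s / 2"
      using IVT'[OF 1 _ gas_law_enthalpy(5)[OF g r(1)]] r by auto
    then show "h 1 - \<epsilon>\<^sup>2 * qh \<Lambda> s / 2 \<in> h ` {r1..r2}" by (intro image_eqI[of _ _ x]) auto
  qed
qed

text \<open>On the compact density interval found before, the derivative of h is at least some m >
  0. So |rho_hat - 1| is at most 1 / m times the enthalpy difference \<epsilon>^2 |qh| / 2. This is
  the origin of the \<epsilon>^2 that the rescaling divides by, and of CR = Q / (2 m). The ends of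
  the interval serve as density bounds.\<close>

lemma rho_hat_bounds:
  fixes \<Omega> :: "'m::finite point set"
  assumes g: "gas_law p h" and c: "cutoff \<Omega> p h \<phi> \<epsilon>0 \<theta> qh" and "0 < \<epsilon>0"
  obtains \<kappa>1 \<kappa>2 CR where "0 < \<kappa>1" "0 < \<kappa>2" "0 \<le> CR"
    "\<And>\<epsilon> s \<Lambda>. \<epsilon> \<in> {0<..<\<epsilon>0} \<Longrightarrow> s \<in> \<phi> ` \<Omega> \<Longrightarrow> 0 \<le> \<Lambda> \<Longrightarrow>
      \<kappa>1 \<le> rho_hat h qh \<epsilon> \<Lambda> s \<and> rho_hat h qh \<epsilon> \<Lambda> s \<le> \<kappa>2 \<and> \<bar>rho_hat h qh \<epsilon> \<Lambda> s - 1\<bar> \<le> CR * \<epsilon>\<^sup>2"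
    "\<And>\<epsilon>. \<epsilon> \<in> {0<..<\<epsilon>0} \<Longrightarrow> continuous_on ({0..} \<times> \<phi> ` \<Omega>) (\<lambda>(\<Lambda>, s). rho_hat h qh \<epsilon> \<Lambda> s)"
proof -
  obtain r1 r2 Q where r: "0 < r1" "r1 < 1" "1 < r2" and Q: "0 \<le> Q"
    "\<And>s \<Lambda>. s \<in> \<phi> ` \<Omega> \<Longrightarrow> 0 \<le> \<Lambda> \<Longrightarrow> \<bar>qh \<Lambda> s\<bar> \<le> Q"
    and ran: "\<And>\<epsilon> s \<Lambda>. \<epsilon> \<in> {0<..<\<epsilon>0} \<Longrightarrow> s \<in> \<phi> ` \<Omega> \<Longrightarrow> 0 \<le> \<Lambda> \<Longrightarrow>
      h 1 - \<epsilon>\<^sup>2 * qh \<Lambda> s / 2 \<in> h ` {r1..r2}"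
    by (rule rho_hat_range[OF g c \<open>0 < \<epsilon>0\<close>]) blast
  note gl = gas_law_enthalpy[OF g]
  obtain x0 where x0: "x0 \<in> {r1..r2}" "\<And>x. x \<in> {r1..r2} \<Longrightarrow> deriv p x0 / x0 \<le> deriv p x / x"
    using continuous_attains_inf[OF compact_Icc _ gl(3)[OF r(1), of r2]] r by auto
  define m where "m = deriv p x0 / x0"
  have m: "0 < m" unfolding m_def by (rule gl(2)) (use x0 r in auto)
  define CR where "CR = Q / (2 * m)"
  show ?thesis
  proof (rule that[of r1 r2 CR])
    show "0 \<le> CR" using Q m by (simp add: CR_def)
    fix \<epsilon> assume e: "\<epsilon> \<in> {0<..<\<epsilon>0}"
    show "r1 \<le> rho_hat h qh \<epsilon> \<Lambda> s \<and> rho_hat h qh \<epsilon> \<Lambda> s \<le> r2 \<and> \<bar>rho_hat h qh \<epsilon> \<Lambda> s - 1\<bar> \<le> CR * \<epsilon>\<^sup>2"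
      if s: "s \<in> \<phi> ` \<Omega>" "0 \<le> \<Lambda>" for s \<Lambda>
    proof -
      obtain x where x: "x \<in> {r1..r2}" "h x = h 1 - \<epsilon>\<^sup>2 * qh \<Lambda> s / 2" using ran[OF e s] by (metis imageE)
      then have rx: "rho_hat h qh \<epsilon> \<Lambda> s = x"
        using h_inv_eq[OF g, of x] r by (simp add: rho_hat_def)
      have lb: "m * \<bar>x - 1\<bar> \<le> \<bar>h x - h 1\<bar>"
      proof -
        have gen: "m * (b - a) \<le> h b - h a" if ab: "r1 \<le> a" "a < b" "b \<le> r2" for a b
        proof -
          have "(h has_real_derivative deriv p z / z) (at z)" if "a \<le> z" "z \<le> b" for z
            by (rule gl(1)) (use that ab(1) r(1) in linarith)
          from MVT2[OF ab(2) this]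
          obtain z where z: "a < z" "z < b" "h b - h a = (b - a) * (deriv p z / z)" by auto
          have "m \<le> deriv p z / z" unfolding m_def by (rule x0(2)) (use z ab in auto)
          then have "(b - a) * m \<le> (b - a) * (deriv p z / z)" using ab by (intro mult_left_mono) auto
          then show ?thesis using z by (simp add: mult.commute)
        qed
        consider "x = 1" | "x < 1" | "1 < x" by linarith
        then show ?thesis
        proof cases
          case 2
          then show ?thesis using gen[of x 1] gl(4)[of x 1] x r by simp
        next
          case 3
          then show ?thesis using gen[of 1 x] gl(4)[of 1 x] x r by simp
        qed simp
      qed
      have "m * \<bar>x - 1\<bar> \<le> \<epsilon>\<^sup>2 * Q / 2"
        using lb x(2) mult_left_mono[OF Q(2)[OF s], of "\<epsilon>\<^sup>2"] by (simp add: abs_mult)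
      then have "\<bar>x - 1\<bar> \<le> CR * \<epsilon>\<^sup>2" using m by (simp add: CR_def field_simps)
      then show ?thesis using x rx by simp
    qed
    \<comment> \<open>A continuous injective function on a compact interval has a continuous
      inverse, which is where confinement to \<open>{r1..r2}\<close> pays off a second time.\<close>
    have hi: "continuous_on (h ` {r1..r2}) (h_inv h)"
      by (rule continuous_on_inv[OF gl(5)[OF r(1)] compact_Icc]) (use h_inv_eq[OF g] r in auto)
    have qc: "continuous_on ({0..} \<times> \<phi> ` \<Omega>) (\<lambda>x. qh (fst x) (snd x))"
      using c unfolding cutoff_def by (simp add: case_prod_beta)
    have "continuous_on ({0..} \<times> \<phi> ` \<Omega>) (\<lambda>x. h_inv h (h 1 - \<epsilon>\<^sup>2 * qh (fst x) (snd x) / 2))"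
      by (intro continuous_on_compose2[OF hi] continuous_intros qc) (use ran[OF e] in auto)
    then show "continuous_on ({0..} \<times> \<phi> ` \<Omega>) (\<lambda>(\<Lambda>, s). rho_hat h qh \<epsilon> \<Lambda> s)"
      by (simp add: rho_hat_def case_prod_beta)
  qed (use r in auto)
qed

text \<open>The values of \<phi> may form any set, so measurability passes through the Borel space
  restricted to the set on which the density is continuous.\<close>

lemma rho_hat_measurable:
  fixes \<Omega> :: "'m::finite point set"
  assumes cont: "continuous_on ({0..} \<times> \<phi> ` \<Omega>) (\<lambda>(\<Lambda>, s). rho_hat h qh \<epsilon> \<Lambda> s)"
    and \<phi>: "\<phi> \<in> borel_measurable (lebesgue_on \<Omega>)" and "D \<subseteq> \<Omega>" and D: "D \<in> sets lebesgue"
    and v: "v \<in> borel_measurable (lebesgue_on D)"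
  shows "(\<lambda>x. rho_hat h qh \<epsilon> ((norm (v x :: 'm point))\<^sup>2) (\<phi> x)) \<in> borel_measurable (lebesgue_on D)"
proof -
  define X where "X = {0::real..} \<times> \<phi> ` \<Omega>"
  have \<phi>D: "\<phi> \<in> borel_measurable (lebesgue_on D)"
    by (rule measurable_restrict_mono[OF \<phi> \<open>D \<subseteq> \<Omega>\<close>])
  have "(\<lambda>x. ((norm (v x))\<^sup>2, \<phi> x)) \<in> lebesgue_on D \<rightarrow>\<^sub>M borel \<Otimes>\<^sub>M borel"
    using \<phi>D v by measurable
  then have "(\<lambda>x. ((norm (v x))\<^sup>2, \<phi> x)) \<in> lebesgue_on D \<rightarrow>\<^sub>M borel"
    by (simp add: borel_prod)
  then have "(\<lambda>x. ((norm (v x))\<^sup>2, \<phi> x)) \<in> lebesgue_on D \<rightarrow>\<^sub>M restrict_space borel X"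
    using \<open>D \<subseteq> \<Omega>\<close> by (intro measurable_restrict_space2) (auto simp: X_def space_restrict_space)
  from measurable_compose[OF this borel_measurable_continuous_on_restrict[OF cont[folded X_def]]]
  show ?thesis by simp
qed

section \<open>Energy estimates\<close>

text \<open>A C^1 ramp from 0 to 1: its derivative is the tent on [0, 1] with peak 2 at 1/2. Squared
  positive parts give exactly the C^1 regularity asked of the cut-offs.\<close>

definition step :: "real \<Rightarrow> real" where
  "step t = 2 * (max 0 t)\<^sup>2 - 4 * (max 0 (t - 1 / 2))\<^sup>2 + 2 * (max 0 (t - 1))\<^sup>2"

definition step' :: "real \<Rightarrow> real" where
  "step' t = 4 * max 0 t - 8 * max 0 (t - 1 / 2) + 4 * max 0 (t - 1)"

lemma step_der: "((\<lambda>t. step (t - c)) has_real_derivative step' (t - c)) (at t)"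
proof -
  have 1: "((\<lambda>t. (max 0 (t - d))\<^sup>2) has_real_derivative 2 * max 0 (t - d)) (at t)" for d :: real
    using DERIV_chain2[OF has_real_derivative_pos_part_sq DERIV_diff[OF DERIV_ident DERIV_const[of d]], of t] by simp
  have "((\<lambda>t. 2 * (max 0 (t - c))\<^sup>2 - 4 * (max 0 (t - (c + 1 / 2)))\<^sup>2 + 2 * (max 0 (t - (c + 1)))\<^sup>2)
      has_real_derivative 2 * (2 * max 0 (t - c)) - 4 * (2 * max 0 (t - (c + 1 / 2))) + 2 * (2 * max 0 (t - (c + 1)))) (at t)"
    by (intro DERIV_add DERIV_diff DERIV_cmult 1)
  then show ?thesis by (simp add: step_def step'_def diff_diff_eq)
qed

lemma step'_cont: "continuous_on UNIV (\<lambda>t. step' (t - c))"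
  unfolding step'_def by (intro continuous_intros)

lemma step_0: "t \<le> 0 \<Longrightarrow> step t = 0" and step'_0: "t \<le> 0 \<or> 1 \<le> t \<Longrightarrow> step' t = 0"
  by (auto simp: step_def step'_def max_def)

lemma step_1: "1 \<le> t \<Longrightarrow> step t = 1"
  by (simp add: step_def max_def power2_eq_square algebra_simps)

lemma step_range: "0 \<le> step t" "step t \<le> 1"
proof -
  consider "t \<le> 0" | "0 < t" "t \<le> 1 / 2" | "1 / 2 < t" "t < 1" | "1 \<le> t" by linarith
  then have "0 \<le> step t \<and> step t \<le> 1"
  proof cases
    case 2
    then have "step t = 2 * t\<^sup>2" by (simp add: step_def max_def)
    moreover have "t\<^sup>2 \<le> (1 / 2)\<^sup>2" using 2 by (intro power_mono) auto
    ultimately show ?thesis by (simp add: power2_eq_square)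
  next
    case 3
    then have "step t = 1 - 2 * (1 - t)\<^sup>2" by (simp add: step_def max_def power2_eq_square algebra_simps)
    moreover have "(1 - t)\<^sup>2 \<le> (1 / 2)\<^sup>2" using 3 by (intro power_mono) auto
    ultimately show ?thesis by (simp add: power2_eq_square)
  qed (simp_all add: step_0 step_1)
  then show "0 \<le> step t" "step t \<le> 1" by auto
qed

lemma step'_range: "\<bar>step' t\<bar> \<le> 2"
  by (auto simp: step'_def max_def)

text \<open>The integrand of the tested equation at one point: z is the cut-off, d1 and d2 the
  slopes of its two ramps, y1 and y2 the deviations of f from the layer constants, and i0, i1, i2,
  iA values of indicators. Young's inequality spends half of the ellipticity on F and turns the ramp
  terms into squares supported on the end layers.\<close>

lemma energy_pointwise:
  fixes G F e :: "'a::real_inner"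
  assumes s: "\<kappa>1 \<le> s" "s \<le> \<kappa>2" "0 < \<kappa>1" and z: "0 \<le> z" "z \<le> 1" and e: "norm e = 1"
    and d: "\<bar>d1\<bar> \<le> 2 * i1" "\<bar>d2\<bar> \<le> 2 * i2" and i: "0 \<le> i1" "0 \<le> i2" "z \<le> iA" "i0 \<le> z"
  shows "\<kappa>1 / 2 * (i0 * (norm G)\<^sup>2)
    \<le> (s *\<^sub>R G + F) \<bullet> (z *\<^sub>R G + (d1 * y1 - d2 * y2) *\<^sub>R e) + 1 / (2 * \<kappa>1) * (iA * (norm F)\<^sup>2)
      + (2 * (i1 * y1\<^sup>2) + \<kappa>2\<^sup>2 * (i1 * (norm G)\<^sup>2) + i1 * (norm F)\<^sup>2)
      + (2 * (i2 * y2\<^sup>2) + \<kappa>2\<^sup>2 * (i2 * (norm G)\<^sup>2) + i2 * (norm F)\<^sup>2)"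
proof -
  define H where "H = s *\<^sub>R G + F"
  define g n where "g = norm G" and "n = norm F"
  have gn: "0 \<le> g" "0 \<le> n" by (auto simp: g_def n_def)
  have k2: "0 < \<kappa>2" using s by linarith
  have main: "z * (\<kappa>1 / 2 * g\<^sup>2 - 1 / (2 * \<kappa>1) * n\<^sup>2) \<le> H \<bullet> (z *\<^sub>R G)"
  proof -
    have "- (g * n) \<le> F \<bullet> G" using Cauchy_Schwarz_ineq2[of F G] by (simp add: g_def n_def mult.commute)
    moreover have "\<kappa>1 * g\<^sup>2 \<le> s * g\<^sup>2" using s by (intro mult_right_mono) auto
    moreover have "g * n \<le> \<kappa>1 / 2 * g\<^sup>2 + 1 / (2 * \<kappa>1) * n\<^sup>2"
    proof -
      have "0 \<le> (\<kappa>1 * g - n)\<^sup>2 / (2 * \<kappa>1)" using s by simp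
      also have "\<dots> = \<kappa>1 / 2 * g\<^sup>2 + 1 / (2 * \<kappa>1) * n\<^sup>2 - g * n"
        using s by (simp add: power2_eq_square field_simps)
      finally show ?thesis by simp
    qed
    ultimately have "\<kappa>1 / 2 * g\<^sup>2 - 1 / (2 * \<kappa>1) * n\<^sup>2 \<le> s * g\<^sup>2 + F \<bullet> G" by linarith
    also have "\<dots> = H \<bullet> G" by (simp add: H_def inner_add_left g_def power2_norm_eq_inner)
    finally have "z * (\<kappa>1 / 2 * g\<^sup>2 - 1 / (2 * \<kappa>1) * n\<^sup>2) \<le> z * (H \<bullet> G)" using z by (intro mult_left_mono)
    then show ?thesis by simp
  qed
  have Hn: "\<bar>H \<bullet> e\<bar> \<le> \<kappa>2 * g + n"
  proof -
    have "\<bar>H \<bullet> e\<bar> \<le> norm H * norm e" by (rule Cauchy_Schwarz_ineq2)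
    also have "\<dots> \<le> \<bar>s\<bar> * g + n" using norm_triangle_ineq[of "s *\<^sub>R G" F] e by (simp add: H_def g_def n_def)
    also have "\<dots> \<le> \<kappa>2 * g + n" using s gn by (intro add_right_mono mult_right_mono) auto
    finally show ?thesis .
  qed
  \<comment> \<open>The slope bound 2 cancels the 1/2 of Young's inequality, which explains the
    coefficients 2, \<kappa>2^2 and 1.\<close>
  have ramp: "\<bar>d * y * (H \<bullet> e)\<bar> \<le> 2 * (j * y\<^sup>2) + \<kappa>2\<^sup>2 * (j * g\<^sup>2) + j * n\<^sup>2"
    if "\<bar>d\<bar> \<le> 2 * j" "0 \<le> j" for d j y
  proof -
    have "\<bar>d * y * (H \<bullet> e)\<bar> \<le> (2 * j * \<bar>y\<bar>) * (\<kappa>2 * g + n)"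
      unfolding abs_mult using that Hn by (intro mult_mono) auto
    also have "\<dots> = j * (2 * \<bar>y\<bar> * (\<kappa>2 * g) + 2 * \<bar>y\<bar> * n)" by (simp add: algebra_simps)
    also have "\<dots> \<le> j * (2 * y\<^sup>2 + \<kappa>2\<^sup>2 * g\<^sup>2 + n\<^sup>2)"
    proof (rule mult_left_mono[OF _ that(2)])
      show "2 * \<bar>y\<bar> * (\<kappa>2 * g) + 2 * \<bar>y\<bar> * n \<le> 2 * y\<^sup>2 + \<kappa>2\<^sup>2 * g\<^sup>2 + n\<^sup>2"
        using sum_squares_bound[of "\<bar>y\<bar>" "\<kappa>2 * g"] sum_squares_bound[of "\<bar>y\<bar>" n] by (simp add: power_mult_distrib)
    qed
    finally show ?thesis by (simp add: algebra_simps)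
  qed
  have "H \<bullet> (z *\<^sub>R G + (d1 * y1 - d2 * y2) *\<^sub>R e) = H \<bullet> (z *\<^sub>R G) + d1 * y1 * (H \<bullet> e) - d2 * y2 * (H \<bullet> e)"
    by (simp add: inner_add_right algebra_simps)
  then have "H \<bullet> (z *\<^sub>R G) \<le> H \<bullet> (z *\<^sub>R G + (d1 * y1 - d2 * y2) *\<^sub>R e)
      + (2 * (i1 * y1\<^sup>2) + \<kappa>2\<^sup>2 * (i1 * g\<^sup>2) + i1 * n\<^sup>2) + (2 * (i2 * y2\<^sup>2) + \<kappa>2\<^sup>2 * (i2 * g\<^sup>2) + i2 * n\<^sup>2)"
    using ramp[OF d(1) i(1), of y1] ramp[OF d(2) i(2), of y2] by linarith
  moreover have "\<kappa>1 / 2 * (i0 * g\<^sup>2) \<le> \<kappa>1 / 2 * (z * g\<^sup>2)"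
    using s i by (intro mult_left_mono mult_right_mono) auto
  moreover have "1 / (2 * \<kappa>1) * (z * n\<^sup>2) \<le> 1 / (2 * \<kappa>1) * (iA * n\<^sup>2)"
    using s i by (intro mult_left_mono mult_right_mono) auto
  moreover have "\<kappa>1 / 2 * (z * g\<^sup>2) - 1 / (2 * \<kappa>1) * (z * n\<^sup>2) \<le> H \<bullet> (z *\<^sub>R G)"
    using main by (simp add: algebra_simps)
  ultimately show ?thesis unfolding g_def n_def H_def by linarith
qed

text \<open>Here x is the energy of the section, z that of the enlarged one, and m the flux term.
  Since z = x + d, absorbing k/8 z costs k/8 of the k/2 on the left, leaving 3k/8, and charges the
  remaining k/8 d to the difference.\<close>

lemma absorb_arith:
  fixes k :: real
  assumes "k / 2 * x \<le> m + y + p * d + 4 * e" "m \<le> k / 8 * z + k * e + w" "d = z - x"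
  shows "3 * k / 8 * x \<le> (p + k / 8) * d + y + w + (4 + k) * e"
proof -
  define X D K P where "X = k / 8 * x" and "D = k / 8 * d" and "K = k * e" and "P = p * d"
  have z: "z = x + d" using assms(3) by simp
  have eqs: "k / 2 * x = 4 * X" "k / 8 * z = X + D" "3 * k / 8 * x = 3 * X"
    "(p + k / 8) * d = P + D" "(4 + k) * e = 4 * e + K"
    unfolding X_def D_def K_def P_def z by (simp_all add: algebra_simps)
  show ?thesis using assms(1,2) unfolding eqs K_def[symmetric] P_def[symmetric] by linarith
qed

section \<open>Local and global energy estimates in the nozzle\<close>

context nozzle_chart begin

text \<open>The factor 8 / (3 \<kappa>1) inverts the 3 \<kappa>1 / 8 left after absorption, and 4 /
  \<kappa>1 in \<open>C3E\<close> inverts what remains of \<kappa>1 / 2 once the boundary term has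
  taken \<kappa>1 / 4. The 8 CP is twice the constant of \<open>trunc_poincare\<close>.\<close>

definition C1E :: "real \<Rightarrow> real \<Rightarrow> real" where
  "C1E \<kappa>1 \<kappa>2 = (8 * CP + \<kappa>2\<^sup>2 + \<kappa>1 / 8) * (8 / (3 * \<kappa>1))"

definition C2E :: "real \<Rightarrow> real" where
  "C2E \<kappa>1 = (8 / (3 * \<kappa>1)) * (1 / (2 * \<kappa>1) + 1 + 4 * (CD + 1) / \<kappa>1)"

definition C3E :: "real \<Rightarrow> real" where
  "C3E \<kappa>1 = (4 / \<kappa>1) * (1 / (2 * \<kappa>1) + Ms * CT / (\<beta> * \<kappa>1))"

lemma C1E_nonneg: "0 < \<kappa>1 \<Longrightarrow> 0 \<le> C1E \<kappa>1 \<kappa>2"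
  and C2E_nonneg: "0 < \<kappa>1 \<Longrightarrow> 0 \<le> C2E \<kappa>1"
  and C3E_nonneg: "0 < \<kappa>1 \<Longrightarrow> 0 \<le> C3E \<kappa>1"
  using CP_nonneg CD_nonneg CT_nonneg Ms_pos \<beta>_pos by (simp_all add: C1E_def C2E_def C3E_def)

lemma measure_slice_ge: "\<beta> / Ms \<le> measure lebesgue (slice \<Omega> t)"
proof -
  have fin: "emeasure lebesgue (slice \<Omega> t) = ennreal (measure lebesgue (slice \<Omega> t))"
    using slice_lmeasurable by (rule emeasure_eq_measure2)
  have "emeasure lebesgue (slice \<Omega> t) = emeasure lborel (slice \<Omega> t)"
    using borel_open[OF open_slice[of t]] by simp
  then have "ennreal \<beta> \<le> ennreal Ms * ennreal (measure lebesgue (slice \<Omega> t))"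
    using emeasure_slice[of t] fin by simp
  then have "\<beta> \<le> Ms * measure lebesgue (slice \<Omega> t)"
    using Ms_pos by (simp add: ennreal_mult[symmetric])
  then show ?thesis using Ms_pos by (simp add: field_simps)
qed

lemma measure_slice_pos: "0 < measure lebesgue (slice \<Omega> t)"
  using measure_slice_ge[of t] \<beta>_pos Ms_pos divide_pos_pos less_le_trans by blast

text \<open>Used with \<open>\<sigma> = rho_hat\<close>, \<open>F = 0\<close>, \<open>\<mu> = m\<close> for \<open>\<phi>L\<close>, and with \<open>\<sigma> = 1\<close>,
  \<open>F = ((rho_hat - 1) / \<epsilon>\<^sup>2) grad \<phi>L\<close>, \<open>\<mu> = 0\<close> for the rescaled difference.\<close>

definition flux_eq :: "real \<Rightarrow> ('m point \<Rightarrow> real) \<Rightarrow> ('m point \<Rightarrow> real) \<Rightarrow> ('m point \<Rightarrow> 'm point) \<Rightarrow> real \<Rightarrow> bool" where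
  "flux_eq L f \<sigma> F \<mu> \<longleftrightarrow> (\<forall>\<eta>\<in>H_trunc \<Omega> L. \<forall>\<tau>. has_trace \<Omega> L L \<eta> \<tau> \<longrightarrow>
    (\<integral>x. (\<sigma> x *\<^sub>R weak_grad (trunc \<Omega> L) f x + F x) \<bullet> weak_grad (trunc \<Omega> L) \<eta> x \<partial>lebesgue_on (trunc \<Omega> L)) =
    \<mu> / measure lebesgue (slice \<Omega> L) * (\<integral>x. \<tau> x \<partial>lebesgue_on (slice \<Omega> L)))"

definition energy :: "real \<Rightarrow> ('m point \<Rightarrow> 'm point) \<Rightarrow> real \<Rightarrow> real \<Rightarrow> real" where
  "energy L G s t = (\<integral>x. indicator (section_between \<Omega> s t) x * (norm (G x))\<^sup>2 \<partial>lebesgue_on (trunc \<Omega> L))"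

lemma section_sub_trunc: "- L \<le> s \<Longrightarrow> t \<le> L \<Longrightarrow> section_between \<Omega> s t \<subseteq> trunc \<Omega> L"
  by (auto simp: section_between_def trunc_def)

lemma section_sets_on_trunc:
  "section_between \<Omega> s t \<inter> space (lebesgue_on (trunc \<Omega> L)) \<in> sets (lebesgue_on (trunc \<Omega> L))"
  using section_sets[of s t] trunc_sets[of L]
  by (auto simp: space_restrict_space sets_restrict_space_iff)

text \<open>The Saint-Venant estimate with a difference of energies on the right, ready for hole
  filling. The test function is s1 (f - c1) - s2 (f - c2) with two ramps s1 and s2: zero on the
  left, f - c1 inside, and the constant c2 - c1 on the right, so the outflow section contributes
  only \<mu> (c2 - c1).\<close>

lemma energy_interior:
  assumes f: "f \<in> H_trunc \<Omega> L" and ab: "a \<le> b" "- L \<le> a - 1" "b + 1 \<le> L"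
    and sm: "\<sigma> \<in> borel_measurable (lebesgue_on (trunc \<Omega> L))"
    and s: "\<And>x. x \<in> trunc \<Omega> L \<Longrightarrow> \<kappa>1 \<le> \<sigma> x \<and> \<sigma> x \<le> \<kappa>2" and k: "0 < \<kappa>1"
    and F: "L2_on (trunc \<Omega> L) F" and eq: "flux_eq L f \<sigma> F \<mu>"
  defines "E \<equiv> energy L (weak_grad (trunc \<Omega> L) f)" and "Q \<equiv> energy L F"
  shows "E a b \<le> C1E \<kappa>1 \<kappa>2 * (E (a - 1) (b + 1) - E a b) + C2E \<kappa>1 * (Q (a - 1) (b + 1) + \<mu>\<^sup>2 * (b - a + 1))"
proof -
  define D where "D = trunc \<Omega> L"
  define g where "g = weak_grad D f"
  have Ds: "D \<in> sets lebesgue" unfolding D_def by (rule trunc_sets)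
  note Lf = H_trunc_L2(1)[OF f, folded D_def] and Lg = H_trunc_L2(2)[OF f, folded D_def, folded g_def]
  note LF = F[folded D_def]
  note [measurable] = L2_onD(1)[OF Lf] L2_onD(1)[OF Lg] L2_onD(1)[OF LF] sm[folded D_def]
  define A0 A1 A2 A where "A0 = section_between \<Omega> a b" and "A1 = section_between \<Omega> (a - 1) a"
    and "A2 = section_between \<Omega> b (b + 1)" and "A = section_between \<Omega> (a - 1) (b + 1)"
  define I where "I S p = (\<integral>x. indicator S x * p x \<partial>lebesgue_on D)" for S and p :: "'m point \<Rightarrow> real"
  define e where "e x = (norm (g x))\<^sup>2" for x
  define q where "q x = (norm (F x))\<^sup>2" for x
  have ie: "integrable (lebesgue_on D) e" and iq: "integrable (lebesgue_on D) q"
    unfolding e_def q_def using L2_onD(2)[OF Lg] L2_onD(2)[OF LF] .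
  have secs: "S \<inter> space (lebesgue_on D) \<in> sets (lebesgue_on D)" if "S \<in> {A0, A1, A2, A}" for S
    using that section_sets_on_trunc[of _ _ L, folded D_def] unfolding A0_def A1_def A2_def A_def by blast
  have ii: "integrable (lebesgue_on D) (\<lambda>x. indicator S x * p x)"
    if "S \<in> {A0, A1, A2, A}" "integrable (lebesgue_on D) p" for S and p :: "'m point \<Rightarrow> real"
    by (rule integrable_indicator_mult[OF secs[OF that(1)] that(2)])
  have EI: "E a b = I A0 e" "E (a - 1) (b + 1) = I A e" "Q (a - 1) (b + 1) = I A q"
    by (simp_all add: E_def Q_def energy_def I_def A0_def A_def e_def q_def g_def D_def)
  \<comment> \<open>The three open sections miss the cross-sections at \<open>a\<close> and
    \<open>b\<close>; an inequality is all that is used.\<close>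
  have split_le: "I A1 p + I A2 p + I A0 p \<le> I A p" if p: "integrable (lebesgue_on D) p" "\<And>x. 0 \<le> p x" for p
  proof -
    have "I A1 p + I A2 p + I A0 p = (\<integral>x. indicator A1 x * p x + indicator A2 x * p x + indicator A0 x * p x \<partial>lebesgue_on D)"
      unfolding I_def using ii[of A0 p] ii[of A1 p] ii[of A2 p] p(1) by simp
    also have "\<dots> \<le> I A p"
      unfolding I_def
    proof (rule integral_mono)
      show "indicator A1 x * p x + indicator A2 x * p x + indicator A0 x * p x \<le> indicator A x * p x" for x
        using p(2)[of x] ab by (auto simp: A0_def A1_def A2_def A_def indicator_def section_between_def)
    qed (use ii p(1) in auto)
    finally show ?thesis .
  qed
  have Inn: "0 \<le> I S p" if "\<And>x. 0 \<le> p x" for S p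
    unfolding I_def using that by (intro Bochner_Integration.integral_nonneg) simp
  have est: "3 * \<kappa>1 / 8 * I A0 e \<le> (8 * CP + \<kappa>2\<^sup>2 + \<kappa>1 / 8) * (I A e - I A0 e)
      + (1 / (2 * \<kappa>1) + 1) * I A q + 4 * (CD + 1) / \<kappa>1 * (\<mu>\<^sup>2 * (b - a + 1)) + (4 + \<kappa>1) * \<delta>" if \<delta>: "0 < \<delta>" for \<delta>
  proof -
    obtain c1 c2 where c1: "I A1 (\<lambda>x. (f x - c1)\<^sup>2) \<le> 4 * CP * I A1 e + \<delta>"
      and c2: "I A2 (\<lambda>x. (f x - c2)\<^sup>2) \<le> 4 * CP * I A2 e + \<delta>"
      and c12: "(c2 - c1)\<^sup>2 \<le> CD * (b - a + 1) * (2 * I A e + \<delta>)"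
      using trunc_poincare[OF f ab \<delta>]
      unfolding I_def A1_def A2_def A_def e_def g_def D_def by blast
    define \<zeta> where "\<zeta> t = step (t - (a - 1)) - step (t - b)" for t
    define \<zeta>' where "\<zeta>' t = step' (t - (a - 1)) - step' (t - b)" for t
    define \<kappa> where "\<kappa> t = (- c1) * step (t - (a - 1)) + c2 * step (t - b)" for t
    define \<kappa>' where "\<kappa>' t = (- c1) * step' (t - (a - 1)) + c2 * step' (t - b)" for t
    have z: "(\<zeta> has_real_derivative \<zeta>' t) (at t)" and kd: "(\<kappa> has_real_derivative \<kappa>' t) (at t)" for t
      unfolding \<zeta>_def[abs_def] \<zeta>'_def \<kappa>_def[abs_def] \<kappa>'_def
      by (intro DERIV_diff DERIV_add DERIV_cmult step_der)+
    have zc: "continuous_on UNIV \<zeta>'" and kc: "continuous_on UNIV \<kappa>'"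
      unfolding \<zeta>'_def \<kappa>'_def by (intro continuous_intros step'_cont)+
    have ends: "\<kappa> (- L) = 0" "\<zeta> L = 0" "\<kappa> L = c2 - c1"
      using ab by (simp_all add: \<kappa>_def \<zeta>_def step_0 step_1)
    define \<eta> where "\<eta> x = \<zeta> (snd x) * f x + \<kappa> (snd x)" for x
    note cut = H_trunc_cutoff[OF f z zc kd kc ends(1,2), folded \<eta>_def[abs_def], folded D_def, folded g_def]
    \<comment> \<open>The integrand with the gradient of \<eta> written out; it agrees a.e. with the
      one containing the chosen \<open>weak_grad\<close>.\<close>
    define V where "V x = (\<sigma> x *\<^sub>R g x + F x) \<bullet> (\<zeta> (snd x) *\<^sub>R g x + (\<zeta>' (snd x) * f x + \<kappa>' (snd x)) *\<^sub>R (0, 1))" for x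
    have LH: "L2_on D (\<lambda>x. \<sigma> x *\<^sub>R g x + F x)"
    proof (rule L2_on_add[OF L2_on_bounded_scale[OF Lg sm[folded D_def] _ Ds] LF])
      show "\<bar>\<sigma> x\<bar> \<le> \<kappa>2" if "x \<in> D" for x using s[of x] that k by (auto simp: D_def)
    qed
    have L\<eta>: "L2_on D (weak_grad D \<eta>)" using H_trunc_L2(2)[OF cut(1)] by (simp add: D_def)
    have iV0: "integrable (lebesgue_on D) (\<lambda>x. (\<sigma> x *\<^sub>R g x + F x) \<bullet> weak_grad D \<eta> x)"
      by (rule L2_inner_integrable(1)[OF LH L\<eta>])
    have meas: "(\<lambda>x. h (snd x)) \<in> borel_measurable (lebesgue_on D)" if "continuous_on UNIV h" for h :: "real \<Rightarrow> real"
      by (intro borel_measurable_lebesgue_on borel_measurable_continuous_onI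
          continuous_on_compose2[OF that] continuous_intros) auto
    have cz: "continuous_on UNIV \<zeta>" using z by (intro DERIV_continuous_on) (auto intro: has_field_derivative_at_within)
    note [measurable] = meas[OF cz] meas[OF zc] meas[OF kc]
    have Vm: "V \<in> borel_measurable (lebesgue_on D)" unfolding V_def by measurable
    have Vae: "AE x in lebesgue_on D. (\<sigma> x *\<^sub>R g x + F x) \<bullet> weak_grad D \<eta> x = V x"
      using cut(3) by eventually_elim (simp add: V_def)
    have iV: "integrable (lebesgue_on D) V"
      by (rule integrable_cong_AE_imp[OF iV0 Vm]) (use Vae in \<open>auto elim!: eventually_mono\<close>)
    have "(\<integral>x. V x \<partial>lebesgue_on D) = (\<integral>x. (\<sigma> x *\<^sub>R g x + F x) \<bullet> weak_grad D \<eta> x \<partial>lebesgue_on D)"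
      using Vae by (intro integral_cong_AE Vm borel_measurable_integrable[OF iV0]) (auto elim!: eventually_mono)
    also have "\<dots> = \<mu> / measure lebesgue (slice \<Omega> L) * (\<integral>x. \<kappa> L \<partial>lebesgue_on (slice \<Omega> L))"
      using eq cut(1,2) unfolding flux_eq_def D_def g_def by blast
    \<comment> \<open>The trace is constant, so the area of the outflow section cancels against the
      density of the flux.\<close>
    also have "(\<integral>x. \<kappa> L \<partial>lebesgue_on (slice \<Omega> L)) = measure lebesgue (slice \<Omega> L) * (c2 - c1)"
      using slice_sets[of L] by (simp add: ends(3) measure_restrict_space space_restrict_space)
    finally have IV: "(\<integral>x. V x \<partial>lebesgue_on D) = \<mu> * (c2 - c1)"
      using measure_slice_pos[of L] by simp
    define R where "R c x = (f x - c)\<^sup>2" for c x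
    have iR: "integrable (lebesgue_on D) (R c)" for c
    proof -
      have "L2_on D (\<lambda>_. c)" by (rule L2_on_bounded[of _ _ "\<bar>c\<bar>"]) (auto simp: D_def trunc_lmeasurable)
      from L2_onD(2)[OF L2_on_diff[OF Lf this Ds]] show ?thesis by (simp add: R_def[abs_def])
    qed
    have "\<kappa>1 / 2 * I A0 e = (\<integral>x. \<kappa>1 / 2 * (indicator A0 x * e x) \<partial>lebesgue_on D)"
      unfolding I_def by simp
    also have "\<dots> \<le> (\<integral>x. V x + 1 / (2 * \<kappa>1) * (indicator A x * q x)
        + (2 * (indicator A1 x * R c1 x) + \<kappa>2\<^sup>2 * (indicator A1 x * e x) + indicator A1 x * q x)
        + (2 * (indicator A2 x * R c2 x) + \<kappa>2\<^sup>2 * (indicator A2 x * e x) + indicator A2 x * q x) \<partial>lebesgue_on D)"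
    proof (rule integral_mono)
      fix x assume "x \<in> space (lebesgue_on D)"
      then have x: "x \<in> D" using Ds by (simp add: space_restrict_space)
      then have x\<Omega>: "x \<in> \<Omega>" by (simp add: D_def trunc_def)
      \<comment> \<open>Regrouping pairs each ramp slope with the deviation of f from the constant
        of that layer, which is where the Poincare inequality applies.\<close>
      have Vx: "V x = (\<sigma> x *\<^sub>R g x + F x) \<bullet> (\<zeta> (snd x) *\<^sub>R g x
          + (step' (snd x - (a - 1)) * (f x - c1) - step' (snd x - b) * (f x - c2)) *\<^sub>R (0, 1))"
        by (simp add: V_def \<zeta>'_def \<kappa>'_def algebra_simps)
      show "\<kappa>1 / 2 * (indicator A0 x * e x) \<le> V x + 1 / (2 * \<kappa>1) * (indicator A x * q x)
        + (2 * (indicator A1 x * R c1 x) + \<kappa>2\<^sup>2 * (indicator A1 x * e x) + indicator A1 x * q x)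
        + (2 * (indicator A2 x * R c2 x) + \<kappa>2\<^sup>2 * (indicator A2 x * e x) + indicator A2 x * q x)"
        unfolding Vx e_def q_def R_def
      proof (rule energy_pointwise[OF _ _ k])
        show "\<kappa>1 \<le> \<sigma> x" "\<sigma> x \<le> \<kappa>2" using s[of x] x by (auto simp: D_def)
        show "norm ((0, 1) :: 'm point) = 1" by (simp add: norm_Pair)
        have mono: "step (snd x - b) = 0 \<or> step (snd x - (a - 1)) = 1"
          using ab by (cases "snd x \<le> b") (auto simp: step_0 intro: step_1)
        then show "0 \<le> \<zeta> (snd x)" "\<zeta> (snd x) \<le> 1"
          using step_range[of "snd x - b"] step_range[of "snd x - (a - 1)"] by (auto simp: \<zeta>_def)
        show "\<bar>step' (snd x - (a - 1))\<bar> \<le> 2 * indicator A1 x"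
          using step'_range[of "snd x - (a - 1)"] step'_0[of "snd x - (a - 1)"] x\<Omega>
          by (cases "a - 1 < snd x \<and> snd x < a") (auto simp: A1_def section_between_def)
        show "\<bar>step' (snd x - b)\<bar> \<le> 2 * indicator A2 x"
          using step'_range[of "snd x - b"] step'_0[of "snd x - b"] x\<Omega>
          by (cases "b < snd x \<and> snd x < b + 1") (auto simp: A2_def section_between_def)
        have z1: "\<zeta> (snd x) = 0" if "\<not> (a - 1 < snd x \<and> snd x < b + 1)"
          using that ab by (cases "snd x \<le> a - 1") (auto simp: \<zeta>_def step_0 step_1)
        show "\<zeta> (snd x) \<le> indicator A x"
          using z1 \<open>\<zeta> (snd x) \<le> 1\<close> x\<Omega>
          by (cases "a - 1 < snd x \<and> snd x < b + 1") (auto simp: A_def section_between_def)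
        show "indicator A0 x \<le> \<zeta> (snd x)"
          using \<open>0 \<le> \<zeta> (snd x)\<close>
          by (auto simp: A0_def section_between_def indicator_def \<zeta>_def step_0 step_1)
      qed auto
    qed (use iV ii[of A q] ii[of A0 e] ii[of A1 "R c1"] ii[of A1 e] ii[of A1 q] ii[of A2 "R c2"] ii[of A2 e] ii[of A2 q]
           iR ie iq in auto)
    also have "\<dots> = \<mu> * (c2 - c1) + 1 / (2 * \<kappa>1) * I A q
        + (2 * I A1 (R c1) + \<kappa>2\<^sup>2 * I A1 e + I A1 q) + (2 * I A2 (R c2) + \<kappa>2\<^sup>2 * I A2 e + I A2 q)"
      unfolding I_def using iV ii[of A q] ii[of A1 "R c1"] ii[of A1 e] ii[of A1 q] ii[of A2 "R c2"] ii[of A2 e] ii[of A2 q]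
        iR ie iq by (simp add: IV)
    finally have 1: "\<kappa>1 / 2 * I A0 e \<le> \<mu> * (c2 - c1) + 1 / (2 * \<kappa>1) * I A q
        + (2 * I A1 (R c1) + \<kappa>2\<^sup>2 * I A1 e + I A1 q) + (2 * I A2 (R c2) + \<kappa>2\<^sup>2 * I A2 e + I A2 q)" .
    have q12: "I A1 q + I A2 q \<le> I A q"
      using split_le[OF iq] Inn[of q A0] by (simp add: q_def)
    have e12: "I A1 e + I A2 e \<le> I A e - I A0 e"
      using split_le[OF ie] by (simp add: e_def)
    have nnC: "0 \<le> 8 * CP + \<kappa>2\<^sup>2" using CP_nonneg by simp
    from 1 c1 c2 q12 have "\<kappa>1 / 2 * I A0 e \<le> \<mu> * (c2 - c1) + (1 / (2 * \<kappa>1) + 1) * I A q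
        + (8 * CP + \<kappa>2\<^sup>2) * (I A1 e + I A2 e) + 4 * \<delta>"
      unfolding R_def[abs_def] by (simp add: algebra_simps)
    also have "\<dots> \<le> \<mu> * (c2 - c1) + (1 / (2 * \<kappa>1) + 1) * I A q
        + (8 * CP + \<kappa>2\<^sup>2) * (I A e - I A0 e) + 4 * \<delta>"
      using mult_left_mono[OF e12 nnC] by simp
    finally have 2: "\<kappa>1 / 2 * I A0 e \<le> \<mu> * (c2 - c1) + (1 / (2 * \<kappa>1) + 1) * I A q
        + (8 * CP + \<kappa>2\<^sup>2) * (I A e - I A0 e) + 4 * \<delta>" .
    have 3: "\<mu> * (c2 - c1) \<le> \<kappa>1 / 8 * I A e + \<kappa>1 * \<delta> + 4 * (CD + 1) / \<kappa>1 * (\<mu>\<^sup>2 * (b - a + 1))"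
    proof -
      define h where "h = b - a + 1"
      have h: "1 \<le> h" using ab by (simp add: h_def)
      \<comment> \<open>Weight in Young's inequality: it holds the (c2 - c1)^2 part below \<kappa>1
        / 8 of the energy, up to a multiple of \<delta>, and makes the other part a multiple of
        \<mu>^2 (b - a + 1). \<open>CD + 1\<close> keeps the denominator positive.\<close>
      define t where "t = \<kappa>1 / (16 * (CD + 1) * h)"
      have CD1: "0 < CD + 1" using CD_nonneg by simp
      have t: "0 < t" using k h CD1 by (simp add: t_def)
      have "0 \<le> (2 * t * (c2 - c1) - \<mu>)\<^sup>2 / (4 * t)" using t by simp
      also have "\<dots> = t * (c2 - c1)\<^sup>2 + \<mu>\<^sup>2 / (4 * t) - \<mu> * (c2 - c1)"
        using t by (simp add: power2_eq_square field_simps)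
      finally have "\<mu> * (c2 - c1) \<le> t * (c2 - c1)\<^sup>2 + \<mu>\<^sup>2 / (4 * t)" by simp
      also have "\<mu>\<^sup>2 / (4 * t) = 4 * (CD + 1) / \<kappa>1 * (\<mu>\<^sup>2 * h)"
        using k h CD1 by (simp add: t_def field_simps)
      also have "t * (c2 - c1)\<^sup>2 \<le> t * (CD * h * (2 * I A e + \<delta>))"
        using c12 t unfolding h_def by (intro mult_left_mono) auto
      also have "t * (CD * h * (2 * I A e + \<delta>)) = \<kappa>1 / 16 * (CD / (CD + 1)) * (2 * I A e + \<delta>)"
      proof -
        have "t * (CD * h * (2 * I A e + \<delta>)) = (t * h) * (CD * (2 * I A e + \<delta>))" by (simp only: mult_ac)
        also have "t * h = \<kappa>1 / 16 / (CD + 1)" using h by (simp add: t_def)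
        finally show ?thesis by simp
      qed
      also have "\<dots> \<le> \<kappa>1 / 16 * 1 * (2 * I A e + \<delta>)"
        using k CD1 CD_nonneg Inn[of e A] \<open>0 < \<delta>\<close>
        by (intro mult_right_mono mult_left_mono) (auto simp: e_def)
      also have "\<dots> \<le> \<kappa>1 / 8 * I A e + \<kappa>1 * \<delta>" using k \<open>0 < \<delta>\<close> by (simp add: algebra_simps)
      finally show ?thesis unfolding h_def by simp
    qed
    show ?thesis by (rule absorb_arith[OF 2 3]) simp
  qed
  \<comment> \<open>The layer constants depend on \<delta> but no longer occur, so \<delta> can be
    sent to 0.\<close>
  have lim: "3 * \<kappa>1 / 8 * I A0 e \<le> (8 * CP + \<kappa>2\<^sup>2 + \<kappa>1 / 8) * (I A e - I A0 e)
      + (1 / (2 * \<kappa>1) + 1) * I A q + 4 * (CD + 1) / \<kappa>1 * (\<mu>\<^sup>2 * (b - a + 1))"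
  proof (rule field_le_epsilon)
    fix d :: real assume "0 < d"
    then show "3 * \<kappa>1 / 8 * I A0 e \<le> (8 * CP + \<kappa>2\<^sup>2 + \<kappa>1 / 8) * (I A e - I A0 e)
      + (1 / (2 * \<kappa>1) + 1) * I A q + 4 * (CD + 1) / \<kappa>1 * (\<mu>\<^sup>2 * (b - a + 1)) + d"
      using est[of "d / (4 + \<kappa>1)"] k by simp
  qed
  define W where "W = 8 / (3 * \<kappa>1)"
  have W: "0 < W" "W * (3 * \<kappa>1 / 8) = 1" using k by (auto simp: W_def)
  have "I A0 e = W * (3 * \<kappa>1 / 8 * I A0 e)" unfolding mult.assoc[symmetric, of W] W(2) by simp
  also have "\<dots> \<le> W * ((8 * CP + \<kappa>2\<^sup>2 + \<kappa>1 / 8) * (I A e - I A0 e)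
      + (1 / (2 * \<kappa>1) + 1) * I A q + 4 * (CD + 1) / \<kappa>1 * (\<mu>\<^sup>2 * (b - a + 1)))"
    using lim W by (intro mult_left_mono) auto
  also have "\<dots> \<le> W * ((8 * CP + \<kappa>2\<^sup>2 + \<kappa>1 / 8) * (I A e - I A0 e)
      + (1 / (2 * \<kappa>1) + 1 + 4 * (CD + 1) / \<kappa>1) * (I A q + \<mu>\<^sup>2 * (b - a + 1)))"
  proof -
    have p: "0 \<le> 1 / (2 * \<kappa>1) + 1" "0 \<le> 4 * (CD + 1) / \<kappa>1" "0 \<le> I A q" "0 \<le> \<mu>\<^sup>2 * (b - a + 1)"
      using k CD_nonneg ab Inn[of q A] by (auto simp: q_def)
    have "0 \<le> (1 / (2 * \<kappa>1) + 1) * (\<mu>\<^sup>2 * (b - a + 1))" "0 \<le> 4 * (CD + 1) / \<kappa>1 * I A q"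
      by (intro mult_nonneg_nonneg p(1,4), intro mult_nonneg_nonneg p(2,3))
    then have "(1 / (2 * \<kappa>1) + 1) * I A q + 4 * (CD + 1) / \<kappa>1 * (\<mu>\<^sup>2 * (b - a + 1))
        \<le> (1 / (2 * \<kappa>1) + 1 + 4 * (CD + 1) / \<kappa>1) * (I A q + \<mu>\<^sup>2 * (b - a + 1))"
      unfolding distrib_right[of "1 / (2 * \<kappa>1) + 1"] distrib_left[of "1 / (2 * \<kappa>1) + 1"] distrib_left[of "4 * (CD + 1) / \<kappa>1"]
      by linarith
    then show ?thesis using W by (intro mult_left_mono) auto
  qed
  also have "W * (X * D' + Y * Z) = X * W * D' + W * Y * Z" for X D' Y Z :: real
    by (simp add: algebra_simps)
  finally show ?thesis unfolding EI C1E_def C2E_def W_def[symmetric] .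
qed

text \<open>Testing with f itself leaves the outflow integral of its trace. Cauchy-Schwarz and the
  trace bound make the square of that term at most a multiple of \<mu>^2 L times the energy, which
  can be absorbed; apart from the forcing, the total energy thus grows at most linearly in
  L.\<close>

lemma energy_global:
  assumes f: "f \<in> H_trunc \<Omega> L" and "0 < L"
    and sm: "\<sigma> \<in> borel_measurable (lebesgue_on (trunc \<Omega> L))"
    and s: "\<And>x. x \<in> trunc \<Omega> L \<Longrightarrow> \<kappa>1 \<le> \<sigma> x \<and> \<sigma> x \<le> \<kappa>2" and k: "0 < \<kappa>1"
    and F: "L2_on (trunc \<Omega> L) F" and eq: "flux_eq L f \<sigma> F \<mu>"
  shows "energy L (weak_grad (trunc \<Omega> L) f) (- L) L \<le> C3E \<kappa>1 * (energy L F (- L) L + \<mu>\<^sup>2 * L)"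
proof -
  define D where "D = trunc \<Omega> L"
  define g where "g = weak_grad D f"
  have Ds: "D \<in> sets lebesgue" unfolding D_def by (rule trunc_sets)
  note Lg = H_trunc_L2(2)[OF f, folded D_def, folded g_def]
  note LF = F[folded D_def]
  note [measurable] = L2_onD(1)[OF Lg] L2_onD(1)[OF LF] sm[folded D_def]
  have en: "energy L G (- L) L = (\<integral>x. (norm (G x))\<^sup>2 \<partial>lebesgue_on D)" for G
    unfolding energy_def trunc_eq[symmetric] D_def using trunc_sets[of L]
    by (intro Bochner_Integration.integral_cong refl) (simp add: space_restrict_space)
  define E where "E = (\<integral>x. (norm (g x))\<^sup>2 \<partial>lebesgue_on D)"
  define Q where "Q = (\<integral>x. (norm (F x))\<^sup>2 \<partial>lebesgue_on D)"
  have E0: "0 \<le> E" "0 \<le> Q" by (auto simp: E_def Q_def)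
  obtain \<tau> where tr: "has_trace \<Omega> L L f \<tau>" and L\<tau>: "L2_on (slice \<Omega> L) \<tau>"
    and \<tau>: "(\<integral>x. (norm (\<tau> x))\<^sup>2 \<partial>lebesgue_on (slice \<Omega> L)) \<le> CT * L * E"
    using H_trunc_trace[OF f \<open>0 < L\<close>] unfolding E_def g_def D_def by blast
  define m where "m = measure lebesgue (slice \<Omega> L)"
  have m: "0 < m" "\<beta> / Ms \<le> m" unfolding m_def by (rule measure_slice_pos, rule measure_slice_ge)
  have L1: "L2_on (slice \<Omega> L) (\<lambda>_. 1::real)" by (rule L2_on_bounded[OF slice_lmeasurable, of _ _ 1]) auto
  have "\<bar>\<integral>x. \<tau> x \<partial>lebesgue_on (slice \<Omega> L)\<bar>
    \<le> sqrt (\<integral>x. (norm (\<tau> x))\<^sup>2 \<partial>lebesgue_on (slice \<Omega> L)) * sqrt (\<integral>x. (norm (1::real))\<^sup>2 \<partial>lebesgue_on (slice \<Omega> L))"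
    using L2_inner_integrable(2)[OF L\<tau> L1] by simp
  also have "(\<integral>x. (norm (1::real))\<^sup>2 \<partial>lebesgue_on (slice \<Omega> L)) = m"
    using slice_sets[of L] by (simp add: m_def measure_restrict_space space_restrict_space)
  also have "sqrt (\<integral>x. (norm (\<tau> x))\<^sup>2 \<partial>lebesgue_on (slice \<Omega> L)) * sqrt m \<le> sqrt (CT * L * E) * sqrt m"
    using \<tau> m by (intro mult_right_mono real_sqrt_le_mono) auto
  finally have t1: "\<bar>\<integral>x. \<tau> x \<partial>lebesgue_on (slice \<Omega> L)\<bar> \<le> sqrt (CT * L * E) * sqrt m" .
  define rhs where "rhs = \<mu> / m * (\<integral>x. \<tau> x \<partial>lebesgue_on (slice \<Omega> L))"
  have rhs2: "rhs\<^sup>2 \<le> \<mu>\<^sup>2 * (Ms * CT / \<beta>) * L * E"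
  proof -
    have "(\<integral>x. \<tau> x \<partial>lebesgue_on (slice \<Omega> L))\<^sup>2 \<le> (sqrt (CT * L * E) * sqrt m)\<^sup>2"
      using power_mono[OF t1 abs_ge_zero, of 2] by simp
    also have "\<dots> = CT * L * E * m"
      using CT_nonneg \<open>0 < L\<close> E0 m by (simp add: power_mult_distrib)
    finally have "rhs\<^sup>2 \<le> (\<mu> / m)\<^sup>2 * (CT * L * E * m)"
      unfolding rhs_def power_mult_distrib by (intro mult_left_mono) auto
    also have "\<dots> = \<mu>\<^sup>2 * (1 / m) * (CT * L * E)" using m by (simp add: power2_eq_square field_simps)
    also have "\<dots> \<le> \<mu>\<^sup>2 * (Ms / \<beta>) * (CT * L * E)"
    proof (intro mult_right_mono mult_left_mono)
      show "1 / m \<le> Ms / \<beta>" using m \<beta>_pos Ms_pos by (simp add: field_simps)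
    qed (use CT_nonneg \<open>0 < L\<close> E0 in auto)
    finally show ?thesis by (simp add: mult_ac)
  qed
  have "(\<integral>x. (\<sigma> x *\<^sub>R g x + F x) \<bullet> g x \<partial>lebesgue_on D) = rhs"
    using eq f tr unfolding flux_eq_def D_def g_def rhs_def m_def by blast
  moreover have "\<kappa>1 / 2 * E - 1 / (2 * \<kappa>1) * Q \<le> (\<integral>x. (\<sigma> x *\<^sub>R g x + F x) \<bullet> g x \<partial>lebesgue_on D)"
  proof -
    have LH: "L2_on D (\<lambda>x. \<sigma> x *\<^sub>R g x + F x)"
    proof (rule L2_on_add[OF L2_on_bounded_scale[OF Lg sm[folded D_def] _ Ds] LF])
      show "\<bar>\<sigma> x\<bar> \<le> \<kappa>2" if "x \<in> D" for x using s[of x] that k by (auto simp: D_def)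
    qed
    have "\<kappa>1 / 2 * E - 1 / (2 * \<kappa>1) * Q = (\<integral>x. \<kappa>1 / 2 * (norm (g x))\<^sup>2 - 1 / (2 * \<kappa>1) * (norm (F x))\<^sup>2 \<partial>lebesgue_on D)"
      unfolding E_def Q_def using L2_onD(2)[OF Lg] L2_onD(2)[OF LF] by simp
    also have "\<dots> \<le> (\<integral>x. (\<sigma> x *\<^sub>R g x + F x) \<bullet> g x \<partial>lebesgue_on D)"
    proof (rule integral_mono)
      fix x assume "x \<in> space (lebesgue_on D)"
      then have x: "x \<in> trunc \<Omega> L" using Ds by (simp add: space_restrict_space D_def)
      have e: "norm ((0, 1) :: 'm point) = 1" by (simp add: norm_Pair)
      \<comment> \<open>The pointwise estimate with cut-off 1 and no ramps.\<close>
      have "\<kappa>1 / 2 * (1 * (norm (g x))\<^sup>2) \<le> (\<sigma> x *\<^sub>R g x + F x) \<bullet> (1 *\<^sub>R g x + (0 * 0 - 0 * 0) *\<^sub>R (0, 1))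
          + 1 / (2 * \<kappa>1) * (1 * (norm (F x))\<^sup>2)
          + (2 * (0 * 0\<^sup>2) + \<kappa>2\<^sup>2 * (0 * (norm (g x))\<^sup>2) + 0 * (norm (F x))\<^sup>2)
          + (2 * (0 * 0\<^sup>2) + \<kappa>2\<^sup>2 * (0 * (norm (g x))\<^sup>2) + 0 * (norm (F x))\<^sup>2)"
        by (rule energy_pointwise) (use s[OF x] k e in auto)
      then show "\<kappa>1 / 2 * (norm (g x))\<^sup>2 - 1 / (2 * \<kappa>1) * (norm (F x))\<^sup>2 \<le> (\<sigma> x *\<^sub>R g x + F x) \<bullet> g x"
        by (simp only: mult_zero_left mult_zero_right add_0_right scaleR_zero_left scaleR_one mult_1_left diff_self)
    qed (use L2_onD(2)[OF Lg] L2_onD(2)[OF LF] L2_inner_integrable(1)[OF LH Lg] in auto)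
    finally show ?thesis .
  qed
  moreover have "rhs \<le> \<kappa>1 / 4 * E + Ms * CT / (\<beta> * \<kappa>1) * (\<mu>\<^sup>2 * L)"
  proof -
    \<comment> \<open>The square of \<open>rhs\<close> is at most Y E, which is four times the
      product of \<kappa>1 E / 4 and Y / \<kappa>1; hence \<open>rhs\<close> is at most the sum of
      these two.\<close>
    define Y where "Y = \<mu>\<^sup>2 * (Ms * CT / \<beta>) * L"
    have Y: "0 \<le> Y" using Ms_pos CT_nonneg \<beta>_pos \<open>0 < L\<close> by (simp add: Y_def)
    have "rhs\<^sup>2 \<le> Y * E" using rhs2 by (simp add: Y_def)
    also have "\<dots> \<le> (\<kappa>1 / 4 * E + Y / \<kappa>1)\<^sup>2"
    proof -
      have "0 \<le> (\<kappa>1 / 4 * E - Y / \<kappa>1)\<^sup>2" by simp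
      moreover have "(\<kappa>1 / 4 * E + Y / \<kappa>1)\<^sup>2 = (\<kappa>1 / 4 * E - Y / \<kappa>1)\<^sup>2 + Y * E"
        using k by (simp add: power2_eq_square field_simps)
      ultimately show ?thesis by simp
    qed
    finally have "rhs \<le> \<kappa>1 / 4 * E + Y / \<kappa>1"
      by (rule power2_le_imp_le) (use k E0 Y in simp)
    moreover have "Y / \<kappa>1 = Ms * CT / (\<beta> * \<kappa>1) * (\<mu>\<^sup>2 * L)" by (simp add: Y_def)
    ultimately show ?thesis by simp
  qed
  ultimately have "\<kappa>1 / 4 * E \<le> 1 / (2 * \<kappa>1) * Q + Ms * CT / (\<beta> * \<kappa>1) * (\<mu>\<^sup>2 * L)"
    by linarith
  also have "\<dots> \<le> (1 / (2 * \<kappa>1) + Ms * CT / (\<beta> * \<kappa>1)) * (Q + \<mu>\<^sup>2 * L)"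
  proof -
    have "0 \<le> 1 / (2 * \<kappa>1) * (\<mu>\<^sup>2 * L)" "0 \<le> Ms * CT / (\<beta> * \<kappa>1) * Q"
      using k E0 Ms_pos CT_nonneg \<beta>_pos \<open>0 < L\<close> by auto
    then show ?thesis by (simp only: distrib_right distrib_left)
  qed
  finally have "4 / \<kappa>1 * (\<kappa>1 / 4 * E) \<le> 4 / \<kappa>1 * ((1 / (2 * \<kappa>1) + Ms * CT / (\<beta> * \<kappa>1)) * (Q + \<mu>\<^sup>2 * L))"
    using k by (intro mult_left_mono) auto
  moreover have "4 / \<kappa>1 * (\<kappa>1 / 4 * E) = E" using k by simp
  ultimately have "E \<le> C3E \<kappa>1 * (Q + \<mu>\<^sup>2 * L)" by (simp only: C3E_def mult.assoc)
  then show ?thesis unfolding en E_def Q_def g_def D_def .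
qed

end

section \<open>Hole filling\<close>

text \<open>Each step lengthens the section by 2, so the accumulated error must be affine in the
  length. The coefficients are the fixed point of the recursion: \<alpha> = \<theta> \<alpha> + 1
  and \<gamma> = 2 \<theta> \<alpha> + \<theta> \<gamma>.\<close>

lemma hole_filling_iteration:
  fixes E :: "real \<Rightarrow> real \<Rightarrow> real"
  assumes \<theta>: "0 \<le> \<theta>" "\<theta> < 1" and G: "0 \<le> G"
    and step: "\<And>a b. a \<le> b \<Longrightarrow> - R \<le> a - 1 \<Longrightarrow> b + 1 \<le> R \<Longrightarrow> E a b \<le> \<theta> * E (a - 1) (b + 1) + G * (b - a + 1)"
    and bd: "\<And>a b. - R \<le> a \<Longrightarrow> b \<le> R \<Longrightarrow> E a b \<le> EB"
    and ab: "a \<le> b" "- R \<le> a - real k" "b + real k \<le> R"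
  defines "\<alpha> \<equiv> 1 / (1 - \<theta>)" and "\<gamma> \<equiv> 2 * \<theta> / (1 - \<theta>)\<^sup>2"
  shows "E a b \<le> \<theta> ^ k * EB + G * (\<alpha> * (b - a + 1) + \<gamma>)"
  using ab
proof (induction k arbitrary: a b)
  case 0
  have "0 \<le> \<alpha>" "0 \<le> \<gamma>" using \<theta> by (simp_all add: \<alpha>_def \<gamma>_def)
  then have "0 \<le> G * (\<alpha> * (b - a + 1) + \<gamma>)" using G 0 by simp
  moreover have "E a b \<le> EB" using 0 by (intro bd) auto
  ultimately show ?case by simp
next
  case (Suc k)
  have \<alpha>: "\<theta> * \<alpha> + 1 = \<alpha>" using \<theta> by (simp add: \<alpha>_def field_simps)
  have "(1 - \<theta>) * \<gamma> = 2 * (\<theta> * \<alpha>)" using \<theta> by (simp add: \<alpha>_def \<gamma>_def power2_eq_square)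
  then have \<gamma>: "2 * (\<theta> * \<alpha>) + \<theta> * \<gamma> = \<gamma>" by (simp add: algebra_simps)
  have "E a b \<le> \<theta> * E (a - 1) (b + 1) + G * (b - a + 1)"
    using Suc.prems by (intro step) auto
  also have "\<dots> \<le> \<theta> * (\<theta> ^ k * EB + G * (\<alpha> * ((b + 1) - (a - 1) + 1) + \<gamma>)) + G * (b - a + 1)"
    using Suc.prems \<theta> by (intro add_right_mono mult_left_mono Suc.IH) auto
  also have "\<dots> = \<theta> ^ Suc k * EB + G * ((\<theta> * \<alpha> + 1) * (b - a + 1) + (2 * (\<theta> * \<alpha>) + \<theta> * \<gamma>))"
    by (simp add: algebra_simps)
  also have "\<dots> = \<theta> ^ Suc k * EB + G * (\<alpha> * (b - a + 1) + \<gamma>)" unfolding \<alpha> \<gamma> ..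
  finally show ?case .
qed

text \<open>The summands are what survives of the global bound after the iteration, and the two
  coefficients of the accumulated error; all are measured against b - a + 1 \<ge> 1.\<close>

definition iteration_const :: "real \<Rightarrow> real \<Rightarrow> real" where
  "iteration_const \<theta> B = B * (4 / (1 - \<theta>) + 4) + 1 / (1 - \<theta>) + 2 * \<theta> / (1 - \<theta>)\<^sup>2"

lemma iteration_const_nonneg: "0 \<le> \<theta> \<Longrightarrow> \<theta> < 1 \<Longrightarrow> 0 \<le> B \<Longrightarrow> 0 \<le> iteration_const \<theta> B"
  by (simp add: iteration_const_def)

text \<open>The a priori bound grows like L, but about L / 4 steps are available and \<theta>^k L
  stays bounded, so the result no longer depends on L.\<close>

lemma hole_filling_local:
  fixes E :: "real \<Rightarrow> real \<Rightarrow> real"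
  assumes \<theta>: "0 \<le> \<theta>" "\<theta> < 1" and G: "0 \<le> G" and B: "0 \<le> B" and "0 < L"
    and step: "\<And>a b. a \<le> b \<Longrightarrow> - R \<le> a - 1 \<Longrightarrow> b + 1 \<le> R \<Longrightarrow> E a b \<le> \<theta> * E (a - 1) (b + 1) + G * (b - a + 1)"
    and bd: "\<And>a b. - R \<le> a \<Longrightarrow> b \<le> R \<Longrightarrow> E a b \<le> G * B * L"
    and ab: "a \<le> b" "- R + L / 4 \<le> a" "b \<le> R - L / 4"
  shows "E a b \<le> G * iteration_const \<theta> B * (b - a + 1)"
proof -
  define k where "k = nat \<lfloor>L / 4\<rfloor>"
  have k: "real k \<le> L / 4" "L / 4 < real k + 1" 
  proof -
    have "real k = of_int \<lfloor>L / 4\<rfloor>" using \<open>0 < L\<close> by (simp add: k_def)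
    then show "real k \<le> L / 4" "L / 4 < real k + 1" by linarith+
  qed
  have pk: "0 \<le> \<theta> ^ k" "\<theta> ^ k \<le> 1" using \<theta> by (auto simp: power_le_one)
  \<comment> \<open>Each of the k equal terms is at most the corresponding term of the geometric
    series, which bounds k \<theta>^k uniformly in k.\<close>
  have "real k * \<theta> ^ k = (\<Sum>j<k. \<theta> ^ k)" by simp
  also have "\<dots> \<le> (\<Sum>j<k. \<theta> ^ j)" using \<theta> by (intro sum_mono power_decreasing) auto
  also have "\<dots> = (1 - \<theta> ^ k) / (1 - \<theta>)" using \<theta> by (simp add: sum_gp_strict)
  also have "\<dots> \<le> 1 / (1 - \<theta>)" using \<theta> pk by (intro divide_right_mono) auto
  finally have kk: "real k * \<theta> ^ k \<le> 1 / (1 - \<theta>)" .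
  have "\<theta> ^ k * L \<le> \<theta> ^ k * (4 * (real k + 1))" using k pk by (intro mult_left_mono) auto
  also have "\<dots> = 4 * (real k * \<theta> ^ k) + 4 * \<theta> ^ k" by (simp add: algebra_simps)
  also have "\<dots> \<le> 4 / (1 - \<theta>) + 4" using kk pk by simp
  finally have tl: "\<theta> ^ k * L \<le> 4 / (1 - \<theta>) + 4" .
  have "E a b \<le> \<theta> ^ k * (G * B * L) + G * (1 / (1 - \<theta>) * (b - a + 1) + 2 * \<theta> / (1 - \<theta>)\<^sup>2)"
    by (rule hole_filling_iteration[OF \<theta> G step bd]) (use ab k in auto)
  also have "\<dots> = G * (B * (\<theta> ^ k * L) + 1 / (1 - \<theta>) * (b - a + 1) + 2 * \<theta> / (1 - \<theta>)\<^sup>2)"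
    by (simp add: algebra_simps)
  also have "\<dots> \<le> G * (B * (4 / (1 - \<theta>) + 4) * (b - a + 1) + 1 / (1 - \<theta>) * (b - a + 1) + 2 * \<theta> / (1 - \<theta>)\<^sup>2 * (b - a + 1))"
  proof (intro mult_left_mono[OF _ G] add_mono order_refl)
    have h: "1 \<le> b - a + 1" using ab by simp
    have "B * (\<theta> ^ k * L) \<le> B * (4 / (1 - \<theta>) + 4)" using tl B by (rule mult_left_mono)
    also have "\<dots> \<le> B * (4 / (1 - \<theta>) + 4) * (b - a + 1)"
      using mult_left_mono[OF h, of "B * (4 / (1 - \<theta>) + 4)"] B \<theta> by simp
    finally show "B * (\<theta> ^ k * L) \<le> B * (4 / (1 - \<theta>) + 4) * (b - a + 1)" .
    show "2 * \<theta> / (1 - \<theta>)\<^sup>2 \<le> 2 * \<theta> / (1 - \<theta>)\<^sup>2 * (b - a + 1)"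
      using mult_left_mono[OF h, of "2 * \<theta> / (1 - \<theta>)\<^sup>2"] \<theta> by simp
  qed
  also have "\<dots> = G * iteration_const \<theta> B * (b - a + 1)"
    by (simp add: iteration_const_def algebra_simps)
  finally show ?thesis .
qed

text \<open>Hole filling: adding C e to both sides turns the difference into a contraction with
  factor C / (1 + C) < 1.\<close>

lemma absorb_into_difference:
  assumes "0 \<le> (C::real)" "e \<le> C * (e' - e) + r" "0 \<le> r"
  shows "e \<le> C / (1 + C) * e' + r"
proof -
  have "(1 + C) * e \<le> C * e' + r" using assms(2) by (simp add: algebra_simps)
  then have "e \<le> (C * e' + r) / (1 + C)" using assms(1) by (simp add: field_simps)
  also have "\<dots> = C / (1 + C) * e' + r / (1 + C)" by (simp add: add_divide_distrib)
  also have "r / (1 + C) \<le> r" using assms by (simp add: divide_le_eq mult_left_le algebra_simps)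
  finally show ?thesis by simp
qed

section \<open>The two passes of the local estimate\<close>

context nozzle_chart begin

lemma energy_mono:
  assumes G: "L2_on (trunc \<Omega> L) G" and "s' \<le> s" "t \<le> t'"
  shows "energy L G s t \<le> energy L G s' t'"
  unfolding energy_def
proof (rule integral_mono)
  show "indicator (section_between \<Omega> s t) x * (norm (G x))\<^sup>2 \<le> indicator (section_between \<Omega> s' t') x * (norm (G x))\<^sup>2" for x
    using assms(2,3) by (auto simp: section_between_def indicator_def)
qed (intro integrable_indicator_mult section_sets_on_trunc L2_onD(2)[OF G])+

lemma energy_scale_le:
  assumes G: "L2_on (trunc \<Omega> L) G" and F: "L2_on (trunc \<Omega> L) F"
    and le: "\<And>x. x \<in> trunc \<Omega> L \<Longrightarrow> norm (F x) \<le> c * norm (G x)"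
  shows "energy L F s t \<le> c\<^sup>2 * energy L G s t"
proof -
  have "energy L F s t \<le> (\<integral>x. c\<^sup>2 * (indicator (section_between \<Omega> s t) x * (norm (G x))\<^sup>2) \<partial>lebesgue_on (trunc \<Omega> L))"
    unfolding energy_def
  proof (rule integral_mono)
    fix x assume "x \<in> space (lebesgue_on (trunc \<Omega> L))"
    then have "norm (F x) \<le> c * norm (G x)" using trunc_sets[of L] by (intro le) (simp add: space_restrict_space)
    then have "(norm (F x))\<^sup>2 \<le> (c * norm (G x))\<^sup>2" by (intro power_mono) auto
    then show "indicator (section_between \<Omega> s t) x * (norm (F x))\<^sup>2
        \<le> c\<^sup>2 * (indicator (section_between \<Omega> s t) x * (norm (G x))\<^sup>2)"
      by (simp add: indicator_def power_mult_distrib)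
  qed (intro integrable_mult_right integrable_indicator_mult section_sets_on_trunc L2_onD(2)[OF F] L2_onD(2)[OF G])+
  then show ?thesis by (simp add: energy_def)
qed

lemma energy_nonneg: "0 \<le> energy L G s t"
  unfolding energy_def by (intro Bochner_Integration.integral_nonneg) simp

lemma section_integral_eq_energy:
  assumes "- L \<le> s" "t \<le> L"
  shows "(LINT x:section_between \<Omega> s t|lebesgue. (norm (G x))\<^sup>2) = energy L G s t"
proof -
  have "energy L G s t = (\<integral>x. indicator (trunc \<Omega> L) x *\<^sub>R (indicator (section_between \<Omega> s t) x * (norm (G x))\<^sup>2) \<partial>lebesgue)"
    unfolding energy_def using trunc_sets[of L] by (subst integral_restrict_space) auto
  also have "(\<lambda>x. indicator (trunc \<Omega> L) x *\<^sub>R (indicator (section_between \<Omega> s t) x * (norm (G x))\<^sup>2))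
      = (\<lambda>x. indicator (section_between \<Omega> s t) x *\<^sub>R (norm (G x))\<^sup>2)"
    using section_sub_trunc[OF assms] by (auto simp: indicator_def fun_eq_iff)
  finally show ?thesis by (simp add: set_lebesgue_integral_def)
qed

text \<open>Every height is attained, by the image under \<open>S\<close> of a point of the axis, so
  an inclusion of sections becomes an inequality between their ends.\<close>

lemma section_subset_trunc_imp:
  assumes "section_between \<Omega> s t \<subseteq> trunc \<Omega> L" "s < t"
  shows "- L \<le> s" "t \<le> L"
proof -
  have pt: "\<bar>r\<bar> < L" if r: "s < r" "r < t" for r
  proof -
    have "((0::real^'m), r) \<in> cylinder" by (simp add: cylinder_def)
    then have "S (0, r) \<in> section_between \<Omega> s t" using S_props[of "(0, r)"] r by (simp add: section_between_def)
    then have "S (0, r) \<in> trunc \<Omega> L" using assms(1) by blast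
    then show ?thesis using S_props[OF \<open>(0, r) \<in> cylinder\<close>] by (simp add: trunc_def)
  qed
  show "- L \<le> s"
  proof (rule dense_ge_bounded[of s t])
    show "- L \<le> r" if "s < r" "r < t" for r using pt[OF that] by linarith
  qed (rule assms(2))
  show "t \<le> L"
  proof (rule dense_le_bounded[of s t])
    show "r \<le> L" if "s < r" "r < t" for r using pt[OF that] by linarith
  qed (rule assms(2))
qed

lemma measure_section_ge:
  assumes "s \<le> t"
  shows "\<beta> / M * (t - s) \<le> measure lebesgue (section_between \<Omega> s t)"
proof -
  have fin: "emeasure lebesgue (section_between \<Omega> s t) = ennreal (measure lebesgue (section_between \<Omega> s t))"
    using section_lmeasurable by (rule emeasure_eq_measure2)
  have "emeasure lebesgue (section_between \<Omega> s t) = emeasure lborel (section_between \<Omega> s t)"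
    using borel_open[OF open_section[of s t]] by simp
  then have "ennreal (\<beta> * (t - s)) \<le> ennreal M * ennreal (measure lebesgue (section_between \<Omega> s t))"
    using emeasure_section[OF assms] fin by simp
  then have "\<beta> * (t - s) \<le> M * measure lebesgue (section_between \<Omega> s t)"
    using M_pos by (simp add: ennreal_mult[symmetric])
  then show ?thesis using M_pos by (simp add: field_simps)
qed

text \<open>One pass, for either problem. \<open>N\<close> is the common scale, m^2 in both uses;
  \<open>H\<close> bounds forcing and flux per unit length inside the window from -R to R,
  \<open>B\<close> bounds them over the whole truncated nozzle, and the conclusion gives up L / 4 at
  each end of the window.\<close>

lemma local_energy_bound:
  assumes f: "f \<in> H_trunc \<Omega> L" and "0 < L"
    and sm: "\<sigma> \<in> borel_measurable (lebesgue_on (trunc \<Omega> L))"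
    and s: "\<And>x. x \<in> trunc \<Omega> L \<Longrightarrow> \<kappa>1 \<le> \<sigma> x \<and> \<sigma> x \<le> \<kappa>2" and k: "0 < \<kappa>1"
    and F: "L2_on (trunc \<Omega> L) F" and eq: "flux_eq L f \<sigma> F \<mu>"
    and R: "R \<le> L" and H: "0 \<le> H" and N: "0 \<le> N"
    and QF: "\<And>a b. a \<le> b \<Longrightarrow> - R \<le> a - 1 \<Longrightarrow> b + 1 \<le> R \<Longrightarrow>
        energy L F (a - 1) (b + 1) + \<mu>\<^sup>2 * (b - a + 1) \<le> H * N * (b - a + 1)"
    and QG: "energy L F (- L) L + \<mu>\<^sup>2 * L \<le> B * N * L" and B: "0 \<le> B"
    and ab: "a \<le> b" "- R + L / 4 \<le> a" "b \<le> R - L / 4"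
  shows "energy L (weak_grad (trunc \<Omega> L) f) a b
    \<le> (C2E \<kappa>1 * H + 1) * iteration_const (C1E \<kappa>1 \<kappa>2 / (1 + C1E \<kappa>1 \<kappa>2)) (C3E \<kappa>1 * B) * N * (b - a + 1)"
proof -
  define E where "E = energy L (weak_grad (trunc \<Omega> L) f)"
  define C1 where "C1 = C1E \<kappa>1 \<kappa>2"
  have C: "0 \<le> C1" "0 \<le> C2E \<kappa>1" "0 \<le> C3E \<kappa>1"
    unfolding C1_def using C1E_nonneg[OF k] C2E_nonneg[OF k] C3E_nonneg[OF k] by auto
  define \<theta> where "\<theta> = C1 / (1 + C1)"
  have \<theta>: "0 \<le> \<theta>" "\<theta> < 1" using C by (auto simp: \<theta>_def)
  \<comment> \<open>The summand 1 lets the same \<open>G\<close> dominate the global energy bound,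
    which carries no factor \<open>C2E\<close>.\<close>
  define G where "G = (C2E \<kappa>1 * H + 1) * N"
  have G: "0 \<le> G" using C H N by (simp add: G_def)
  have "E a b \<le> G * iteration_const \<theta> (C3E \<kappa>1 * B) * (b - a + 1)"
  proof (rule hole_filling_local[OF \<theta> G _ \<open>0 < L\<close> _ _ ab])
    show "0 \<le> C3E \<kappa>1 * B" using C B by simp
    show "E a b \<le> \<theta> * E (a - 1) (b + 1) + G * (b - a + 1)" if a: "a \<le> b" "- R \<le> a - 1" "b + 1 \<le> R" for a b
    proof -
      have h: "0 \<le> N * (b - a + 1)" using N a by simp
      have q: "0 \<le> energy L F (a - 1) (b + 1) + \<mu>\<^sup>2 * (b - a + 1)" using energy_nonneg[of L F] a by simp
      have "E a b \<le> C1 * (E (a - 1) (b + 1) - E a b) + C2E \<kappa>1 * (energy L F (a - 1) (b + 1) + \<mu>\<^sup>2 * (b - a + 1))"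
        unfolding E_def C1_def by (rule energy_interior[OF f a(1) _ _ sm s k F eq]) (use a R in auto)
      then have "E a b \<le> \<theta> * E (a - 1) (b + 1) + C2E \<kappa>1 * (energy L F (a - 1) (b + 1) + \<mu>\<^sup>2 * (b - a + 1))"
        unfolding \<theta>_def by (rule absorb_into_difference[OF C(1)]) (use C q in simp)
      also have "C2E \<kappa>1 * (energy L F (a - 1) (b + 1) + \<mu>\<^sup>2 * (b - a + 1)) \<le> C2E \<kappa>1 * (H * N * (b - a + 1))"
        using QF[OF a] C by (intro mult_left_mono) auto
      also have "\<dots> \<le> G * (b - a + 1)" using h by (simp add: G_def algebra_simps)
      finally show ?thesis by simp
    qed
    show "E s t \<le> G * (C3E \<kappa>1 * B) * L" if st: "- R \<le> s" "t \<le> R" for s t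
    proof -
      have "E s t \<le> E (- L) L"
        unfolding E_def by (rule energy_mono[OF H_trunc_L2(2)[OF f]]) (use st R in auto)
      also have "\<dots> \<le> C3E \<kappa>1 * (energy L F (- L) L + \<mu>\<^sup>2 * L)"
        unfolding E_def by (rule energy_global[OF f \<open>0 < L\<close> sm s k F eq])
      also have "\<dots> \<le> C3E \<kappa>1 * (B * N * L)" using QG C by (intro mult_left_mono) auto
      also have "\<dots> = 1 * (N * (C3E \<kappa>1 * B * L))" by (simp add: mult_ac)
      also have "\<dots> \<le> (C2E \<kappa>1 * H + 1) * (N * (C3E \<kappa>1 * B * L))"
        using C H N B \<open>0 < L\<close> by (intro mult_right_mono) auto
      finally show ?thesis by (simp add: G_def mult_ac)
    qed
  qed
  then show ?thesis by (simp add: E_def G_def \<theta>_def C1_def mult_ac)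
qed

lemma weighted_flux_integral:
  assumes u: "L2_on (trunc \<Omega> L) g" and "L2_on (trunc \<Omega> L) G" "L2_on (trunc \<Omega> L) H" "L2_on (trunc \<Omega> L) g'"
    and "AE x in lebesgue_on (trunc \<Omega> L). H x = c *\<^sub>R (g x - G x)"
  shows "(\<integral>x. H x \<bullet> g' x \<partial>lebesgue_on (trunc \<Omega> L))
    = c * ((\<integral>x. g x \<bullet> g' x \<partial>lebesgue_on (trunc \<Omega> L)) - (\<integral>x. G x \<bullet> g' x \<partial>lebesgue_on (trunc \<Omega> L)))"
proof -
  note i = L2_inner_integrable(1)[OF u assms(4)] L2_inner_integrable(1)[OF assms(2,4)] L2_inner_integrable(1)[OF assms(3,4)]
  have "(\<integral>x. H x \<bullet> g' x \<partial>lebesgue_on (trunc \<Omega> L))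
    = (\<integral>x. c * (g x \<bullet> g' x - G x \<bullet> g' x) \<partial>lebesgue_on (trunc \<Omega> L))"
  proof (rule integral_cong_AE)
    show "AE x in lebesgue_on (trunc \<Omega> L). H x \<bullet> g' x = c * (g x \<bullet> g' x - G x \<bullet> g' x)"
      using assms(5) by eventually_elim (simp add: inner_diff_left)
  qed (use i in auto)
  also have "\<dots> = c * ((\<integral>x. g x \<bullet> g' x \<partial>lebesgue_on (trunc \<Omega> L)) - (\<integral>x. G x \<bullet> g' x \<partial>lebesgue_on (trunc \<Omega> L)))"
    using i by simp
  finally show ?thesis .
qed

text \<open>All constants are fixed before \<epsilon>, m, L and the section are chosen: the first
  pass gives \<open>Cu\<close>, which bounds the forcing of the second. Dividing by the volume of
  the section, at least a multiple of b - a, gives the average.\<close>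

lemma averaged_gradient_bound:
  assumes gl: "gas_law p h" and fp: "force_potential \<Omega> h \<epsilon>0 \<phi>star \<phi>" and "0 < \<epsilon>0"
    and cut: "cutoff \<Omega> p h \<phi> \<epsilon>0 \<theta> qh"
  shows "\<exists>C>0. \<forall>\<epsilon> m L a b \<phi>L \<phi>bar.
       0 < \<epsilon> \<longrightarrow> \<epsilon> < \<epsilon>0 \<longrightarrow> 0 < m \<longrightarrow> 0 < L \<longrightarrow>
       compressible_solution \<Omega> h qh \<phi> \<epsilon> L m \<phi>L \<longrightarrow>
       incompressible_solution \<Omega> L m \<phi>bar \<longrightarrow>
       b - a > 1 \<longrightarrow> section_between \<Omega> (a - 1) (b + 1) \<subseteq> trunc \<Omega> (L / 2) \<longrightarrow>
       1 / measure lebesgue (section_between \<Omega> a b) *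
         (LINT x:section_between \<Omega> a b|lebesgue.
            (norm (weak_grad (trunc \<Omega> L) (\<lambda>x. (\<phi>L x - \<phi>bar x) / \<epsilon>\<^sup>2) x))\<^sup>2)
       \<le> C * m\<^sup>2"
proof -
  obtain \<kappa>1 \<kappa>2 CR where k: "0 < \<kappa>1" "0 < \<kappa>2" "0 \<le> CR"
    and rho: "\<And>\<epsilon> s \<Lambda>. \<epsilon> \<in> {0<..<\<epsilon>0} \<Longrightarrow> s \<in> \<phi> ` \<Omega> \<Longrightarrow> 0 \<le> \<Lambda> \<Longrightarrow>
      \<kappa>1 \<le> rho_hat h qh \<epsilon> \<Lambda> s \<and> rho_hat h qh \<epsilon> \<Lambda> s \<le> \<kappa>2 \<and> \<bar>rho_hat h qh \<epsilon> \<Lambda> s - 1\<bar> \<le> CR * \<epsilon>\<^sup>2"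
    and cont: "\<And>\<epsilon>. \<epsilon> \<in> {0<..<\<epsilon>0} \<Longrightarrow> continuous_on ({0..} \<times> \<phi> ` \<Omega>) (\<lambda>(\<Lambda>, s). rho_hat h qh \<epsilon> \<Lambda> s)"
    by (rule rho_hat_bounds[OF gl cut \<open>0 < \<epsilon>0\<close>]) blast
  have \<phi>m: "\<phi> \<in> borel_measurable (lebesgue_on \<Omega>)" using fp by (simp add: force_potential_def)
  define it where "it x y B = iteration_const (C1E x y / (1 + C1E x y)) (C3E x * B)" for x y B
  have it0: "0 \<le> it x y B" if "0 < x" "0 \<le> B" for x y B
    unfolding it_def using C1E_nonneg[OF that(1), of y] C3E_nonneg[OF that(1)] that(2)
    by (intro iteration_const_nonneg) auto
  define Cu where "Cu = (C2E \<kappa>1 * 1 + 1) * it \<kappa>1 \<kappa>2 1"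
  have Cu: "0 \<le> Cu" using C2E_nonneg[OF k(1)] it0[OF k(1)] by (simp add: Cu_def)
  \<comment> \<open>The 3 pays for enlarging a section by one layer on each side: t - s + 1 becomes
    t - s + 3, at most three times as much.\<close>
  define H B where "H = 3 * (CR\<^sup>2 * Cu)" and "B = CR\<^sup>2 * C3E \<kappa>1"
  have HB: "0 \<le> H" "0 \<le> B" using Cu C3E_nonneg[OF k(1)] by (simp_all add: H_def B_def)
  define Cw where "Cw = (C2E 1 * H + 1) * it 1 1 B"
  have Cw: "0 \<le> Cw" using C2E_nonneg[of 1] it0[of 1 B 1] HB by (simp add: Cw_def)
  \<comment> \<open>2 from b - a + 1 \<le> 2 (b - a), M / \<beta> from the lower bound on the volume
    of a section, and 1 for positivity.\<close>
  define C where "C = 2 * (M / \<beta>) * Cw + 1"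
  have MB: "0 < M / \<beta>" using M_pos \<beta>_pos by simp
  have "0 \<le> 2 * (M / \<beta>) * Cw" using Cw MB by (intro mult_nonneg_nonneg) auto
  then have C: "0 < C" unfolding C_def by linarith
  show ?thesis
  proof (intro exI[of _ C] conjI C allI impI)
    fix \<epsilon> m L a b \<phi>L \<phi>bar
    assume \<epsilon>: "0 < \<epsilon>" "\<epsilon> < \<epsilon>0" and "0 < m" and L: "0 < L"
      and comp: "compressible_solution \<Omega> h qh \<phi> \<epsilon> L m \<phi>L"
      and inc: "incompressible_solution \<Omega> L m \<phi>bar"
      and ab: "b - a > 1" and sub: "section_between \<Omega> (a - 1) (b + 1) \<subseteq> trunc \<Omega> (L / 2)"
    define D where "D = trunc \<Omega> L"
    have Ds: "D \<in> sets lebesgue" unfolding D_def by (rule trunc_sets)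
    have \<epsilon>in: "\<epsilon> \<in> {0<..<\<epsilon>0}" using \<epsilon> by simp
    have hu: "\<phi>L \<in> H_trunc \<Omega> L" and hv: "\<phi>bar \<in> H_trunc \<Omega> L"
      using comp inc by (auto simp: compressible_solution_def incompressible_solution_def)
    define g gv where "g = weak_grad D \<phi>L" and "gv = weak_grad D \<phi>bar"
    note Lg = H_trunc_L2(2)[OF hu, folded D_def, folded g_def]
      and Lgv = H_trunc_L2(2)[OF hv, folded D_def, folded gv_def]
    define \<rho> where "\<rho> x = rho_hat h qh \<epsilon> ((norm (g x))\<^sup>2) (\<phi> x)" for x
    have D\<Omega>: "D \<subseteq> \<Omega>" by (auto simp: D_def trunc_def)
    have \<rho>m: "\<rho> \<in> borel_measurable (lebesgue_on D)"
      unfolding \<rho>_def by (rule rho_hat_measurable[OF cont[OF \<epsilon>in] \<phi>m D\<Omega> Ds L2_onD(1)[OF Lg]])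
    have \<rho>b: "\<kappa>1 \<le> \<rho> x \<and> \<rho> x \<le> \<kappa>2 \<and> \<bar>\<rho> x - 1\<bar> \<le> CR * \<epsilon>\<^sup>2" if "x \<in> D" for x
      unfolding \<rho>_def using that D\<Omega> by (intro rho[OF \<epsilon>in]) auto
    have L\<rho>g: "L2_on D (\<lambda>x. \<rho> x *\<^sub>R g x)"
    proof (rule L2_on_bounded_scale[OF Lg \<rho>m _ Ds])
      show "\<bar>\<rho> x\<bar> \<le> \<kappa>2" if "x \<in> D" for x using \<rho>b[OF that] k by auto
    qed
    have L0: "L2_on D (\<lambda>_. 0 :: 'm point)"
      unfolding D_def by (rule L2_on_bounded[OF trunc_lmeasurable, of _ _ 0]) auto
    have e0: "energy L (\<lambda>_. 0) s t = 0" for s t by (simp add: energy_def)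
    have equ: "flux_eq L \<phi>L \<rho> (\<lambda>_. 0) m"
      using comp unfolding flux_eq_def compressible_solution_def
      by (simp add: set_integral_lebesgue_on trunc_sets slice_sets \<rho>_def g_def D_def)
    define Eu where "Eu = energy L g"
    \<comment> \<open>First pass, on the window R = L with \<open>H\<close> and \<open>B\<close>
      equal to 1, since there is no forcing besides the flux m.\<close>
    have Eu: "Eu s t \<le> Cu * m\<^sup>2 * (t - s + 1)" if st: "s \<le> t" "- L + L / 4 \<le> s" "t \<le> L - L / 4" for s t
      unfolding Eu_def g_def D_def Cu_def it_def
      by (rule local_energy_bound[OF hu L \<rho>m[unfolded D_def] _ k(1) L0[unfolded D_def] equ order_refl _ _ _ _ _ st])
         (use \<rho>b in \<open>auto simp: D_def e0\<close>)
    have Eug: "Eu (- L) L \<le> C3E \<kappa>1 * (m\<^sup>2 * L)"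
      using energy_global[OF hu L \<rho>m[unfolded D_def] _ k(1) L0[unfolded D_def] equ, of \<kappa>2] \<rho>b
      by (simp add: e0 Eu_def g_def D_def)
    define c where "c = 1 / \<epsilon>\<^sup>2"
    have c: "0 < c" "c * \<epsilon>\<^sup>2 = 1" using \<epsilon> by (auto simp: c_def)
    define w where "w = (\<lambda>x. (\<phi>L x - \<phi>bar x) / \<epsilon>\<^sup>2)"
    have w_eq: "w = (\<lambda>x. c * (\<phi>L x - \<phi>bar x))" by (simp add: w_def c_def)
    have hw: "w \<in> H_trunc \<Omega> L" unfolding w_eq by (rule H_trunc_lincomb(1)[OF hu hv])
    define gw where "gw = weak_grad D w"
    note Lgw = H_trunc_L2(2)[OF hw, folded D_def, folded gw_def]
    have gw: "AE x in lebesgue_on D. gw x = c *\<^sub>R (g x - gv x)"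
      using H_trunc_lincomb(2)[OF hu hv, of c] unfolding gw_def w_eq g_def gv_def D_def .
    \<comment> \<open>At most CR |g| for every \<epsilon>, because \<open>c\<close> cancels the
      \<epsilon>^2 of the density bound.\<close>
    define F where "F x = (c * (\<rho> x - 1)) *\<^sub>R g x" for x
    have cr: "\<bar>c * (\<rho> x - 1)\<bar> \<le> CR" if "x \<in> D" for x
    proof -
      have "c * \<bar>\<rho> x - 1\<bar> \<le> c * (CR * \<epsilon>\<^sup>2)" using \<rho>b[OF that] c by (intro mult_left_mono) auto
      also have "\<dots> = CR" using c(2) by (simp add: mult.left_commute)
      finally show ?thesis using c by (simp add: abs_mult)
    qed
    have LF: "L2_on D F"
      unfolding F_def by (rule L2_on_bounded_scale[OF Lg _ cr Ds]) (use \<rho>m in measurable)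
    have Fg: "energy L F s t \<le> CR\<^sup>2 * Eu s t" for s t
      unfolding Eu_def
    proof (rule energy_scale_le[OF Lg[unfolded D_def] LF[unfolded D_def]])
      show "norm (F x) \<le> CR * norm (g x)" if "x \<in> trunc \<Omega> L" for x
        using cr[of x] that by (simp add: F_def D_def mult_right_mono)
    qed
    \<comment> \<open>Both problems prescribe the same outflow, so it cancels in the difference and
      only the interior forcing \<open>F\<close> remains.\<close>
    have eqw: "flux_eq L w (\<lambda>_. 1) F 0"
      unfolding flux_eq_def
    proof (intro ballI allI impI)
      fix \<eta> \<tau> assume \<eta>: "\<eta> \<in> H_trunc \<Omega> L" and tr: "has_trace \<Omega> L L \<eta> \<tau>"
      have L\<eta>: "L2_on D (weak_grad D \<eta>)" using H_trunc_L2(2)[OF \<eta>] by (simp add: D_def)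
      have Lsum: "L2_on D (\<lambda>x. gw x + F x)" by (rule L2_on_add[OF Lgw LF])
      have ae: "AE x in lebesgue_on D. gw x + F x = c *\<^sub>R (\<rho> x *\<^sub>R g x - gv x)"
        using gw by eventually_elim (simp add: F_def algebra_simps)
      have "(\<integral>x. (gw x + F x) \<bullet> weak_grad D \<eta> x \<partial>lebesgue_on D)
        = c * ((\<integral>x. (\<rho> x *\<^sub>R g x) \<bullet> weak_grad D \<eta> x \<partial>lebesgue_on D) - (\<integral>x. gv x \<bullet> weak_grad D \<eta> x \<partial>lebesgue_on D))"
        unfolding D_def
        by (rule weighted_flux_integral[OF L\<rho>g[unfolded D_def] Lgv[unfolded D_def] Lsum[unfolded D_def]
              L\<eta>[unfolded D_def] ae[unfolded D_def]])
      also have "(\<integral>x. (\<rho> x *\<^sub>R g x) \<bullet> weak_grad D \<eta> x \<partial>lebesgue_on D)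
          = m / measure lebesgue (slice \<Omega> L) * (\<integral>x. \<tau> x \<partial>lebesgue_on (slice \<Omega> L))"
        using equ \<eta> tr unfolding flux_eq_def g_def D_def by simp
      also have "(\<integral>x. gv x \<bullet> weak_grad D \<eta> x \<partial>lebesgue_on D)
          = m / measure lebesgue (slice \<Omega> L) * (\<integral>x. \<tau> x \<partial>lebesgue_on (slice \<Omega> L))"
        using inc \<eta> tr unfolding incompressible_solution_def gv_def D_def
        by (simp add: set_integral_lebesgue_on trunc_sets slice_sets)
      finally show "(\<integral>x. (1 *\<^sub>R weak_grad (trunc \<Omega> L) w x + F x) \<bullet> weak_grad (trunc \<Omega> L) \<eta> x \<partial>lebesgue_on (trunc \<Omega> L))
          = 0 / measure lebesgue (slice \<Omega> L) * (\<integral>x. \<tau> x \<partial>lebesgue_on (slice \<Omega> L))"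
        by (simp add: gw_def D_def)
    qed
    have range: "- (L / 2) \<le> a - 1" "b + 1 \<le> L / 2"
      using section_subset_trunc_imp[OF sub] ab by auto
    \<comment> \<open>Second pass, on the window R = 3 L / 4 where the first pass controls the
      forcing; it leaves the heights |x_n| \<le> L / 2.\<close>
    have "energy L gw a b \<le> Cw * m\<^sup>2 * (b - a + 1)"
      unfolding gw_def D_def Cw_def it_def
    proof (rule local_energy_bound[OF hw L _ _ zero_less_one LF[unfolded D_def] eqw, where R="L - L / 4"])
      fix s t assume st: "s \<le> t" "- (L - L / 4) \<le> s - 1" "t + 1 \<le> L - L / 4"
      have "energy L F (s - 1) (t + 1) \<le> CR\<^sup>2 * Eu (s - 1) (t + 1)" by (rule Fg)
      also have "\<dots> \<le> CR\<^sup>2 * (Cu * m\<^sup>2 * ((t + 1) - (s - 1) + 1))"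
        using st by (intro mult_left_mono Eu) auto
      also have "\<dots> \<le> CR\<^sup>2 * (Cu * m\<^sup>2 * (3 * (t - s + 1)))"
        using st Cu by (intro mult_left_mono) auto
      also have "\<dots> = H * m\<^sup>2 * (t - s + 1)" by (simp only: H_def mult_ac)
      finally show "energy L F (s - 1) (t + 1) + 0\<^sup>2 * (t - s + 1) \<le> H * m\<^sup>2 * (t - s + 1)"
        by simp
    next
      have "energy L F (- L) L \<le> CR\<^sup>2 * Eu (- L) L" by (rule Fg)
      also have "\<dots> \<le> CR\<^sup>2 * (C3E \<kappa>1 * (m\<^sup>2 * L))" using Eug by (intro mult_left_mono) auto
      also have "\<dots> = B * m\<^sup>2 * L" by (simp only: B_def mult_ac)
      finally show "energy L F (- L) L + 0\<^sup>2 * L \<le> B * m\<^sup>2 * L" by simp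
    qed (use HB range L ab in auto)
    also have "\<dots> \<le> Cw * m\<^sup>2 * (2 * (b - a))"
      using Cw ab by (intro mult_left_mono) auto
    also have "\<dots> = 2 * Cw * m\<^sup>2 * (b - a)" by (simp only: mult_ac)
    finally have Ew: "energy L gw a b \<le> 2 * Cw * m\<^sup>2 * (b - a)" .
    define A where "A = measure lebesgue (section_between \<Omega> a b)"
    have A: "\<beta> / M * (b - a) \<le> A" unfolding A_def using ab by (intro measure_section_ge) auto
    moreover have "0 < \<beta> / M * (b - a)" using \<beta>_pos M_pos ab by simp
    ultimately have A0: "0 < A" by linarith
    have "b - a = M / \<beta> * (\<beta> / M * (b - a))" using M_pos \<beta>_pos by simp
    also have "\<dots> \<le> M / \<beta> * A" using A MB by (intro mult_left_mono) auto
    finally have bA: "b - a \<le> M / \<beta> * A" .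
    have "(LINT x:section_between \<Omega> a b|lebesgue. (norm (gw x))\<^sup>2) = energy L gw a b"
      by (rule section_integral_eq_energy) (use range L in auto)
    also note Ew
    also have "2 * Cw * m\<^sup>2 * (b - a) \<le> 2 * Cw * m\<^sup>2 * (M / \<beta> * A)"
      using bA Cw by (intro mult_left_mono) auto
    also have "\<dots> = (C - 1) * m\<^sup>2 * A" by (simp add: C_def)
    also have "\<dots> \<le> C * m\<^sup>2 * A"
      using A0 by (intro mult_right_mono) auto
    finally have "1 / A * (LINT x:section_between \<Omega> a b|lebesgue. (norm (gw x))\<^sup>2) \<le> C * m\<^sup>2"
      using A0 by (simp add: divide_le_eq)
    then show "1 / measure lebesgue (section_between \<Omega> a b) *
         (LINT x:section_between \<Omega> a b|lebesgue.
            (norm (weak_grad (trunc \<Omega> L) (\<lambda>x. (\<phi>L x - \<phi>bar x) / \<epsilon>\<^sup>2) x))\<^sup>2) \<le> C * m\<^sup>2"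
      unfolding A_def gw_def D_def w_def .
  qed
qed

end

theorem lemma4p4:
  fixes \<Omega> :: "((real ^ 'm) \<times> real) set"
  assumes "nozzle \<Omega>"
  shows "\<exists>l>0. \<forall>p h \<phi> \<phi>star \<epsilon>0 \<theta> qh.
    gas_law p h \<longrightarrow> force_potential \<Omega> h \<epsilon>0 \<phi>star \<phi> \<longrightarrow>
    0 < \<epsilon>0 \<longrightarrow> \<epsilon>0 < 1 \<longrightarrow> 0 < \<theta> \<longrightarrow> \<theta> < 1 \<longrightarrow> cutoff \<Omega> p h \<phi> \<epsilon>0 \<theta> qh \<longrightarrow>
    (\<exists>C>0. \<forall>\<epsilon> m L a b \<phi>L \<phi>bar.
       0 < \<epsilon> \<longrightarrow> \<epsilon> < \<epsilon>0 \<longrightarrow> 0 < m \<longrightarrow> 0 < L \<longrightarrow>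
       compressible_solution \<Omega> h qh \<phi> \<epsilon> L m \<phi>L \<longrightarrow>
       incompressible_solution \<Omega> L m \<phi>bar \<longrightarrow>
       b - a > l \<longrightarrow> section_between \<Omega> (a - 1) (b + 1) \<subseteq> trunc \<Omega> (L / 2) \<longrightarrow>
       1 / measure lebesgue (section_between \<Omega> a b) *
         (LINT x:section_between \<Omega> a b|lebesgue.
            (norm (weak_grad (trunc \<Omega> L) (\<lambda>x. (\<phi>L x - \<phi>bar x) / \<epsilon>\<^sup>2) x))\<^sup>2)
       \<le> C * m\<^sup>2)"
proof -
  obtain T S T' S' K where "nozzle_chart \<Omega> T S T' S' K"
    by (rule nozzle_imp_chart[OF assms])
  then interpret nozzle_chart \<Omega> T S T' S' K .
  show ?thesis
    \<comment> \<open>l = 1 gives b - a + 1 \<le> 2 (b - a), which turns the local bound into one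
      per unit length; this choice fits every nozzle.\<close>
    by (intro exI[of _ 1] conjI zero_less_one allI impI averaged_gradient_bound)
qed

end
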